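(* Let $n\ge1$ and $\lambda\vdash n$. As $m\to\infty$, we have (i) $\displaystyle\sum_{\nu\vdash nm}a_{\lambda,m}^\nu\sim\frac{\chi^\lambda(1)}{n!}\operatorname{Vol}(\mathcal{P}(1_{\mathfrak{S}_n}))\,m^{\frac{n(n-1)}{2}}$; and (ii) $\displaystyle\sum_{\nu\vdash nm}a_{\lambda,m}^\nu=\chi^\lambda(1)\sum_{\nu\vdash nm}a_{n,m}^\nu+O\!\left(m^{\frac{(n-1)(n-2)}{2}}\right)$.
   Context: Here $f(m)\sim g(m)$ means $f(m)/g(m)\to1$. $\chi^\lambda$ is the irreducible character of $\mathfrak{S}_n$ indexed by $\lambda$, so $\chi^\lambda(1)$ is its degree. Plethysm is the unique binary operation $(f,g)\mapsto f[g]$ on the ring $\Lambda$ of symmetric functions over $\mathbb{Q}$ such that $p_k[p_l]=p_{kl}$ for power sums ($k,l\ge1$), $g\mapsto p_k[g]$ is a $\mathbb{Q}$-algebra homomorphism for each $k\ge1$, and $f\mapsto f[g]$ is a $\mathbb{Q}$-algebra homomorphism for each $g\in\Lambda$. The coefficients $a_{\lambda,m}^\nu$ are defined by $s_\lambda[s_m]=\sum_{\nu\vdash nm}a_{\lambda,m}^\nu s_\nu$ ($s_\lambda$ Schur functions, $s_m=s_{(m)}$); $a_{n,m}^\nu$ is the case $\lambda=(n)$. Equivalently, $a_{\lambda,m}^\nu=\langle\chi^\nu,\operatorname{Ind}_{\mathfrak{S}_m\wr\mathfrak{S}_n}^{\mathfrak{S}_{nm}}\operatorname{Inf}_{\mathfrak{S}_n}^{\mathfrak{S}_m\wr\mathfrak{S}_n}\chi^\lambda\rangle$,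 where $\mathfrak{S}_m\wr\mathfrak{S}_n\le\mathfrak{S}_{nm}$ is the stabilizer of the set partition of $\{1,\dots,nm\}$ into the blocks $\{(i-1)m+1,\dots,im\}$, $1\le i\le n$, and $\operatorname{Inf}$ is inflation along $\mathfrak{S}_m\wr\mathfrak{S}_n\to\mathfrak{S}_n$. $\mathcal{P}(1_{\mathfrak{S}_n})$ is the rational convex polytope of symmetric $n\times n$ real matrices with non-negative entries and all row sums equal to $1$. $\operatorname{Vol}$ denotes relative volume: the volume of the polytope within its affine hull, normalized so that a fundamental domain of the lattice of integer points in the linear subspace parallel to the affine hull has volume $1$ (here the lattice is that of integer matrices in $M_n(\mathbb{R})=\mathbb{R}^{n^2}$). *)

theory Defs
  imports
    "HOL-Analysis.Analysis"
    "HOL-Library.Multiset"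
    "HOL-Library.Function_Algebras"
    "HOL-Library.Landau_Symbols"
    "HOL-Combinatorics.Permutations"
begin

section \<open>Partitions and Young diagrams\<close>

definition partitions :: "nat \<Rightarrow> nat list set" where
  "partitions n = {la. sorted_wrt (\<ge>) la \<and> 0 \<notin> set la \<and> sum_list la = n}"

text \<open>Cells are pairs (row, column), both counted from 0.\<close>

definition cells :: "nat list \<Rightarrow> (nat \<times> nat) set" where
  "cells la = {(i, j). i < length la \<and> j < la ! i}"

section \<open>The ring of symmetric functions over the rationals\<close>

text \<open>
  A symmetric function is a formal power series of bounded degree in the variables
  \<open>x\<^sub>0, x\<^sub>1, x\<^sub>2, \<dots>\<close> that is invariant under permuting the variables.
  A monomial is represented by the multiset of the indices of its variables, so that the
  product of monomials is the sum of multisets, and a series by its coefficient function.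
\<close>

definition is_symfun :: "(nat multiset \<Rightarrow> rat) \<Rightarrow> bool" where
  "is_symfun f \<longleftrightarrow> (\<forall>\<pi>. bij \<pi> \<longrightarrow> (\<forall>M. f (image_mset \<pi> M) = f M)) \<and>
     (\<exists>d. \<forall>M. size M > d \<longrightarrow> f M = 0)"

typedef symfun = "{f. is_symfun f}"
  morphisms coeff_sf Abs_symfun
  by (rule exI [of _ "\<lambda>_. 0"]) (simp add: is_symfun_def)

setup_lifting type_definition_symfun

definition msplits :: "'a multiset \<Rightarrow> ('a multiset \<times> 'a multiset) set" where
  "msplits M = {(A, B). A + B = M}"

lemma finite_submultisets: "finite {A. A \<subseteq># M}"
proof (induction M)
  case empty
  then show ?case by simp
next
  case (add x M)
  have "{A. A \<subseteq># add_mset x M} \<subseteq> {A. A \<subseteq># M} \<union> add_mset x ` {A. A \<subseteq># M}"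
  proof
    fix A assume "A \<in> {A. A \<subseteq># add_mset x M}"
    then have A: "A \<subseteq># add_mset x M" by simp
    show "A \<in> {A. A \<subseteq># M} \<union> add_mset x ` {A. A \<subseteq># M}"
    proof (cases "x \<in># A")
      case True
      then obtain B where "A = add_mset x B" by (metis insert_DiffM)
      with A show ?thesis by auto
    next
      case False
      with A have "A \<subseteq># M"
        by (metis add_mset_remove_trivial diff_single_trivial subset_eq_diff_conv
            add_mset_add_single)
      then show ?thesis by simp
    qed
  qed
  with add.IH show ?case by (meson finite_UnI finite_imageI finite_subset)
qed

lemma finite_msplits [simp]: "finite (msplits M)"
proof -
  have "msplits M \<subseteq> {A. A \<subseteq># M} \<times> {A. A \<subseteq># M}"
    by (auto simp: msplits_def)
  then show ?thesis
    using finite_submultisets [of M] by (meson finite_SigmaI finite_subset)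
qed

lemma msplits_empty [simp]: "msplits {#} = {({#}, {#})}"
  by (auto simp: msplits_def)

lemma sum_msplits_swap: "(\<Sum>(A, B)\<in>msplits M. h A B) = (\<Sum>(A, B)\<in>msplits M. h B A)"
  by (rule sum.reindex_bij_witness [of _ prod.swap prod.swap])
     (auto simp: msplits_def add.commute)

lemma sum_msplits_assoc:
  fixes h :: "'a multiset \<Rightarrow> 'a multiset \<Rightarrow> 'a multiset \<Rightarrow> rat"
  shows "(\<Sum>(A, C)\<in>msplits M. \<Sum>(A', B)\<in>msplits A. h A' B C) =
         (\<Sum>(A', D)\<in>msplits M. \<Sum>(B, C)\<in>msplits D. h A' B C)"
proof -
  have "(\<Sum>(A, C)\<in>msplits M. \<Sum>(A', B)\<in>msplits A. h A' B C) =
        (\<Sum>p\<in>(SIGMA p:msplits M. msplits (fst p)). h (fst (snd p)) (snd (snd p)) (snd (fst p)))"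
    by (simp add: case_prod_beta sum.Sigma)
  also have "\<dots> = (\<Sum>p\<in>(SIGMA p:msplits M. msplits (snd p)). h (fst (fst p)) (fst (snd p)) (snd (snd p)))"
    by (rule sum.reindex_bij_witness
          [of _ "\<lambda>((A, D), (B, C)). ((A + B, C), (A, B))" "\<lambda>((E, C), (A, B)). ((A, B + C), (B, C))"])
       (auto simp: msplits_def add.assoc)
  also have "\<dots> = (\<Sum>(A', D)\<in>msplits M. \<Sum>(B, C)\<in>msplits D. h A' B C)"
    by (simp add: case_prod_beta sum.Sigma)
  finally show ?thesis .
qed

lemma sum_msplits_image:
  assumes "bij \<pi>"
  shows "(\<Sum>(A, B)\<in>msplits (image_mset \<pi> M). h A B) =
         (\<Sum>(A, B)\<in>msplits M. h (image_mset \<pi> A) (image_mset \<pi> B))"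
proof -
  have 1: "image_mset \<pi> (image_mset (inv \<pi>) A) = A" for A
    using assms by (simp add: multiset.map_comp bij_is_surj surj_iff [THEN iffD1] multiset.map_id)
  have 2: "image_mset (inv \<pi>) (image_mset \<pi> A) = A" for A
    using assms by (simp add: multiset.map_comp bij_is_inj inv_o_cancel multiset.map_id)
  show ?thesis
    by (rule sum.reindex_bij_witness
          [of _ "map_prod (image_mset \<pi>) (image_mset \<pi>)"
                "map_prod (image_mset (inv \<pi>)) (image_mset (inv \<pi>))"])
       (auto simp: msplits_def 1 2 simp flip: image_mset_union)
qed

lemma is_symfun_add:
  assumes f: "is_symfun f" and g: "is_symfun g"
  shows "is_symfun (\<lambda>M. f M + g M)"
proof -
  obtain d where "\<forall>M. size M > d \<longrightarrow> f M = 0" using f by (auto simp: is_symfun_def)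
  moreover obtain e where "\<forall>M. size M > e \<longrightarrow> g M = 0" using g by (auto simp: is_symfun_def)
  ultimately have "\<forall>M. size M > max d e \<longrightarrow> f M + g M = 0" by simp
  then have "\<exists>d. \<forall>M. size M > d \<longrightarrow> f M + g M = 0" by blast
  then show ?thesis using f g by (simp add: is_symfun_def)
qed

lemma is_symfun_mult:
  assumes f: "is_symfun f" and g: "is_symfun g"
  shows "is_symfun (\<lambda>M. \<Sum>(A, B)\<in>msplits M. f A * g B)"
proof -
  obtain d where d: "\<forall>M. size M > d \<longrightarrow> f M = 0" using f by (auto simp: is_symfun_def)
  obtain e where e: "\<forall>M. size M > e \<longrightarrow> g M = 0" using g by (auto simp: is_symfun_def)
  have "(\<Sum>(A, B)\<in>msplits M. f A * g B) = 0" if M: "size M > d + e" for M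
  proof (rule sum.neutral, clarify)
    fix A B assume "(A, B) \<in> msplits M"
    then have "size A + size B = size M" by (auto simp: msplits_def)
    with M have "size A > d \<or> size B > e" by linarith
    with d e show "f A * g B = 0" by auto
  qed
  then have "\<exists>d. \<forall>M. size M > d \<longrightarrow> (\<Sum>(A, B)\<in>msplits M. f A * g B) = 0" by blast
  then show ?thesis using f g by (simp add: is_symfun_def sum_msplits_image)
qed

instantiation symfun :: comm_ring_1
begin

lift_definition zero_symfun :: symfun is "\<lambda>_. 0" by (simp add: is_symfun_def)

lift_definition one_symfun :: symfun is "\<lambda>M. if M = {#} then 1 else 0"
  by (auto simp: is_symfun_def)

lift_definition plus_symfun :: "symfun \<Rightarrow> symfun \<Rightarrow> symfun" is "\<lambda>f g M. f M + g M"
  by (rule is_symfun_add)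

lift_definition uminus_symfun :: "symfun \<Rightarrow> symfun" is "\<lambda>f M. - f M"
  by (simp add: is_symfun_def)

definition minus_symfun :: "symfun \<Rightarrow> symfun \<Rightarrow> symfun" where
  "minus_symfun f g = f + - g"

lift_definition times_symfun :: "symfun \<Rightarrow> symfun \<Rightarrow> symfun" is
  "\<lambda>f g M. \<Sum>(A, B)\<in>msplits M. f A * g B"
  by (rule is_symfun_mult)

instance
proof
  fix a b c :: symfun
  show "a + b + c = a + (b + c)" by transfer (simp add: add.assoc)
  show "a + b = b + a" by transfer (simp add: add.commute)
  show "0 + a = a" by transfer simp
  show "- a + a = 0" by transfer simp
  show "a - b = a + - b" by (simp add: minus_symfun_def)
  show "a * b * c = a * (b * c)"
  proof (transfer, rule ext)
    fix f g h :: "nat multiset \<Rightarrow> rat" and M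
    have "(\<Sum>(A, C)\<in>msplits M. (\<Sum>(A', B)\<in>msplits A. f A' * g B) * h C) =
          (\<Sum>(A, C)\<in>msplits M. \<Sum>(A', B)\<in>msplits A. f A' * g B * h C)"
      by (simp add: sum_distrib_right case_prod_beta)
    also have "\<dots> = (\<Sum>(A', D)\<in>msplits M. \<Sum>(B, C)\<in>msplits D. f A' * g B * h C)"
      by (rule sum_msplits_assoc)
    also have "\<dots> = (\<Sum>(A', D)\<in>msplits M. f A' * (\<Sum>(B, C)\<in>msplits D. g B * h C))"
      by (simp add: sum_distrib_left case_prod_beta mult.assoc)
    finally show "(\<Sum>(A, C)\<in>msplits M. (\<Sum>(A', B)\<in>msplits A. f A' * g B) * h C) =
          (\<Sum>(A', D)\<in>msplits M. f A' * (\<Sum>(B, C)\<in>msplits D. g B * h C))" .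
  qed
  show "a * b = b * a"
  proof (transfer, rule ext)
    fix f g :: "nat multiset \<Rightarrow> rat" and M
    show "(\<Sum>(A, B)\<in>msplits M. f A * g B) = (\<Sum>(A, B)\<in>msplits M. g A * f B)"
      by (subst sum_msplits_swap) (simp add: mult.commute)
  qed
  show "1 * a = a"
  proof (transfer, rule ext)
    fix f :: "nat multiset \<Rightarrow> rat" and M
    have "(\<Sum>(A, B)\<in>msplits M. (if A = {#} then 1 else 0) * f B) =
          (\<Sum>p\<in>msplits M. if p = ({#}, M) then f M else 0)"
      by (rule sum.cong) (auto simp: msplits_def split: if_splits)
    moreover have "({#}, M) \<in> msplits M" by (simp add: msplits_def)
    ultimately have "(\<Sum>(A, B)\<in>msplits M. (if A = {#} then 1 else 0) * f B) = f M"
      by simp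
    then show "(\<Sum>(A, B)\<in>msplits M. (if A = {#} then 1 else 0) * f B) = f M" by simp
  qed
  show "(a + b) * c = a * c + b * c"
    by transfer (simp add: fun_eq_iff case_prod_beta distrib_right sum.distrib)
  show "(0::symfun) \<noteq> 1"
    by transfer (auto simp: fun_eq_iff)
qed

end

lift_definition scale_sf :: "rat \<Rightarrow> symfun \<Rightarrow> symfun" is "\<lambda>c f M. c * f M"
  by (auto simp: is_symfun_def)

text \<open>
  The power sum \<open>p\<^sub>k = \<Sum>\<^sub>i x\<^sub>i\<^sup>k\<close>; only used for \<open>k \<ge> 1\<close>.
\<close>

lift_definition power_sum :: "nat \<Rightarrow> symfun" is
  "\<lambda>k M. if \<exists>i. M = replicate_mset k i then 1 else 0"
unfolding is_symfun_def
proof (intro conjI allI impI)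
  fix k :: nat and \<pi> :: "nat \<Rightarrow> nat" and M :: "nat multiset"
  assume \<pi>: "bij \<pi>"
  have "(\<exists>i. image_mset \<pi> M = replicate_mset k i) \<longleftrightarrow> (\<exists>i. M = replicate_mset k i)"
  proof
    assume "\<exists>i. image_mset \<pi> M = replicate_mset k i"
    then obtain i where "image_mset \<pi> M = replicate_mset k i" ..
    then have "image_mset (inv \<pi>) (image_mset \<pi> M) = replicate_mset k (inv \<pi> i)" by simp
    moreover have "image_mset (inv \<pi>) (image_mset \<pi> M) = M"
      using \<pi> by (simp add: multiset.map_comp bij_is_inj inv_o_cancel multiset.map_id)
    ultimately show "\<exists>i. M = replicate_mset k i" by auto
  qed auto
  then show "(if \<exists>i. image_mset \<pi> M = replicate_mset k i then 1 else 0 :: rat) =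
      (if \<exists>i. M = replicate_mset k i then 1 else 0)" by simp
next
  fix k :: nat
  show "\<exists>d. \<forall>M :: nat multiset. size M > d \<longrightarrow>
      (if \<exists>i. M = replicate_mset k i then 1 else 0 :: rat) = 0"
    by (rule exI [of _ k]) auto
qed

text \<open>
  Schur functions are generating functions of semistandard tableaux. That the resulting series
  is symmetric (and hence that \<^const>\<open>Abs_symfun\<close> is applied to an element of the
  representing set) is the classical theorem proved by the Bender-Knuth involutions.
\<close>

definition ssyt :: "nat list \<Rightarrow> (nat \<times> nat \<Rightarrow> nat) set" where
  "ssyt la = {T \<in> cells la \<rightarrow>\<^sub>E UNIV.
     (\<forall>i j. (i, Suc j) \<in> cells la \<longrightarrow> T (i, j) \<le> T (i, Suc j)) \<and>
     (\<forall>i j. (Suc i, j) \<in> cells la \<longrightarrow> T (i, j) < T (Suc i, j))}"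

definition schur :: "nat list \<Rightarrow> symfun" where
  "schur la = Abs_symfun
     (\<lambda>M. of_nat (card {T \<in> ssyt la. image_mset T (mset_set (cells la)) = M}))"

section \<open>Plethysm\<close>

definition rat_alg_hom :: "(symfun \<Rightarrow> symfun) \<Rightarrow> bool" where
  "rat_alg_hom \<phi> \<longleftrightarrow> \<phi> 1 = 1 \<and> (\<forall>f g. \<phi> (f + g) = \<phi> f + \<phi> g) \<and>
     (\<forall>f g. \<phi> (f * g) = \<phi> f * \<phi> g) \<and> (\<forall>c f. \<phi> (scale_sf c f) = scale_sf c (\<phi> f))"

definition is_plethysm :: "(symfun \<Rightarrow> symfun \<Rightarrow> symfun) \<Rightarrow> bool" where
  "is_plethysm pl \<longleftrightarrow>
     (\<forall>k\<ge>1. \<forall>l\<ge>1. pl (power_sum k) (power_sum l) = power_sum (k * l)) \<and>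
     (\<forall>k\<ge>1. rat_alg_hom (pl (power_sum k))) \<and>
     (\<forall>g. rat_alg_hom (\<lambda>f. pl f g))"

definition plethysm :: "symfun \<Rightarrow> symfun \<Rightarrow> symfun" where
  "plethysm = (THE pl. is_plethysm pl)"

text \<open>
  The coefficients \<open>a\<close> of \<open>s\<^sub>\<lambda>[s\<^sub>m]\<close> in the basis of Schur functions, extended by 0 to
  lists that are not partitions of the right size.
\<close>

definition plethysm_coeff :: "nat list \<Rightarrow> nat \<Rightarrow> nat list \<Rightarrow> rat" where
  "plethysm_coeff la m =
     (THE a. (\<forall>\<nu>. \<nu> \<notin> partitions (sum_list la * m) \<longrightarrow> a \<nu> = 0) \<and>
        plethysm (schur la) (schur [m]) =
          (\<Sum>\<nu>\<in>partitions (sum_list la * m). scale_sf (a \<nu>) (schur \<nu>)))"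

section \<open>Irreducible characters of symmetric groups\<close>

text \<open>
  The irreducible character of the symmetric group on \<open>{1..n}\<close> indexed by a partition
  \<open>la\<close> of \<open>n\<close> is the character of the complex Specht module, the span of
  the polytabloids in the permutation module on tabloids. With this convention the partition
  \<open>[n]\<close> indexes the trivial character.
\<close>

global_interpretation cfun: vector_space "\<lambda>(c::complex) (f :: 'a \<Rightarrow> complex) x. c * f x"
  defines cfun_span = cfun.span
    and cfun_independent = "\<lambda>B. \<not> cfun.dependent B"
    and cfun_representation = cfun.representation
  by unfold_locales (auto simp: fun_eq_iff algebra_simps)

definition tableaux :: "nat list \<Rightarrow> (nat \<times> nat \<Rightarrow> nat) set" where
  "tableaux la = {T. bij_betw T (cells la) {1..sum_list la}}"

text \<open>A tabloid is the list of the sets of entries of the rows.\<close>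

definition tabloid :: "nat list \<Rightarrow> (nat \<times> nat \<Rightarrow> nat) \<Rightarrow> nat set list" where
  "tabloid la T = map (\<lambda>i. {T (i, j) | j. (i, j) \<in> cells la}) [0..<length la]"

definition column_stabilizer :: "nat list \<Rightarrow> (nat \<times> nat \<Rightarrow> nat) \<Rightarrow> (nat \<Rightarrow> nat) set" where
  "column_stabilizer la T = {\<sigma>. \<sigma> permutes {1..sum_list la} \<and>
     (\<forall>j. \<sigma> ` {T (i, j) | i. (i, j) \<in> cells la} = {T (i, j) | i. (i, j) \<in> cells la})}"

definition polytabloid ::
  "nat list \<Rightarrow> (nat \<times> nat \<Rightarrow> nat) \<Rightarrow> nat set list \<Rightarrow> complex" where
  "polytabloid la T = (\<lambda>t. \<Sum>\<sigma>\<in>column_stabilizer la T.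
     of_int (sign \<sigma>) * of_bool (tabloid la (\<sigma> \<circ> T) = t))"

definition specht :: "nat list \<Rightarrow> (nat set list \<Rightarrow> complex) set" where
  "specht la = cfun_span (polytabloid la ` tableaux la)"

text \<open>
  The action of a permutation on functions on tabloids, that is, the linear extension of
  its action on tabloids.
\<close>

definition perm_act ::
  "(nat \<Rightarrow> nat) \<Rightarrow> (nat set list \<Rightarrow> complex) \<Rightarrow> nat set list \<Rightarrow> complex" where
  "perm_act \<sigma> v = (\<lambda>t. v (map ((`) (inv \<sigma>)) t))"

text \<open>The trace of an endomorphism of a finite-dimensional subspace, for any choice of a basis.\<close>

definition trace_on ::
  "('a \<Rightarrow> complex) set \<Rightarrow> (('a \<Rightarrow> complex) \<Rightarrow> 'a \<Rightarrow> complex) \<Rightarrow> complex" where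
  "trace_on V F = (let B = (SOME B. cfun_independent B \<and> cfun_span B = V)
     in \<Sum>b\<in>B. cfun_representation B (F b) b)"

definition irr_char :: "nat list \<Rightarrow> (nat \<Rightarrow> nat) \<Rightarrow> complex" where
  "irr_char la \<sigma> = trace_on (specht la) (perm_act \<sigma>)"

section \<open>Relative volume\<close>

text \<open>
  The volume of \<open>P\<close> within its affine hull. Given an integral basis \<open>b\<close> of the
  lattice of integer points of the linear subspace parallel to the affine hull, and a point
  \<open>p\<close> of the affine hull, it is the Lebesgue measure of the coordinate domain of \<open>P\<close>
  under \<open>t \<mapsto> p + \<Sum>\<^sub>i t\<^sub>i b\<^sub>i\<close>; this gives the fundamental
  parallelepiped of \<open>b\<close> volume 1. The value does not depend on \<open>p\<close> and \<open>b\<close>,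
  and such a \<open>b\<close> exists for every nonempty rational polytope \<open>P\<close>.
\<close>

definition direction :: "'a::euclidean_space set \<Rightarrow> 'a set" where
  "direction S = {x - y | x y. x \<in> affine hull S \<and> y \<in> affine hull S}"

definition integer_points :: "'a::euclidean_space set" where
  "integer_points = {x. \<forall>e\<in>Basis. x \<bullet> e \<in> \<int>}"

definition is_lattice_basis :: "nat \<Rightarrow> (nat \<Rightarrow> 'a::euclidean_space) \<Rightarrow> 'a set \<Rightarrow> bool" where
  "is_lattice_basis d b V \<longleftrightarrow>
     inj_on b {..<d} \<and> independent (b ` {..<d}) \<and> span (b ` {..<d}) = V \<and>
     integer_points \<inter> V = {(\<Sum>i<d. of_int (c i) *\<^sub>R b i) | c :: nat \<Rightarrow> int. True}"

definition rel_volume :: "'a::euclidean_space set \<Rightarrow> real" where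
  "rel_volume P = (THE v. \<exists>p d b. p \<in> affine hull P \<and> is_lattice_basis d b (direction P) \<and>
     v = measure (\<Pi>\<^sub>M i\<in>{..<d}. lborel)
           {t \<in> {..<d} \<rightarrow>\<^sub>E UNIV. p + (\<Sum>i<d. t i *\<^sub>R b i) \<in> P})"

definition sym_stochastic :: "(real ^ 'n ^ 'n) set" where
  "sym_stochastic = {A. transpose A = A \<and> (\<forall>i j. 0 \<le> A $ i $ j) \<and>
     (\<forall>i. (\<Sum>j\<in>UNIV. A $ i $ j) = 1)}"

end

theory Submission
  imports Defs
begin


text \<open>Let phi be the linear functional on symmetric functions with value 1 on every Schur
  function. The sum of the Schur coefficients of s_lambda[s_m] is then phi(s_lambda[h_m]). Expanding
  s_lambda = sum_mu c_mu p_mu in power sums turns it into the sum of the terms c_mu phi(prod_i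
  p_{mu_i}[h_m]), and c_mu = f^lambda / n! for mu = (1^n), where f^lambda is the number of standard
  tableaux of shape lambda (\<open>plethysm_coeff_sum_expansion\<close>).

  The numbers phi(prod_i p_{k_i}[h_{m_i}]) count lattice points. The reason is the identity sum_nu
  s_nu = exp(sum_k p_k^2/(2k) + sum_{k odd} p_k/k): pairing it with the generating function of these
  products gives a product of geometric series, hence the number of non-negative solutions of a
  weighted linear system (\<open>fphi_eq_csol\<close>). The identity enters as phi(p_a f) = [a odd]
  phi(f) + phi(p_a^perp f) (\<open>phi_power_sum_mult\<close>). This follows by Newton's identities
  from phi(h_a f) = sum_{k <= a} phi(h_k^perp f) (\<open>phi_hh_mult\<close>), which is a
  consequence of the exchange rule for adding and removing horizontal strips
  (\<open>hsup_hsdn_commute\<close>). With it, both the values of phi and the solution counts obey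
  one recursion.

  For mu = (1^n) the solutions are the symmetric n x n matrices of natural numbers with all row sums
  m (\<open>csol_ones\<close>). They are the integral points of the m-th dilate of the polytope, and
  their number N(m) divided by m^{n(n-1)/2} tends to the relative volume, which is positive
  (\<open>stochastic_volume\<close>). For every other mu, with r parts, one variable per equation is
  determined by the rest, which leaves at most (m+1)^{v-r} solutions in v variables, and v - r <=
  (n-1)(n-2)/2 (\<open>csol_bound\<close>, \<open>card_vars_bound\<close>).

  So the sum of coefficients is (f^lambda / n!) N(m) + O(m^{(n-1)(n-2)/2}). Comparison with the case
  lambda = (n), where f^lambda = 1, gives (ii). For n >= 2 the error has smaller order than N(m),
  and for n = 1 there is no other mu; this gives (i).

  It remains that chi^lambda(1) = f^lambda (\<open>irr_char_id\<close>). The polytabloids of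
  standard tableaux are independent by triangularity, and a transposed form of the Garnir relations
  shows that an element of the Specht module is determined by its values on standard tabloids
  (\<open>specht_determined\<close>).\<close>

section \<open>Symmetric functions as a rational vector space\<close>

lemma symfun_eqI: "(\<And>M. coeff_sf f M = coeff_sf g M) \<Longrightarrow> f = g"
  by (metis coeff_sf_inverse ext)

lemma coeff_add [simp]: "coeff_sf (f + g) M = coeff_sf f M + coeff_sf g M"
  by transfer simp

lemma coeff_zero [simp]: "coeff_sf 0 M = 0"
  by transfer simp

lemma coeff_one: "coeff_sf 1 M = (if M = {#} then 1 else 0)"
  by transfer simp

lemma coeff_uminus [simp]: "coeff_sf (- f) M = - coeff_sf f M"
  by transfer simp

lemma coeff_diff [simp]: "coeff_sf (f - g) M = coeff_sf f M - coeff_sf g M"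
  by (simp only: minus_symfun_def coeff_add coeff_uminus diff_conv_add_uminus)

lemma coeff_scale [simp]: "coeff_sf (scale_sf c f) M = c * coeff_sf f M"
  by transfer simp

lemma coeff_mult: "coeff_sf (f * g) M = (\<Sum>(A, B)\<in>msplits M. coeff_sf f A * coeff_sf g B)"
  by transfer simp

lemma coeff_sum [simp]: "coeff_sf (sum f S) M = (\<Sum>i\<in>S. coeff_sf (f i) M)"
  by (induction S rule: infinite_finite_induct) auto

lemma coeff_sym: "bij \<pi> \<Longrightarrow> coeff_sf f (image_mset \<pi> M) = coeff_sf f M"
  using coeff_sf [of f] by (simp add: is_symfun_def)

lemma coeff_bounded_degree: "\<exists>d. \<forall>M. size M > d \<longrightarrow> coeff_sf f M = 0"
  using coeff_sf [of f] by (simp add: is_symfun_def)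

global_interpretation sf: vector_space scale_sf
  by unfold_locales (rule symfun_eqI, simp add: distrib_left distrib_right mult.assoc)+

global_interpretation sf2: vector_space_pair scale_sf scale_sf
  by unfold_locales

lemma vector_space_rat: "vector_space ((*) :: rat \<Rightarrow> rat \<Rightarrow> rat)"
  by unfold_locales (auto simp: algebra_simps)

lemma vector_space_pair_sf_rat: "vector_space_pair scale_sf ((*) :: rat \<Rightarrow> rat \<Rightarrow> rat)"
  by (intro vector_space_pair.intro vector_space_rat sf.vector_space_axioms)

lemma scale_mult_left: "scale_sf c f * g = scale_sf c (f * g)"
  by (intro symfun_eqI) (auto simp: coeff_mult sum_distrib_left case_prod_beta mult.assoc)

lemma scale_mult_right: "f * scale_sf c g = scale_sf c (f * g)"
  by (metis scale_mult_left mult.commute)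

lemma of_nat_mult_scale: "of_nat n * f = scale_sf (of_nat n) f"
  by (induction n) (auto simp: sf.scale_left_distrib distrib_right)

text \<open>Among the indices with non-zero coefficient take one of least weight and evaluate at its
  test point: no other member of the support survives there. The weights are integers so that a
  statistic can also be used with its sign reversed. The lemma serves power sums, Schur functions
  and polytabloids alike.\<close>

lemma triangular_zero:
  fixes e :: "'i \<Rightarrow> 'x \<Rightarrow> 'a::field" and wt :: "'i \<Rightarrow> int" and ev :: "'i \<Rightarrow> 'x"
  assumes S: "finite S"
    and diag: "\<And>i. i \<in> S \<Longrightarrow> e i (ev i) \<noteq> 0"
    and tri: "\<And>i j. i \<in> S \<Longrightarrow> j \<in> S \<Longrightarrow> e j (ev i) \<noteq> 0 \<Longrightarrow> j = i \<or> wt j < wt i"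
    and eq: "\<And>x. (\<Sum>i\<in>S. a i * e i x) = 0" and i: "i \<in> S"
  shows "a i = 0"
proof (rule ccontr)
  assume "a i \<noteq> 0"
  let ?N = "{j \<in> S. a j \<noteq> 0}"
  have "finite ?N" "?N \<noteq> {}" using S i \<open>a i \<noteq> 0\<close> by auto
  then obtain j where j: "j \<in> ?N" and min: "\<And>k. k \<in> ?N \<Longrightarrow> wt j \<le> wt k"
    using arg_min_if_finite [of ?N wt] by (meson not_le)
  have "(\<Sum>i\<in>S. a i * e i (ev j)) = (\<Sum>i\<in>S. if i = j then a j * e j (ev j) else 0)"
  proof (rule sum.cong)
    fix k assume k: "k \<in> S"
    show "a k * e k (ev j) = (if k = j then a j * e j (ev j) else 0)"
    proof (cases "k = j \<or> a k = 0")
      case False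
      then have "wt j \<le> wt k" using min k by auto
      with False have "e k (ev j) = 0" using tri [of j k] j k by fastforce
      with False show ?thesis by auto
    qed auto
  qed simp
  then show False using eq [of "ev j"] diag [of j] S j by auto
qed

lemma triangular_family:
  fixes g :: "'i \<Rightarrow> symfun" and wt :: "'i \<Rightarrow> int" and ev :: "'i \<Rightarrow> nat multiset"
  assumes diag: "\<And>i. i \<in> P \<Longrightarrow> coeff_sf (g i) (ev i) \<noteq> 0"
    and tri: "\<And>i j. i \<in> P \<Longrightarrow> j \<in> P \<Longrightarrow> coeff_sf (g j) (ev i) \<noteq> 0 \<Longrightarrow> j = i \<or> wt j < wt i"
  shows triangular_family_zero:
      "finite S \<Longrightarrow> S \<subseteq> P \<Longrightarrow> (\<Sum>i\<in>S. scale_sf (a i) (g i)) = 0 \<Longrightarrow> i \<in> S \<Longrightarrow> a i = 0"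
    and triangular_family_inj: "inj_on g P"
    and triangular_family_independent: "sf.independent (g ` P)"
proof -
  have zero: "a i = 0" if S: "finite S" "S \<subseteq> P" and eq: "(\<Sum>i\<in>S. scale_sf (a i) (g i)) = 0"
    and i: "i \<in> S" for S a i
  proof (rule triangular_zero [where e = "\<lambda>i. coeff_sf (g i)" and ev = ev and wt = wt and S = S])
    fix M
    have "(\<Sum>i\<in>S. a i * coeff_sf (g i) M) = coeff_sf (\<Sum>i\<in>S. scale_sf (a i) (g i)) M" by simp
    then show "(\<Sum>i\<in>S. a i * coeff_sf (g i) M) = 0" unfolding eq by simp
  qed (use S diag tri i in blast)+
  then show "finite S \<Longrightarrow> S \<subseteq> P \<Longrightarrow> (\<Sum>i\<in>S. scale_sf (a i) (g i)) = 0 \<Longrightarrow> i \<in> S \<Longrightarrow> a i = 0" .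
  show inj: "inj_on g P"
  proof (rule inj_onI, rule ccontr)
    fix i j assume ij: "i \<in> P" "j \<in> P" "g i = g j" "i \<noteq> j"
    have "coeff_sf (g j) (ev i) \<noteq> 0" "coeff_sf (g i) (ev j) \<noteq> 0"
      using diag ij by force+
    with tri [of i j] tri [of j i] ij show False by force
  qed
  show "sf.independent (g ` P)"
    unfolding sf.independent_explicit_finite_subsets
  proof (intro allI impI ballI)
    fix S u v assume S: "S \<subseteq> g ` P" "finite S" "(\<Sum>v\<in>S. scale_sf (u v) v) = 0" "v \<in> S"
    then obtain R where R: "R \<subseteq> P" "finite R" "S = g ` R" by (meson finite_subset_image)
    then have "inj_on g R" using inj inj_on_subset by blast
    then have "(\<Sum>i\<in>R. scale_sf (u (g i)) (g i)) = 0"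
      using S(3) unfolding R(3) by (simp add: sum.reindex)
    with zero [of R "u \<circ> g"] R S(4) show "u v = 0" by auto
  qed
qed



section \<open>Products of power sums form a basis\<close>

section \<open>The power sum basis\<close>

definition pm :: "nat multiset \<Rightarrow> symfun" where
  "pm M = prod_mset (image_mset power_sum M)"

lemma pm_empty [simp]: "pm {#} = 1"
  by (simp add: pm_def)

lemma pm_add_mset [simp]: "pm (add_mset k M) = power_sum k * pm M"
  by (simp add: pm_def)

lemma pm_union: "pm (M + N) = pm M * pm N"
  by (simp add: pm_def)

lemma coeff_power_sum: "coeff_sf (power_sum k) M = (if \<exists>i. M = replicate_mset k i then 1 else 0)"
  by transfer simp

text \<open>Only splittings whose first half is the k-th power of one variable contribute, and for
  \<open>k >= 1\<close> that variable can be recovered from the splitting.\<close>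

lemma coeff_power_sum_mult:
  assumes "k \<ge> 1"
  shows "coeff_sf (power_sum k * f) A =
    (\<Sum>i | i \<in># A \<and> k \<le> count A i. coeff_sf f (A - replicate_mset k i))"
proof -
  let ?I = "{i. i \<in># A \<and> k \<le> count A i}"
  let ?h = "\<lambda>i. (replicate_mset k i, A - replicate_mset k i)"
  have inj: "inj_on ?h ?I"
    using assms by (auto simp: inj_on_def dest!: arg_cong [where f = set_mset])
  have sub: "?h ` ?I \<subseteq> msplits A"
    by (auto simp: msplits_def count_le_replicate_mset_subset_eq)
  have "coeff_sf (power_sum k * f) A =
      (\<Sum>p\<in>msplits A. coeff_sf (power_sum k) (fst p) * coeff_sf f (snd p))"
    by (simp add: coeff_mult case_prod_beta)
  also have "\<dots> = (\<Sum>p\<in>?h ` ?I. coeff_sf (power_sum k) (fst p) * coeff_sf f (snd p))"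
  proof (rule sum.mono_neutral_right)
    show "\<forall>p\<in>msplits A - ?h ` ?I. coeff_sf (power_sum k) (fst p) * coeff_sf f (snd p) = 0"
    proof
      fix p assume p: "p \<in> msplits A - ?h ` ?I"
      have "\<nexists>i. fst p = replicate_mset k i"
      proof
        assume "\<exists>i. fst p = replicate_mset k i"
        then obtain i where i: "fst p = replicate_mset k i" ..
        with p have A: "A = replicate_mset k i + snd p" by (auto simp: msplits_def)
        then have "i \<in> ?I" using assms by auto
        moreover have "p = ?h i" using A i by (cases p) auto
        ultimately show False using p by blast
      qed
      then show "coeff_sf (power_sum k) (fst p) * coeff_sf f (snd p) = 0"
        by (simp add: coeff_power_sum)
    qed
  qed (use sub in auto)
  also have "\<dots> = (\<Sum>i\<in>?I. coeff_sf f (A - replicate_mset k i))"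
    by (subst sum.reindex [OF inj]) (auto simp: coeff_power_sum intro!: sum.cong)
  finally show ?thesis .
qed

text \<open>The exponent vector of a monomial, up to order.\<close>

definition mtype :: "nat multiset \<Rightarrow> nat multiset" where
  "mtype A = image_mset (count A) (mset_set (set_mset A))"

lemma mtype_empty [simp]: "mtype {#} = {#}"
  by (simp add: mtype_def)

lemma zero_notin_mtype: "0 \<notin># mtype A"
  by (auto simp: mtype_def count_eq_zero_iff)

lemma size_mtype: "size (mtype A) = card (set_mset A)"
  by (simp add: mtype_def)

lemma sum_mset_mtype: "sum_mset (mtype A) = size A"
  by (simp add: mtype_def size_multiset_overloaded_eq sum_unfold_sum_mset)

lemma mtype_add:
  assumes "k \<ge> 1" "i \<notin># A"
  shows "mtype (A + replicate_mset k i) = add_mset k (mtype A)"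
proof -
  have s: "set_mset (A + replicate_mset k i) = insert i (set_mset A)" using assms by auto
  have "image_mset (count (A + replicate_mset k i)) (mset_set (set_mset A)) = image_mset (count A) (mset_set (set_mset A))"
    using assms by (intro image_mset_cong) auto
  then show ?thesis
    using assms unfolding mtype_def s by (simp add: not_in_iff [symmetric] count_eq_zero_iff)
qed

lemma mset_decompose:
  "\<exists>B. M = B + replicate_mset (count M x) x \<and> x \<notin># B"
  by (intro exI [of _ "filter_mset (\<lambda>y. y \<noteq> x) M"]) (auto simp: multiset_eq_iff)

lemma mtype_surj: "0 \<notin># M \<Longrightarrow> \<exists>A. mtype A = M"
proof (induction M)
  case (add k M)
  then obtain A where A: "mtype A = M" by auto
  obtain i where "i \<notin># A" using ex_new_if_finite [of "set_mset A"] by auto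
  then have "mtype (A + replicate_mset k i) = add_mset k M" using add A by (simp add: mtype_add)
  then show ?case ..
qed (auto intro: exI [of _ "{#}"])

lemma coeff_pm_nonneg: "0 \<notin># M \<Longrightarrow> coeff_sf (pm M) A \<ge> 0"
proof (induction M arbitrary: A)
  case (add k M)
  then show ?case by (auto simp: coeff_power_sum_mult Suc_le_eq intro!: sum_nonneg)
qed (auto simp: coeff_one)

lemma coeff_pm_mtype: "mtype A = M \<Longrightarrow> coeff_sf (pm M) A > 0"
proof (induction M arbitrary: A)
  case empty
  then have "A = {#}" by (metis size_mtype size_empty card_eq_0_iff finite_set_mset set_mset_eq_empty_iff)
  then show ?case by (simp add: coeff_one)
next
  case (add k M)
  then have "k \<in># mtype A" by simp
  then obtain i where i: "i \<in># A" "k = count A i" by (auto simp: mtype_def)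
  obtain B where B: "A = B + replicate_mset k i" "i \<notin># B"
    using mset_decompose [of A i] unfolding i(2) [symmetric] by blast
  have k: "k \<ge> 1" using i by (simp add: Suc_le_eq)
  have "mtype A = add_mset k (mtype B)" unfolding B(1) by (rule mtype_add [OF k B(2)])
  then have "coeff_sf (pm M) B > 0" using add by simp
  moreover have "0 \<notin># M" using add.prems zero_notin_mtype [of A] by auto
  moreover have "A - replicate_mset k i = B" using B(1) by simp
  ultimately show ?case
    using k i by (auto simp: coeff_power_sum_mult coeff_pm_nonneg intro!: sum_pos2 [of _ i])
qed

text \<open>Multiplying out assigns each part of \<open>M\<close> to a variable, so the exponents of
  a monomial that occurs are sums over blocks of parts. There are at most \<open>size M\<close>
  blocks, and if there are that many, each is a single part. Thus the products are triangular with
  respect to the number of parts.\<close>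

lemma coeff_pm_nonzero:
  assumes "0 \<notin># M" "coeff_sf (pm M) A \<noteq> 0"
  shows "card (set_mset A) \<le> size M \<and> (card (set_mset A) = size M \<longrightarrow> mtype A = M)"
  using assms
proof (induction M arbitrary: A)
  case (add k M)
  then have k: "k \<ge> 1" by auto
  with add.prems obtain i where i: "i \<in># A" "k \<le> count A i"
    and nz: "coeff_sf (pm M) (A - replicate_mset k i) \<noteq> 0"
    by (auto simp: coeff_power_sum_mult elim!: sum.not_neutral_contains_not_neutral)
  define B where "B = A - replicate_mset k i"
  have A: "A = B + replicate_mset k i"
    using i by (simp add: B_def count_le_replicate_mset_subset_eq)
  have s: "set_mset A = insert i (set_mset B)" using A k by auto
  have IH: "card (set_mset B) \<le> size M" "card (set_mset B) = size M \<Longrightarrow> mtype B = M"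
    using add nz by (auto simp: B_def)
  have "mtype A = add_mset k M" if "card (set_mset A) = Suc (size M)"
  proof -
    have "i \<notin># B"
      using that IH(1) s by (metis card.insert finite_set_mset insert_absorb not_less_eq_eq order.refl)
    moreover have "card (set_mset B) = size M" using that s \<open>i \<notin># B\<close> by simp
    ultimately show ?thesis using mtype_add [OF k] A IH(2) by simp
  qed
  moreover have "card (set_mset A) \<le> Suc (size M)" using IH(1) s by (simp add: card_insert_if)
  ultimately show ?case by simp
qed (auto simp: coeff_one split: if_splits)

lemma pm_inj: "inj_on pm {M. 0 \<notin># M}"
  and pm_independent: "sf.independent (pm ` {M. 0 \<notin># M})"
proof -
  let ?P = "{M :: nat multiset. 0 \<notin># M}"
  define ev where "ev M = (SOME A. mtype A = M)" for M
  have ev: "mtype (ev M) = M" if "M \<in> ?P" for M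
    unfolding ev_def using mtype_surj [of M] that by (auto intro: someI_ex)
  have 1: "coeff_sf (pm M) (ev M) \<noteq> 0" if "M \<in> ?P" for M
    using coeff_pm_mtype [OF ev [OF that]] by simp
  have 2: "N = M \<or> - int (size N) < - int (size M)"
    if "M \<in> ?P" "N \<in> ?P" "coeff_sf (pm N) (ev M) \<noteq> 0" for M N
    using coeff_pm_nonzero [of N "ev M"] that ev [of M] size_mtype [of "ev M"] by auto
  show "inj_on pm ?P" by (rule triangular_family_inj [of ?P pm ev "\<lambda>M. - int (size M)"]) (fact 1 2)+
  show "sf.independent (pm ` ?P)"
    by (rule triangular_family_independent [of ?P pm ev "\<lambda>M. - int (size M)"]) (fact 1 2)+
qed

text \<open>The bijection is built one variable at a time; composing with a transposition corrects
  the image of the new variable. Consequently a coefficient of a symmetric function depends on the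
  exponents only (\<open>coeff_mtype\<close>).\<close>

lemma mtype_eq_bij:
  assumes "mtype A = mtype B"
  shows "\<exists>\<pi>. bij \<pi> \<and> image_mset \<pi> A = B"
  using assms
proof (induction "card (set_mset A)" arbitrary: A B)
  case 0
  then have "A = {#}" by simp
  with 0 have "size (mtype B) = 0" by simp
  then have "B = {#}" by (simp add: size_mtype)
  with \<open>A = {#}\<close> show ?case by (auto intro: bij_id)
next
  case (Suc n)
  then obtain i where i: "i \<in># A" by (metis card_eq_0_iff ex_in_conv nat.simps(3))
  then have "count A i \<in># mtype A" by (simp add: mtype_def)
  then have "count A i \<in># mtype B" using Suc.prems by simp
  then obtain j where j: "j \<in># B" "count B j = count A i" by (auto simp: mtype_def)
  define k where "k = count A i"
  have k: "k \<ge> 1" using i by (simp add: k_def Suc_le_eq)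
  obtain A' where A': "A = A' + replicate_mset k i" "i \<notin># A'"
    using mset_decompose [of A i] unfolding k_def by blast
  obtain B' where B': "B = B' + replicate_mset k j" "j \<notin># B'"
    using mset_decompose [of B j] unfolding j(2) k_def [symmetric] by blast
  have "add_mset k (mtype A') = add_mset k (mtype B')"
    using Suc.prems unfolding A'(1) B'(1) by (simp only: mtype_add [OF k A'(2)] mtype_add [OF k B'(2)])
  then have t: "mtype A' = mtype B'" by simp
  have "set_mset A = insert i (set_mset A')" unfolding A'(1) using k by auto
  then have "card (set_mset A') = n" using Suc.hyps(2) A'(2) by simp
  then obtain \<pi> where \<pi>: "bij \<pi>" "image_mset \<pi> A' = B'" using Suc.hyps(1) t by blast
  let ?\<sigma> = "Transposition.transpose (\<pi> i) j \<circ> \<pi>"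
  have "image_mset ?\<sigma> A' = image_mset \<pi> A'"
  proof (rule image_mset_cong)
    fix x assume x: "x \<in># A'"
    then have "\<pi> x \<noteq> \<pi> i" using A'(2) \<pi>(1) by (metis bij_pointE)
    moreover have "\<pi> x \<noteq> j" using B'(2) \<pi>(2) x by auto
    ultimately show "?\<sigma> x = \<pi> x" by (simp add: transpose_apply_other)
  qed
  then have "image_mset ?\<sigma> A = B" unfolding A'(1) B'(1) using \<pi>(2) by simp
  moreover have "bij ?\<sigma>" using \<pi>(1) by (intro bij_comp) auto
  ultimately show ?case by blast
qed

lemma coeff_mtype: "mtype A = mtype B \<Longrightarrow> coeff_sf f A = coeff_sf f B"
  by (metis mtype_eq_bij coeff_sym)

lemma coeff_pm_degree: "0 \<notin># M \<Longrightarrow> sum_mset M \<noteq> size A \<Longrightarrow> coeff_sf (pm M) A = 0"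
proof (induction M arbitrary: A)
  case (add k M)
  have "coeff_sf (pm M) (A - replicate_mset k i) = 0" if "k \<le> count A i" for i
  proof -
    have "replicate_mset k i \<subseteq># A" using that by (simp add: count_le_replicate_mset_subset_eq)
    then have "size (A - replicate_mset k i) = size A - k" "k \<le> size A"
      using size_mset_mono by (force simp: size_Diff_submset)+
    then show ?thesis using add by auto
  qed
  with add.prems show ?case by (simp add: coeff_power_sum_mult Suc_le_eq)
qed (auto simp: coeff_one)

text \<open>Elimination by the number of distinct variables, downwards from a degree bound
  \<open>d\<close>. Once the coefficients at monomials with more than \<open>l\<close> variables are
  zero, those at monomials with exactly \<open>l\<close> variables are removed by a combination of
  products with \<open>l\<close> parts, which by \<open>coeff_pm_nonzero\<close> does not touch
  monomials with more variables.\<close>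

lemma pm_span: "f \<in> sf.span (pm ` {M. 0 \<notin># M})"
proof -
  let ?P = "{M :: nat multiset. 0 \<notin># M}"
  obtain d where d: "\<And>M. size M > d \<Longrightarrow> coeff_sf f M = 0" using coeff_bounded_degree by blast
  have card_le: "card (set_mset A) \<le> size A" for A :: "nat multiset"
    by (induction A) (auto simp: card_insert_if)
  have "\<exists>g. g \<in> sf.span (pm ` ?P) \<and> (\<forall>A. size A > d \<longrightarrow> coeff_sf (f - g) A = 0) \<and>
      (\<forall>A. d < card (set_mset A) + k \<longrightarrow> coeff_sf (f - g) A = 0)" for k
  proof (induction k)
    case 0
    have "size A > d" if "d < card (set_mset A)" for A :: "nat multiset"
      using card_le [of A] that by simp
    then show ?case by (intro exI [of _ 0]) (auto simp: d sf.span_zero)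
  next
    case (Suc k)
    then obtain g where g: "g \<in> sf.span (pm ` ?P)"
      and g1: "\<And>A. size A > d \<Longrightarrow> coeff_sf (f - g) A = 0"
      and g2: "\<And>A. d < card (set_mset A) + k \<Longrightarrow> coeff_sf (f - g) A = 0" by blast
    show ?case
    proof (cases "d < k")
      case True
      with g g1 g2 show ?thesis by (intro exI [of _ g]) auto
    next
      case False
    define l where "l = d - k"
    define r where "r = f - g"
    define S where "S = {M. 0 \<notin># M \<and> size M = l \<and> sum_mset M \<le> d}"
    define ev where "ev M = (SOME A. mtype A = M)" for M
    have ev: "mtype (ev M) = M" if "M \<in> S" for M
      unfolding ev_def using mtype_surj [of M] that by (auto simp: S_def intro: someI_ex)
    have "S \<subseteq> mset ` {xs. set xs \<subseteq> {..d} \<and> length xs = l}"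
    proof
      fix M assume M: "M \<in> S"
      obtain xs where xs: "mset xs = M" using ex_mset by blast
      have "x \<le> d" if "x \<in># M" for x
        using M that by (auto simp: S_def dest!: multi_member_split)
      with xs M have "xs \<in> {xs. set xs \<subseteq> {..d} \<and> length xs = l}" by (auto simp: S_def)
      with xs show "M \<in> mset ` {xs. set xs \<subseteq> {..d} \<and> length xs = l}" by blast
    qed
    then have fin: "finite S" by (rule finite_subset) (simp add: finite_lists_length_eq)
    define q where "q = (\<Sum>M\<in>S. scale_sf (coeff_sf r (ev M) / coeff_sf (pm M) (ev M)) (pm M))"
    have q: "q \<in> sf.span (pm ` ?P)"
      unfolding q_def by (intro sf.span_sum sf.span_scale sf.span_base) (auto simp: S_def)
    have 1: "coeff_sf (r - q) A = 0" if A: "size A > d" for A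
      using g1 [OF A] coeff_pm_degree A by (auto simp: r_def q_def S_def intro!: sum.neutral)
    have 2: "coeff_sf (r - q) A = 0" if A: "d < card (set_mset A) + Suc k" for A
    proof (cases "l < card (set_mset A)")
      case True
      have "coeff_sf (pm M) A = 0" if "M \<in> S" for M
        using coeff_pm_nonzero [of M A] that True by (fastforce simp: S_def)
      then show ?thesis using g2 [of A] True by (auto simp: l_def r_def q_def intro!: sum.neutral)
    next
      case False
      with A \<open>\<not> d < k\<close> have l: "card (set_mset A) = l" by (simp add: l_def)
      have "coeff_sf q A = (\<Sum>M\<in>S. if M = mtype A then coeff_sf r A else 0)"
        unfolding q_def coeff_sum coeff_scale
      proof (rule sum.cong)
        fix M assume M: "M \<in> S"
        show "coeff_sf r (ev M) / coeff_sf (pm M) (ev M) * coeff_sf (pm M) A =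
            (if M = mtype A then coeff_sf r A else 0)"
        proof (cases "M = mtype A")
          case True
          then have e: "coeff_sf h (ev M) = coeff_sf h A" for h using ev [OF M] coeff_mtype by metis
          have "coeff_sf (pm M) A \<noteq> 0" using coeff_pm_mtype [of A M] True by simp
          then show ?thesis unfolding e using True by simp
        next
          case False
          then have "coeff_sf (pm M) A = 0" using coeff_pm_nonzero [of M A] M l by (auto simp: S_def)
          with False show ?thesis by simp
        qed
      qed simp
      also have "\<dots> = (if mtype A \<in> S then coeff_sf r A else 0)" using fin by simp
      also have "\<dots> = coeff_sf r A"
      proof (cases "mtype A \<in> S")
        case False
        then have "size A > d" using l zero_notin_mtype [of A] by (auto simp: S_def size_mtype sum_mset_mtype)
        with g1 show ?thesis by (simp add: r_def)
      qed simp
      finally show ?thesis by simp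
    qed
    have "f - (g + q) = r - q" by (simp add: r_def)
    with 1 2 sf.span_add [OF g q] show ?thesis by metis
    qed
  qed
  from this [of "Suc d"] obtain g where g: "g \<in> sf.span (pm ` ?P)"
    and g2: "\<And>A. coeff_sf (f - g) A = 0" by auto
  then have "f = g" by (intro symfun_eqI) simp
  with g show ?thesis by simp
qed


section \<open>Adams operations, and existence and uniqueness of plethysm\<close>

section \<open>Plethysm\<close>

lemma repeat_mset_inj: "k \<ge> 1 \<Longrightarrow> repeat_mset k A = repeat_mset k B \<Longrightarrow> A = B"
  by (simp add: multiset_eq_iff)

lemma image_mset_repeat_mset: "image_mset h (repeat_mset k N) = repeat_mset k (image_mset h N)"
  by (induction N) (auto simp: repeat_mset_distrib_add_mset)

lemma the_repeat_mset: "k \<ge> 1 \<Longrightarrow> (THE N. repeat_mset k A = repeat_mset k N) = A"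
  by (rule the_equality) (auto dest: repeat_mset_inj [rotated])

lemma image_mset_inv_bij: "bij \<pi> \<Longrightarrow> image_mset (inv \<pi>) (image_mset \<pi> M) = M"
  by (simp add: multiset.map_comp bij_is_inj inv_o_cancel multiset.map_id)

text \<open>The Adams operation that replaces every variable by its k-th power, which will turn out
  to be p_k[f]. The value 0 for \<open>k = 0\<close>, where k-th roots of monomials are not unique,
  makes it total.\<close>

lift_definition psi :: "nat \<Rightarrow> symfun \<Rightarrow> symfun" is
  "\<lambda>k f M. if k \<ge> 1 \<and> (\<exists>N. M = repeat_mset k N) then f (THE N. M = repeat_mset k N) else 0"
  unfolding is_symfun_def
proof (intro conjI allI impI)
  fix k :: nat and f :: "nat multiset \<Rightarrow> rat" and M and \<pi> :: "nat \<Rightarrow> nat"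
  assume f: "(\<forall>\<pi>. bij \<pi> \<longrightarrow> (\<forall>M. f (image_mset \<pi> M) = f M)) \<and> (\<exists>d. \<forall>M. d < size M \<longrightarrow> f M = 0)"
    and \<pi>: "bij \<pi>"
  show "(if 1 \<le> k \<and> (\<exists>N. image_mset \<pi> M = repeat_mset k N)
            then f (THE N. image_mset \<pi> M = repeat_mset k N) else 0) =
           (if 1 \<le> k \<and> (\<exists>N. M = repeat_mset k N) then f (THE N. M = repeat_mset k N) else 0)"
  proof (cases "k \<ge> 1 \<and> (\<exists>N. M = repeat_mset k N)")
    case True
    then obtain N where N: "M = repeat_mset k N" by blast
    with True show ?thesis using f \<pi> by (auto simp: the_repeat_mset image_mset_repeat_mset)
  next
    case False
    have "\<exists>N. M = repeat_mset k N" if N: "image_mset \<pi> M = repeat_mset k N" for N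
      using arg_cong [OF N, of "image_mset (inv \<pi>)"] \<pi>
      by (auto simp: image_mset_inv_bij image_mset_repeat_mset)
    with False have "\<not> (k \<ge> 1 \<and> (\<exists>N. image_mset \<pi> M = repeat_mset k N))" by blast
    with False show ?thesis by (simp only: if_False)
  qed
next
  fix k :: nat and f :: "nat multiset \<Rightarrow> rat"
  assume f: "(\<forall>\<pi>. bij \<pi> \<longrightarrow> (\<forall>M. f (image_mset \<pi> M) = f M)) \<and> (\<exists>d. \<forall>M. d < size M \<longrightarrow> f M = 0)"
  then obtain d where d: "\<forall>M. d < size M \<longrightarrow> f M = 0" by blast
  show "\<exists>d. \<forall>M. d < size M \<longrightarrow>
       (if 1 \<le> k \<and> (\<exists>N. M = repeat_mset k N) then f (THE N. M = repeat_mset k N) else 0) = 0"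
  proof (intro exI [of _ "k * d"] allI impI)
    fix M :: "nat multiset" assume M: "k * d < size M"
    show "(if 1 \<le> k \<and> (\<exists>N. M = repeat_mset k N) then f (THE N. M = repeat_mset k N) else 0) = 0"
      using M d by (auto simp: the_repeat_mset)
  qed
qed

lemma coeff_psi_repeat [simp]: "k \<ge> 1 \<Longrightarrow> coeff_sf (psi k f) (repeat_mset k N) = coeff_sf f N"
  by transfer (auto simp: the_repeat_mset)

lemma coeff_psi_other: "\<nexists>N. M = repeat_mset k N \<Longrightarrow> coeff_sf (psi k f) M = 0"
  by transfer auto

lemma psi_eqI:
  assumes "k \<ge> 1" "\<And>N. coeff_sf g (repeat_mset k N) = coeff_sf f N"
    and "\<And>M. \<nexists>N. M = repeat_mset k N \<Longrightarrow> coeff_sf g M = 0"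
  shows "psi k f = g"
proof (rule symfun_eqI)
  fix M
  show "coeff_sf (psi k f) M = coeff_sf g M"
    using assms by (cases "\<exists>N. M = repeat_mset k N") (auto simp: coeff_psi_other)
qed

text \<open>A splitting of a k-th power contributes only if both halves are k-th powers, and these
  splittings correspond to those of the root.\<close>

lemma psi_mult:
  assumes k: "k \<ge> 1"
  shows "psi k (f * g) = psi k f * psi k g"
proof (rule psi_eqI [OF k])
  fix N :: "nat multiset"
  let ?r = "map_prod (repeat_mset k) (repeat_mset k)"
  have sub: "?r ` msplits N \<subseteq> msplits (repeat_mset k N)"
    by (auto simp: msplits_def simp flip: repeat_mset_distrib2)
  have "coeff_sf (psi k f * psi k g) (repeat_mset k N) =
      (\<Sum>p\<in>msplits (repeat_mset k N). coeff_sf (psi k f) (fst p) * coeff_sf (psi k g) (snd p))"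
    by (simp add: coeff_mult case_prod_beta)
  also have "\<dots> = (\<Sum>p\<in>?r ` msplits N. coeff_sf (psi k f) (fst p) * coeff_sf (psi k g) (snd p))"
  proof (rule sum.mono_neutral_right)
    show "\<forall>p\<in>msplits (repeat_mset k N) - ?r ` msplits N.
        coeff_sf (psi k f) (fst p) * coeff_sf (psi k g) (snd p) = 0"
    proof
      fix p assume p: "p \<in> msplits (repeat_mset k N) - ?r ` msplits N"
      obtain A B where AB: "p = (A, B)" by (cases p)
      have "\<not> ((\<exists>N. A = repeat_mset k N) \<and> (\<exists>N. B = repeat_mset k N))"
      proof
        assume "(\<exists>N. A = repeat_mset k N) \<and> (\<exists>N. B = repeat_mset k N)"
        then obtain A' B' where A': "A = repeat_mset k A'" and B': "B = repeat_mset k B'" by blast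
        with p AB have "repeat_mset k (A' + B') = repeat_mset k N"
          by (simp add: msplits_def repeat_mset_distrib2)
        then have "A' + B' = N" by (rule repeat_mset_inj [OF k])
        then have "p \<in> ?r ` msplits N" using A' B' AB by (auto simp: msplits_def)
        with p show False by blast
      qed
      then show "coeff_sf (psi k f) (fst p) * coeff_sf (psi k g) (snd p) = 0"
        using coeff_psi_other [of A k f] coeff_psi_other [of B k g] AB by auto
    qed
  qed (use sub in auto)
  also have "\<dots> = (\<Sum>p\<in>msplits N. coeff_sf f (fst p) * coeff_sf g (snd p))"
    using k by (subst sum.reindex) (auto simp: inj_on_def dest: repeat_mset_inj [OF k])
  finally show "coeff_sf (psi k f * psi k g) (repeat_mset k N) = coeff_sf (f * g) N"
    by (simp add: coeff_mult case_prod_beta)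
next
  fix M :: "nat multiset" assume M: "\<nexists>N. M = repeat_mset k N"
  show "coeff_sf (psi k f * psi k g) M = 0"
    unfolding coeff_mult
  proof (rule sum.neutral, clarify)
    fix A B assume "(A, B) \<in> msplits M"
    then have "\<not> ((\<exists>N. A = repeat_mset k N) \<and> (\<exists>N. B = repeat_mset k N))"
      using M by (auto simp: msplits_def simp flip: repeat_mset_distrib2)
    then show "coeff_sf (psi k f) A * coeff_sf (psi k g) B = 0"
      using coeff_psi_other [of A k f] coeff_psi_other [of B k g] by auto
  qed
qed

lemma rat_alg_hom_psi:
  assumes k: "k \<ge> 1"
  shows "rat_alg_hom (psi k)"
  unfolding rat_alg_hom_def
proof (intro conjI allI)
  have "repeat_mset k N = {#} \<longleftrightarrow> N = {#}" for N :: "nat multiset"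
    using k by (cases N) auto
  then show "psi k 1 = 1"
    using k by (intro psi_eqI) (auto simp: coeff_one intro: exI [of _ "{#}"])
  show "psi k (f + g) = psi k f + psi k g" for f g
    using k by (intro psi_eqI) (auto simp: coeff_psi_other)
  show "psi k (scale_sf c f) = scale_sf c (psi k f)" for c f
    using k by (intro psi_eqI) (auto simp: coeff_psi_other)
qed (rule psi_mult [OF k])

lemma repeat_replicate_mset: "repeat_mset k (replicate_mset l i) = replicate_mset (k * l) i"
  by (simp add: multiset_eq_iff)

lemma psi_power_sum:
  assumes "k \<ge> 1" "l \<ge> 1"
  shows "psi k (power_sum l) = power_sum (k * l)"
proof (rule psi_eqI)
  fix N :: "nat multiset"
  have "(\<exists>i. repeat_mset k N = replicate_mset (k * l) i) \<longleftrightarrow> (\<exists>i. N = replicate_mset l i)"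
    by (metis repeat_replicate_mset repeat_mset_inj assms(1))
  then show "coeff_sf (power_sum (k * l)) (repeat_mset k N) = coeff_sf (power_sum l) N"
    by (simp add: coeff_power_sum)
next
  fix M :: "nat multiset" assume "\<nexists>N. M = repeat_mset k N"
  then have "\<nexists>i. M = replicate_mset (k * l) i" by (metis repeat_replicate_mset)
  then show "coeff_sf (power_sum (k * l)) M = 0" by (simp add: coeff_power_sum)
qed (rule assms)

lemma sf_linearI:
  assumes "\<And>x y. \<theta> (x + y) = \<theta> x + \<theta> y" "\<And>c x. \<theta> (scale_sf c x) = scale_sf c (\<theta> x)"
  shows "Vector_Spaces.linear scale_sf scale_sf \<theta>"
  unfolding Vector_Spaces.linear_iff using assms sf.vector_space_axioms by auto

lemma rat_alg_hom_linear: "rat_alg_hom \<theta> \<Longrightarrow> Vector_Spaces.linear scale_sf scale_sf \<theta>"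
  by (rule sf_linearI) (auto simp: rat_alg_hom_def)

lemma rat_alg_hom_pm:
  "rat_alg_hom \<theta> \<Longrightarrow> \<theta> (pm M) = (\<Prod>k\<in>#M. \<theta> (power_sum k))"
  by (induction M) (auto simp: rat_alg_hom_def)

lemma rat_alg_hom_unique:
  assumes "rat_alg_hom \<theta>" "rat_alg_hom \<eta>" "\<And>k. k \<ge> 1 \<Longrightarrow> \<theta> (power_sum k) = \<eta> (power_sum k)"
  shows "\<theta> = \<eta>"
proof
  fix f
  have "\<theta> (pm M) = \<eta> (pm M)" if "0 \<notin># M" for M
  proof -
    have "image_mset (\<lambda>k. \<theta> (power_sum k)) M = image_mset (\<lambda>k. \<eta> (power_sum k)) M"
      using assms(3) that by (intro image_mset_cong) (metis One_nat_def Suc_leI gr0I)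
    then show ?thesis by (simp only: rat_alg_hom_pm assms(1,2))
  qed
  then show "\<theta> f = \<eta> f"
    by (rule_tac sf2.linear_eq_on [OF rat_alg_hom_linear [OF assms(1)] rat_alg_hom_linear [OF assms(2)] pm_span]) auto
qed

text \<open>Since products of power sums form a basis, prescribed values on power sums extend to a
  linear map that is multiplicative on basis elements; linearity then extends this to one argument
  at a time.\<close>

lemma rat_alg_hom_exists: "\<exists>\<theta>. rat_alg_hom \<theta> \<and> (\<forall>k\<ge>1. \<theta> (power_sum k) = q k)"
proof -
  let ?P = "{M :: nat multiset. 0 \<notin># M}"
  obtain \<theta> where lin: "Vector_Spaces.linear scale_sf scale_sf \<theta>"
    and \<theta>: "\<And>x. x \<in> pm ` ?P \<Longrightarrow> \<theta> x = prod_mset (image_mset q (inv_into ?P pm x))"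
    using sf2.linear_independent_extend [OF pm_independent,
        of "\<lambda>x. prod_mset (image_mset q (inv_into ?P pm x))"] by blast
  have pm: "\<theta> (pm M) = prod_mset (image_mset q M)" if "M \<in> ?P" for M
    using \<theta> [of "pm M"] inv_into_f_f [OF pm_inj that] that by simp
  have add: "\<theta> (x + y) = \<theta> x + \<theta> y" and scale: "\<theta> (scale_sf c x) = scale_sf c (\<theta> x)" for x y c
    using sf2.linear_add [OF lin] sf2.linear_scale [OF lin] by auto
  have lin1: "Vector_Spaces.linear scale_sf scale_sf (\<lambda>x. \<theta> (x * y))" for y
    by (rule sf_linearI) (auto simp: add scale distrib_right scale_mult_left)
  have lin2: "Vector_Spaces.linear scale_sf scale_sf (\<lambda>x. \<theta> x * \<theta> y)" for y
    by (rule sf_linearI) (auto simp: add scale distrib_right scale_mult_left)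
  have lin3: "Vector_Spaces.linear scale_sf scale_sf (\<lambda>y. \<theta> (x * y))" for x
    by (rule sf_linearI) (auto simp: add scale distrib_left scale_mult_right)
  have lin4: "Vector_Spaces.linear scale_sf scale_sf (\<lambda>y. \<theta> x * \<theta> y)" for x
    by (rule sf_linearI) (auto simp: add scale distrib_left scale_mult_right)
  have 1: "\<theta> (pm M * pm N) = \<theta> (pm M) * \<theta> (pm N)" if "M \<in> ?P" "N \<in> ?P" for M N
    using that by (simp add: pm flip: pm_union)
  have 2: "\<theta> (pm M * y) = \<theta> (pm M) * \<theta> y" if "M \<in> ?P" for M y
    by (rule sf2.linear_eq_on [OF lin3 lin4 pm_span]) (use 1 that in auto)
  have 3: "\<theta> (x * y) = \<theta> x * \<theta> y" for x y
    by (rule sf2.linear_eq_on [OF lin1 lin2 pm_span]) (use 2 in auto)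
  have "\<theta> 1 = 1" using pm [of "{#}"] by simp
  moreover have "\<theta> (power_sum k) = q k" if "k \<ge> 1" for k
    using pm [of "{#k#}"] that by simp
  ultimately show ?thesis using 3 add scale by (auto simp: rat_alg_hom_def)
qed

lemma is_plethysm_power_sum:
  assumes pl: "is_plethysm pl" and k: "k \<ge> 1"
  shows "pl (power_sum k) = psi k"
proof (rule rat_alg_hom_unique)
  show "rat_alg_hom (pl (power_sum k))" using pl k unfolding is_plethysm_def by blast
  show "rat_alg_hom (psi k)" by (rule rat_alg_hom_psi [OF k])
  show "pl (power_sum k) (power_sum l) = psi k (power_sum l)" if "l \<ge> 1" for l
    using pl k that unfolding is_plethysm_def psi_power_sum [OF k that] by blast
qed

text \<open>Power sums generate the ring freely. The first two axioms force p_k[g] to be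
  \<open>psi k g\<close> for every \<open>g\<close>, and the third then determines f[g]; so the
  description in \<open>plethysm\<close> has exactly one solution.\<close>

lemma plethysm_properties: "is_plethysm plethysm"
proof -
  \<comment> \<open>The homomorphism is chosen from \<open>g\<close> alone and then applied to
    \<open>f\<close>, so that one choice serves all \<open>f\<close>.\<close>
  define pl :: "symfun \<Rightarrow> symfun \<Rightarrow> symfun" where "pl f g = (SOME \<theta>. rat_alg_hom \<theta> \<and> (\<forall>k\<ge>1. \<theta> (power_sum k) = psi k g)) f" for f g
  have pl: "rat_alg_hom (\<lambda>f. pl f g)" "\<And>k. k \<ge> 1 \<Longrightarrow> pl (power_sum k) g = psi k g" for g
    unfolding pl_def using someI_ex [OF rat_alg_hom_exists [of "\<lambda>k. psi k g"]] by auto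
  have plk: "pl (power_sum k) = psi k" if "k \<ge> 1" for k using pl(2) [OF that] by blast
  have "is_plethysm pl"
    unfolding is_plethysm_def
  proof (intro conjI allI impI)
    show "pl (power_sum k) (power_sum l) = power_sum (k * l)" if "1 \<le> k" "1 \<le> l" for k l
      unfolding plk [OF that(1)] using that by (rule psi_power_sum)
    show "rat_alg_hom (pl (power_sum k))" if "1 \<le> k" for k
      unfolding plk [OF that] using that by (rule rat_alg_hom_psi)
  qed (rule pl)
  moreover have "pl' = pl" if pl': "is_plethysm pl'" for pl'
  proof -
    have k: "pl' (power_sum k) = psi k" if "k \<ge> 1" for k
      by (rule is_plethysm_power_sum [OF pl' that])
    have "(\<lambda>f. pl' f g) = (\<lambda>f. pl f g)" for g
    proof (rule rat_alg_hom_unique)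
      show "rat_alg_hom (\<lambda>f. pl' f g)" using pl' by (simp add: is_plethysm_def)
      show "rat_alg_hom (\<lambda>f. pl f g)" by (rule pl)
      show "pl' (power_sum k) g = pl (power_sum k) g" if "k \<ge> 1" for k by (simp only: k plk that)
    qed
    from fun_cong [OF this] show ?thesis by (intro ext) simp
  qed
  ultimately show ?thesis unfolding plethysm_def by (rule theI)
qed

lemma plethysm_power_sum: "k \<ge> 1 \<Longrightarrow> plethysm (power_sum k) = psi k"
  by (rule is_plethysm_power_sum [OF plethysm_properties])

lemma rat_alg_hom_plethysm: "rat_alg_hom (\<lambda>f. plethysm f g)"
  using plethysm_properties by (simp add: is_plethysm_def)

lemma plethysm_pm:
  assumes "0 \<notin># M"
  shows "plethysm (pm M) g = (\<Prod>k\<in>#M. psi k g)"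
proof -
  have "plethysm (pm M) g = (\<Prod>k\<in>#M. plethysm (power_sum k) g)"
    by (rule rat_alg_hom_pm [OF rat_alg_hom_plethysm])
  also have "image_mset (\<lambda>k. plethysm (power_sum k) g) M = image_mset (\<lambda>k. psi k g) M"
  proof (rule image_mset_cong)
    fix k assume "k \<in># M"
    with assms have "k \<ge> 1" by (cases k) auto
    then show "plethysm (power_sum k) g = psi k g" by (simp only: plethysm_power_sum)
  qed
  finally show ?thesis .
qed


section \<open>Kostka numbers and the removal of horizontal strips\<close>

section \<open>Horizontal strips and semistandard tableaux\<close>

text \<open>Partitions are represented here by weakly decreasing, eventually vanishing functions.\<close>

definition is_part :: "(nat \<Rightarrow> nat) \<Rightarrow> bool" where
  "is_part \<nu> \<longleftrightarrow> (\<forall>i. \<nu> (Suc i) \<le> \<nu> i) \<and> (\<exists>N. \<forall>i\<ge>N. \<nu> i = 0)"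

definition diagram :: "(nat \<Rightarrow> nat) \<Rightarrow> (nat \<times> nat) set" where
  "diagram \<nu> = {(i, j). j < \<nu> i}"

definition psize :: "(nat \<Rightarrow> nat) \<Rightarrow> nat" where
  "psize \<nu> = card (diagram \<nu>)"

text \<open>\<open>\<nu> / \<kappa>\<close> is a horizontal strip.\<close>

definition hstrip :: "(nat \<Rightarrow> nat) \<Rightarrow> (nat \<Rightarrow> nat) \<Rightarrow> bool" where
  "hstrip \<nu> \<kappa> \<longleftrightarrow> (\<forall>i. \<nu> (Suc i) \<le> \<kappa> i \<and> \<kappa> i \<le> \<nu> i)"

definition hsdn :: "(nat \<Rightarrow> nat) \<Rightarrow> nat \<Rightarrow> (nat \<Rightarrow> nat) set" where
  "hsdn \<nu> c = {\<kappa>. hstrip \<nu> \<kappa> \<and> psize \<nu> = psize \<kappa> + c}"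

definition hsup :: "(nat \<Rightarrow> nat) \<Rightarrow> nat \<Rightarrow> (nat \<Rightarrow> nat) set" where
  "hsup \<rho> c = {\<nu>. hstrip \<nu> \<rho> \<and> psize \<nu> = psize \<rho> + c}"

definition tab :: "(nat \<Rightarrow> nat) \<Rightarrow> nat multiset \<Rightarrow> (nat \<times> nat \<Rightarrow> nat) set" where
  "tab \<nu> M = {T \<in> diagram \<nu> \<rightarrow>\<^sub>E UNIV.
     (\<forall>i j. (i, Suc j) \<in> diagram \<nu> \<longrightarrow> T (i, j) \<le> T (i, Suc j)) \<and>
     (\<forall>i j. (Suc i, j) \<in> diagram \<nu> \<longrightarrow> T (i, j) < T (Suc i, j)) \<and>
     image_mset T (mset_set (diagram \<nu>)) = M}"

definition kostka :: "(nat \<Rightarrow> nat) \<Rightarrow> nat multiset \<Rightarrow> nat" where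
  "kostka \<nu> M = card (tab \<nu> M)"

lemma mem_diagram [simp]: "(i, j) \<in> diagram \<nu> \<longleftrightarrow> j < \<nu> i"
  by (simp add: diagram_def)

lemma diagram_Sigma: "\<forall>i\<ge>N. \<nu> i = 0 \<Longrightarrow> diagram \<nu> = (SIGMA i:{..<N}. {..<\<nu> i})"
  by (auto simp: diagram_def) (metis leI less_nat_zero_code)

lemma finite_diagram [simp]: "is_part \<nu> \<Longrightarrow> finite (diagram \<nu>)"
  by (auto simp: is_part_def diagram_Sigma)

lemma psize_sum: "\<forall>i\<ge>N. \<nu> i = 0 \<Longrightarrow> psize \<nu> = (\<Sum>i<N. \<nu> i)"
  by (simp add: psize_def diagram_Sigma)

lemma diagram_mono: "(\<And>i. \<kappa> i \<le> \<nu> i) \<Longrightarrow> diagram \<kappa> \<subseteq> diagram \<nu>"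
  by (auto simp: diagram_def intro: less_le_trans)

lemma psize_mono: "is_part \<nu> \<Longrightarrow> (\<And>i. \<kappa> i \<le> \<nu> i) \<Longrightarrow> psize \<kappa> \<le> psize \<nu>"
  unfolding psize_def by (intro card_mono diagram_mono) auto

lemma diagram_inj: "diagram \<nu> = diagram \<kappa> \<Longrightarrow> \<nu> = \<kappa>"
proof
  fix i assume "diagram \<nu> = diagram \<kappa>"
  then have "j < \<nu> i \<longleftrightarrow> j < \<kappa> i" for j by (metis mem_diagram)
  then show "\<nu> i = \<kappa> i" by (metis linorder_neqE_nat less_irrefl)
qed

lemma hstrip_le: "hstrip \<nu> \<kappa> \<Longrightarrow> \<kappa> i \<le> \<nu> i"
  by (simp add: hstrip_def)

lemma is_part_hstrip_dn: "hstrip \<nu> \<kappa> \<Longrightarrow> is_part \<nu> \<Longrightarrow> is_part \<kappa>"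
  unfolding is_part_def hstrip_def by (metis le_trans le_zero_eq)

lemma is_part_hstrip_up: "hstrip \<nu> \<kappa> \<Longrightarrow> is_part \<kappa> \<Longrightarrow> is_part \<nu>"
proof -
  assume h: "hstrip \<nu> \<kappa>" and k: "is_part \<kappa>"
  then obtain N where N: "\<forall>i\<ge>N. \<kappa> i = 0" by (auto simp: is_part_def)
  have "\<forall>i\<ge>Suc N. \<nu> i = 0"
  proof (intro allI impI)
    fix i assume "i \<ge> Suc N"
    then obtain k where "i = Suc k" "k \<ge> N" by (cases i) auto
    then show "\<nu> i = 0" using h N by (metis hstrip_def le_zero_eq)
  qed
  moreover have "\<forall>i. \<nu> (Suc i) \<le> \<nu> i" using h by (meson hstrip_def le_trans)
  ultimately show ?thesis unfolding is_part_def by blast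
qed

lemma is_part_hsdn: "\<kappa> \<in> hsdn \<nu> c \<Longrightarrow> is_part \<nu> \<Longrightarrow> is_part \<kappa>"
  by (auto simp: hsdn_def intro: is_part_hstrip_dn)

lemma is_part_hsup: "\<nu> \<in> hsup \<kappa> c \<Longrightarrow> is_part \<kappa> \<Longrightarrow> is_part \<nu>"
  by (auto simp: hsup_def intro: is_part_hstrip_up)

lemma finite_bounded_fun:
  fixes f :: "nat \<Rightarrow> nat"
  assumes "\<forall>i\<ge>N. f i = 0"
  shows "finite {\<kappa>. \<forall>i. \<kappa> i \<le> f i}"
proof (rule finite_subset)
  show "{\<kappa>. \<forall>i. \<kappa> i \<le> f i} \<subseteq> (\<lambda>g i. if i < N then g i else 0) ` (\<Pi>\<^sub>E i\<in>{..<N}. {..f i})"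
  proof
    fix \<kappa> assume k: "\<kappa> \<in> {\<kappa>. \<forall>i. \<kappa> i \<le> f i}"
    have "\<kappa> = (\<lambda>i. if i < N then restrict \<kappa> {..<N} i else 0)"
    proof
      fix i
      have "\<kappa> i \<le> f i" using k by simp
      then show "\<kappa> i = (if i < N then restrict \<kappa> {..<N} i else 0)" using assms by auto
    qed
    moreover have "restrict \<kappa> {..<N} \<in> (\<Pi>\<^sub>E i\<in>{..<N}. {..f i})" using k by auto
    ultimately show "\<kappa> \<in> (\<lambda>g i. if i < N then g i else 0) ` (\<Pi>\<^sub>E i\<in>{..<N}. {..f i})" by blast
  qed
qed (auto intro: finite_PiE)

lemma finite_hsdn [simp]: "is_part \<nu> \<Longrightarrow> finite (hsdn \<nu> c)"
proof -
  assume "is_part \<nu>"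
  then obtain N where "\<forall>i\<ge>N. \<nu> i = 0" by (auto simp: is_part_def)
  then have "finite {\<kappa>. \<forall>i. \<kappa> i \<le> \<nu> i}" by (rule finite_bounded_fun)
  then show ?thesis by (rule rev_finite_subset) (auto simp: hsdn_def hstrip_le)
qed

lemma finite_hsup [simp]: "is_part \<rho> \<Longrightarrow> finite (hsup \<rho> c)"
proof -
  assume r: "is_part \<rho>"
  then obtain N where N: "\<forall>i\<ge>N. \<rho> i = 0" by (auto simp: is_part_def)
  define f where "f = case_nat (psize \<rho> + c) \<rho>"
  have "\<forall>i\<ge>Suc N. f i = 0" using N by (auto simp: f_def split: nat.split)
  then have fin: "finite {\<nu>. \<forall>i. \<nu> i \<le> f i}" by (rule finite_bounded_fun)
  have "\<nu> i \<le> f i" if v: "\<nu> \<in> hsup \<rho> c" for \<nu> i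
  proof (cases i)
    case 0
    have "is_part \<nu>" using v r is_part_hsup by blast
    then obtain K where K: "\<forall>i\<ge>K. \<nu> i = 0" by (auto simp: is_part_def)
    then have "\<forall>i\<ge>Suc K. \<nu> i = 0" by auto
    then have "\<nu> 0 \<le> psize \<nu>" by (simp add: psize_sum sum.lessThan_Suc_shift del: sum.lessThan_Suc)
    with v 0 show ?thesis by (simp add: f_def hsup_def)
  next
    case (Suc k)
    then show ?thesis using v by (auto simp: f_def hsup_def hstrip_def)
  qed
  then show ?thesis using fin by (auto intro: rev_finite_subset)
qed

lemma finite_tab [simp]: "is_part \<nu> \<Longrightarrow> finite (tab \<nu> M)"
proof (rule finite_subset)
  assume v: "is_part \<nu>"
  show "tab \<nu> M \<subseteq> diagram \<nu> \<rightarrow>\<^sub>E set_mset M" using v by (auto simp: tab_def PiE_iff extensional_def)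
  show "finite (diagram \<nu> \<rightarrow>\<^sub>E set_mset M)" using v by (auto intro: finite_PiE)
qed

lemma size_tab: "T \<in> tab \<nu> M \<Longrightarrow> size M = psize \<nu>"
  by (auto simp: tab_def psize_def)

lemma kostka_size: "kostka \<nu> M \<noteq> 0 \<Longrightarrow> size M = psize \<nu>"
  unfolding kostka_def by (metis card.empty ex_in_conv size_tab)

lemma downset_nat:
  fixes S :: "nat set"
  assumes "finite S" "\<And>j j'. j \<in> S \<Longrightarrow> j' < j \<Longrightarrow> j' \<in> S"
  shows "S = {..<card S}"
proof -
  define m where "m = (LEAST m. m \<notin> S)"
  have "m \<notin> S" unfolding m_def using ex_new_if_finite [OF _ assms(1)] by (metis LeastI infinite_UNIV_nat)
  moreover have "j \<in> S" if "j < m" for j using not_less_Least that m_def by blast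
  ultimately have "S = {..<m}" using assms(2) by (metis lessThan_iff linorder_neqE_nat subsetI subset_antisym)
  then show ?thesis by simp
qed

text \<open>Removing the largest entries of a semistandard tableau leaves one of smaller shape.\<close>

lemma kostka_max:
  assumes \<nu>: "is_part \<nu>" and y: "\<And>x. x \<in># M \<Longrightarrow> x < y"
  shows "kostka \<nu> (M + replicate_mset c y) = (\<Sum>\<kappa>\<in>hsdn \<nu> c. kostka \<kappa> M)"
proof -
  let ?X = "tab \<nu> (M + replicate_mset c y)" and ?Y = "SIGMA \<kappa>:hsdn \<nu> c. tab \<kappa> M"
  \<comment> \<open>Rows increase weakly, so the entries below \<open>y\<close> fill an initial
    segment of each row, and counting them gives the row lengths of the remaining shape.
    \<open>f\<close> cuts off the entries \<open>y\<close> and \<open>g\<close> puts them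
    back.\<close>
  define sh where "sh T i = card {j. j < \<nu> i \<and> T (i, j) < y}" for T :: "nat \<times> nat \<Rightarrow> nat" and i
  define f where "f T = (sh T, restrict T (diagram (sh T)))" for T
  define g where "g p = (\<lambda>c\<in>diagram \<nu>. if c \<in> diagram (fst p) then snd p c else y)"
    for p :: "(nat \<Rightarrow> nat) \<times> (nat \<times> nat \<Rightarrow> nat)"
  have sh: "j < sh T i \<longleftrightarrow> j < \<nu> i \<and> T (i, j) < y" if T: "T \<in> ?X" for T i j
  proof -
    have step: "T (i, j) \<le> T (i, Suc j)" if "Suc j < \<nu> i" for j using T that by (simp add: tab_def)
    have mono: "T (i, j') \<le> T (i, j)" if "j' \<le> j" "j < \<nu> i" for j j'
      using that by (induction j rule: dec_induct) (auto intro: le_trans [OF _ step])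
    have "{j. j < \<nu> i \<and> T (i, j) < y} = {..<card {j. j < \<nu> i \<and> T (i, j) < y}}"
    proof (rule downset_nat)
      fix j j' assume "j \<in> {j. j < \<nu> i \<and> T (i, j) < y}" "j' < j"
      then show "j' \<in> {j. j < \<nu> i \<and> T (i, j) < y}" using mono [of j' j] by auto
    qed simp
    then show ?thesis unfolding sh_def by blast
  qed
  have le: "T p \<le> y" if T: "T \<in> ?X" and p: "p \<in> diagram \<nu>" for T p
  proof -
    have "image_mset T (mset_set (diagram \<nu>)) = M + replicate_mset c y" using T by (simp add: tab_def)
    then have "T p \<in># M + replicate_mset c y" using p \<nu> by (metis finite_diagram finite_set_mset_mset_set image_eqI set_image_mset)
    then show ?thesis using y by (auto split: if_splits dest: less_imp_le)
  qed
  have dsh: "diagram (sh T) = {p \<in> diagram \<nu>. T p < y}" if T: "T \<in> ?X" for T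
    using sh [OF T] by (auto simp: diagram_def)
  have f: "f T \<in> ?Y" if T: "T \<in> ?X" for T
  proof -
    have hs: "hstrip \<nu> (sh T)"
      unfolding hstrip_def
    proof
      fix i
      \<comment> \<open>Otherwise the first cell of row \<open>i\<close> with entry \<open>y\<close>
        would have a cell below it, whose entry is at most \<open>y\<close>, against strict increase
        in columns.\<close>
      have "\<nu> (Suc i) \<le> sh T i"
      proof (rule ccontr)
        assume a: "\<not> \<nu> (Suc i) \<le> sh T i"
        then have "T (i, sh T i) < T (Suc i, sh T i)" using T by (simp add: tab_def)
        also have "\<dots> \<le> y" using le [OF T, of "(Suc i, sh T i)"] a by simp
        finally have "T (i, sh T i) < y" .
        moreover have "sh T i < \<nu> i" using a \<nu> by (meson is_part_def leI less_le_trans)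
        ultimately show False using sh [OF T, of "sh T i" i] by simp
      qed
      moreover have "sh T i \<le> \<nu> i" using sh [OF T, of "\<nu> i" i] by (simp add: not_less)
      ultimately show "\<nu> (Suc i) \<le> sh T i \<and> sh T i \<le> \<nu> i" by blast
    qed
    have part: "is_part (sh T)" using is_part_hstrip_dn [OF hs \<nu>] .
    have "image_mset T (mset_set (diagram (sh T))) = filter_mset (\<lambda>x. x < y) (image_mset T (mset_set (diagram \<nu>)))"
      unfolding dsh [OF T] using \<nu> by (simp add: filter_mset_image_mset filter_mset_mset_set o_def)
    also have "image_mset T (mset_set (diagram \<nu>)) = M + replicate_mset c y" using T by (simp add: tab_def)
    also have "filter_mset (\<lambda>x. x < y) \<dots> = M"
      using y by (auto simp: multiset_eq_iff not_in_iff [symmetric] count_eq_zero_iff)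
    finally have cont: "image_mset T (mset_set (diagram (sh T))) = M" .
    have "psize \<nu> = size M + c" using size_tab [OF T] by simp
    moreover have "psize (sh T) = size M" using arg_cong [OF cont, of size] by (simp add: psize_def)
    ultimately have "sh T \<in> hsdn \<nu> c" using hs by (simp add: hsdn_def)
    moreover have "restrict T (diagram (sh T)) \<in> tab (sh T) M"
    proof -
      have "image_mset (restrict T (diagram (sh T))) (mset_set (diagram (sh T))) = M"
        using cont by (metis (mono_tags, lifting) finite_diagram finite_set_mset_mset_set image_mset_cong part restrict_apply')
      moreover have "j < sh T i" if "j < sh T (Suc i)" for i j
        using part that by (meson is_part_def less_le_trans)
      moreover have "j < \<nu> i" if "j < sh T i" for i j using sh [OF T] that by blast
      ultimately show ?thesis using T by (simp add: tab_def)
    qed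
    ultimately show ?thesis by (simp add: f_def)
  qed
  have g: "g p \<in> ?X" and fg: "f (g p) = p" if p: "p \<in> ?Y" for p
  proof -
    obtain \<kappa> T where k: "p = (\<kappa>, T)" "\<kappa> \<in> hsdn \<nu> c" "T \<in> tab \<kappa> M" using p by blast
    have hs: "hstrip \<nu> \<kappa>" and ps: "psize \<nu> = psize \<kappa> + c" using k(2) by (auto simp: hsdn_def)
    have part: "is_part \<kappa>" using is_part_hstrip_dn [OF hs \<nu>] .
    have sub: "diagram \<kappa> \<subseteq> diagram \<nu>" using hs by (intro diagram_mono hstrip_le)
    have g1: "g p c = T c" if "c \<in> diagram \<kappa>" for c using that sub by (auto simp: g_def k)
    have g2: "g p c = y" if "c \<in> diagram \<nu> - diagram \<kappa>" for c using that by (auto simp: g_def k)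
    have cont: "image_mset T (mset_set (diagram \<kappa>)) = M" using k(3) by (simp add: tab_def)
    have Ty: "T c < y" if "c \<in> diagram \<kappa>" for c
    proof (rule y)
      show "T c \<in># M" using that part unfolding cont [symmetric] by simp
    qed
    have "mset_set (diagram \<nu>) = mset_set (diagram \<kappa>) + mset_set (diagram \<nu> - diagram \<kappa>)"
      using \<nu> sub by (metis Diff_disjoint Diff_partition finite_Diff finite_diagram mset_set_Union part)
    then have "image_mset (g p) (mset_set (diagram \<nu>)) =
        image_mset (g p) (mset_set (diagram \<kappa>)) + image_mset (g p) (mset_set (diagram \<nu> - diagram \<kappa>))"
      by simp
    also have "image_mset (g p) (mset_set (diagram \<kappa>)) = M"
      unfolding cont [symmetric] using g1 part by (intro image_mset_cong) simp
    also have "image_mset (g p) (mset_set (diagram \<nu> - diagram \<kappa>)) =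
        image_mset (\<lambda>_. y) (mset_set (diagram \<nu> - diagram \<kappa>))"
      using g2 \<nu> by (intro image_mset_cong) simp
    also have "\<dots> = replicate_mset c y"
      using ps card_Diff_subset [of "diagram \<kappa>" "diagram \<nu>"] sub part by (simp add: image_mset_const_eq psize_def)
    finally have cont': "image_mset (g p) (mset_set (diagram \<nu>)) = M + replicate_mset c y" .
    have row: "g p (i, j) \<le> g p (i, Suc j)" if "Suc j < \<nu> i" for i j
    proof (cases "Suc j < \<kappa> i")
      case True
      then have "T (i, j) \<le> T (i, Suc j)" using k(3) by (simp add: tab_def)
      with True show ?thesis using g1 [of "(i, j)"] g1 [of "(i, Suc j)"] by simp
    next
      case False
      then have "g p (i, Suc j) = y" using that by (intro g2) simp
      moreover have "g p (i, j) \<le> y" using that Ty [of "(i, j)"] g1 [of "(i, j)"] g2 [of "(i, j)"] by fastforce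
      ultimately show ?thesis by simp
    qed
    have col: "g p (i, j) < g p (Suc i, j)" if "j < \<nu> (Suc i)" for i j
    proof -
      have ij: "j < \<kappa> i" using hs that by (meson hstrip_def less_le_trans)
      show ?thesis
      proof (cases "j < \<kappa> (Suc i)")
        case True
        then have "T (i, j) < T (Suc i, j)" using k(3) by (simp add: tab_def)
        with True ij show ?thesis using g1 [of "(i, j)"] g1 [of "(Suc i, j)"] by simp
      next
        case False
        with that ij show ?thesis using g1 [of "(i, j)"] g2 [of "(Suc i, j)"] Ty [of "(i, j)"] by simp
      qed
    qed
    show gX: "g p \<in> ?X" using row col cont' by (auto simp: tab_def g_def)
    have "sh (g p) i = \<kappa> i" for i
    proof -
      have "j < sh (g p) i \<longleftrightarrow> j < \<kappa> i" for j
        unfolding sh [OF gX] using g1 [of "(i, j)"] g2 [of "(i, j)"] Ty [of "(i, j)"] hstrip_le [OF hs, of i] by fastforce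
      then show ?thesis by (metis linorder_neqE_nat less_irrefl)
    qed
    then have s: "sh (g p) = \<kappa>" by blast
    have "restrict (g p) (diagram \<kappa>) = T"
    proof
      fix c show "restrict (g p) (diagram \<kappa>) c = T c"
        using k(3) g1 by (cases "c \<in> diagram \<kappa>") (auto simp: tab_def)
    qed
    then show "f (g p) = p" unfolding f_def s by (simp add: k(1))
  qed
  have gf: "g (f T) = T" if T: "T \<in> ?X" for T
  proof
    fix c
    show "g (f T) c = T c"
    proof (cases "c \<in> diagram \<nu>")
      case True
      then show ?thesis using le [OF T True] by (auto simp: g_def f_def dsh [OF T])
    next
      case False
      then show ?thesis using T by (auto simp: g_def tab_def)
    qed
  qed
  have "bij_betw f ?X ?Y" using f g fg gf by (intro bij_betw_byWitness [where f' = g] ballI image_subsetI)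
  then have "card ?X = card ?Y" by (rule bij_betw_same_card)
  also have "\<dots> = (\<Sum>\<kappa>\<in>hsdn \<nu> c. card (tab \<kappa> M))"
    using \<nu> by (intro card_SigmaI) (auto dest: is_part_hsdn)
  finally show ?thesis by (simp add: kostka_def)
qed

section \<open>Local rules for pairs of horizontal strips\<close>

text \<open>
  The local rules. Removing two horizontal strips one after the other, or adding one and then
  removing another, leaves the middle partition free in a product of intervals; the sizes of the
  strips are exchanged by reflecting each of these intervals.
\<close>

definition upper :: "(nat \<Rightarrow> nat) \<Rightarrow> (nat \<Rightarrow> nat) \<Rightarrow> nat \<Rightarrow> nat" where
  "upper \<nu> \<rho> i = (case i of 0 \<Rightarrow> \<nu> 0 | Suc k \<Rightarrow> min (\<nu> (Suc k)) (\<rho> k))"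

lemma hstrip_two: "hstrip \<nu> \<kappa> \<and> hstrip \<kappa> \<rho> \<longleftrightarrow>
    (\<forall>i. max (\<rho> i) (\<nu> (Suc i)) \<le> \<kappa> i \<and> \<kappa> i \<le> upper \<nu> \<rho> i)"
  (is "?L \<longleftrightarrow> ?R")
proof
  assume ?L then show ?R by (auto simp: hstrip_def upper_def split: nat.split)
next
  assume R: ?R
  have "\<nu> (Suc i) \<le> \<kappa> i \<and> \<kappa> i \<le> \<nu> i" for i
    using R [rule_format, of i] by (auto simp: upper_def split: nat.splits)
  moreover have "\<kappa> (Suc i) \<le> \<rho> i \<and> \<rho> i \<le> \<kappa> i" for i
    using R [rule_format, of i] R [rule_format, of "Suc i"] by (auto simp: upper_def split: nat.splits)
  ultimately show ?L by (simp add: hstrip_def)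
qed

definition flip :: "(nat \<Rightarrow> nat) \<Rightarrow> (nat \<Rightarrow> nat) \<Rightarrow> (nat \<Rightarrow> nat) \<Rightarrow> nat \<Rightarrow> nat" where
  "flip \<nu> \<rho> \<kappa> i = max (\<rho> i) (\<nu> (Suc i)) + upper \<nu> \<rho> i - \<kappa> i"

lemma flip_flip:
  assumes "hstrip \<nu> \<kappa>" "hstrip \<kappa> \<rho>"
  shows "hstrip \<nu> (flip \<nu> \<rho> \<kappa>)" "hstrip (flip \<nu> \<rho> \<kappa>) \<rho>" "flip \<nu> \<rho> (flip \<nu> \<rho> \<kappa>) = \<kappa>"
proof -
  have b: "max (\<rho> i) (\<nu> (Suc i)) \<le> \<kappa> i" "\<kappa> i \<le> upper \<nu> \<rho> i" for i
    using assms hstrip_two by blast+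
  have "max (\<rho> i) (\<nu> (Suc i)) \<le> flip \<nu> \<rho> \<kappa> i \<and> flip \<nu> \<rho> \<kappa> i \<le> upper \<nu> \<rho> i" for i
    using b [of i] unfolding flip_def by linarith
  then show "hstrip \<nu> (flip \<nu> \<rho> \<kappa>)" "hstrip (flip \<nu> \<rho> \<kappa>) \<rho>" using hstrip_two by blast+
  show "flip \<nu> \<rho> (flip \<nu> \<rho> \<kappa>) = \<kappa>"
  proof
    fix i show "flip \<nu> \<rho> (flip \<nu> \<rho> \<kappa>) i = \<kappa> i" using b [of i] unfolding flip_def by linarith
  qed
qed

text \<open>A partition and its reflection add up to the sum of the interval bounds, and each
  maximum pairs with a minimum of the same two numbers, so the bounds sum to the sizes of the outer
  partitions.\<close>

lemma psize_flip:
  assumes \<nu>: "is_part \<nu>" and h: "hstrip \<nu> \<kappa>" "hstrip \<kappa> \<rho>"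
  shows "psize (flip \<nu> \<rho> \<kappa>) + psize \<kappa> = psize \<nu> + psize \<rho>"
proof -
  obtain N where N: "\<forall>i\<ge>N. \<nu> i = 0" using \<nu> by (auto simp: is_part_def)
  have N': "\<forall>i\<ge>N. \<kappa> i = 0" "\<forall>i\<ge>N. \<rho> i = 0" "\<forall>i\<ge>N. flip \<nu> \<rho> \<kappa> i = 0"
    using N hstrip_le [OF h(1)] hstrip_le [OF h(2)] hstrip_le [OF flip_flip(1) [OF h]] by (metis le_zero_eq)+
  have S: "\<forall>i\<ge>Suc N. \<xi> i = 0" if "\<forall>i\<ge>N. \<xi> i = 0" for \<xi> :: "nat \<Rightarrow> nat" using that by auto
  have "psize (flip \<nu> \<rho> \<kappa>) + psize \<kappa> = (\<Sum>i<Suc N. flip \<nu> \<rho> \<kappa> i + \<kappa> i)"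
    using psize_sum [OF S [OF N'(3)]] psize_sum [OF S [OF N'(1)]] by (simp only: sum.distrib)
  also have "\<dots> = (\<Sum>i<Suc N. max (\<rho> i) (\<nu> (Suc i)) + upper \<nu> \<rho> i)"
  proof (rule sum.cong)
    fix i
    have "\<kappa> i \<le> upper \<nu> \<rho> i" using h hstrip_two by blast
    then show "flip \<nu> \<rho> \<kappa> i + \<kappa> i = max (\<rho> i) (\<nu> (Suc i)) + upper \<nu> \<rho> i"
      unfolding flip_def by linarith
  qed simp
  also have "\<dots> = (\<Sum>i<N. max (\<rho> i) (\<nu> (Suc i))) + (\<nu> 0 + (\<Sum>i<N. min (\<nu> (Suc i)) (\<rho> i)))"
  proof -
    have "(\<Sum>i<Suc N. max (\<rho> i) (\<nu> (Suc i))) = (\<Sum>i<N. max (\<rho> i) (\<nu> (Suc i)))"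
      using N N'(2) by simp
    moreover have "(\<Sum>i<Suc N. upper \<nu> \<rho> i) = \<nu> 0 + (\<Sum>i<N. min (\<nu> (Suc i)) (\<rho> i))"
      unfolding sum.lessThan_Suc_shift by (simp add: upper_def)
    ultimately show ?thesis by (simp only: sum.distrib)
  qed
  also have "\<dots> = \<nu> 0 + (\<Sum>i<N. \<nu> (Suc i) + \<rho> i)"
  proof -
    have "(\<Sum>i<N. max (\<rho> i) (\<nu> (Suc i))) + (\<Sum>i<N. min (\<nu> (Suc i)) (\<rho> i)) = (\<Sum>i<N. \<nu> (Suc i) + \<rho> i)"
      unfolding sum.distrib [symmetric] by (intro sum.cong) auto
    then show ?thesis by simp
  qed
  also have "\<dots> = (\<Sum>i<Suc N. \<nu> i) + (\<Sum>i<N. \<rho> i)"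
    unfolding sum.lessThan_Suc_shift sum.distrib by simp
  also have "\<dots> = psize \<nu> + psize \<rho>"
    using psize_sum [OF S [OF N]] psize_sum [OF N'(2)] by simp
  finally show ?thesis .
qed

text \<open>Reflecting the middle partition of a chain of two strips exchanges their sizes. This is
  the Bender-Knuth involution in terms of chains of partitions, and it is the source of the symmetry
  of Kostka numbers.\<close>

lemma hsdn_swap:
  fixes F :: "(nat \<Rightarrow> nat) \<Rightarrow> 'a::comm_monoid_add"
  assumes \<nu>: "is_part \<nu>"
  shows "(\<Sum>\<kappa>\<in>hsdn \<nu> a. \<Sum>\<rho>\<in>hsdn \<kappa> b. F \<rho>) = (\<Sum>\<kappa>\<in>hsdn \<nu> b. \<Sum>\<rho>\<in>hsdn \<kappa> a. F \<rho>)"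
proof -
  have S: "(\<Sum>\<kappa>\<in>hsdn \<nu> a. \<Sum>\<rho>\<in>hsdn \<kappa> b. F \<rho>) = (\<Sum>p\<in>(SIGMA \<kappa>:hsdn \<nu> a. hsdn \<kappa> b). F (snd p))" for a b
    using \<nu> by (subst sum.Sigma) (auto dest: is_part_hsdn simp: case_prod_beta)
  have 1: "(flip \<nu> (snd p) (fst p), snd p) \<in> (SIGMA \<kappa>:hsdn \<nu> b. hsdn \<kappa> a)"
    if "p \<in> (SIGMA \<kappa>:hsdn \<nu> a. hsdn \<kappa> b)" for p a b
  proof -
    obtain \<kappa> \<rho> where p: "p = (\<kappa>, \<rho>)" by (cases p)
    have h: "hstrip \<nu> \<kappa>" "hstrip \<kappa> \<rho>" "psize \<nu> = psize \<kappa> + a" "psize \<kappa> = psize \<rho> + b"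
      using that by (auto simp: p hsdn_def)
    then show ?thesis using flip_flip [OF h(1,2)] psize_flip [OF \<nu> h(1,2)] by (simp add: p hsdn_def)
  qed
  have 2: "(flip \<nu> (snd p) (flip \<nu> (snd p) (fst p)), snd p) = p"
    if "p \<in> (SIGMA \<kappa>:hsdn \<nu> a. hsdn \<kappa> b)" for p a b
    using that flip_flip(3) by (cases p) (auto simp: hsdn_def)
  show ?thesis
    unfolding S
    by (rule sum.reindex_bij_witness [where i = "\<lambda>p. (flip \<nu> (snd p) (fst p), snd p)"
          and j = "\<lambda>p. (flip \<nu> (snd p) (fst p), snd p)"])
       (use 1 2 in \<open>simp_all only: fst_conv snd_conv\<close>)
qed

text \<open>Here \<open>\<rho> (Suc i)\<close> ranges over the same interval as
  \<open>\<delta> i\<close> in \<open>hstrip_below\<close>, while \<open>\<rho> 0\<close> has no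
  upper bound. Reflecting the intervals therefore trades a common upper neighbour of
  \<open>\<alpha>\<close> and \<open>\<kappa>\<close> for a common lower one together with the
  excess of \<open>\<rho> 0\<close>.\<close>

lemma hstrip_above: "hstrip \<rho> \<alpha> \<and> hstrip \<rho> \<kappa> \<longleftrightarrow> max (\<alpha> 0) (\<kappa> 0) \<le> \<rho> 0 \<and>
    (\<forall>i. max (\<alpha> (Suc i)) (\<kappa> (Suc i)) \<le> \<rho> (Suc i) \<and> \<rho> (Suc i) \<le> min (\<alpha> i) (\<kappa> i))"
  unfolding hstrip_def by (metis (no_types, opaque_lifting) max.bounded_iff min.bounded_iff not0_implies_Suc)

lemma hstrip_below: "hstrip \<alpha> \<delta> \<and> hstrip \<kappa> \<delta> \<longleftrightarrow>
    (\<forall>i. max (\<alpha> (Suc i)) (\<kappa> (Suc i)) \<le> \<delta> i \<and> \<delta> i \<le> min (\<alpha> i) (\<kappa> i))"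
  unfolding hstrip_def by auto

text \<open>As in \<open>psize_flip\<close>, maxima and minima of the same pair recombine; here the
  index 0, which is not reflected, leaves boundary terms.\<close>

lemma psize_above_below:
  assumes \<alpha>: "is_part \<alpha>" and \<kappa>: "is_part \<kappa>" and \<rho>: "is_part \<rho>" and \<delta>: "is_part \<delta>"
    and e: "\<And>i. \<rho> (Suc i) + \<delta> i = min (\<alpha> i) (\<kappa> i) + max (\<alpha> (Suc i)) (\<kappa> (Suc i))"
  shows "psize \<delta> + psize \<rho> + max (\<alpha> 0) (\<kappa> 0) = psize \<alpha> + psize \<kappa> + \<rho> 0"
proof -
  obtain N1 where N1: "\<forall>i\<ge>N1. \<alpha> i = 0" using \<alpha> by (auto simp: is_part_def)
  obtain N2 where N2: "\<forall>i\<ge>N2. \<kappa> i = 0" using \<kappa> by (auto simp: is_part_def)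
  obtain N3 where N3: "\<forall>i\<ge>N3. \<rho> i = 0" using \<rho> by (auto simp: is_part_def)
  obtain N4 where N4: "\<forall>i\<ge>N4. \<delta> i = 0" using \<delta> by (auto simp: is_part_def)
  define N where "N = max (max N1 N2) (max N3 N4)"
  have z: "\<forall>i\<ge>N. \<alpha> i = 0" "\<forall>i\<ge>N. \<kappa> i = 0" "\<forall>i\<ge>N. \<rho> i = 0" "\<forall>i\<ge>N. \<delta> i = 0"
    using N1 N2 N3 N4 by (auto simp: N_def)
  have z': "\<forall>i\<ge>Suc N. \<rho> i = 0" using z by auto
  have "psize \<delta> + psize \<rho> = (\<Sum>i<N. \<delta> i) + (\<rho> 0 + (\<Sum>i<N. \<rho> (Suc i)))"
    using psize_sum [OF z(4)] psize_sum [OF z'] unfolding sum.lessThan_Suc_shift by simp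
  also have "\<dots> = \<rho> 0 + (\<Sum>i<N. \<rho> (Suc i) + \<delta> i)" by (simp add: sum.distrib)
  also have "\<dots> = \<rho> 0 + ((\<Sum>i<N. min (\<alpha> i) (\<kappa> i)) + (\<Sum>i<N. max (\<alpha> (Suc i)) (\<kappa> (Suc i))))"
    by (simp add: e sum.distrib)
  finally have 1: "psize \<delta> + psize \<rho> = \<dots>" .
  have "(\<Sum>i<N. max (\<alpha> (Suc i)) (\<kappa> (Suc i))) + max (\<alpha> 0) (\<kappa> 0) = (\<Sum>i<Suc N. max (\<alpha> i) (\<kappa> i))"
    unfolding sum.lessThan_Suc_shift by simp
  also have "\<dots> = (\<Sum>i<N. max (\<alpha> i) (\<kappa> i))" using z by simp
  finally have 2: "(\<Sum>i<N. max (\<alpha> (Suc i)) (\<kappa> (Suc i))) + max (\<alpha> 0) (\<kappa> 0) = \<dots>" .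
  have "(\<Sum>i<N. min (\<alpha> i) (\<kappa> i)) + (\<Sum>i<N. max (\<alpha> i) (\<kappa> i)) = (\<Sum>i<N. \<alpha> i + \<kappa> i)"
    unfolding sum.distrib [symmetric] by (intro sum.cong) auto
  also have "\<dots> = psize \<alpha> + psize \<kappa>" using psize_sum [OF z(1)] psize_sum [OF z(2)] by (simp add: sum.distrib)
  finally show ?thesis using 1 2 by linarith
qed

text \<open>In operator form: h_k^perp h_a = sum_j h_{a-j} h_{k-j}^perp on Schur functions. The
  bijection keeps \<open>\<kappa>\<close>, reflects \<open>\<rho>\<close> to
  \<open>\<delta>\<close>, and records as \<open>j\<close> the excess of \<open>\<rho> 0\<close>
  over the larger of the first rows of \<open>\<alpha>\<close> and \<open>\<kappa>\<close>.\<close>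

lemma hsup_hsdn_commute:
  fixes F :: "(nat \<Rightarrow> nat) \<Rightarrow> 'a::comm_monoid_add"
  assumes \<alpha>: "is_part \<alpha>"
  shows "(\<Sum>\<rho>\<in>hsup \<alpha> a. \<Sum>\<kappa>\<in>hsdn \<rho> k. F \<kappa>) =
    (\<Sum>j\<le>min a k. \<Sum>\<delta>\<in>hsdn \<alpha> (k - j). \<Sum>\<kappa>\<in>hsup \<delta> (a - j). F \<kappa>)"
proof -
  let ?A = "SIGMA \<rho>:hsup \<alpha> a. hsdn \<rho> k"
  let ?B = "SIGMA j:{..min a k}. SIGMA \<delta>:hsdn \<alpha> (k - j). hsup \<delta> (a - j)"
  define f where "f p = (fst p 0 - max (\<alpha> 0) (snd p 0),
      (\<lambda>i. min (\<alpha> i) (snd p i) + max (\<alpha> (Suc i)) (snd p (Suc i)) - fst p (Suc i)), snd p)"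
    for p :: "(nat \<Rightarrow> nat) \<times> (nat \<Rightarrow> nat)"
  define g where "g q = (case q of (j, \<delta>, \<kappa>) \<Rightarrow>
      ((\<lambda>i. case i of 0 \<Rightarrow> max (\<alpha> 0) (\<kappa> 0) + j
         | Suc i \<Rightarrow> min (\<alpha> i) (\<kappa> i) + max (\<alpha> (Suc i)) (\<kappa> (Suc i)) - \<delta> i), \<kappa>))"
    for q :: "nat \<times> (nat \<Rightarrow> nat) \<times> (nat \<Rightarrow> nat)"
  have 1: "f p \<in> ?B \<and> g (f p) = p" if p: "p \<in> ?A" for p
  proof -
    obtain \<rho> \<kappa> where pe: "p = (\<rho>, \<kappa>)" by (cases p)
    have h: "hstrip \<rho> \<alpha>" "hstrip \<rho> \<kappa>" "psize \<rho> = psize \<alpha> + a" "psize \<rho> = psize \<kappa> + k"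
      using p by (auto simp: pe hsdn_def hsup_def)
    define \<delta> where "\<delta> i = min (\<alpha> i) (\<kappa> i) + max (\<alpha> (Suc i)) (\<kappa> (Suc i)) - \<rho> (Suc i)" for i
    define j where "j = \<rho> 0 - max (\<alpha> 0) (\<kappa> 0)"
    have b: "max (\<alpha> 0) (\<kappa> 0) \<le> \<rho> 0"
      "\<And>i. max (\<alpha> (Suc i)) (\<kappa> (Suc i)) \<le> \<rho> (Suc i) \<and> \<rho> (Suc i) \<le> min (\<alpha> i) (\<kappa> i)"
      using h hstrip_above by blast+
    have "max (\<alpha> (Suc i)) (\<kappa> (Suc i)) \<le> \<delta> i \<and> \<delta> i \<le> min (\<alpha> i) (\<kappa> i)" for i
      using b(2) [of i] unfolding \<delta>_def by linarith
    then have hd: "hstrip \<alpha> \<delta>" "hstrip \<kappa> \<delta>" using hstrip_below by blast+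
    have \<rho>: "is_part \<rho>" using h \<alpha> is_part_hstrip_up by blast
    then have \<kappa>: "is_part \<kappa>" using h is_part_hstrip_dn by blast
    have \<delta>: "is_part \<delta>" using hd \<alpha> is_part_hstrip_dn by blast
    have e: "\<rho> (Suc i) + \<delta> i = min (\<alpha> i) (\<kappa> i) + max (\<alpha> (Suc i)) (\<kappa> (Suc i))" for i
      using b(2) [of i] unfolding \<delta>_def by linarith
    have ps: "psize \<delta> + psize \<rho> = psize \<alpha> + psize \<kappa> + j"
      using psize_above_below [OF \<alpha> \<kappa> \<rho> \<delta> e] b(1) unfolding j_def by linarith
    have le: "psize \<delta> \<le> psize \<alpha>" "psize \<delta> \<le> psize \<kappa>"
      using psize_mono [OF \<alpha> hstrip_le [OF hd(1)]] psize_mono [OF \<kappa> hstrip_le [OF hd(2)]] .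
    have "f p = (j, \<delta>, \<kappa>)" by (simp add: f_def pe j_def \<delta>_def fun_eq_iff)
    moreover have "(j, \<delta>, \<kappa>) \<in> ?B" using ps le h hd by (auto simp: hsdn_def hsup_def)
    moreover have "g (j, \<delta>, \<kappa>) = (\<rho>, \<kappa>)"
    proof -
      have "(case i of 0 \<Rightarrow> max (\<alpha> 0) (\<kappa> 0) + j
         | Suc i \<Rightarrow> min (\<alpha> i) (\<kappa> i) + max (\<alpha> (Suc i)) (\<kappa> (Suc i)) - \<delta> i) = \<rho> i" for i
      proof (cases i)
        case 0 then show ?thesis using b(1) by (simp add: j_def)
      next
        case (Suc k) then show ?thesis using e [of k] by simp
      qed
      then show ?thesis by (simp add: g_def fun_eq_iff)
    qed
    ultimately show ?thesis by (simp add: pe)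
  qed
  have 2: "g q \<in> ?A \<and> f (g q) = q" if q: "q \<in> ?B" for q
  proof -
    obtain j \<delta> \<kappa> where qe: "q = (j, \<delta>, \<kappa>)" by (cases q)
    have h: "hstrip \<alpha> \<delta>" "hstrip \<kappa> \<delta>" "psize \<alpha> = psize \<delta> + (k - j)" "psize \<kappa> = psize \<delta> + (a - j)"
      and j: "j \<le> a" "j \<le> k"
      using q by (auto simp: qe hsdn_def hsup_def)
    define \<rho> where "\<rho> = (\<lambda>i. case i of 0 \<Rightarrow> max (\<alpha> 0) (\<kappa> 0) + j
         | Suc i \<Rightarrow> min (\<alpha> i) (\<kappa> i) + max (\<alpha> (Suc i)) (\<kappa> (Suc i)) - \<delta> i)"
    have b: "max (\<alpha> (Suc i)) (\<kappa> (Suc i)) \<le> \<delta> i \<and> \<delta> i \<le> min (\<alpha> i) (\<kappa> i)" for i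
      using h hstrip_below by blast
    have e: "\<rho> (Suc i) + \<delta> i = min (\<alpha> i) (\<kappa> i) + max (\<alpha> (Suc i)) (\<kappa> (Suc i))" for i
      using b [of i] unfolding \<rho>_def by (simp add: min_def max_def)
    have "max (\<alpha> (Suc i)) (\<kappa> (Suc i)) \<le> \<rho> (Suc i) \<and> \<rho> (Suc i) \<le> min (\<alpha> i) (\<kappa> i)" for i
      using b [of i] e [of i] by linarith
    moreover have r0: "\<rho> 0 = max (\<alpha> 0) (\<kappa> 0) + j" by (simp add: \<rho>_def)
    ultimately have hd: "hstrip \<rho> \<alpha>" "hstrip \<rho> \<kappa>" using hstrip_above [of \<rho> \<alpha> \<kappa>] by auto
    have \<rho>: "is_part \<rho>" using hd \<alpha> is_part_hstrip_up by blast
    then have \<kappa>: "is_part \<kappa>" using hd is_part_hstrip_dn by blast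
    have \<delta>: "is_part \<delta>" using h \<alpha> is_part_hstrip_dn by blast
    have ps: "psize \<delta> + psize \<rho> = psize \<alpha> + psize \<kappa> + j"
      using psize_above_below [OF \<alpha> \<kappa> \<rho> \<delta> e] r0 by linarith
    have "g q = (\<rho>, \<kappa>)" by (simp add: g_def qe \<rho>_def)
    moreover have "(\<rho>, \<kappa>) \<in> ?A" using ps h hd j by (auto simp: hsdn_def hsup_def)
    moreover have "f (\<rho>, \<kappa>) = q"
    proof -
      have "min (\<alpha> i) (\<kappa> i) + max (\<alpha> (Suc i)) (\<kappa> (Suc i)) - \<rho> (Suc i) = \<delta> i" for i
        using e [of i] by linarith
      then show ?thesis by (simp add: f_def r0 qe)
    qed
    ultimately show ?thesis by simp
  qed
  have "(\<Sum>\<rho>\<in>hsup \<alpha> a. \<Sum>\<kappa>\<in>hsdn \<rho> k. F \<kappa>) = (\<Sum>p\<in>?A. F (snd p))"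
    using \<alpha> by (subst sum.Sigma) (auto dest: is_part_hsup simp: case_prod_beta)
  also have "\<dots> = (\<Sum>q\<in>?B. F (snd (snd q)))"
    by (rule sum.reindex_bij_witness [where i = g and j = f]) (use 1 2 in \<open>auto simp: f_def\<close>)
  also have "\<dots> = (\<Sum>j\<le>min a k. \<Sum>\<delta>\<in>hsdn \<alpha> (k - j). \<Sum>\<kappa>\<in>hsup \<delta> (a - j). F \<kappa>)"
  proof -
    have "(\<Sum>\<delta>\<in>hsdn \<alpha> (k - j). \<Sum>\<kappa>\<in>hsup \<delta> (a - j). F \<kappa>) =
        (\<Sum>p\<in>(SIGMA \<delta>:hsdn \<alpha> (k - j). hsup \<delta> (a - j)). F (snd p))" for j
      using \<alpha> by (subst sum.Sigma) (auto dest: is_part_hsdn simp: case_prod_beta)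
    moreover have "\<forall>j\<in>{..min a k}. finite (SIGMA \<delta>:hsdn \<alpha> (k - j). hsup \<delta> (a - j))"
      using \<alpha> is_part_hsdn by (intro ballI finite_SigmaI) auto
    from sum.Sigma [OF finite_atMost this, of "\<lambda>j p. F (snd p)"]
    have "(\<Sum>j\<le>min a k. \<Sum>p\<in>(SIGMA \<delta>:hsdn \<alpha> (k - j). hsup \<delta> (a - j)). F (snd p)) =
        (\<Sum>q\<in>?B. F (snd (snd q)))"
      by (simp only: case_prod_unfold)
    ultimately show ?thesis by simp
  qed
  finally show ?thesis .
qed

text \<open>Take the indicator of \<open>\<alpha>\<close> in \<open>hsup_hsdn_commute\<close> with
  equal strip sizes: on the left every partition above \<open>\<alpha>\<close> counts once, on the
  right every one below.\<close>

lemma card_hsup: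
  assumes \<alpha>: "is_part \<alpha>"
  shows "card (hsup \<alpha> a) = (\<Sum>k\<le>a. card (hsdn \<alpha> k))"
proof -
  let ?F = "\<lambda>\<kappa>. if \<kappa> = \<alpha> then 1 else (0::nat)"
  have "card (hsup \<alpha> a) = (\<Sum>\<rho>\<in>hsup \<alpha> a. \<Sum>\<kappa>\<in>hsdn \<rho> a. ?F \<kappa>)"
    unfolding card_eq_sum
  proof (rule sum.cong)
    fix \<rho> assume r: "\<rho> \<in> hsup \<alpha> a"
    then have "\<alpha> \<in> hsdn \<rho> a" by (auto simp: hsup_def hsdn_def)
    with r \<alpha> show "1 = (\<Sum>\<kappa>\<in>hsdn \<rho> a. ?F \<kappa>)" using is_part_hsup by auto
  qed simp
  also have "\<dots> = (\<Sum>j\<le>a. \<Sum>\<delta>\<in>hsdn \<alpha> (a - j). \<Sum>\<kappa>\<in>hsup \<delta> (a - j). ?F \<kappa>)"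
    using hsup_hsdn_commute [OF \<alpha>, of ?F a a] by simp
  also have "\<dots> = (\<Sum>j\<le>a. card (hsdn \<alpha> (a - j)))"
    unfolding card_eq_sum
  proof (intro sum.cong refl)
    fix j \<delta> assume d: "\<delta> \<in> hsdn \<alpha> (a - j)"
    then have "\<alpha> \<in> hsup \<delta> (a - j)" by (auto simp: hsup_def hsdn_def)
    with d \<alpha> show "(\<Sum>\<kappa>\<in>hsup \<delta> (a - j). ?F \<kappa>) = 1" using is_part_hsdn by auto
  qed
  also have "\<dots> = (\<Sum>k\<le>a. card (hsdn \<alpha> k))"
    by (rule sum.reindex_bij_witness [where i = "\<lambda>k. a - k" and j = "\<lambda>k. a - k"]) auto
  finally show ?thesis .
qed

text \<open>\<open>kostka_max\<close> needs the removed letter to be the largest. Otherwise the true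
  maximum is removed first, the induction hypothesis removes \<open>x\<close>,
  \<open>hsdn_swap\<close> exchanges the two strips, and the maximum is put back.\<close>

lemma kostka_remove:
  assumes "is_part \<nu>" "x \<notin># M"
  shows "kostka \<nu> (M + replicate_mset c x) = (\<Sum>\<kappa>\<in>hsdn \<nu> c. kostka \<kappa> M)"
  using assms
proof (induction "size M" arbitrary: M \<nu> rule: less_induct)
  case less
  show ?case
  proof (cases "\<forall>z\<in>#M. z < x")
    case True
    then show ?thesis using less.prems by (intro kostka_max) auto
  next
    case False
    define y where "y = Max (set_mset M)"
    have ne: "set_mset M \<noteq> {}" using False by auto
    then have yM: "y \<in># M" unfolding y_def by (intro Max_in) auto
    have ymax: "z \<le> y" if "z \<in># M" for z using that unfolding y_def by simp
    define d where "d = count M y"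
    obtain M' where M': "M = M' + replicate_mset d y" "y \<notin># M'"
      using mset_decompose [of M y] unfolding d_def by blast
    have d: "d > 0" using yM by (simp add: d_def)
    obtain z where "z \<in># M" "\<not> z < x" using False by blast
    then have "z \<noteq> x" "x \<le> z" "z \<le> y" using less.prems(2) ymax by auto
    then have xy: "x < y" by simp
    have My: "z < y" if "z \<in># M'" for z
      using that M' ymax [of z] by (metis le_neq_implies_less union_iff)
    have small: "size M' < size M" using M'(1) d by simp
    have xM': "x \<notin># M'" using less.prems(2) M'(1) by auto
    have "kostka \<nu> (M + replicate_mset c x) = kostka \<nu> ((M' + replicate_mset c x) + replicate_mset d y)"
      unfolding M'(1) by (simp add: add.assoc add.commute add.left_commute)
    also have "\<dots> = (\<Sum>\<kappa>\<in>hsdn \<nu> d. kostka \<kappa> (M' + replicate_mset c x))"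
      using My xy by (intro kostka_max less.prems(1)) (auto split: if_splits)
    also have "\<dots> = (\<Sum>\<kappa>\<in>hsdn \<nu> d. \<Sum>\<rho>\<in>hsdn \<kappa> c. kostka \<rho> M')"
      using less.hyps [OF small] xM' is_part_hsdn less.prems(1) by (intro sum.cong) auto
    also have "\<dots> = (\<Sum>\<kappa>\<in>hsdn \<nu> c. \<Sum>\<rho>\<in>hsdn \<kappa> d. kostka \<rho> M')"
      by (rule hsdn_swap [OF less.prems(1)])
    also have "\<dots> = (\<Sum>\<kappa>\<in>hsdn \<nu> c. kostka \<kappa> M)"
      unfolding M'(1) using My is_part_hsdn less.prems(1) by (intro sum.cong refl kostka_max [symmetric]) auto
    finally show ?thesis .
  qed
qed

text \<open>The recursion \<open>kostka_remove\<close> does not see the order of the letters, so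
  renaming them changes nothing.\<close>

lemma kostka_sym:
  assumes "is_part \<nu>" "inj \<pi>"
  shows "kostka \<nu> (image_mset \<pi> M) = kostka \<nu> M"
  using assms(1)
proof (induction "size M" arbitrary: M \<nu> rule: less_induct)
  case less
  show ?case
  proof (cases "M = {#}")
    case False
    then obtain x where x: "x \<in># M" by auto
    define c where "c = count M x"
    obtain M' where M': "M = M' + replicate_mset c x" "x \<notin># M'"
      using mset_decompose [of M x] unfolding c_def by blast
    have c: "c > 0" using x by (simp add: c_def)
    have small: "size M' < size M" using M'(1) c by simp
    have "\<pi> x \<notin># image_mset \<pi> M'" using M'(2) assms(2) by (auto dest: injD)
    then have "kostka \<nu> (image_mset \<pi> M) = (\<Sum>\<kappa>\<in>hsdn \<nu> c. kostka \<kappa> (image_mset \<pi> M'))"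
      unfolding M'(1) using less.prems by (simp add: kostka_remove)
    also have "\<dots> = (\<Sum>\<kappa>\<in>hsdn \<nu> c. kostka \<kappa> M')"
      using less.hyps [OF small] is_part_hsdn less.prems by (intro sum.cong) auto
    also have "\<dots> = kostka \<nu> M" unfolding M'(1) using less.prems M'(2) by (simp add: kostka_remove)
    finally show ?thesis .
  qed simp
qed


section \<open>Schur functions as symmetric functions\<close>

section \<open>Schur functions\<close>

text \<open>Schur functions indexed by functions instead of lists, with value 0 off the partitions.
  The symmetry required for the lifting is \<open>kostka_sym\<close>.\<close>

lift_definition sch :: "(nat \<Rightarrow> nat) \<Rightarrow> symfun" is
  "\<lambda>\<nu> M. if is_part \<nu> then of_nat (kostka \<nu> M) else 0"
  unfolding is_symfun_def
proof (intro conjI allI impI)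
  fix \<nu> M and \<pi> :: "nat \<Rightarrow> nat" assume "bij \<pi>"
  then show "(if is_part \<nu> then of_nat (kostka \<nu> (image_mset \<pi> M)) else 0) =
      (if is_part \<nu> then of_nat (kostka \<nu> M) else (0 :: rat))"
    using kostka_sym bij_is_inj by auto
next
  fix \<nu> :: "nat \<Rightarrow> nat"
  show "\<exists>d. \<forall>M. d < size M \<longrightarrow> (if is_part \<nu> then of_nat (kostka \<nu> M) else (0 :: rat)) = 0"
    by (rule exI [of _ "psize \<nu>"]) (use kostka_size in fastforce)
qed

lemma coeff_sch: "is_part \<nu> \<Longrightarrow> coeff_sf (sch \<nu>) M = of_nat (kostka \<nu> M)"
  by transfer simp

definition part_of :: "nat list \<Rightarrow> nat \<Rightarrow> nat" where
  "part_of la i = (if i < length la then la ! i else 0)"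

lemma cells_part_of: "cells la = diagram (part_of la)"
  by (auto simp: cells_def diagram_def part_of_def split: if_splits)

text \<open>This justifies the use of \<open>Abs_symfun\<close> in \<open>schur\<close>: its
  argument is the coefficient function of \<open>sch\<close>, so it does lie in the representing
  set.\<close>

lemma schur_eq_sch: "is_part (part_of la) \<Longrightarrow> schur la = sch (part_of la)"
proof -
  assume p: "is_part (part_of la)"
  have "{T \<in> ssyt la. image_mset T (mset_set (cells la)) = M} = tab (part_of la) M" for M
    by (auto simp: ssyt_def tab_def cells_part_of)
  then have "(\<lambda>M. of_nat (card {T \<in> ssyt la. image_mset T (mset_set (cells la)) = M})) = coeff_sf (sch (part_of la))"
    using p by (simp add: fun_eq_iff coeff_sch kostka_def)
  then show ?thesis by (simp add: schur_def coeff_sf_inverse)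
qed

lemma is_part_part_of: "la \<in> partitions n \<Longrightarrow> is_part (part_of la)"
  unfolding is_part_def part_of_def
  by (auto simp: partitions_def sorted_wrt_iff_nth_less intro: exI [of _ "length la"])

lemma psize_part_of: "psize (part_of la) = sum_list la"
proof -
  have "psize (part_of la) = (\<Sum>i<length la. part_of la i)"
    by (rule psize_sum) (simp add: part_of_def)
  then show ?thesis by (simp add: part_of_def sum_list_sum_nth atLeast0LessThan)
qed

lemma part_of_inj: "inj_on part_of (partitions n)"
proof (rule inj_onI)
  fix la lb assume l: "la \<in> partitions n" "lb \<in> partitions n" "part_of la = part_of lb"
  have le: "length lb \<le> length la" if "part_of la = part_of lb" "0 \<notin> set lb" for la lb
  proof (rule ccontr)
    assume "\<not> length lb \<le> length la"
    then have "part_of la (length la) = 0" "part_of lb (length la) \<in> set lb" by (auto simp: part_of_def)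
    with that show False by metis
  qed
  have "length la = length lb" using le [of la lb] le [of lb la] l by (auto simp: partitions_def)
  moreover have "la ! i = lb ! i" if "i < length la" for i
    using fun_cong [OF l(3), of i] that \<open>length la = length lb\<close> by (simp add: part_of_def)
  ultimately show "la = lb" by (simp add: list_eq_iff_nth_eq)
qed

lemma part_of_surj: "part_of ` partitions n = {\<nu>. is_part \<nu> \<and> psize \<nu> = n}"
proof (intro subset_antisym subsetI)
  fix \<nu> assume "\<nu> \<in> part_of ` partitions n"
  then show "\<nu> \<in> {\<nu>. is_part \<nu> \<and> psize \<nu> = n}"
    using is_part_part_of psize_part_of by (auto simp: partitions_def)
next
  fix \<nu> assume "\<nu> \<in> {\<nu>. is_part \<nu> \<and> psize \<nu> = n}"
  then have \<nu>: "is_part \<nu>" "psize \<nu> = n" by auto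
  have anti: "\<nu> j \<le> \<nu> i" if "i \<le> j" for i j
    using lift_Suc_antimono_le [of \<nu>] \<nu>(1) that by (simp add: is_part_def)
  define L where "L = (LEAST i. \<nu> i = 0)"
  have "\<exists>i. \<nu> i = 0" using \<nu>(1) by (auto simp: is_part_def)
  then have L: "\<nu> L = 0" unfolding L_def by (rule LeastI_ex)
  have pos: "\<nu> i \<noteq> 0" if "i < L" for i using that not_less_Least unfolding L_def by blast
  let ?la = "map \<nu> [0..<L]"
  have po: "part_of ?la = \<nu>"
  proof
    fix i show "part_of ?la i = \<nu> i"
      using anti [of L i] L by (auto simp: part_of_def not_less)
  qed
  have "0 \<notin> set ?la"
  proof
    assume "0 \<in> set ?la"
    then obtain x where "x < L" "\<nu> x = 0" by auto
    with pos show False by blast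
  qed
  then have "?la \<in> partitions n"
    using anti psize_part_of [of ?la] po \<nu>(2) by (auto simp: partitions_def sorted_wrt_iff_nth_less)
  with po show "\<nu> \<in> part_of ` partitions n" by (metis image_eqI)
qed

lemma finite_partitions: "finite (partitions n)"
proof (rule finite_subset)
  have len: "length xs \<le> sum_list xs" if "0 \<notin> set xs" for xs :: "nat list"
    using that by (induction xs) auto
  show "partitions n \<subseteq> {xs. set xs \<subseteq> {..n} \<and> length xs \<le> n}"
    using len by (auto simp: partitions_def intro: member_le_sum_list)
qed (rule finite_lists_length_le, simp)

lemma part_zero [simp]: "is_part (\<lambda>_. 0)" "psize (\<lambda>_. 0) = 0"
  by (auto simp: is_part_def psize_def diagram_def)

lemma psize_eq_0: "is_part \<nu> \<Longrightarrow> psize \<nu> = 0 \<longleftrightarrow> \<nu> = (\<lambda>_. 0)"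
proof -
  assume "is_part \<nu>"
  then have "psize \<nu> = 0 \<longleftrightarrow> diagram \<nu> = {}" by (simp add: psize_def)
  also have "\<dots> \<longleftrightarrow> \<nu> = (\<lambda>_. 0)" by (auto simp: fun_eq_iff diagram_def)
  finally show ?thesis .
qed

lemma kostka_empty: "is_part \<nu> \<Longrightarrow> kostka \<nu> {#} = of_bool (\<nu> = (\<lambda>_. 0))"
proof (cases "\<nu> = (\<lambda>_. 0)")
  case True
  then have "tab \<nu> {#} = {\<lambda>_. undefined}" by (auto simp: tab_def diagram_def)
  then show ?thesis using True by (simp add: kostka_def)
next
  case False
  assume "is_part \<nu>"
  then have "psize \<nu> \<noteq> 0" using False psize_eq_0 by blast
  then show ?thesis using kostka_size [of \<nu> "{#}"] False by auto
qed

lemma sch_zero: "sch (\<lambda>_. 0) = 1"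
proof (rule symfun_eqI)
  fix M
  show "coeff_sf (sch (\<lambda>_. 0)) M = coeff_sf 1 M"
    using kostka_empty [of "\<lambda>_. 0"] kostka_size [of "\<lambda>_. 0" M] by (cases "M = {#}") (auto simp: coeff_sch coeff_one)
qed

text \<open>The complete homogeneous symmetric function h_a.\<close>

lift_definition hh :: "nat \<Rightarrow> symfun" is "\<lambda>a M. of_bool (size M = a)"
  by (auto simp: is_symfun_def intro!: exI [of _ "_::nat"])

lemma coeff_hh: "coeff_sf (hh a) M = of_bool (size M = a)"
  by transfer simp

lemma hh_0 [simp]: "hh 0 = 1"
  by (rule symfun_eqI) (simp add: coeff_hh coeff_one)

definition one_row :: "nat \<Rightarrow> nat \<Rightarrow> nat" where
  "one_row a i = (if i = 0 then a else 0)"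

lemma one_row_part: "is_part (one_row a)" "psize (one_row a) = a"
proof -
  show "is_part (one_row a)" by (auto simp: is_part_def one_row_def intro: exI [of _ 1])
  have "psize (one_row a) = (\<Sum>i<1. one_row a i)" by (rule psize_sum) (auto simp: one_row_def)
  then show "psize (one_row a) = a" by (simp add: one_row_def)
qed

lemma hsdn_one_row: "hsdn (one_row a) c = (if c \<le> a then {one_row (a - c)} else {})"
proof -
  have "hstrip (one_row a) \<kappa> \<longleftrightarrow> (\<exists>b\<le>a. \<kappa> = one_row b)" for \<kappa>
  proof
    assume "hstrip (one_row a) \<kappa>"
    then have h: "\<kappa> i \<le> one_row a i" for i by (rule hstrip_le)
    have "\<kappa> i = one_row (\<kappa> 0) i" for i using h [of i] by (cases i) (auto simp: one_row_def)
    then have "\<kappa> = one_row (\<kappa> 0)" by (rule ext)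
    moreover have "\<kappa> 0 \<le> a" using h [of 0] by (simp add: one_row_def)
    ultimately show "\<exists>b\<le>a. \<kappa> = one_row b" by blast
  qed (auto simp: hstrip_def one_row_def)
  then show ?thesis by (auto simp: hsdn_def one_row_part intro!: exI [of _ "a - c"])
qed

lemma kostka_one_row: "kostka (one_row a) M = of_bool (size M = a)"
proof (induction "size M" arbitrary: M a rule: less_induct)
  case less
  show ?case
  proof (cases "M = {#}")
    case True
    then show ?thesis using kostka_empty [OF one_row_part(1), of a] by (auto simp: one_row_def fun_eq_iff)
  next
    case False
    then obtain x where x: "x \<in># M" by auto
    define c where "c = count M x"
    obtain M' where M': "M = M' + replicate_mset c x" "x \<notin># M'"
      using mset_decompose [of M x] unfolding c_def by blast
    have c: "c > 0" using x by (simp add: c_def)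
    have small: "size M' < size M" using M'(1) c by simp
    have "kostka (one_row a) M = (\<Sum>\<kappa>\<in>hsdn (one_row a) c. kostka \<kappa> M')"
      unfolding M'(1) by (rule kostka_remove [OF one_row_part(1) M'(2)])
    also have "\<dots> = of_bool (size M = a)"
      by (auto simp: hsdn_one_row less.hyps [OF small] M'(1))
    finally show ?thesis .
  qed
qed

lemma schur_row: "schur [m] = hh m"
proof -
  have p: "part_of [m] = one_row m" by (auto simp: part_of_def one_row_def)
  have "schur [m] = sch (one_row m)" using schur_eq_sch [of "[m]"] by (simp add: p one_row_part)
  also have "\<dots> = hh m" by (rule symfun_eqI) (simp add: coeff_sch one_row_part kostka_one_row coeff_hh)
  finally show ?thesis .
qed

section \<open>The adjoint of multiplication by h_k, and the Pieri rule\<close>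

text \<open>The adjoint of multiplication by \<open>h\<^sub>k\<close>: the coefficient of the \<open>k\<close>-th power of one variable.\<close>

lift_definition hp :: "nat \<Rightarrow> symfun \<Rightarrow> symfun" is
  "\<lambda>k f M. f (image_mset Suc M + replicate_mset k 0)"
  unfolding is_symfun_def
proof (intro conjI allI impI)
  fix k :: nat and f :: "nat multiset \<Rightarrow> rat" and \<pi> :: "nat \<Rightarrow> nat" and M
  assume f: "(\<forall>\<pi>. bij \<pi> \<longrightarrow> (\<forall>M. f (image_mset \<pi> M) = f M)) \<and> (\<exists>d. \<forall>M. d < size M \<longrightarrow> f M = 0)"
    and \<pi>: "bij \<pi>"
  define \<pi>' where "\<pi>' = case_nat 0 (\<lambda>i. Suc (\<pi> i))"
  have "bij \<pi>'"
  proof (rule bij_betw_byWitness [where f' = "case_nat 0 (\<lambda>i. Suc (inv \<pi> i))"])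
    show "\<forall>a\<in>UNIV. case_nat 0 (\<lambda>i. Suc (inv \<pi> i)) (\<pi>' a) = a"
      using \<pi> by (auto simp: \<pi>'_def bij_is_inj split: nat.split)
    show "\<forall>a\<in>UNIV. \<pi>' (case_nat 0 (\<lambda>i. Suc (inv \<pi> i)) a) = a"
      using \<pi> by (auto simp: \<pi>'_def bij_is_surj surj_f_inv_f split: nat.split)
  qed auto
  then have "f (image_mset \<pi>' (image_mset Suc M + replicate_mset k 0)) = f (image_mset Suc M + replicate_mset k 0)"
    using f by blast
  moreover have "image_mset \<pi>' (image_mset Suc M + replicate_mset k 0) =
      image_mset Suc (image_mset \<pi> M) + replicate_mset k 0"
    by (simp add: \<pi>'_def multiset.map_comp o_def)
  ultimately show "f (image_mset Suc (image_mset \<pi> M) + replicate_mset k 0) =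
      f (image_mset Suc M + replicate_mset k 0)" by simp
next
  fix k :: nat and f :: "nat multiset \<Rightarrow> rat"
  assume "(\<forall>\<pi>. bij \<pi> \<longrightarrow> (\<forall>M. f (image_mset \<pi> M) = f M)) \<and> (\<exists>d. \<forall>M. d < size M \<longrightarrow> f M = 0)"
  then obtain d where "\<forall>M. d < size M \<longrightarrow> f M = 0" by blast
  then show "\<exists>d. \<forall>M. d < size M \<longrightarrow> f (image_mset Suc M + replicate_mset k 0) = 0"
    by (intro exI [of _ d]) simp
qed

lemma coeff_hp: "coeff_sf (hp k f) M = coeff_sf f (image_mset Suc M + replicate_mset k 0)"
  by transfer simp

lemma hp_add [simp]: "hp k (f + g) = hp k f + hp k g"
  by (rule symfun_eqI) (simp add: coeff_hp)

lemma hp_scale [simp]: "hp k (scale_sf c f) = scale_sf c (hp k f)"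
  by (rule symfun_eqI) (simp add: coeff_hp)

lemma hp_zero [simp]: "hp k 0 = 0"
  by (rule symfun_eqI) (simp add: coeff_hp)

lemma hp_sum [simp]: "hp k (sum f S) = (\<Sum>i\<in>S. hp k (f i))"
  by (rule symfun_eqI) (simp add: coeff_hp)

lemma hp_of_nat_mult: "hp k (of_nat n * f) = of_nat n * hp k f"
  by (simp add: of_nat_mult_scale)

text \<open>Shifting all variables by one keeps the exponents of a monomial, and a coefficient
  depends on nothing else.\<close>

lemma hp_0 [simp]: "hp 0 f = f"
proof (rule symfun_eqI)
  fix M :: "nat multiset"
  have "count (image_mset Suc M) (Suc x) = count M x" for x
    by (induction M) auto
  moreover have "mset_set (Suc ` set_mset M) = image_mset Suc (mset_set (set_mset M))"
    by (rule image_mset_mset_set [symmetric]) simp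
  ultimately have "mtype (image_mset Suc M) = mtype M"
    by (simp add: mtype_def multiset.map_comp o_def)
  from coeff_mtype [OF this, of f] show "coeff_sf (hp 0 f) M = coeff_sf f M" by (simp add: coeff_hp)
qed

definition unshift :: "nat multiset \<Rightarrow> nat multiset" where
  "unshift M = image_mset (\<lambda>z. z - 1) (filter_mset (\<lambda>z. z \<noteq> 0) M)"

lemma unshift_shift [simp]: "unshift (image_mset Suc M + replicate_mset k 0) = M"
  by (simp add: unshift_def filter_mset_image_mset multiset.map_comp o_def multiset.map_ident)

lemma unshift_union: "unshift (A + B) = unshift A + unshift B"
  by (simp add: unshift_def)

lemma shift_unshift [simp]: "image_mset Suc (unshift M) + replicate_mset (count M 0) 0 = M"
proof (induction M)
  case (add x M)
  then show ?case by (cases "x = 0") (auto simp: unshift_def)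
qed (simp add: unshift_def)

lemma count_image_Suc_0 [simp]: "count (image_mset Suc M) 0 = 0"
  by (induction M) auto

lemma count_shift: "count (image_mset Suc M + replicate_mset k 0) 0 = k"
  by simp

text \<open>The power of the variable 0 and the rest of a monomial are split independently;
  \<open>count\<close> and \<open>unshift\<close> recover the two splittings.\<close>

lemma hp_mult: "hp k (f * g) = (\<Sum>i\<le>k. hp i f * hp (k - i) g)"
proof (rule symfun_eqI)
  fix M
  let ?M = "image_mset Suc M + replicate_mset k 0"
  have "coeff_sf (\<Sum>i\<le>k. hp i f * hp (k - i) g) M =
      (\<Sum>i\<le>k. \<Sum>p\<in>msplits M. coeff_sf (hp i f) (fst p) * coeff_sf (hp (k - i) g) (snd p))"
    by (simp add: coeff_mult case_prod_beta)
  also have "\<dots> = (\<Sum>q\<in>{..k} \<times> msplits M.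
      coeff_sf (hp (fst q) f) (fst (snd q)) * coeff_sf (hp (k - fst q) g) (snd (snd q)))"
    by (simp add: sum.cartesian_product case_prod_beta)
  also have "\<dots> = (\<Sum>p\<in>msplits ?M. coeff_sf f (fst p) * coeff_sf g (snd p))"
  proof (rule sum.reindex_bij_witness [where
        i = "\<lambda>p. (count (fst p) 0, (unshift (fst p), unshift (snd p)))" and
        j = "\<lambda>q. (image_mset Suc (fst (snd q)) + replicate_mset (fst q) 0,
               image_mset Suc (snd (snd q)) + replicate_mset (k - fst q) 0)"], goal_cases)
    case (3 p)
    then have e: "fst p + snd p = ?M" by (auto simp: msplits_def)
    have "count (fst p) 0 + count (snd p) 0 = k" using arg_cong [OF e, of "\<lambda>M. count M 0"]
      by (metis count_shift count_union)
    then show ?case using shift_unshift [of "fst p"] shift_unshift [of "snd p"]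
      by (metis add_diff_cancel_left' fst_conv snd_conv prod.collapse)
  next
    case (4 p)
    then have e: "fst p + snd p = ?M" by (auto simp: msplits_def)
    have "unshift (fst p) + unshift (snd p) = M"
      unfolding unshift_union [symmetric] e by simp
    moreover have "count (fst p) 0 + count (snd p) 0 = k" using arg_cong [OF e, of "\<lambda>M. count M 0"]
      by (metis count_shift count_union)
    ultimately show ?case by (auto simp: msplits_def)
  next
    case (2 q)
    obtain i A B where q: "q = (i, A, B)" by (cases q)
    with 2 have i: "i \<le> k" and AB: "A + B = M" by (auto simp: msplits_def)
    have "(image_mset Suc A + replicate_mset i 0) + (image_mset Suc B + replicate_mset (k - i) 0) =
        image_mset Suc (A + B) + (replicate_mset i 0 + replicate_mset (k - i) 0)"
      by simp
    also have "replicate_mset i 0 + replicate_mset (k - i) 0 = replicate_mset k (0::nat)"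
      using i by (simp add: multiset_eq_iff)
    finally show ?case by (simp add: q msplits_def AB)
  next
    case (1 q)
    then show ?case by (cases q) simp
  next
    case (5 q)
    then show ?case by (cases q) (simp add: coeff_hp)
  qed
  also have "\<dots> = coeff_sf (hp k (f * g)) M" by (simp add: coeff_hp coeff_mult case_prod_beta)
  finally show "coeff_sf (hp k (f * g)) M = coeff_sf (\<Sum>i\<le>k. hp i f * hp (k - i) g) M" ..
qed

lemma hp_sch: "is_part \<nu> \<Longrightarrow> hp k (sch \<nu>) = (\<Sum>\<kappa>\<in>hsdn \<nu> k. sch \<kappa>)"
proof (rule symfun_eqI)
  fix M assume \<nu>: "is_part \<nu>"
  have "kostka \<nu> (image_mset Suc M + replicate_mset k 0) = (\<Sum>\<kappa>\<in>hsdn \<nu> k. kostka \<kappa> (image_mset Suc M))"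
    using \<nu> by (intro kostka_remove) auto
  also have "\<dots> = (\<Sum>\<kappa>\<in>hsdn \<nu> k. kostka \<kappa> M)"
    using \<nu> is_part_hsdn by (intro sum.cong kostka_sym) auto
  finally show "coeff_sf (hp k (sch \<nu>)) M = coeff_sf (\<Sum>\<kappa>\<in>hsdn \<nu> k. sch \<kappa>) M"
    using \<nu> is_part_hsdn by (auto simp: coeff_hp coeff_sch intro!: sum.cong)
qed

lemma hp_hh: "hp k (hh a) = (if k \<le> a then hh (a - k) else 0)"
  by (rule symfun_eqI) (auto simp: coeff_hp coeff_hh)

text \<open>By symmetry, a variable of \<open>M\<close> can be moved to index 0 and split off with
  its full power. Since \<open>c\<close> and \<open>N\<close> do not depend on \<open>f\<close>,
  this allows two symmetric functions to be compared by induction on the degree through their images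
  under the operators \<open>hp c\<close>.\<close>

lemma coeff_via_hp:
  assumes "M \<noteq> {#}"
  shows "\<exists>c N. size N < size M \<and> (\<forall>f. coeff_sf f M = coeff_sf (hp c f) N)"
proof -
  obtain x where x: "x \<in># M" using assms by auto
  define \<pi> where "\<pi> = Transposition.transpose x (0::nat)"
  define M' where "M' = image_mset \<pi> M"
  define c where "c = count M' 0"
  have \<pi>: "bij \<pi>" by (simp add: \<pi>_def)
  have "\<pi> x \<in># M'" using x by (simp add: M'_def)
  then have c: "c > 0" by (simp add: \<pi>_def c_def)
  have e: "image_mset Suc (unshift M') + replicate_mset c 0 = M'"
    unfolding c_def by (rule shift_unshift)
  have "coeff_sf f M = coeff_sf (hp c f) (unshift M')" for f
    unfolding coeff_hp e unfolding M'_def by (rule coeff_sym [OF \<pi>, symmetric])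
  moreover have "size (unshift M') < size M" using arg_cong [OF e, of size] c by (simp add: M'_def)
  ultimately show ?thesis by blast
qed

text \<open>By \<open>coeff_via_hp\<close> it is enough to compare constant terms and images under
  \<open>hp c\<close>. The latter are given by \<open>hp_mult\<close> on the left and by
  \<open>hp_sch\<close> on the right, and \<open>hsup_hsdn_commute\<close> matches them.\<close>

lemma pieri:
  assumes "is_part \<rho>"
  shows "hh a * sch \<rho> = (\<Sum>\<nu>\<in>hsup \<rho> a. sch \<nu>)"
proof (rule symfun_eqI)
  fix M
  show "coeff_sf (hh a * sch \<rho>) M = coeff_sf (\<Sum>\<nu>\<in>hsup \<rho> a. sch \<nu>) M"
    using assms
  proof (induction "size M" arbitrary: M a \<rho> rule: less_induct)
    case less
    note \<rho> = less.prems
    show ?case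
    proof (cases "M = {#}")
      case True
      have "coeff_sf (\<Sum>\<nu>\<in>hsup \<rho> a. sch \<nu>) {#} = (\<Sum>\<nu>\<in>hsup \<rho> a. if \<nu> = (\<lambda>_. 0) then 1 else 0)"
        using \<rho> is_part_hsup by (auto simp: coeff_sch kostka_empty intro!: sum.cong)
      also have "\<dots> = (if (\<lambda>_. 0) \<in> hsup \<rho> a then 1 else 0)" using \<rho> by simp
      also have "(\<lambda>_. 0) \<in> hsup \<rho> a \<longleftrightarrow> a = 0 \<and> \<rho> = (\<lambda>_. 0)"
        using psize_eq_0 [OF \<rho>] by (auto simp: hsup_def hstrip_def)
      finally show ?thesis
        using \<rho> True by (auto simp: coeff_mult coeff_hh coeff_sch kostka_empty)
    next
      case False
      obtain c N where N: "size N < size M" "\<And>f. coeff_sf f M = coeff_sf (hp c f) N"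
        using coeff_via_hp [OF False] by blast
      have "hp c (hh a * sch \<rho>) = (\<Sum>j\<le>c. hp j (hh a) * hp (c - j) (sch \<rho>))" by (rule hp_mult)
      also have "\<dots> = (\<Sum>j\<le>min a c. hh (a - j) * hp (c - j) (sch \<rho>))"
        by (rule sum.mono_neutral_cong_right) (auto simp: hp_hh)
      also have "\<dots> = (\<Sum>j\<le>min a c. \<Sum>\<delta>\<in>hsdn \<rho> (c - j). hh (a - j) * sch \<delta>)"
        using \<rho> by (simp add: hp_sch sum_distrib_left)
      finally have "coeff_sf (hh a * sch \<rho>) M = (\<Sum>j\<le>min a c. \<Sum>\<delta>\<in>hsdn \<rho> (c - j). coeff_sf (hh (a - j) * sch \<delta>) N)"
        by (simp add: N(2))
      also have "\<dots> = (\<Sum>j\<le>min a c. \<Sum>\<delta>\<in>hsdn \<rho> (c - j). coeff_sf (\<Sum>\<kappa>\<in>hsup \<delta> (a - j). sch \<kappa>) N)"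
        using less.hyps [OF N(1)] \<rho> is_part_hsdn by (intro sum.cong refl) auto
      also have "\<dots> = (\<Sum>j\<le>min a c. \<Sum>\<delta>\<in>hsdn \<rho> (c - j). \<Sum>\<kappa>\<in>hsup \<delta> (a - j). coeff_sf (sch \<kappa>) N)"
        by simp
      also have "\<dots> = (\<Sum>\<nu>\<in>hsup \<rho> a. \<Sum>\<kappa>\<in>hsdn \<nu> c. coeff_sf (sch \<kappa>) N)"
        by (rule hsup_hsdn_commute [OF \<rho>, symmetric])
      also have "\<dots> = (\<Sum>\<nu>\<in>hsup \<rho> a. coeff_sf (hp c (sch \<nu>)) N)"
        using \<rho> is_part_hsup by (intro sum.cong refl) (auto simp: hp_sch)
      also have "\<dots> = coeff_sf (\<Sum>\<nu>\<in>hsup \<rho> a. sch \<nu>) M" by (simp add: N(2))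
      finally show ?thesis .
    qed
  qed
qed

text \<open>
  A semistandard tableau has entries at least \<open>i\<close> in one_row \<open>i\<close>, so that comparing the sums of all
  entries shows that the Kostka matrix is unitriangular.
\<close>

definition content_of :: "(nat \<Rightarrow> nat) \<Rightarrow> nat multiset" where
  "content_of \<nu> = image_mset fst (mset_set (diagram \<nu>))"

lemma content_of_inj: "is_part \<nu> \<Longrightarrow> is_part \<kappa> \<Longrightarrow> content_of \<nu> = content_of \<kappa> \<Longrightarrow> \<nu> = \<kappa>"
proof
  fix i assume p: "is_part \<nu>" "is_part \<kappa>" and e: "content_of \<nu> = content_of \<kappa>"
  have c: "count (content_of \<nu>) i = \<nu> i" if "is_part \<nu>" for \<nu>
  proof -
    have "count (content_of \<nu>) i = card {c \<in> diagram \<nu>. fst c = i}"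
      using that by (simp add: content_of_def count_image_mset Int_def vimage_def conj_commute)
    also have "{c \<in> diagram \<nu>. fst c = i} = Pair i ` {..<\<nu> i}" by (auto simp: diagram_def)
    finally show ?thesis by (simp add: card_image inj_on_def)
  qed
  show "\<nu> i = \<kappa> i" using c [OF p(1)] c [OF p(2)] e by simp
qed

lemma kostka_content_of: "is_part \<nu> \<Longrightarrow> kostka \<nu> (content_of \<nu>) \<noteq> 0"
proof -
  assume \<nu>: "is_part \<nu>"
  have "image_mset (restrict fst (diagram \<nu>)) (mset_set (diagram \<nu>)) = content_of \<nu>"
    unfolding content_of_def using \<nu> by (intro image_mset_cong) simp
  moreover have "j < \<nu> i" if "j < \<nu> (Suc i)" for i j
    using \<nu> that by (meson is_part_def less_le_trans)
  ultimately have "restrict fst (diagram \<nu>) \<in> tab \<nu> (content_of \<nu>)"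
    by (auto simp: tab_def)
  with \<nu> show ?thesis by (auto simp: kostka_def)
qed

lemma kostka_content_triangular:
  assumes \<nu>: "is_part \<nu>" and \<kappa>: "is_part \<kappa>" and nz: "kostka \<kappa> (content_of \<nu>) \<noteq> 0"
  shows "\<kappa> = \<nu> \<or> (\<Sum>c\<in>diagram \<kappa>. fst c) < (\<Sum>c\<in>diagram \<nu>. fst c)"
proof -
  obtain T where T: "T \<in> tab \<kappa> (content_of \<nu>)" using nz unfolding kostka_def by (metis card.empty ex_in_conv)
  have ge: "i \<le> T (i, j)" if "j < \<kappa> i" for i j
    using that
  proof (induction i)
    case (Suc i)
    then have "T (i, j) < T (Suc i, j)" using T by (simp add: tab_def)
    moreover have "j < \<kappa> i" using Suc.prems \<kappa> by (meson is_part_def less_le_trans)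
    ultimately show ?case using Suc.IH by simp
  qed simp
  have cont: "image_mset T (mset_set (diagram \<kappa>)) = content_of \<nu>" using T by (simp add: tab_def)
  have s: "(\<Sum>c\<in>diagram \<kappa>. T c) = (\<Sum>c\<in>diagram \<nu>. fst c)"
    using arg_cong [OF cont, of sum_mset] by (simp add: content_of_def sum_unfold_sum_mset)
  show ?thesis
  proof (cases "\<forall>c\<in>diagram \<kappa>. T c = fst c")
    case True
    then have "content_of \<nu> = content_of \<kappa>"
      unfolding cont [symmetric] unfolding content_of_def using \<kappa> by (intro image_mset_cong) simp
    then show ?thesis using content_of_inj \<nu> \<kappa> by metis
  next
    case False
    then obtain c where c: "c \<in> diagram \<kappa>" "T c \<noteq> fst c" by blast
    have ge': "fst c \<le> T c" if "c \<in> diagram \<kappa>" for c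
      using ge [of "snd c" "fst c"] that by (cases c) simp
    have "(\<Sum>c\<in>diagram \<kappa>. fst c) < (\<Sum>c\<in>diagram \<kappa>. T c)"
    proof (rule sum_strict_mono_ex1)
      show "\<exists>c\<in>diagram \<kappa>. fst c < T c" using c ge' [OF c(1)] by (intro bexI [of _ c]) auto
    qed (use \<kappa> ge' in auto)
    then show ?thesis by (simp add: s)
  qed
qed

lemma sch_inj: "inj_on sch (Collect is_part)"
  and sch_independent: "sf.independent (sch ` Collect is_part)"
  and sch_zero_sum: "\<And>S a i. finite S \<Longrightarrow> S \<subseteq> Collect is_part \<Longrightarrow>
    (\<Sum>i\<in>S. scale_sf (a i) (sch i)) = 0 \<Longrightarrow> i \<in> S \<Longrightarrow> a i = 0"
proof -
  let ?w = "\<lambda>\<nu>. int (\<Sum>c\<in>diagram \<nu>. fst c)"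
  have 1: "coeff_sf (sch \<nu>) (content_of \<nu>) \<noteq> 0" if "\<nu> \<in> Collect is_part" for \<nu>
    using that kostka_content_of by (simp add: coeff_sch)
  have 2: "\<kappa> = \<nu> \<or> ?w \<kappa> < ?w \<nu>"
    if "\<nu> \<in> Collect is_part" "\<kappa> \<in> Collect is_part" "coeff_sf (sch \<kappa>) (content_of \<nu>) \<noteq> 0" for \<nu> \<kappa>
    using kostka_content_triangular [of \<nu> \<kappa>] that by (simp add: coeff_sch del: of_nat_sum)
  show "inj_on sch (Collect is_part)"
    by (rule triangular_family_inj [of "Collect is_part" sch content_of ?w]) (fact 1 2)+
  show "sf.independent (sch ` Collect is_part)"
    by (rule triangular_family_independent [of "Collect is_part" sch content_of ?w]) (fact 1 2)+
  show "a i = 0" if "finite S" "S \<subseteq> Collect is_part" "(\<Sum>i\<in>S. scale_sf (a i) (sch i)) = 0" "i \<in> S" for S a i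
    by (rule triangular_family_zero [of "Collect is_part" sch content_of ?w S]) (fact 1 2 that)+
qed

text \<open>At a monomial of degree \<open>a\<close> the right side counts the pairs of a variable
  \<open>i\<close> and a number \<open>j\<close> between 1 and its exponent, of which there are
  \<open>a\<close>; in other degrees both sides vanish.\<close>

lemma newton: "of_nat a * hh a = (\<Sum>j=1..a. power_sum j * hh (a - j))"
proof (rule symfun_eqI)
  fix M
  have j: "coeff_sf (power_sum j * hh (a - j)) M =
      (\<Sum>i\<in>set_mset M. of_bool (j \<le> count M i) * of_bool (size M = a))" if "j \<in> {1..a}" for j
  proof -
    have "coeff_sf (power_sum j * hh (a - j)) M =
        (\<Sum>i | i \<in># M \<and> j \<le> count M i. of_bool (size (M - replicate_mset j i) = a - j))"
      using that by (simp add: coeff_power_sum_mult coeff_hh)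
    also have "\<dots> = (\<Sum>i | i \<in># M \<and> j \<le> count M i. of_bool (size M = a))"
    proof (rule sum.cong)
      fix i assume "i \<in> {i. i \<in># M \<and> j \<le> count M i}"
      then have "replicate_mset j i \<subseteq># M" by (simp add: count_le_replicate_mset_subset_eq)
      then have "size (M - replicate_mset j i) = size M - j" "j \<le> size M"
        using size_mset_mono by (force simp: size_Diff_submset)+
      with that show "of_bool (size (M - replicate_mset j i) = a - j) = (of_bool (size M = a) :: rat)"
        by auto
    qed simp
    also have "\<dots> = (\<Sum>i\<in>set_mset M. of_bool (j \<le> count M i) * of_bool (size M = a))"
      by (rule sum.mono_neutral_cong_left) auto
    finally show ?thesis .
  qed
  have "coeff_sf (\<Sum>j=1..a. power_sum j * hh (a - j)) M =
      (\<Sum>j=1..a. \<Sum>i\<in>set_mset M. of_bool (j \<le> count M i) * of_bool (size M = a))"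
    unfolding coeff_sum using j by (rule sum.cong [OF refl])
  also have "\<dots> = (\<Sum>i\<in>set_mset M. \<Sum>j=1..a. of_bool (j \<le> count M i) * of_bool (size M = a))"
    by (rule sum.swap)
  also have "\<dots> = (\<Sum>i\<in>set_mset M. of_nat (count M i) * of_bool (size M = a))"
  proof (rule sum.cong)
    fix i assume "i \<in> set_mset M"
    show "(\<Sum>j=1..a. of_bool (j \<le> count M i) * of_bool (size M = a)) =
        (of_nat (count M i) * of_bool (size M = a) :: rat)"
    proof (cases "size M = a")
      case True
      have "(\<Sum>j=1..a. of_bool (j \<le> count M i)) = (\<Sum>j=1..count M i. 1 :: rat)"
        using count_le_size [of M i] True by (intro sum.mono_neutral_cong_right) auto
      with True show ?thesis by simp
    qed simp
  qed simp
  also have "\<dots> = of_nat (size M) * of_bool (size M = a)"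
    by (simp add: size_multiset_overloaded_eq sum_distrib_right)
  also have "\<dots> = coeff_sf (of_nat a * hh a) M" by (simp add: of_nat_mult_scale coeff_hh)
  finally show "coeff_sf (of_nat a * hh a) M = coeff_sf (\<Sum>j=1..a. power_sum j * hh (a - j)) M" ..
qed

text \<open>The span of the Schur functions contains 1 and is closed under multiplication by h_a
  (Pieri), hence by p_a (Newton, by induction on \<open>a\<close>), hence contains every product of
  power sums.\<close>

lemma sch_span: "f \<in> sf.span (sch ` Collect is_part)"
proof -
  let ?S = "sf.span (sch ` Collect is_part)"
  have h: "hh a * f \<in> ?S" if "f \<in> ?S" for a f
    using that
  proof (induction rule: sf.span_induct_alt)
    case base
    show ?case by (simp add: sf.span_zero)
  next
    case (step c x y)
    from step(1) obtain \<nu> where \<nu>: "is_part \<nu>" "x = sch \<nu>" by blast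
    have "(\<Sum>\<nu>'\<in>hsup \<nu> a. sch \<nu>') \<in> ?S"
      using is_part_hsup [OF _ \<nu>(1)] by (intro sf.span_sum) (auto intro: sf.span_base)
    then have "hh a * x \<in> ?S" using pieri [OF \<nu>(1), of a] \<nu>(2) by simp
    then show ?case using step(2)
      by (simp add: distrib_left scale_mult_right sf.span_add sf.span_scale)
  qed
  have p: "power_sum a * f \<in> ?S" if "f \<in> ?S" "a \<ge> 1" for a f
    using that
  proof (induction a arbitrary: f rule: less_induct)
    case (less a)
    have "{1..a} = insert a {1..<a}" using less.prems by auto
    then have "of_nat a * hh a = power_sum a + (\<Sum>j\<in>{1..<a}. power_sum j * hh (a - j))"
      using newton [of a] by simp
    then have "power_sum a * f = of_nat a * (hh a * f) - (\<Sum>j\<in>{1..<a}. power_sum j * (hh (a - j) * f))"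
      by (simp add: algebra_simps sum_distrib_left sum_distrib_right)
    moreover have "of_nat a * (hh a * f) \<in> ?S"
      unfolding of_nat_mult_scale using h less.prems by (simp add: sf.span_scale)
    moreover have "(\<Sum>j\<in>{1..<a}. power_sum j * (hh (a - j) * f)) \<in> ?S"
      using less h by (intro sf.span_sum) auto
    ultimately show ?case by (simp add: sf.span_diff)
  qed
  have "pm M \<in> ?S" if "0 \<notin># M" for M
    using that
  proof (induction M)
    case empty
    have "sch (\<lambda>_. 0) \<in> ?S" by (intro sf.span_base) simp
    then show ?case by (simp add: sch_zero)
  next
    case (add k M)
    then show ?case using p [of "pm M" k] by (simp add: Suc_le_eq)
  qed
  then have "pm ` {M. 0 \<notin># M} \<subseteq> ?S" by auto
  then have "sf.span (pm ` {M. 0 \<notin># M}) \<subseteq> ?S"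
    by (intro sf.span_minimal sf.subspace_span)
  then show ?thesis using pm_span by blast
qed

section \<open>The functional phi, or pairing with the sum of all Schur functions\<close>

section \<open>The sum of the Schur coefficients\<close>

text \<open>Schur functions form a basis, so the two conditions determine this functional and the
  choice is immaterial.\<close>

definition phi :: "symfun \<Rightarrow> rat" where
  "phi = (SOME \<phi>. Vector_Spaces.linear scale_sf (*) \<phi> \<and> (\<forall>\<nu>. is_part \<nu> \<longrightarrow> \<phi> (sch \<nu>) = 1))"

lemma phi_add [simp]: "phi (f + g) = phi f + phi g"
  and phi_scale [simp]: "phi (scale_sf c f) = c * phi f"
  and phi_sch: "is_part \<nu> \<Longrightarrow> phi (sch \<nu>) = 1"
proof -
  have "\<exists>\<phi>. Vector_Spaces.linear scale_sf ((*) :: rat \<Rightarrow> rat \<Rightarrow> rat) \<phi> \<and> (\<forall>\<nu>. is_part \<nu> \<longrightarrow> \<phi> (sch \<nu>) = 1)"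
    using vector_space_pair.linear_independent_extend [OF vector_space_pair_sf_rat sch_independent, of "\<lambda>_. 1"]
    by auto
  then have "Vector_Spaces.linear scale_sf (*) phi \<and> (\<forall>\<nu>. is_part \<nu> \<longrightarrow> phi (sch \<nu>) = 1)"
    unfolding phi_def by (rule someI_ex)
  then show "phi (f + g) = phi f + phi g" "phi (scale_sf c f) = c * phi f"
    "is_part \<nu> \<Longrightarrow> phi (sch \<nu>) = 1"
    by (auto simp: Vector_Spaces.linear_iff)
qed

lemma phi_zero [simp]: "phi 0 = 0"
  using phi_scale [of 0 0] by simp

lemma phi_sum [simp]: "phi (sum f S) = (\<Sum>i\<in>S. phi (f i))"
  by (induction S rule: infinite_finite_induct) auto

lemma phi_diff: "phi (f - g) = phi f - phi g"
  using phi_add [of "f - g" g] by simp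

lemma phi_of_nat_mult: "phi (of_nat n * f) = of_nat n * phi f"
  by (simp add: of_nat_mult_scale)

lemma phi_one: "phi 1 = 1"
  using phi_sch [of "\<lambda>_. 0"] by (simp add: sch_zero)

text \<open>On a Schur function the left side counts the ways to add a horizontal strip of size
  \<open>a\<close> and the right side the ways to remove one of size at most \<open>a\<close>; these
  agree by \<open>card_hsup\<close>.\<close>

lemma phi_hh_mult: "phi (hh a * f) = (\<Sum>k\<le>a. phi (hp k f))"
  using sch_span [of f]
proof (induction rule: sf.span_induct_alt)
  case base
  show ?case by simp
next
  case (step c x y)
  then obtain \<nu> where \<nu>: "is_part \<nu>" "x = sch \<nu>" by auto
  have "phi (hh a * sch \<nu>) = of_nat (card (hsup \<nu> a))"
    using \<nu>(1) is_part_hsup by (simp add: pieri phi_sch)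
  also have "\<dots> = (\<Sum>k\<le>a. phi (hp k (sch \<nu>)))"
    using \<nu>(1) is_part_hsdn by (simp add: card_hsup hp_sch phi_sch)
  finally show ?case using step(2) \<nu>(2)
    by (simp add: distrib_left scale_mult_right sum.distrib sum_distrib_left)
qed


section \<open>The derivations p_k^perp and their interaction with phi\<close>

section \<open>The adjoints of power sums\<close>

text \<open>The adjoint of multiplication by \<open>p\<^sub>k\<close>, defined through Newton's identities.\<close>

fun Dp :: "nat \<Rightarrow> symfun \<Rightarrow> symfun" where
  "Dp k f = of_nat k * hp k f - (\<Sum>j\<in>{1..<k}. hp (k - j) (Dp j f))"

declare Dp.simps [simp del]

lemma Dp_0 [simp]: "Dp 0 f = 0"
  by (subst Dp.simps) simp

lemma Dp_newton: "(\<Sum>j=1..k. hp (k - j) (Dp j f)) = of_nat k * hp k f"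
proof (cases k)
  case (Suc l)
  then have "{1..k} = insert k {1..<k}" by auto
  then show ?thesis by (simp add: Dp.simps [of k])
qed simp

lemma triangle_sum:
  "(\<Sum>j=1..k. \<Sum>i\<le>k - j. G (i + j) j) = (\<Sum>s\<le>k. \<Sum>j=1..s. G s j)"
  for G :: "nat \<Rightarrow> nat \<Rightarrow> 'a::comm_monoid_add"
proof -
  have "(\<Sum>j=1..k. \<Sum>i\<le>k - j. G (i + j) j) = (\<Sum>p\<in>(SIGMA j:{1..k}. {..k - j}). G (snd p + fst p) (fst p))"
    by (simp add: sum.Sigma case_prod_unfold)
  also have "\<dots> = (\<Sum>p\<in>(SIGMA s:{..k}. {1..s}). G (fst p) (snd p))"
    by (rule sum.reindex_bij_witness [where i = "\<lambda>p. (snd p, fst p - snd p)" and j = "\<lambda>p. (snd p + fst p, fst p)"]) auto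
  also have "\<dots> = (\<Sum>s\<le>k. \<Sum>j=1..s. G s j)"
    by (simp add: sum.Sigma case_prod_unfold)
  finally show ?thesis .
qed

text \<open>After expanding \<open>hp\<close> of the product, the terms in which \<open>f\<close> is
  lowered by \<open>s\<close> in total are summed by \<open>Dp_newton\<close>.\<close>

lemma hp_Dp_mult:
  "(\<Sum>j=1..k. hp (k - j) (Dp j f * g)) = (\<Sum>s\<le>k. of_nat s * (hp s f * hp (k - s) g))"
proof -
  have "(\<Sum>j=1..k. hp (k - j) (Dp j f * g)) =
      (\<Sum>j=1..k. \<Sum>i\<le>k - j. hp (i + j - j) (Dp j f) * hp (k - (i + j)) g)"
    by (intro sum.cong refl) (simp add: hp_mult add.commute diff_diff_add)
  also have "\<dots> = (\<Sum>s\<le>k. \<Sum>j=1..s. hp (s - j) (Dp j f) * hp (k - s) g)"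
    by (rule triangle_sum)
  also have "\<dots> = (\<Sum>s\<le>k. of_nat s * hp s f * hp (k - s) g)"
    by (simp only: sum_distrib_right [symmetric] Dp_newton)
  finally show ?thesis by (simp add: mult.assoc)
qed

text \<open>The generating series of the \<open>hp k\<close> is multiplicative, so its logarithmic
  derivative is a derivation. In coefficients: \<open>hp_Dp_mult\<close> for both orders of the
  factors, where the weights \<open>s\<close> and \<open>k - s\<close> add up to \<open>k\<close>,
  and cancellation of the terms below \<open>k\<close> by induction.\<close>

lemma Dp_mult: "Dp k (f * g) = Dp k f * g + f * Dp k g"
proof (induction k rule: less_induct)
  case (less k)
  show ?case
  proof (cases k)
    case (Suc l)
    then have I: "{1..k} = insert k {1..<k}" by auto
    have "(\<Sum>j=1..k. hp (k - j) (Dp j f * g)) + (\<Sum>j=1..k. hp (k - j) (Dp j g * f)) =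
        (\<Sum>s\<le>k. of_nat s * (hp s f * hp (k - s) g)) + (\<Sum>s\<le>k. of_nat s * (hp s g * hp (k - s) f))"
      by (simp only: hp_Dp_mult)
    also have "(\<Sum>s\<le>k. of_nat s * (hp s g * hp (k - s) f)) = (\<Sum>s\<le>k. of_nat (k - s) * (hp s f * hp (k - s) g))"
      by (rule sum.reindex_bij_witness [where i = "\<lambda>s. k - s" and j = "\<lambda>s. k - s"]) (auto simp: mult.commute)
    also have "(\<Sum>s\<le>k. of_nat s * (hp s f * hp (k - s) g)) + \<dots> = (\<Sum>s\<le>k. of_nat k * (hp s f * hp (k - s) g))"
      unfolding sum.distrib [symmetric] distrib_right [symmetric] of_nat_add [symmetric]
      by (intro sum.cong refl) simp
    also have "\<dots> = of_nat k * hp k (f * g)" by (simp add: hp_mult sum_distrib_left)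
    finally have 1: "(\<Sum>j=1..k. hp (k - j) (Dp j f * g)) + (\<Sum>j=1..k. hp (k - j) (Dp j g * f)) =
        of_nat k * hp k (f * g)" .
    have 2: "(\<Sum>j=1..k. hp (k - j) (Dp j f * g)) = Dp k f * g + (\<Sum>j\<in>{1..<k}. hp (k - j) (Dp j f * g))"
      "(\<Sum>j=1..k. hp (k - j) (Dp j g * f)) = f * Dp k g + (\<Sum>j\<in>{1..<k}. hp (k - j) (Dp j g * f))"
      unfolding I by (simp_all add: mult.commute)
    have "(\<Sum>j\<in>{1..<k}. hp (k - j) (Dp j (f * g))) =
        (\<Sum>j\<in>{1..<k}. hp (k - j) (Dp j f * g)) + (\<Sum>j\<in>{1..<k}. hp (k - j) (Dp j g * f))"
      unfolding sum.distrib [symmetric] by (intro sum.cong refl) (simp add: less mult.commute)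
    then show ?thesis
      unfolding Dp.simps [of k "f * g"] 1 [symmetric] 2 by (simp only: add_diff_eq diff_add_eq) simp
  qed simp
qed

lemma Dp_one [simp]: "Dp k 1 = 0"
  using Dp_mult [of k 1 1] by simp

lemma Dp_prod:
  "finite I \<Longrightarrow> Dp k (\<Prod>i\<in>I. f i) = (\<Sum>i\<in>I. Dp k (f i) * (\<Prod>j\<in>I - {i}. f j))"
proof (induction I rule: finite_induct)
  case (insert x I)
  have "(\<Prod>j\<in>insert x I - {i}. f j) = f x * (\<Prod>j\<in>I - {i}. f j)" if "i \<in> I" for i
  proof -
    have "insert x I - {i} = insert x (I - {i})" using that insert.hyps by auto
    then show ?thesis using insert.hyps by simp
  qed
  then have "(\<Sum>i\<in>I. Dp k (f i) * (\<Prod>j\<in>insert x I - {i}. f j)) = f x * (\<Sum>i\<in>I. Dp k (f i) * (\<Prod>j\<in>I - {i}. f j))"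
    by (simp add: sum_distrib_left mult.left_commute)
  then show ?case using insert by (simp add: Dp_mult)
qed simp

text \<open>Setting h_a = 0 for negative \<open>a\<close> lets the recursions below lower the index
  without case distinctions.\<close>

definition hz :: "int \<Rightarrow> symfun" where
  "hz a = (if a < 0 then 0 else hh (nat a))"

lemma hz_of_nat [simp]: "hz (int a) = hh a"
  by (simp add: hz_def)

lemma hz_neg [simp]: "a < 0 \<Longrightarrow> hz a = 0"
  by (simp add: hz_def)

lemma psi_zero [simp]: "psi k 0 = 0"
proof (rule symfun_eqI)
  fix M show "coeff_sf (psi k 0) M = coeff_sf 0 M"
    by transfer auto
qed

lemma psi_one: "k \<ge> 1 \<Longrightarrow> psi k 1 = 1"
  using rat_alg_hom_psi by (simp add: rat_alg_hom_def)

text \<open>In p_k[h_a] all exponents are multiples of \<open>k\<close>, and splitting off the j-th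
  power of one variable lowers the degree of h_a by j/k.\<close>

lemma hp_psi_hz:
  assumes k: "k \<ge> 1"
  shows "hp j (psi k (hz a)) = (if k dvd j then psi k (hz (a - int (j div k))) else 0)"
proof (rule symfun_eqI)
  fix M
  let ?M = "image_mset Suc M + replicate_mset j 0"
  have neg: "coeff_sf (hz a) N = of_bool (int (size N) = a)" for a N
    by (auto simp: hz_def coeff_hh)
  have dvd: "(\<exists>N. ?M = repeat_mset k N) \<longleftrightarrow> k dvd j \<and> (\<exists>N. M = repeat_mset k N)"
  proof
    assume "\<exists>N. ?M = repeat_mset k N"
    then obtain N where N: "?M = repeat_mset k N" ..
    have "k dvd j" using arg_cong [OF N, of "\<lambda>M. count M 0"] by simp
    moreover have "unshift (repeat_mset k N) = repeat_mset k (unshift N)"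
      by (induction k) (auto simp: unshift_union unshift_def)
    then have "M = repeat_mset k (unshift N)" using arg_cong [OF N, of unshift] by simp
    ultimately show "k dvd j \<and> (\<exists>N. M = repeat_mset k N)" by blast
  next
    assume "k dvd j \<and> (\<exists>N. M = repeat_mset k N)"
    then obtain N where "M = repeat_mset k N" "j = k * (j div k)" by auto
    then have "?M = repeat_mset k (image_mset Suc N + replicate_mset (j div k) 0)"
      by (metis image_mset_repeat_mset repeat_mset_distrib2 repeat_replicate_mset)
    then show "\<exists>N. ?M = repeat_mset k N" by blast
  qed
  show "coeff_sf (hp j (psi k (hz a))) M = coeff_sf (if k dvd j then psi k (hz (a - int (j div k))) else 0) M"
  proof (cases "k dvd j \<and> (\<exists>N. M = repeat_mset k N)")
    case True
    then obtain N where N: "M = repeat_mset k N" and j: "j = k * (j div k)" by auto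
    then have e: "?M = repeat_mset k (image_mset Suc N + replicate_mset (j div k) 0)"
      by (metis image_mset_repeat_mset repeat_mset_distrib2 repeat_replicate_mset)
    have "coeff_sf (hp j (psi k (hz a))) M = of_bool (int (size N + j div k) = a)"
      unfolding coeff_hp e coeff_psi_repeat [OF k] neg by simp
    moreover have "coeff_sf (psi k (hz (a - int (j div k)))) M = of_bool (int (size N) = a - int (j div k))"
      unfolding N using k by (simp add: neg)
    ultimately show ?thesis using True by (auto simp: algebra_simps)
  next
    case False
    then have "coeff_sf (hp j (psi k (hz a))) M = 0"
      using dvd by (simp only: coeff_hp coeff_psi_other not_False_eq_True)
    with False show ?thesis by (auto simp: coeff_psi_other)
  qed
qed

text \<open>For j = kq, the terms of the Newton recursion that survive come from the q - 1 smaller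
  multiples of \<open>k\<close>. By induction each of them equals k p_k[h_{a-q}], so kq - k(q-1) = k
  copies are left.\<close>

lemma Dp_psi_hz:
  assumes k: "k \<ge> 1"
  shows "Dp j (psi k (hz a)) = (if k dvd j \<and> j > 0 then of_nat k * psi k (hz (a - int (j div k))) else 0)"
proof (induction j rule: less_induct)
  case (less j)
  have e: "hp (j - i) (Dp i (psi k (hz a))) =
      (if k dvd i \<and> k dvd j then of_nat k * psi k (hz (a - int (j div k))) else 0)" if i: "i \<in> {1..<j}" for i
  proof (cases "k dvd i")
    case True
    have d: "k dvd (j - i) \<longleftrightarrow> k dvd j" using True i by (simp add: dvd_diff_nat dvd_minus_self) (metis dvd_diffD i atLeastLessThan_iff less_imp_le dvd_diff_nat)
    have "hz (a - int (i div k) - int ((j - i) div k)) = hz (a - int (j div k))" if "k dvd j"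
    proof -
      have "i div k + (j - i) div k = j div k"
        using True that i k by (simp flip: div_add add: d)
      then have "a - int (i div k) - int ((j - i) div k) = a - int (j div k)" by linarith
      then show ?thesis by (simp only:)
    qed
    then show ?thesis using True i k by (auto simp: less hp_of_nat_mult hp_psi_hz d)
  qed (use i in \<open>simp add: less\<close>)
  show ?case
  proof (cases "k dvd j \<and> j > 0")
    case True
    then obtain q where q: "j = k * q" "q > 0" by (metis dvdE gr0I mult_0_right)
    have "{i \<in> {1..<j}. k dvd i} = (\<lambda>b. k * b) ` {1..<q}"
      using k q by (auto simp: image_iff elim!: dvdE)
    then have c: "card {i \<in> {1..<j}. k dvd i} = q - 1"
      using k by (simp add: card_image inj_on_def)
    have "(\<Sum>i\<in>{1..<j}. hp (j - i) (Dp i (psi k (hz a)))) =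
        (\<Sum>i\<in>{1..<j}. if k dvd i then of_nat k * psi k (hz (a - int q)) else 0)"
    proof (rule sum.cong [OF refl])
      fix i assume i: "i \<in> {1..<j}"
      show "hp (j - i) (Dp i (psi k (hz a))) = (if k dvd i then of_nat k * psi k (hz (a - int q)) else 0)"
        unfolding e [OF i] using q k by simp
    qed
    also have "\<dots> = of_nat (q - 1) * (of_nat k * psi k (hz (a - int q)))"
      unfolding c [symmetric] by (simp add: sum.If_cases Int_def)
    finally have 1: "(\<Sum>i\<in>{1..<j}. hp (j - i) (Dp i (psi k (hz a)))) =
        of_nat (q - 1) * (of_nat k * psi k (hz (a - int q)))" .
    have 2: "hp j (psi k (hz a)) = psi k (hz (a - int q))" using q k by (simp add: hp_psi_hz)
    have "Dp j (psi k (hz a)) = of_nat (k * q) * psi k (hz (a - int q)) -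
        of_nat (q - 1) * (of_nat k * psi k (hz (a - int q)))"
      unfolding Dp.simps [of j] 1 2 using q(1) by simp
    also have "\<dots> = (of_nat (k * q) - of_nat (q - 1) * of_nat k) * psi k (hz (a - int q))"
      by (simp add: left_diff_distrib mult.assoc)
    also have "of_nat (k * q) - of_nat (q - 1) * of_nat k = (of_nat k :: symfun)"
      using q(2) by (cases q) (auto simp: algebra_simps)
    finally show ?thesis using True q k by simp
  next
    case False
    then have "(\<Sum>i\<in>{1..<j}. hp (j - i) (Dp i (psi k (hz a)))) = 0"
      by (intro sum.neutral) (auto simp: e [simplified])
    with False show ?thesis using k by (auto simp: Dp.simps [of j] hp_psi_hz)
  qed
qed

lemma psi_1: "psi 1 f = f"
proof (rule psi_eqI)
  have 1: "repeat_mset 1 N = N" for N :: "nat multiset" by (simp add: multiset_eq_iff)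
  show "coeff_sf f (repeat_mset 1 N) = coeff_sf f N" for N unfolding 1 ..
  show "coeff_sf f M = 0" if "\<nexists>N. M = repeat_mset 1 N" for M using that 1 by metis
qed simp

lemma Dp_hh_mult: "j \<ge> 1 \<Longrightarrow> Dp j (hh b * f) = hz (int b - int j) * f + hh b * Dp j f"
  using Dp_psi_hz [of 1 j "int b"] unfolding psi_1 by (simp add: Dp_mult)

lemma phi_hz_mult: "b \<le> int a \<Longrightarrow> phi (hz b * f) = (\<Sum>k\<le>a. of_bool (int k \<le> b) * phi (hp k f))"
proof (cases "b < 0")
  case False
  assume b: "b \<le> int a"
  from False obtain c where c: "b = int c" by (metis nonneg_int_cases not_less)
  have "(\<Sum>k\<le>a. of_bool (int k \<le> b) * phi (hp k f)) = (\<Sum>k\<le>c. phi (hp k f))"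
    using b c by (intro sum.mono_neutral_cong_right) auto
  then show ?thesis by (simp add: c phi_hh_mult)
qed (auto intro!: sum.neutral)

lemma odd_double_sum: "(\<Sum>j=1..n. of_bool (odd j) + of_bool (2 * j \<le> n)) = n" for n :: nat
proof -
  have "(\<Sum>j=1..n. of_bool (odd j)) = (n + 1) div 2"
    by (induction n) auto
  moreover have "(\<Sum>j=1..n. of_bool (2 * j \<le> n)) = (\<Sum>j=1..n div 2. (1::nat))"
    by (intro sum.mono_neutral_cong_right) auto
  ultimately show ?thesis by (simp add: sum.distrib)
qed

text \<open>The comparison of coefficients for \<open>phi_power_sum_mult\<close>. Summands with
  \<open>j > a - k\<close> vanish and the rest are counted by \<open>odd_double_sum\<close>; for
  \<open>k = 0\<close> the index \<open>j = a\<close> is missing from the range, whence the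
  correction for odd \<open>a\<close>.\<close>

lemma odd_double_sum_less:
  assumes "k \<le> a" "a \<ge> 1"
  shows "(\<Sum>j\<in>{1..<a}. of_bool (odd j) * of_bool (k \<le> a - j) + of_bool (int k \<le> int a - 2 * int j)) + k
    + of_bool (k = 0) * of_bool (odd a) = a"
proof -
  have eq: "of_bool (odd j) * of_bool (k \<le> a - j) + of_bool (int k \<le> int a - 2 * int j) =
      (if j \<le> a - k then of_bool (odd j) + of_bool (2 * j \<le> a - k) else 0 :: nat)" if "j \<in> {1..<a}" for j
    using that assms by auto
  have "(\<Sum>j\<in>{1..<a}. of_bool (odd j) * of_bool (k \<le> a - j) + of_bool (int k \<le> int a - 2 * int j) :: nat) =
      (\<Sum>j\<in>{1..<a}. if j \<le> a - k then of_bool (odd j) + of_bool (2 * j \<le> a - k) else 0 :: nat)"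
    by (intro sum.cong refl) (rule eq)
  also have "\<dots> = (\<Sum>j | j \<in> {1..<a} \<and> j \<le> a - k. of_bool (odd j) + of_bool (2 * j \<le> a - k))"
    by (rule sum.inter_filter [symmetric]) simp
  finally have s: "(\<Sum>j\<in>{1..<a}. of_bool (odd j) * of_bool (k \<le> a - j) + of_bool (int k \<le> int a - 2 * int j) :: nat) =
      (\<Sum>j | j \<in> {1..<a} \<and> j \<le> a - k. of_bool (odd j) + of_bool (2 * j \<le> a - k))" .
  show ?thesis
  proof (cases "k = 0")
    case True
    have "{j. j \<in> {1..<a} \<and> j \<le> a - k} = {1..<a}" "{1..a} = insert a {1..<a}" using True assms by auto
    then show ?thesis using s odd_double_sum [of a] True assms by auto
  next
    case False
    then have "{j. j \<in> {1..<a} \<and> j \<le> a - k} = {1..a - k}" by auto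
    then show ?thesis using s odd_double_sum [of "a - k"] False assms by simp
  qed
qed

text \<open>For the sum S of all Schur functions this says p_a^perp S = (p_a + [a odd]) S, the
  differential form of the exponential formula for S. The proof replaces p_a by Newton's identity;
  induction and \<open>phi_hh_mult\<close> reduce everything to the numbers \<open>P k\<close>,
  whose coefficients are settled by \<open>odd_double_sum_less\<close>.\<close>

lemma phi_power_sum_mult:
  "a \<ge> 1 \<Longrightarrow> phi (power_sum a * f) = of_bool (odd a) * phi f + phi (Dp a f)"
proof (induction a arbitrary: f rule: less_induct)
  case (less a)
  define P where "P k = phi (hp k f)" for k
  have I: "{1..a} = insert a {1..<a}" using less.prems by auto
  have "of_nat a * hh a = power_sum a + (\<Sum>j\<in>{1..<a}. power_sum j * hh (a - j))"
    using newton [of a] unfolding I by simp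
  then have e1: "power_sum a * f = of_nat a * (hh a * f) - (\<Sum>j\<in>{1..<a}. power_sum j * (hh (a - j) * f))"
    by (simp add: algebra_simps sum_distrib_left sum_distrib_right)
  \<comment> \<open>The induction hypothesis is applied to h_{a-j} f, on which the derivation
    p_j^perp gives h_{a-2j} f + h_{a-j} p_j^perp f.\<close>
  have e2: "phi (power_sum j * (hh (a - j) * f)) =
      (\<Sum>k\<le>a. (of_bool (odd j) * of_bool (k \<le> a - j) + of_bool (int k \<le> int a - 2 * int j)) * P k)
      + (\<Sum>k\<le>a - j. phi (hp k (Dp j f)))" if j: "j \<in> {1..<a}" for j
  proof -
    have "phi (power_sum j * (hh (a - j) * f)) =
        of_bool (odd j) * phi (hh (a - j) * f) + (phi (hz (int (a - j) - int j) * f) + phi (hh (a - j) * Dp j f))"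
      using less.IH [of j "hh (a - j) * f"] j by (simp add: Dp_hh_mult)
    also have "phi (hh (a - j) * Dp j f) = (\<Sum>k\<le>a - j. phi (hp k (Dp j f)))" by (rule phi_hh_mult)
    also have "phi (hh (a - j) * f) = (\<Sum>k\<le>a. of_bool (k \<le> a - j) * P k)"
      using phi_hz_mult [of "int (a - j)" a f] by (simp add: P_def)
    also have "phi (hz (int (a - j) - int j) * f) = (\<Sum>k\<le>a. of_bool (int k \<le> int a - 2 * int j) * P k)"
    proof -
      have "int (a - j) - int j = int a - 2 * int j" using j by auto
      then show ?thesis using phi_hz_mult [of "int a - 2 * int j" a f] by (simp add: P_def)
    qed
    finally show ?thesis by (simp add: sum_distrib_left distrib_right sum.distrib mult.assoc)
  qed
  \<comment> \<open>Newton's relation for the adjoints, summed up to \<open>a\<close>; the missing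
    index \<open>j = a\<close> accounts for the term \<open>phi (Dp a f)\<close> that is
    wanted.\<close>
  have e3: "(\<Sum>j\<in>{1..<a}. \<Sum>k\<le>a - j. phi (hp k (Dp j f))) = (\<Sum>k\<le>a. of_nat k * P k) - phi (Dp a f)"
  proof -
    have "(\<Sum>j=1..a. \<Sum>i\<le>a - j. phi (hp (i + j - j) (Dp j f))) = (\<Sum>s\<le>a. \<Sum>j=1..s. phi (hp (s - j) (Dp j f)))"
      by (rule triangle_sum)
    also have "\<dots> = (\<Sum>s\<le>a. of_nat s * P s)"
      using Dp_newton [of _ f] by (simp add: P_def phi_of_nat_mult flip: phi_sum)
    finally show ?thesis unfolding I by simp
  qed
  have "phi (power_sum a * f) = of_nat a * (\<Sum>k\<le>a. P k)
      - (\<Sum>j\<in>{1..<a}. \<Sum>k\<le>a. (of_bool (odd j) * of_bool (k \<le> a - j) + of_bool (int k \<le> int a - 2 * int j)) * P k)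
      - (\<Sum>k\<le>a. of_nat k * P k) + phi (Dp a f)"
    unfolding e1 phi_diff phi_sum phi_of_nat_mult phi_hh_mult using e2 e3 by (simp add: P_def sum.distrib)
  also have "(\<Sum>j\<in>{1..<a}. \<Sum>k\<le>a. (of_bool (odd j) * of_bool (k \<le> a - j) + of_bool (int k \<le> int a - 2 * int j)) * P k)
      = (\<Sum>k\<le>a. of_nat (\<Sum>j\<in>{1..<a}. of_bool (odd j) * of_bool (k \<le> a - j) + of_bool (int k \<le> int a - 2 * int j)) * P k)"
    by (subst sum.swap) (simp add: sum_distrib_right)
  also have "of_nat a * (\<Sum>k\<le>a. P k) - \<dots> - (\<Sum>k\<le>a. of_nat k * P k) =
      (\<Sum>k\<le>a. of_bool (k = 0) * of_bool (odd a) * P k)"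
    unfolding sum_distrib_left sum_subtractf [symmetric]
  proof (rule sum.cong)
    fix k assume "k \<in> {..a}"
    then have "k \<le> a" by simp
    let ?s = "(\<Sum>j\<in>{1..<a}. of_bool (odd j) * of_bool (k \<le> a - j) + of_bool (int k \<le> int a - 2 * int j)) :: nat"
    have "of_nat a = (of_nat (?s + k + of_bool (k = 0) * of_bool (odd a)) :: rat)"
      using odd_double_sum_less [OF \<open>k \<le> a\<close> less.prems] by (simp only:)
    then have a: "of_nat a = of_nat ?s + of_nat k + of_bool (k = 0) * (of_bool (odd a) :: rat)"
      by (simp only: of_nat_add of_nat_mult of_nat_of_bool)
    show "of_nat a * P k - of_nat ?s * P k - of_nat k * P k = of_bool (k = 0) * of_bool (odd a) * P k"
      unfolding a by (simp only: left_diff_distrib [symmetric]) simp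
  qed simp
  also have "\<dots> = of_bool (odd a) * phi f"
  proof -
    have "(\<Sum>k\<le>a. of_bool (k = 0) * of_bool (odd a) * P k) = (\<Sum>k\<in>{0}. of_bool (odd a) * P k)"
      by (rule sum.mono_neutral_cong_right) auto
    then show ?thesis by (simp add: P_def)
  qed
  finally show ?case .
qed


section \<open>Solutions of weighted linear systems and a recursion for their number\<close>

section \<open>Counting weighted solutions\<close>

text \<open>The right-hand sides are integers so that they can be lowered past 0, where no solution
  is left.\<close>

definition sols :: "'v set \<Rightarrow> ('v \<Rightarrow> nat \<Rightarrow> nat) \<Rightarrow> nat \<Rightarrow> (nat \<Rightarrow> int) \<Rightarrow> ('v \<Rightarrow> nat) set" where
  "sols V w r m = {x \<in> V \<rightarrow>\<^sub>E UNIV. \<forall>i<r. int (\<Sum>v\<in>V. w v i * x v) = m i}"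

lemma solsD: "x \<in> sols V w r m \<Longrightarrow> i < r \<Longrightarrow> m i = int (\<Sum>v\<in>V. w v i * x v)"
proof -
  assume "x \<in> sols V w r m" and i: "i < r"
  then have "\<forall>i<r. int (\<Sum>v\<in>V. w v i * x v) = m i"
    unfolding sols_def by (elim CollectE conjE)
  from this [rule_format, OF i] show ?thesis by (rule sym)
qed

lemma sols_le:
  assumes "finite V" "x \<in> sols V w r m" "v \<in> V" "i < r" "w v i \<ge> 1"
  shows "int (x v) \<le> m i"
proof -
  have "x v \<le> w v i * x v" using assms(5) by simp
  also have "\<dots> \<le> (\<Sum>v\<in>V. w v i * x v)" using assms by (intro member_le_sum) auto
  finally show ?thesis unfolding solsD [OF assms(2,4)] by (rule of_nat_mono)
qed

lemma finite_sols:
  assumes V: "finite V" and pos: "\<And>v. v \<in> V \<Longrightarrow> \<exists>i<r. w v i \<ge> 1"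
  shows "finite (sols V w r m)"
proof (rule finite_subset)
  define B where "B = (\<Sum>i<r. nat (m i))"
  show "sols V w r m \<subseteq> V \<rightarrow>\<^sub>E {..B}"
  proof
    fix x assume x: "x \<in> sols V w r m"
    have "x v \<le> B" if v: "v \<in> V" for v
    proof -
      obtain i where i: "i < r" "w v i \<ge> 1" using pos [OF v] by blast
      then have "int (x v) \<le> m i" by (intro sols_le [OF V x v])
      then have "x v \<le> nat (m i)" by simp
      also have "\<dots> \<le> B" unfolding B_def using i by (intro member_le_sum) auto
      finally show ?thesis .
    qed
    then show "x \<in> V \<rightarrow>\<^sub>E {..B}" using x by (auto simp: sols_def PiE_iff)
  qed
qed (use V in \<open>auto intro: finite_PiE\<close>)

lemma card_sols_shift:
  assumes V: "finite V" and v: "v \<in> V"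
  shows "card {x \<in> sols V w r m. b \<le> x v} = card (sols V w r (\<lambda>i. m i - int (b * w v i)))"
proof (rule bij_betw_same_card)
  let ?S = "{x \<in> sols V w r m. b \<le> x v}" and ?T = "sols V w r (\<lambda>i. m i - int (b * w v i))"
  have s: "(\<Sum>u\<in>V. w u i * (x(v := c)) u) = w v i * c + (\<Sum>u\<in>V - {v}. w u i * x u)" for x c i
    using V v by (simp add: sum.remove [of V v])
  have s0: "(\<Sum>u\<in>V. w u i * x u) = w v i * x v + (\<Sum>u\<in>V - {v}. w u i * x u)" for x i
    using V v by (simp add: sum.remove [of V v])
  show "bij_betw (\<lambda>x. x(v := x v - b)) ?S ?T"
  proof (rule bij_betw_byWitness [where f' = "\<lambda>x. x(v := x v + b)"])
    show "(\<lambda>x. x(v := x v - b)) ` ?S \<subseteq> ?T"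
    proof (rule image_subsetI)
      fix x assume "x \<in> ?S"
      then have x: "x \<in> sols V w r m" "b \<le> x v" by auto
      have "int (\<Sum>u\<in>V. w u i * (x(v := x v - b)) u) = m i - int (b * w v i)" if "i < r" for i
      proof -
        obtain c where "x v = b + c" using x(2) le_Suc_ex by blast
        then have "w v i * x v = w v i * (x v - b) + b * w v i" by (simp add: algebra_simps)
        then show ?thesis unfolding solsD [OF x(1) that] s s0 by linarith
      qed
      moreover have "x(v := x v - b) \<in> V \<rightarrow>\<^sub>E UNIV" using x(1) v by (auto simp: sols_def PiE_iff extensional_def)
      ultimately show "x(v := x v - b) \<in> ?T" unfolding sols_def by blast
    qed
    show "(\<lambda>x. x(v := x v + b)) ` ?T \<subseteq> ?S"
    proof (rule image_subsetI)
      fix x assume x: "x \<in> ?T"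
      have "int (\<Sum>u\<in>V. w u i * (x(v := x v + b)) u) = m i" if "i < r" for i
      proof -
        have "m i - int (b * w v i) = int (w v i * x v + (\<Sum>u\<in>V - {v}. w u i * x u))"
          using solsD [OF x that] unfolding s0 .
        moreover have "w v i * (x v + b) = w v i * x v + b * w v i" by (simp add: algebra_simps)
        ultimately show ?thesis unfolding s by linarith
      qed
      moreover have "x(v := x v + b) \<in> V \<rightarrow>\<^sub>E UNIV" using x v by (auto simp: sols_def PiE_iff extensional_def)
      ultimately show "x(v := x v + b) \<in> ?S" unfolding sols_def by simp
    qed
  qed auto
qed

text \<open>
  The logarithmic derivative, with respect to one of the variables, of the generating function
  \<open>\<Prod>\<^sub>v 1 / (1 - y\<^bsup>w v\<^esup>)\<close>, read off at one coefficient.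
\<close>

lemma sols_recursion:
  assumes V: "finite V" and pos: "\<And>v. v \<in> V \<Longrightarrow> \<exists>i<r. w v i \<ge> 1"
    and i: "i < r" and L: "m i \<le> int L"
  shows "of_int (m i) * of_nat (card (sols V w r m)) =
    (\<Sum>v\<in>V. of_nat (w v i) * (\<Sum>b=1..L. of_nat (card (sols V w r (\<lambda>i. m i - int (b * w v i)))) :: rat))"
proof -
  let ?S = "sols V w r m"
  have fin: "finite ?S" using V pos by (rule finite_sols)
  \<comment> \<open>\<open>x v\<close> is written as the number of \<open>b >= 1\<close> with
    \<open>b <= x v\<close>, and \<open>card_sols_shift\<close> turns the solutions with
    \<open>b <= x v\<close> into solutions for lowered right-hand sides.\<close>
  have c: "of_nat (w v i) * (\<Sum>b=1..L. of_nat (card (sols V w r (\<lambda>i. m i - int (b * w v i))))) =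
      (\<Sum>x\<in>?S. of_nat (w v i * x v) :: rat)" if v: "v \<in> V" for v
  proof (cases "w v i = 0")
    case False
    have "(\<Sum>b=1..L. of_nat (card (sols V w r (\<lambda>i. m i - int (b * w v i))))) =
        (\<Sum>b=1..L. \<Sum>x\<in>?S. of_bool (b \<le> x v) :: rat)"
    proof (rule sum.cong [OF refl])
      fix b
      have "of_nat (card {x \<in> ?S. b \<le> x v}) = (\<Sum>x\<in>?S. of_bool (b \<le> x v) :: rat)"
        using fin by (simp add: Int_def)
      then show "of_nat (card (sols V w r (\<lambda>i. m i - int (b * w v i)))) = (\<Sum>x\<in>?S. of_bool (b \<le> x v) :: rat)"
        by (simp add: card_sols_shift [OF V v])
    qed
    also have "\<dots> = (\<Sum>x\<in>?S. \<Sum>b=1..L. of_bool (b \<le> x v))" by (rule sum.swap)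
    also have "\<dots> = (\<Sum>x\<in>?S. of_nat (x v))"
    proof (rule sum.cong [OF refl])
      fix x assume x: "x \<in> ?S"
      have "x v \<le> L" using sols_le [OF V x v i] False L by simp
      then have "(\<Sum>b=1..L. of_bool (b \<le> x v)) = (\<Sum>b=1..x v. 1 :: rat)"
        by (intro sum.mono_neutral_cong_right) auto
      then show "(\<Sum>b=1..L. of_bool (b \<le> x v)) = (of_nat (x v) :: rat)" by simp
    qed
    finally show ?thesis by (simp add: sum_distrib_left)
  qed simp
  have "of_int (m i) * of_nat (card ?S) = (\<Sum>x\<in>?S. of_int (m i) :: rat)" by simp
  also have "\<dots> = (\<Sum>x\<in>?S. \<Sum>v\<in>V. of_nat (w v i * x v))"
  proof (rule sum.cong [OF refl])
    fix x assume "x \<in> ?S"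
    then have "m i = int (\<Sum>v\<in>V. w v i * x v)" using i by (intro solsD)
    then show "of_int (m i) = (\<Sum>v\<in>V. of_nat (w v i * x v) :: rat)"
      by (metis of_int_of_nat_eq of_nat_sum)
  qed
  also have "\<dots> = (\<Sum>v\<in>V. \<Sum>x\<in>?S. of_nat (w v i * x v))" by (rule sum.swap)
  finally show ?thesis using c by simp
qed

section \<open>Values of phi on products of p_k[h_m] as solution counts\<close>

section \<open>The cycle index expansion\<close>

text \<open>
  Pairing \<open>\<Prod>\<^sub>i p\<^bsub>k i\<^esub>[H(y\<^sub>i)]\<close> with \<open>\<Sum>\<^sub>\<nu> s\<^sub>\<nu>\<close> gives a product of geometric series. Its factors are
  indexed by triples \<open>(i, j, g)\<close>: the pairs \<open>i < j\<close> contribute \<open>gcd (k i) (k j)\<close> factors each, and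
  the pairs \<open>i = j\<close> contribute \<open>\<lceil>k i / 2\<rceil>\<close> factors, of weight 2 except for one factor of weight 1
  if \<open>k i\<close> is odd.
\<close>

definition mult_var :: "(nat \<Rightarrow> nat) \<Rightarrow> nat \<Rightarrow> nat \<Rightarrow> nat" where
  "mult_var k i j = (if i = j then (k i + 1) div 2 else if i < j then gcd (k i) (k j) else 0)"

definition vars :: "nat \<Rightarrow> (nat \<Rightarrow> nat) \<Rightarrow> (nat \<times> nat \<times> nat) set" where
  "vars r k = (SIGMA i:{..<r}. SIGMA j:{..<r}. {..<mult_var k i j})"

definition wgt :: "(nat \<Rightarrow> nat) \<Rightarrow> nat \<times> nat \<times> nat \<Rightarrow> nat \<Rightarrow> nat" where
  "wgt k v i = (case v of (a, b, g) \<Rightarrow>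
     if a = b then (if i = a then (if odd (k a) \<and> g = 0 then 1 else 2) else 0)
     else if i = a then k b div gcd (k a) (k b)
     else if i = b then k a div gcd (k a) (k b) else 0)"

definition csol :: "nat \<Rightarrow> (nat \<Rightarrow> nat) \<Rightarrow> (nat \<Rightarrow> int) \<Rightarrow> rat" where
  "csol r k m = of_nat (card (sols (vars r k) (wgt k) r m))"

definition fphi :: "nat \<Rightarrow> (nat \<Rightarrow> nat) \<Rightarrow> (nat \<Rightarrow> int) \<Rightarrow> rat" where
  "fphi r k m = phi (\<Prod>i<r. psi (k i) (hz (m i)))"

lemma finite_vars [simp]: "finite (vars r k)"
  by (simp add: vars_def)

lemma sum_vars: "(\<Sum>v\<in>vars r k. G v) = (\<Sum>i<r. \<Sum>j<r. \<Sum>g<mult_var k i j. G (i, j, g))"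
  by (simp add: vars_def sum.Sigma case_prod_unfold)

lemma div_gcd_pos: "k \<ge> 1 \<Longrightarrow> a div gcd a k \<ge> 1 \<or> a = 0" for a k :: nat
  by (metis div_greater_zero_iff gcd_le1_nat gcd_pos_nat gr0I less_one not_less)

lemma wgt_pos:
  assumes k: "\<And>i. i < r \<Longrightarrow> k i \<ge> 1" and v: "v \<in> vars r k"
  shows "\<exists>i<r. wgt k v i \<ge> 1"
proof -
  obtain a b g where v': "v = (a, b, g)" "a < r" "b < r" using v by (auto simp: vars_def)
  have "wgt k v a \<ge> 1"
  proof (cases "a = b")
    case False
    have "k b div gcd (k b) (k a) \<ge> 1" using div_gcd_pos [of "k a" "k b"] k v'(2,3) by fastforce
    then show ?thesis using False by (simp add: wgt_def v' gcd.commute)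
  qed (simp add: wgt_def v')
  then show ?thesis using v'(2) by blast
qed

lemma csol_neg:
  assumes "i < r" "m i < 0"
  shows "csol r k m = 0"
proof -
  have "x \<notin> sols (vars r k) (wgt k) r m" for x
  proof
    assume "x \<in> sols (vars r k) (wgt k) r m"
    from solsD [OF this assms(1)] have "m i \<ge> 0" by linarith
    with assms(2) show False by simp
  qed
  then have "sols (vars r k) (wgt k) r m = {}" by blast
  then show ?thesis by (simp add: csol_def)
qed

lemma csol_zero:
  assumes k: "\<And>i. i < r \<Longrightarrow> k i \<ge> 1" and m: "\<And>i. i < r \<Longrightarrow> m i = 0"
  shows "csol r k m = 1"
proof -
  have "sols (vars r k) (wgt k) r m = {\<lambda>v\<in>vars r k. 0}"
  proof (intro subset_antisym subsetI)
    fix x assume x: "x \<in> sols (vars r k) (wgt k) r m"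
    have "x v = 0" if v: "v \<in> vars r k" for v
    proof -
      obtain i where i: "i < r" "wgt k v i \<ge> 1" using wgt_pos [OF k v] by blast
      then have "int (x v) \<le> m i" by (intro sols_le [OF finite_vars x v])
      then show ?thesis using m i by simp
    qed
    then have "x = (\<lambda>v\<in>vars r k. 0)" using x by (intro ext) (auto simp: sols_def PiE_iff extensional_def)
    then show "x \<in> {\<lambda>v\<in>vars r k. 0}" by simp
  qed (use m in \<open>auto simp: sols_def\<close>)
  then show ?thesis by (simp add: csol_def)
qed

lemma mult_var_sym:
  "i \<noteq> j \<Longrightarrow> (\<Sum>g<mult_var k i j. c) + (\<Sum>g<mult_var k j i. c) = of_nat (gcd (k i) (k j)) * c" for c :: rat
  by (cases "i < j") (auto simp: mult_var_def gcd.commute)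

text \<open>This is \<open>sols_recursion\<close> regrouped into the shape of
  \<open>fphi_recursion\<close>. Only the factors that involve \<open>i0\<close> carry weight there:
  those of the pair \<open>(i0, i0)\<close> and those of \<open>i0\<close> with another
  index.\<close>

lemma csol_recursion:
  assumes k: "\<And>i. i < r \<Longrightarrow> k i \<ge> 1" and i0: "i0 < r" and L: "m i0 \<le> int L"
  shows "of_int (m i0) * csol r k m =
    (\<Sum>l=1..L. of_bool (odd (k i0 * l)) * csol r k (m(i0 := m i0 - int l))
      + of_nat (k i0) * csol r k (m(i0 := m i0 - 2 * int l))
      + (\<Sum>i\<in>{..<r} - {i0}. of_bool (k i dvd k i0 * l) * (of_nat (k i) *
          csol r k (m(i0 := m i0 - int l, i := m i - int (k i0 * l div k i))))))"
proof -
  define C where "C = csol r k"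
  define H where "H v = of_nat (wgt k v i0) * (\<Sum>b=1..L. C (\<lambda>i. m i - int (b * wgt k v i)))" for v
  define K where "K i j = (\<Sum>g<mult_var k i j. H (i, j, g))" for i j
  have zero: "C m' = 0" if "m' i0 < 0" for m'
    unfolding C_def using i0 that by (rule csol_neg)
  have "of_int (m i0) * C m = (\<Sum>v\<in>vars r k. H v)"
    unfolding H_def C_def csol_def using finite_vars wgt_pos [OF k] i0 L by (rule sols_recursion)
  also have "\<dots> = (\<Sum>i<r. \<Sum>j<r. K i j)" by (simp add: sum_vars K_def)
  also have "\<dots> = K i0 i0 + (\<Sum>i\<in>{..<r} - {i0}. K i0 i + K i i0)"
  proof -
    have K0: "K i j = 0" if "i \<noteq> i0" "j \<noteq> i0" for i j
    proof -
      have "wgt k (i, j, g) i0 = 0" for g using that by (simp add: wgt_def)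
      then show ?thesis by (simp add: K_def H_def)
    qed
    have "(\<Sum>i<r. \<Sum>j<r. K i j) = (\<Sum>j<r. K i0 j) + (\<Sum>i\<in>{..<r} - {i0}. \<Sum>j<r. K i j)"
      using i0 by (simp add: sum.remove [of "{..<r}" i0])
    also have "(\<Sum>j<r. K i0 j) = K i0 i0 + (\<Sum>j\<in>{..<r} - {i0}. K i0 j)"
      using i0 by (simp add: sum.remove [of "{..<r}" i0])
    also have "(\<Sum>i\<in>{..<r} - {i0}. \<Sum>j<r. K i j) = (\<Sum>i\<in>{..<r} - {i0}. K i i0)"
    proof (rule sum.cong [OF refl])
      fix i assume "i \<in> {..<r} - {i0}"
      then have "(\<Sum>j<r. K i j) = (\<Sum>j\<in>{i0}. K i j)"
        using i0 K0 by (intro sum.mono_neutral_right) auto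
      then show "(\<Sum>j<r. K i j) = K i i0" by simp
    qed
    finally show ?thesis by (simp add: sum.distrib)
  qed
  \<comment> \<open>A factor of weight 1 yields \<open>S1\<close>, one of weight 2 yields
    \<open>2 * S2\<close>. The even shifts within \<open>S1\<close> make up one more
    \<open>S2\<close>, so for both parities of \<open>k i0\<close> the total multiplicity of
    \<open>S2\<close> is \<open>k i0\<close>.\<close>
  also have "K i0 i0 = (\<Sum>l=1..L. of_bool (odd (k i0 * l)) * C (m(i0 := m i0 - int l))
      + of_nat (k i0) * C (m(i0 := m i0 - 2 * int l)))"
  proof -
    define S1 where "S1 = (\<Sum>b=1..L. C (m(i0 := m i0 - int b)))"
    define S2 where "S2 = (\<Sum>b=1..L. C (m(i0 := m i0 - 2 * int b)))"
    have e1: "(\<lambda>i. m i - int (b * wgt k (i0, i0, g) i)) = m(i0 := m i0 - int b)" if "odd (k i0)" "g = 0" for b g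
      using that by (auto simp: wgt_def fun_eq_iff)
    have e2: "(\<lambda>i. m i - int (b * wgt k (i0, i0, g) i)) = m(i0 := m i0 - 2 * int b)" if "\<not> (odd (k i0) \<and> g = 0)" for b g
      using that by (auto simp: wgt_def fun_eq_iff)
    have H1: "H (i0, i0, g) = S1" if "odd (k i0)" "g = 0" for g
      unfolding H_def e1 [OF that] using that by (simp add: wgt_def S1_def)
    have H2: "H (i0, i0, g) = 2 * S2" if "\<not> (odd (k i0) \<and> g = 0)" for g
      unfolding H_def e2 [OF that] using that by (auto simp: wgt_def S2_def)
    have S1: "S1 = (\<Sum>l=1..L. of_bool (odd l) * C (m(i0 := m i0 - int l))) + S2"
    proof -
      have "S1 = (\<Sum>l=1..L. of_bool (odd l) * C (m(i0 := m i0 - int l))) + (\<Sum>l=1..L. of_bool (even l) * C (m(i0 := m i0 - int l)))"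
        unfolding S1_def sum.distrib [symmetric] by (intro sum.cong refl) auto
      also have "(\<Sum>l=1..L. of_bool (even l) * C (m(i0 := m i0 - int l))) =
          (\<Sum>l\<in>(\<lambda>b. 2 * b) ` {1..L div 2}. C (m(i0 := m i0 - int l)))"
        by (rule sum.mono_neutral_cong_right) (auto elim!: evenE)
      also have "\<dots> = (\<Sum>b=1..L div 2. C (m(i0 := m i0 - 2 * int b)))"
        by (subst sum.reindex) (auto simp: inj_on_def)
      also have "\<dots> = S2"
        unfolding S2_def using L by (intro sum.mono_neutral_left) (auto intro!: zero)
      finally show ?thesis .
    qed
    show ?thesis
    proof (cases "odd (k i0)")
      case True
      then obtain q where q: "k i0 = 2 * q + 1" by (elim oddE)
      have "K i0 i0 = (\<Sum>g<Suc q. H (i0, i0, g))" by (simp add: K_def mult_var_def q)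
      also have "\<dots> = H (i0, i0, 0) + (\<Sum>g<q. H (i0, i0, Suc g))" by (rule sum.lessThan_Suc_shift)
      also have "\<dots> = S1 + of_nat q * (2 * S2)" using True by (simp add: H1 H2)
      also have "\<dots> = (\<Sum>l=1..L. of_bool (odd l) * C (m(i0 := m i0 - int l))) + of_nat (k i0) * S2"
        by (simp add: S1 q algebra_simps)
      finally show ?thesis using True by (simp add: S2_def sum.distrib sum_distrib_left)
    next
      case False
      then have "even (k i0)" by simp
      then obtain q where q: "k i0 = 2 * q" by (elim evenE)
      have "K i0 i0 = (\<Sum>g<q. H (i0, i0, g))" by (simp add: K_def mult_var_def q)
      also have "\<dots> = of_nat (k i0) * S2" using False by (simp add: H2 q)
      finally show ?thesis using False by (simp add: S2_def sum_distrib_left)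
    qed
  qed
  also have "(\<Sum>i\<in>{..<r} - {i0}. K i0 i + K i i0) =
      (\<Sum>i\<in>{..<r} - {i0}. \<Sum>l=1..L. of_bool (k i dvd k i0 * l) *
          (of_nat (k i) * C (m(i0 := m i0 - int l, i := m i - int (k i0 * l div k i)))))"
  proof (rule sum.cong [OF refl])
    fix i assume "i \<in> {..<r} - {i0}"
    then have i: "i < r" "i \<noteq> i0" by auto
    define d where "d = gcd (k i) (k i0)"
    \<comment> \<open>Each of the \<open>d\<close> factors shifts the arguments at \<open>i0\<close>
      and \<open>i\<close> by multiples of \<open>q\<close> and \<open>q0\<close>. Shifts
      \<open>l\<close> by multiples of \<open>q\<close> are just those with
      \<open>k i dvd k i0 * l\<close>, and the total multiplicity is
      \<open>d * q = k i\<close>.\<close>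
    define q q0 where "q = k i div d" and "q0 = k i0 div d"
    have kpos: "k i > 0" using k [OF i(1)] by simp
    then have d: "d \<ge> 1" by (simp add: d_def Suc_le_eq)
    have ki: "k i = d * q" "k i0 = d * q0" by (simp_all add: d_def q_def q0_def)
    have q: "q \<ge> 1" using ki(1) kpos by (cases q) auto
    have "coprime q q0" unfolding q_def q0_def d_def using kpos by (intro div_gcd_coprime) auto
    then have dvd: "k i dvd k i0 * l \<longleftrightarrow> q dvd l" for l
      using d by (simp add: ki coprime_dvd_mult_right_iff)
    define D where "D l = C (m(i0 := m i0 - int l, i := m i - int (k i0 * l div k i)))" for l
    define S where "S = (\<Sum>b=1..L. D (b * q))"
    have div: "k i0 * (b * q) div k i = b * q0" for b using d q by (simp add: ki)
    have H1: "H (i0, i, g) = of_nat q * S" for g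
    proof -
      have "(\<lambda>j. m j - int (b * wgt k (i0, i, g) j)) = m(i0 := m i0 - int (b * q), i := m i - int (b * q0))" for b
        using i by (auto simp: wgt_def fun_eq_iff q_def q0_def d_def gcd.commute)
      then show ?thesis using i by (simp add: H_def S_def D_def div) (simp add: wgt_def q_def d_def gcd.commute)
    qed
    have H2: "H (i, i0, g) = of_nat q * S" for g
    proof -
      have "(\<lambda>j. m j - int (b * wgt k (i, i0, g) j)) = m(i0 := m i0 - int (b * q), i := m i - int (b * q0))" for b
        using i by (auto simp: wgt_def fun_eq_iff q_def q0_def d_def gcd.commute)
      then show ?thesis using i by (simp add: H_def S_def D_def div) (simp add: wgt_def q_def d_def gcd.commute)
    qed
    have "K i0 i + K i i0 = of_nat (gcd (k i0) (k i)) * (of_nat q * S)"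
      unfolding K_def H1 H2 using i mult_var_sym [where i = i0 and j = i and k = k and c = "of_nat q * S"] by simp
    also have "gcd (k i0) (k i) = d" by (simp add: d_def gcd.commute)
    also have "of_nat d * (of_nat q * S) = of_nat (k i) * S" unfolding ki(1) by simp
    also have "S = (\<Sum>l\<in>(\<lambda>b. b * q) ` {1..L}. D l)"
      unfolding S_def using q by (subst sum.reindex) (auto simp: inj_on_def)
    also have "\<dots> = (\<Sum>l | l \<in> {1..L} \<and> q dvd l. D l)"
    proof (rule sum.mono_neutral_right)
      show "{l. l \<in> {1..L} \<and> q dvd l} \<subseteq> (\<lambda>b. b * q) ` {1..L}"
      proof
        fix l assume "l \<in> {l. l \<in> {1..L} \<and> q dvd l}"
        then obtain b where b: "l = b * q" "1 \<le> l" "l \<le> L" by (auto elim!: dvdE simp: mult.commute)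
        have "b \<noteq> 0" using b(1,2) by (intro notI) simp
        moreover have "b \<le> b * q" using q by simp
        then have "b \<le> L" using b(1,3) by linarith
        ultimately have "1 \<le> b" "b \<le> L" by simp_all
        with b show "l \<in> (\<lambda>b. b * q) ` {1..L}" by auto
      qed
      show "\<forall>l\<in>(\<lambda>b. b * q) ` {1..L} - {l. l \<in> {1..L} \<and> q dvd l}. D l = 0"
      proof
        fix l assume l: "l \<in> (\<lambda>b. b * q) ` {1..L} - {l. l \<in> {1..L} \<and> q dvd l}"
        then have "l > L" using q by (auto simp: Suc_le_eq)
        then show "D l = 0" unfolding D_def using L i by (intro zero) simp
      qed
    qed simp
    also have "\<dots> = (\<Sum>l=1..L. of_bool (q dvd l) * D l)"
      by (rule sum.mono_neutral_cong_left) auto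
    finally have e: "K i0 i + K i i0 = of_nat (k i) * (\<Sum>l=1..L. of_bool (q dvd l) * D l)" .
    show "K i0 i + K i i0 = (\<Sum>l=1..L. of_bool (k i dvd k i0 * l) *
          (of_nat (k i) * C (m(i0 := m i0 - int l, i := m i - int (k i0 * l div k i)))))"
      unfolding e dvd D_def [symmetric] sum_distrib_left by (simp only: mult.left_commute)
  qed
  also have "\<dots> = (\<Sum>l=1..L. \<Sum>i\<in>{..<r} - {i0}. of_bool (k i dvd k i0 * l) *
          (of_nat (k i) * C (m(i0 := m i0 - int l, i := m i - int (k i0 * l div k i)))))"
    by (rule sum.swap)
  finally show ?thesis unfolding C_def by (simp only: sum.distrib)
qed

text \<open>Newton's identity carried through the homomorphism p_k[-], which sends p_l to
  p_{kl}.\<close>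

lemma psi_newton:
  assumes k: "k \<ge> 1" and L: "0 \<le> a" "a \<le> int L"
  shows "scale_sf (of_int a) (psi k (hz a)) = (\<Sum>l=1..L. power_sum (k * l) * psi k (hz (a - int l)))"
proof -
  have hom: "rat_alg_hom (psi k)" using k by (rule rat_alg_hom_psi)
  have sum: "psi k (sum f S) = (\<Sum>i\<in>S. psi k (f i))" for f :: "nat \<Rightarrow> symfun" and S
    using hom by (induction S rule: infinite_finite_induct) (auto simp: rat_alg_hom_def)
  obtain b where b: "a = int b" using L(1) by (metis nonneg_int_cases)
  have "scale_sf (of_int a) (hz a) = (\<Sum>j=1..b. power_sum j * hh (b - j))"
    using newton [of b] by (simp add: b of_nat_mult_scale)
  also have "\<dots> = (\<Sum>j=1..L. power_sum j * hz (a - int j))"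
    using L b by (intro sum.mono_neutral_cong_left) (auto simp flip: of_nat_diff)
  finally have "psi k (scale_sf (of_int a) (hz a)) = (\<Sum>j=1..L. psi k (power_sum j * hz (a - int j)))"
    by (simp add: sum)
  moreover have "psi k (power_sum j * hz (a - int j)) = power_sum (k * j) * psi k (hz (a - int j))" if "j \<in> {1..L}" for j
    using hom k that by (simp add: psi_mult psi_power_sum)
  ultimately show ?thesis using hom by (simp add: rat_alg_hom_def)
qed

text \<open>The factor of \<open>i0\<close> is expanded by \<open>psi_newton\<close>, the resulting
  power sum is moved across phi by \<open>phi_power_sum_mult\<close>, and the derivation acts on one
  factor at a time. Acting on the factor of \<open>i0\<close> itself, it produces the shift by
  \<open>2 * l\<close>.\<close>

lemma fphi_recursion:
  assumes k: "\<And>i. i < r \<Longrightarrow> k i \<ge> 1" and i0: "i0 < r" and L: "0 \<le> m i0" "m i0 \<le> int L"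
  shows "of_int (m i0) * fphi r k m =
    (\<Sum>l=1..L. of_bool (odd (k i0 * l)) * fphi r k (m(i0 := m i0 - int l))
      + of_nat (k i0) * fphi r k (m(i0 := m i0 - 2 * int l))
      + (\<Sum>i\<in>{..<r} - {i0}. of_bool (k i dvd k i0 * l) * (of_nat (k i) *
          fphi r k (m(i0 := m i0 - int l, i := m i - int (k i0 * l div k i))))))"
proof -
  define I where "I = {..<r} - {i0}"
  define R where "R = (\<Prod>i\<in>I. psi (k i) (hz (m i)))"
  define Q where "Q i = (\<Prod>j\<in>I - {i}. psi (k j) (hz (m j)))" for i
  have I: "finite I" "{..<r} = insert i0 I" "i0 \<notin> I" using i0 by (auto simp: I_def)
  have F1: "fphi r k (m(i0 := a)) = phi (psi (k i0) (hz a) * R)" for a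
  proof -
    have "(\<Prod>i\<in>I. psi (k i) (hz ((m(i0 := a)) i))) = R" unfolding R_def using I(3) by (intro prod.cong) auto
    then show ?thesis using I by (simp add: fphi_def)
  qed
  have F2: "fphi r k (m(i0 := a, i := b)) = phi (psi (k i0) (hz a) * (psi (k i) (hz b) * Q i))" if i: "i \<in> I" for a b i
  proof -
    have "(\<Prod>j\<in>I - {i}. psi (k j) (hz ((m(i0 := a, i := b)) j))) = Q i"
      unfolding Q_def using I(3) by (intro prod.cong) auto
    moreover have "(\<Prod>j\<in>I. psi (k j) (hz ((m(i0 := a, i := b)) j))) =
        psi (k i) (hz b) * (\<Prod>j\<in>I - {i}. psi (k j) (hz ((m(i0 := a, i := b)) j)))"
      using I i by (subst prod.remove [of I i]) auto
    moreover have "i \<noteq> i0" using i I by auto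
    ultimately show ?thesis using I by (simp add: fphi_def)
  qed
  have k0: "k i0 \<ge> 1" using k i0 by blast
  have "of_int (m i0) * fphi r k m = phi (scale_sf (of_int (m i0)) (psi (k i0) (hz (m i0))) * R)"
    using F1 [of "m i0"] by (simp add: scale_mult_left)
  also have "\<dots> = (\<Sum>l=1..L. phi (power_sum (k i0 * l) * (psi (k i0) (hz (m i0 - int l)) * R)))"
    unfolding psi_newton [OF k0 L] by (simp add: sum_distrib_right mult.assoc)
  also have "\<dots> = (\<Sum>l=1..L. of_bool (odd (k i0 * l)) * fphi r k (m(i0 := m i0 - int l))
      + of_nat (k i0) * fphi r k (m(i0 := m i0 - 2 * int l))
      + (\<Sum>i\<in>I. of_bool (k i dvd k i0 * l) * (of_nat (k i) *
          fphi r k (m(i0 := m i0 - int l, i := m i - int (k i0 * l div k i))))))"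
  proof (rule sum.cong [OF refl])
    fix l assume l: "l \<in> {1..L}"
    then have kl: "k i0 * l \<ge> 1" using k0 by simp
    let ?a = "m i0 - int l" and ?j = "k i0 * l"
    have "phi (power_sum ?j * (psi (k i0) (hz ?a) * R)) =
        of_bool (odd ?j) * phi (psi (k i0) (hz ?a) * R) + phi (Dp ?j (psi (k i0) (hz ?a) * R))"
      by (rule phi_power_sum_mult [OF kl])
    also have "Dp ?j (psi (k i0) (hz ?a) * R) =
        of_nat (k i0) * (psi (k i0) (hz (m i0 - 2 * int l)) * R) + psi (k i0) (hz ?a) * Dp ?j R"
    proof -
      have "m i0 - 2 * int l = ?a - int (?j div k i0)" using k0 by simp
      then show ?thesis using k0 l kl by (simp add: Dp_mult Dp_psi_hz mult.assoc)
    qed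
    also have "Dp ?j R = (\<Sum>i\<in>I. Dp ?j (psi (k i) (hz (m i))) * Q i)"
      unfolding R_def Q_def by (rule Dp_prod [OF I(1)])
    also have "psi (k i0) (hz ?a) * \<dots> = (\<Sum>i\<in>I. scale_sf (of_bool (k i dvd ?j) * of_nat (k i))
        (psi (k i0) (hz ?a) * (psi (k i) (hz (m i - int (?j div k i))) * Q i)))"
      unfolding sum_distrib_left
    proof (rule sum.cong [OF refl])
      fix i assume "i \<in> I"
      then have "k i \<ge> 1" using k by (auto simp: I_def)
      then have "Dp ?j (psi (k i) (hz (m i))) =
          scale_sf (of_bool (k i dvd ?j) * of_nat (k i)) (psi (k i) (hz (m i - int (?j div k i))))"
        using kl by (auto simp: Dp_psi_hz of_nat_mult_scale)
      then show "psi (k i0) (hz ?a) * (Dp ?j (psi (k i) (hz (m i))) * Q i) =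
          scale_sf (of_bool (k i dvd ?j) * of_nat (k i))
            (psi (k i0) (hz ?a) * (psi (k i) (hz (m i - int (?j div k i))) * Q i))"
        by (simp add: scale_mult_left scale_mult_right)
    qed
    finally show "phi (power_sum ?j * (psi (k i0) (hz ?a) * R)) =
        of_bool (odd ?j) * fphi r k (m(i0 := ?a)) + of_nat (k i0) * fphi r k (m(i0 := m i0 - 2 * int l))
        + (\<Sum>i\<in>I. of_bool (k i dvd ?j) * (of_nat (k i) * fphi r k (m(i0 := ?a, i := m i - int (?j div k i)))))"
      by (simp add: F1 F2 phi_of_nat_mult mult.assoc del: fun_upd_apply)
  qed
  finally show ?thesis unfolding I_def .
qed

text \<open>At a positive argument the common recursion expresses a positive multiple of the value
  by values at smaller arguments. Both sides vanish if some argument is negative, and both are 1 if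
  all are 0.\<close>

theorem fphi_eq_csol:
  assumes k: "\<And>i. i < r \<Longrightarrow> k i \<ge> 1"
  shows "fphi r k m = csol r k m"
proof (induction "\<Sum>i<r. nat (m i)" arbitrary: m rule: less_induct)
  case less
  consider (neg) i where "i < r" "m i < 0" | (zero) "\<And>i. i < r \<Longrightarrow> m i = 0"
    | (pos) i where "i < r" "m i > 0"
    by (metis linorder_neqE_linordered_idom)
  then show ?case
  proof cases
    case neg
    then have "psi (k i) (hz (m i)) = 0" by simp
    then have "(\<Prod>i<r. psi (k i) (hz (m i))) = 0" using neg by (meson finite_lessThan lessThan_iff prod_zero)
    then show ?thesis using csol_neg [of i r m k] neg by (simp add: fphi_def)
  next
    case zero
    have "(\<Prod>i<r. psi (k i) (hz (m i))) = 1"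
      using zero k psi_one hz_of_nat [of 0] by (intro prod.neutral) auto
    then show ?thesis using csol_zero [OF k zero] by (simp add: fphi_def phi_one)
  next
    case pos
    define L where "L = nat (m i)"
    have L: "0 \<le> m i" "m i \<le> int L" using pos by (auto simp: L_def)
    have IH: "fphi r k m' = csol r k m'" if "m' i < m i" "\<And>j. m' j \<le> m j" for m'
    proof (rule less)
      show "(\<Sum>i<r. nat (m' i)) < (\<Sum>i<r. nat (m i))"
        using pos that by (intro sum_strict_mono_ex1) (auto intro!: bexI [of _ i] nat_mono)
    qed
    have "(\<Sum>l=1..L. of_bool (odd (k i * l)) * fphi r k (m(i := m i - int l))
          + of_nat (k i) * fphi r k (m(i := m i - 2 * int l))
          + (\<Sum>j\<in>{..<r} - {i}. of_bool (k j dvd k i * l) * (of_nat (k j) *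
              fphi r k (m(i := m i - int l, j := m j - int (k i * l div k j)))))) = (\<Sum>l=1..L. of_bool (odd (k i * l)) * csol r k (m(i := m i - int l))
          + of_nat (k i) * csol r k (m(i := m i - 2 * int l))
          + (\<Sum>j\<in>{..<r} - {i}. of_bool (k j dvd k i * l) * (of_nat (k j) *
              csol r k (m(i := m i - int l, j := m j - int (k i * l div k j))))))"
      (is "?A = ?B")
    proof (rule sum.cong [OF refl])
      fix l assume l: "l \<in> {1..L}"
      have 1: "fphi r k (m(i := m i - int l)) = csol r k (m(i := m i - int l))"
        "fphi r k (m(i := m i - 2 * int l)) = csol r k (m(i := m i - 2 * int l))"
        using l by (auto intro!: IH)
      have "fphi r k (m(i := m i - int l, j := m j - int (k i * l div k j))) =
          csol r k (m(i := m i - int l, j := m j - int (k i * l div k j)))" if "j \<in> {..<r} - {i}" for j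
        using l that by (intro IH) auto
      then have 2: "(\<Sum>j\<in>{..<r} - {i}. of_bool (k j dvd k i * l) * (of_nat (k j) *
          fphi r k (m(i := m i - int l, j := m j - int (k i * l div k j))))) =
          (\<Sum>j\<in>{..<r} - {i}. of_bool (k j dvd k i * l) * (of_nat (k j) *
          csol r k (m(i := m i - int l, j := m j - int (k i * l div k j)))))"
        by (intro sum.cong refl) simp
      show "of_bool (odd (k i * l)) * fphi r k (m(i := m i - int l))
          + of_nat (k i) * fphi r k (m(i := m i - 2 * int l))
          + (\<Sum>j\<in>{..<r} - {i}. of_bool (k j dvd k i * l) * (of_nat (k j) *
              fphi r k (m(i := m i - int l, j := m j - int (k i * l div k j))))) =
          of_bool (odd (k i * l)) * csol r k (m(i := m i - int l))
          + of_nat (k i) * csol r k (m(i := m i - 2 * int l))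
          + (\<Sum>j\<in>{..<r} - {i}. of_bool (k j dvd k i * l) * (of_nat (k j) *
              csol r k (m(i := m i - int l, j := m j - int (k i * l div k j)))))"
        unfolding 1 2 ..
    qed
    moreover have "of_int (m i) * fphi r k m = ?A" using k pos(1) L by (rule fphi_recursion)
    moreover have "of_int (m i) * csol r k m = ?B" using k pos(1) L(2) by (rule csol_recursion)
    ultimately have "of_int (m i) * fphi r k m = of_int (m i) * csol r k m" by simp
    then show ?thesis using pos by simp
  qed
qed


text \<open>Every variable is at most \<open>m\<close>. Moreover the variable
  \<open>(i, i, 0)\<close> has positive weight in equation \<open>i\<close> and weight 0 in all
  others, so these \<open>r\<close> variables are determined by the remaining ones.\<close>

lemma csol_bound:
  assumes k: "\<And>i. i < r \<Longrightarrow> k i \<ge> 1"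
  shows "csol r k (\<lambda>_. int m) \<le> of_nat ((m + 1) ^ (card (vars r k) - r))"
proof -
  let ?V = "vars r k"
  define B where "B = (\<lambda>i. (i, i, 0::nat)) ` {..<r}"
  have mv: "mult_var k i i \<ge> 1" if "i < r" for i using k [OF that] by (simp add: mult_var_def)
  have B: "B \<subseteq> ?V" "card B = r" using mv by (force simp: B_def vars_def Suc_le_eq, simp add: B_def card_image inj_on_def)
  let ?S = "sols ?V (wgt k) r (\<lambda>_. int m)"
  let ?f = "\<lambda>x. restrict x (?V - B)"
  have inj: "inj_on ?f ?S"
  proof (rule inj_onI)
    fix x y assume x: "x \<in> ?S" and y: "y \<in> ?S" and e: "?f x = ?f y"
    have same: "x v = y v" if "v \<in> ?V - B" for v using fun_cong [OF e, of v] that by simp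
    have "x (i, i, 0) = y (i, i, 0)" if i: "i < r" for i
    proof -
      have split: "(\<Sum>v\<in>?V. wgt k v i * z v) = wgt k (i, i, 0) i * z (i, i, 0) + (\<Sum>v\<in>?V - B. wgt k v i * z v)" for z
      proof -
        have "(\<Sum>v\<in>?V. wgt k v i * z v) = (\<Sum>v\<in>B. wgt k v i * z v) + (\<Sum>v\<in>?V - B. wgt k v i * z v)"
          using sum.subset_diff [OF B(1) finite_vars, of "\<lambda>v. wgt k v i * z v"] by simp
        also have "(\<Sum>v\<in>B. wgt k v i * z v) = (\<Sum>v\<in>{(i, i, 0)}. wgt k v i * z v)"
          using i by (intro sum.mono_neutral_right) (auto simp: B_def wgt_def split: if_splits)
        finally show ?thesis by simp
      qed
      have "(\<Sum>v\<in>?V - B. wgt k v i * x v) = (\<Sum>v\<in>?V - B. wgt k v i * y v)"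
        using same by (intro sum.cong) auto
      moreover have "(\<Sum>v\<in>?V. wgt k v i * x v) = (\<Sum>v\<in>?V. wgt k v i * y v)"
        using solsD [OF x i] solsD [OF y i] by linarith
      ultimately have "wgt k (i, i, 0) i * x (i, i, 0) = wgt k (i, i, 0) i * y (i, i, 0)"
        unfolding split by linarith
      then show ?thesis by (simp add: wgt_def split: if_splits)
    qed
    then have "x v = y v" if "v \<in> B" for v using that by (auto simp: B_def)
    then have "x v = y v" if "v \<in> ?V" for v using same [of v] that by blast
    moreover have "x \<in> ?V \<rightarrow>\<^sub>E UNIV" "y \<in> ?V \<rightarrow>\<^sub>E UNIV" using x y by (auto simp: sols_def)
    ultimately show "x = y" by (intro PiE_ext) auto
  qed
  have "?f ` ?S \<subseteq> (?V - B) \<rightarrow>\<^sub>E {..m}"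
  proof (intro image_subsetI)
    fix x assume x: "x \<in> ?S"
    have "x v \<le> m" if v: "v \<in> ?V" for v
    proof -
      have "\<exists>i<r. wgt k v i \<ge> 1" using k v by (rule wgt_pos)
      then obtain i where "i < r" "wgt k v i \<ge> 1" by blast
      then show ?thesis using sols_le [OF finite_vars x v] by simp
    qed
    then show "?f x \<in> (?V - B) \<rightarrow>\<^sub>E {..m}" by auto
  qed
  then have "card ?S \<le> card ((?V - B) \<rightarrow>\<^sub>E {..m})"
    by (intro card_inj_on_le [OF inj]) (auto intro: finite_PiE)
  also have "\<dots> = (m + 1) ^ (card ?V - r)"
    using B by (simp add: card_PiE card_Diff_subset finite_subset)
  finally show ?thesis unfolding csol_def by (rule of_nat_mono)
qed

lemma card_vars: "card (vars r k) = (\<Sum>i<r. \<Sum>j<r. mult_var k i j)"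
  by (simp add: vars_def)

text \<open>With c the number of variables, 2c is at most the sum of all \<open>G i j\<close>, and
  n^2 minus this sum is \<open>S\<close>, so it suffices that \<open>S\<close> is at least 3n - 2r -
  2. \<open>S\<close> splits into diagonal parts \<open>F i\<close> and off-diagonal parts
  \<open>E i\<close>. The bounds 3 k_{i0} - 4 for \<open>F i0\<close>, k_i - 2 for any other
  \<open>F i\<close>, and n - k_{i0} both for \<open>E i0\<close> and for the sum of the other
  \<open>E i\<close> add up to exactly this number.\<close>

lemma card_vars_bound:
  assumes k: "\<And>i. i < r \<Longrightarrow> k i \<ge> 1" and i0: "i0 < r" "k i0 \<ge> 2"
  defines "n \<equiv> \<Sum>i<r. k i"
  shows "card (vars r k) - r \<le> (n - 1) * (n - 2) div 2"
proof -
  define G where "G i j = (if i = j then 2 * ((k i + 1) div 2) else gcd (k i) (k j))" for i j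
  define F where "F i = int (k i) * int (k i) - int (2 * ((k i + 1) div 2))" for i
  define E where "E i = (\<Sum>j\<in>{..<r} - {i}. int (k i) * int (k j) - int (gcd (k i) (k j)))" for i
  have "2 * card (vars r k) = (\<Sum>i<r. \<Sum>j<r. mult_var k i j) + (\<Sum>i<r. \<Sum>j<r. mult_var k j i)"
    by (subst (2) sum.swap) (simp add: card_vars)
  also have "\<dots> = (\<Sum>i<r. \<Sum>j<r. mult_var k i j + mult_var k j i)" by (simp add: sum.distrib)
  also have "\<dots> \<le> (\<Sum>i<r. \<Sum>j<r. G i j)"
    by (intro sum_mono) (auto simp: mult_var_def G_def gcd.commute)
  finally have 0: "2 * card (vars r k) \<le> (\<Sum>i<r. \<Sum>j<r. G i j)" .
  have 1: "2 * int (card (vars r k)) \<le> (\<Sum>i<r. \<Sum>j<r. int (G i j))"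
    using of_nat_mono [OF 0, where 'a = int] by simp
  have nn: "int n * int n = (\<Sum>i<r. \<Sum>j<r. int (k i) * int (k j))"
    unfolding n_def by (simp add: sum_product)
  have row: "(\<Sum>j<r. int (k i) * int (k j)) - (\<Sum>j<r. int (G i j)) = F i + E i"
    if "i < r" for i
  proof -
    have "(\<Sum>j<r. int (k i) * int (k j) - int (G i j)) =
        (int (k i) * int (k i) - int (G i i)) + (\<Sum>j\<in>{..<r} - {i}. int (k i) * int (k j) - int (G i j))"
      using that by (intro sum.remove) auto
    also have "(\<Sum>j\<in>{..<r} - {i}. int (k i) * int (k j) - int (G i j)) = E i"
      unfolding E_def by (intro sum.cong) (auto simp: G_def)
    finally show ?thesis by (simp add: sum_subtractf G_def F_def)
  qed
  have gle: "gcd (k i) (k j) \<le> k j" if "j < r" for i j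
    using k [OF that] by (intro gcd_le2_nat) simp
  have gle': "gcd (k i) (k j) \<le> k i * k j" if "i < r" "j < r" for i j
  proof -
    have "1 * k j \<le> k i * k j" using k [OF that(1)] by (intro mult_right_mono) auto
    then show ?thesis using gle [OF that(2), of i] by linarith
  qed
  have Epos: "E i \<ge> 0" if "i < r" for i
    unfolding E_def using gle' [OF that] by (intro sum_nonneg) (auto simp flip: of_nat_mult)
  have sk: "(\<Sum>j\<in>{..<r} - {i0}. int (k j)) = int n - int (k i0)"
    unfolding n_def using i0 by (simp add: sum.remove [of "{..<r}" i0])
  have key: "int (k j) \<le> int (k i0) * int (k j) - int (gcd (k i0) (k j))" if "j < r" for j
  proof -
    have "2 * int (k j) \<le> int (k i0) * int (k j)" using i0(2) by (intro mult_right_mono) auto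
    then show ?thesis using gle [OF that, of i0] by linarith
  qed
  have Ei0: "int n - int (k i0) \<le> E i0"
    unfolding sk [symmetric] E_def using key by (intro sum_mono) auto
  have Eo: "int n - int (k i0) \<le> (\<Sum>i\<in>{..<r} - {i0}. E i)"
    unfolding sk [symmetric]
  proof (rule sum_mono)
    fix i assume i: "i \<in> {..<r} - {i0}"
    have "int (k i) \<le> int (k i) * int (k i0) - int (gcd (k i) (k i0))"
      using key [of i] i by (simp add: gcd.commute mult.commute)
    also have "\<dots> \<le> E i"
      unfolding E_def
    proof (rule member_le_sum [where f = "\<lambda>j. int (k i) * int (k j) - int (gcd (k i) (k j))"])
      show "i0 \<in> {..<r} - {i}" using i i0 by auto
      show "0 \<le> int (k i) * int (k x) - int (gcd (k i) (k x))" if "x \<in> {..<r} - {i} - {i0}" for x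
        using gle' [of i x] that i by (auto simp flip: of_nat_mult)
    qed simp
    finally show "int (k i) \<le> E i" .
  qed
  define S where "S = (\<Sum>i<r. F i + E i)"
  define S' where "S' = (\<Sum>i\<in>{..<r} - {i0}. F i + E i)"
  define E' where "E' = (\<Sum>i\<in>{..<r} - {i0}. E i)"
  define GG where "GG = (\<Sum>i<r. \<Sum>j<r. int (G i j))"
  have 2: "S = (F i0 + E i0) + S'"
    unfolding S_def S'_def using i0 by (intro sum.remove) auto
  have "(\<Sum>i\<in>{..<r} - {i0}. int (k i) - 2 + E i) \<le> S'"
    unfolding S'_def
  proof (rule sum_mono)
    fix i assume "i \<in> {..<r} - {i0}"
    have "(int (k i) - 1) * (int (k i) - 1) \<ge> 0" by simp
    then have "int (k i) * int (k i) \<ge> 2 * int (k i) - 1" by (simp add: algebra_simps)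
    moreover have "2 * ((k i + 1) div 2) \<le> k i + 1" by simp
    ultimately show "int (k i) - 2 + E i \<le> F i + E i" unfolding F_def by linarith
  qed
  moreover have "(\<Sum>i\<in>{..<r} - {i0}. int (k i) - 2 + E i) = (int n - int (k i0)) - 2 * (int r - 1) + E'"
    using i0 unfolding sk [symmetric] E'_def by (simp add: sum.distrib sum_subtractf of_nat_diff)
  ultimately have 3: "(int n - int (k i0)) - 2 * (int r - 1) + E' \<le> S'" by simp
  have 4: "int n * int n - GG = S"
    unfolding nn GG_def S_def sum_subtractf [symmetric] using row by (simp add: sum_subtractf)
  have 5: "F i0 \<ge> 3 * int (k i0) - 4"
  proof (cases "k i0 \<ge> 4")
    case True
    then have "4 * int (k i0) \<le> int (k i0) * int (k i0)" by (intro mult_right_mono) auto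
    moreover have "2 * ((k i0 + 1) div 2) \<le> k i0 + 1" by simp
    ultimately show ?thesis unfolding F_def by linarith
  next
    case False
    then have "k i0 = 2 \<or> k i0 = 3" using i0(2) by linarith
    then show ?thesis by (auto simp: F_def)
  qed
  define c where "c = card (vars r k)"
  have "3 * int n - 2 * int r - 2 \<le> S"
    using 2 3 5 Ei0 Eo [folded E'_def] by (simp add: algebra_simps)
  then have 6: "2 * int c \<le> int n * int n - 3 * int n + 2 * int r + 2"
    using 1 [folded GG_def c_def] 4 by linarith
  have "k i0 \<le> n" unfolding n_def using i0 by (intro member_le_sum) auto
  then have "2 \<le> n" using i0(2) by (rule order_trans [rotated])
  then obtain q where q: "n = 2 + q" by (rule less_eqE)
  have "int (2 * c) \<le> int ((n - 1) * (n - 2) + 2 * r)"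
    using 6 unfolding q by (simp add: algebra_simps)
  then have "2 * c \<le> (n - 1) * (n - 2) + 2 * r" by (rule of_nat_le_iff [THEN iffD1])
  then show ?thesis unfolding c_def [symmetric] by linarith
qed

lemma phi_prod_psi:
  assumes "0 \<notin> set ks"
  shows "phi (\<Prod>k\<in>#mset ks. psi k (hh m)) = csol (length ks) (\<lambda>i. ks ! i) (\<lambda>_. int m)"
proof -
  have "(\<Prod>k\<in>#mset ks. psi k (hh m)) = prod_list (map (\<lambda>k. psi k (hh m)) ks)"
    by (simp flip: prod_mset_prod_list)
  also have "\<dots> = (\<Prod>i<length ks. psi (ks ! i) (hz (int m)))"
    by (simp add: prod.list_conv_set_nth atLeast0LessThan)
  finally have "phi (\<Prod>k\<in>#mset ks. psi k (hh m)) = fphi (length ks) (\<lambda>i. ks ! i) (\<lambda>_. int m)"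
    by (simp add: fphi_def)
  also have "\<dots> = csol (length ks) (\<lambda>i. ks ! i) (\<lambda>_. int m)"
  proof (rule fphi_eq_csol)
    fix i assume "i < length ks"
    then have "ks ! i \<noteq> 0" using assms by (metis nth_mem)
    then show "1 \<le> ks ! i" by simp
  qed
  finally show ?thesis .
qed

section \<open>Homogeneous components and the passage from plethysm coefficients to phi\<close>

section \<open>Homogeneous symmetric functions\<close>

definition homog :: "nat \<Rightarrow> symfun \<Rightarrow> bool" where
  "homog d f \<longleftrightarrow> (\<forall>M. coeff_sf f M \<noteq> 0 \<longrightarrow> size M = d)"

lift_definition hom_part :: "nat \<Rightarrow> symfun \<Rightarrow> symfun" is "\<lambda>d f M. if size M = d then f M else 0"
  by (auto simp: is_symfun_def)

lemma coeff_hom_part: "coeff_sf (hom_part d f) M = (if size M = d then coeff_sf f M else 0)"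
  by transfer simp

lemma hom_part_homog: "homog d f \<Longrightarrow> hom_part d f = f"
  by (rule symfun_eqI) (auto simp: coeff_hom_part homog_def)

lemma hom_part_other: "homog e f \<Longrightarrow> e \<noteq> d \<Longrightarrow> hom_part d f = 0"
  by (rule symfun_eqI) (auto simp: coeff_hom_part homog_def)

lemma hom_part_lin: "hom_part d (scale_sf c f + g) = scale_sf c (hom_part d f) + hom_part d g"
  by (rule symfun_eqI) (auto simp: coeff_hom_part)

text \<open>Projecting an arbitrary expansion to degree \<open>d\<close> keeps the members of that
  degree and kills the others.\<close>

lemma homog_expand:
  assumes span: "\<And>f. f \<in> sf.span (g ` P)" and deg: "\<And>i. i \<in> P \<Longrightarrow> homog (e i) (g i)"
    and Pd: "finite {i \<in> P. e i = d}" and f: "homog d f"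
  shows "\<exists>c. f = (\<Sum>i | i \<in> P \<and> e i = d. scale_sf (c i) (g i))"
proof -
  have "\<exists>c. hom_part d f = (\<Sum>i | i \<in> P \<and> e i = d. scale_sf (c i) (g i))"
    using span [of f]
  proof (induction rule: sf.span_induct_alt)
    case base
    have "hom_part d 0 = 0" by (rule symfun_eqI) (simp add: coeff_hom_part)
    then show ?case by (intro exI [of _ "\<lambda>_. 0"]) simp
  next
    case (step b x y)
    then obtain i c where i: "i \<in> P" "x = g i"
      and c: "hom_part d y = (\<Sum>i | i \<in> P \<and> e i = d. scale_sf (c i) (g i))" by blast
    show ?case
    proof (cases "e i = d")
      case True
      have 1: "scale_sf b (g i) = (\<Sum>j | j \<in> P \<and> e j = d. scale_sf (if j = i then b else 0) (g j))"
      proof -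
        have "(\<Sum>j | j \<in> P \<and> e j = d. scale_sf (if j = i then b else 0) (g j)) =
            (\<Sum>j | j \<in> P \<and> e j = d. if j = i then scale_sf b (g i) else 0)"
          by (rule sum.cong) auto
        then show ?thesis using Pd i True by simp
      qed
      have 2: "hom_part d (g i) = g i" using deg [OF i(1)] True by (auto intro: hom_part_homog)
      have "hom_part d (scale_sf b x + y) =
          (\<Sum>j | j \<in> P \<and> e j = d. scale_sf ((if j = i then b else 0) + c j) (g j))"
        unfolding i(2) hom_part_lin 2 unfolding 1 c sf.scale_left_distrib sum.distrib ..
      then show ?thesis by (rule exI [of _ "\<lambda>j. (if j = i then b else 0) + c j"])
    next
      case False
      then have "hom_part d (g i) = 0" using deg [OF i(1)] by (rule_tac hom_part_other)
      then show ?thesis using c by (auto simp: hom_part_lin i(2))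
    qed
  qed
  then show ?thesis using hom_part_homog [OF f] by simp
qed

lemma homog_mult: "homog d f \<Longrightarrow> homog e g \<Longrightarrow> homog (d + e) (f * g)"
  unfolding homog_def coeff_mult
proof (intro allI impI)
  fix M assume f: "\<forall>M. coeff_sf f M \<noteq> 0 \<longrightarrow> size M = d" and g: "\<forall>M. coeff_sf g M \<noteq> 0 \<longrightarrow> size M = e"
    and nz: "(\<Sum>(A, B)\<in>msplits M. coeff_sf f A * coeff_sf g B) \<noteq> 0"
  then obtain A B where "(A, B) \<in> msplits M" "coeff_sf f A * coeff_sf g B \<noteq> 0"
    by (auto elim!: sum.not_neutral_contains_not_neutral)
  then show "size M = d + e" using f g by (auto simp: msplits_def)
qed

lemma homog_one: "homog 0 1"
  by (auto simp: homog_def coeff_one)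

lemma homog_sum: "(\<And>i. i \<in> S \<Longrightarrow> homog d (f i)) \<Longrightarrow> homog d (sum f S)"
  unfolding homog_def by (auto elim!: sum.not_neutral_contains_not_neutral)

lemma homog_scale: "homog d f \<Longrightarrow> homog d (scale_sf c f)"
  by (auto simp: homog_def)

lemma homog_psi: "homog d f \<Longrightarrow> k \<ge> 1 \<Longrightarrow> homog (k * d) (psi k f)"
  unfolding homog_def
proof (intro allI impI)
  fix M assume f: "\<forall>M. coeff_sf f M \<noteq> 0 \<longrightarrow> size M = d" and k: "1 \<le> k" and nz: "coeff_sf (psi k f) M \<noteq> 0"
  then obtain N where N: "M = repeat_mset k N" using coeff_psi_other by blast
  then show "size M = k * d" using nz k f by simp
qed

lemma homog_hh: "homog d (hh d)"
  by (simp add: homog_def coeff_hh)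

lemma homog_sch: "is_part \<nu> \<Longrightarrow> homog (psize \<nu>) (sch \<nu>)"
  by (simp add: homog_def coeff_sch kostka_size)

lemma homog_pm:
  assumes "0 \<notin># M"
  shows "homog (sum_mset M) (pm M)"
  unfolding homog_def
proof (intro allI impI)
  fix A assume "coeff_sf (pm M) A \<noteq> 0"
  then show "size A = sum_mset M" using coeff_pm_degree [OF assms, of A] by (cases "sum_mset M = size A") auto
qed

lemma homog_prod_psi: "0 \<notin># M \<Longrightarrow> homog (sum_mset M * m) (\<Prod>k\<in>#M. psi k (hh m))"
proof (induction M)
  case (add k M)
  then have "homog (k * m + sum_mset M * m) (psi k (hh m) * (\<Prod>k\<in>#M. psi k (hh m)))"
    by (intro homog_mult homog_psi homog_hh) auto
  then show ?case by (simp add: algebra_simps)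
qed (simp add: homog_one)

definition mparts :: "nat \<Rightarrow> nat multiset set" where
  "mparts n = {M. 0 \<notin># M \<and> sum_mset M = n}"

lemma mparts_le: "M \<in> mparts n \<Longrightarrow> size M \<le> n \<and> (size M = n \<longrightarrow> M = replicate_mset n 1)"
proof -
  have "size M \<le> sum_mset M \<and> (size M = sum_mset M \<longrightarrow> M = replicate_mset (sum_mset M) 1)" if "0 \<notin># M" for M :: "nat multiset"
    using that
  proof (induction M)
    case (add k M)
    then have "k \<ge> 1" by auto
    with add show ?case by (cases "k = 1") auto
  qed simp
  then show "M \<in> mparts n \<Longrightarrow> ?thesis" by (auto simp: mparts_def)
qed

lemma finite_mparts: "finite (mparts n)"
proof (rule finite_subset)
  show "mparts n \<subseteq> mset ` {xs. set xs \<subseteq> {..n} \<and> length xs \<le> n}"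
  proof
    fix M assume M: "M \<in> mparts n"
    obtain xs where xs: "mset xs = M" using ex_mset by blast
    have "x \<le> n" if "x \<in># M" for x
      using M that by (auto simp: mparts_def dest!: multi_member_split)
    moreover have "size M \<le> n" using mparts_le [OF M] by blast
    then have "length xs \<le> n" unfolding xs [symmetric] by simp
    ultimately have "xs \<in> {xs. set xs \<subseteq> {..n} \<and> length xs \<le> n}" using xs by auto
    with xs show "M \<in> mset ` {xs. set xs \<subseteq> {..n} \<and> length xs \<le> n}" by blast
  qed
qed (simp add: finite_lists_length_le)

lemma coeff_pm_ones:
  "finite S \<Longrightarrow> card S = n \<Longrightarrow> coeff_sf (pm (replicate_mset n 1)) (mset_set S) = fact n"
proof (induction n arbitrary: S)
  case (Suc n)
  have "coeff_sf (pm (replicate_mset (Suc n) 1)) (mset_set S) =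
      (\<Sum>i | i \<in># mset_set S \<and> 1 \<le> count (mset_set S) i. coeff_sf (pm (replicate_mset n 1)) (mset_set S - replicate_mset 1 i))"
    by (simp add: coeff_power_sum_mult)
  also have "{i. i \<in># mset_set S \<and> 1 \<le> count (mset_set S) i} = S"
    using Suc.prems by auto
  also have "(\<Sum>i\<in>S. coeff_sf (pm (replicate_mset n 1)) (mset_set S - replicate_mset 1 i)) = (\<Sum>i\<in>S. fact n)"
  proof (rule sum.cong [OF refl])
    fix i assume i: "i \<in> S"
    then have "mset_set S - replicate_mset 1 i = mset_set (S - {i})"
      using Suc.prems by (simp add: mset_set_Diff)
    then show "coeff_sf (pm (replicate_mset n 1)) (mset_set S - replicate_mset 1 i) = fact n"
      using Suc i by simp
  qed
  finally show ?case using Suc.prems by simp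
qed (simp add: coeff_one)

text \<open>The coefficient of p_1^n is read off at a squarefree monomial in n variables: products
  with fewer than n parts do not reach n distinct variables, and p_1^n has coefficient n!
  there.\<close>

lemma power_sum_expansion:
  assumes "homog n f"
  shows "\<exists>c. f = (\<Sum>M\<in>mparts n. scale_sf (c M) (pm M)) \<and>
    c (replicate_mset n 1) = coeff_sf f (mset_set {1..n}) / fact n"
proof -
  have e: "{M. M \<in> {M. 0 \<notin># M} \<and> sum_mset M = n} = mparts n" by (auto simp: mparts_def)
  have "\<exists>c. f = (\<Sum>M | M \<in> {M. 0 \<notin># M} \<and> sum_mset M = n. scale_sf (c M) (pm M))"
    by (rule homog_expand [where d = n, OF pm_span])
       (use homog_pm assms finite_mparts [of n] in \<open>auto simp: mparts_def\<close>)
  then have "\<exists>c. f = (\<Sum>M\<in>mparts n. scale_sf (c M) (pm M))" by (simp only: e)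
  then obtain c where c: "f = (\<Sum>M\<in>mparts n. scale_sf (c M) (pm M))" by blast
  let ?A = "mset_set {1..n} :: nat multiset"
  have ones: "replicate_mset n 1 \<in> mparts n" by (simp add: mparts_def)
  have "coeff_sf f ?A = (\<Sum>M\<in>mparts n. c M * coeff_sf (pm M) ?A)" by (subst c) simp
  also have "\<dots> = (\<Sum>M\<in>{replicate_mset n 1}. c M * coeff_sf (pm M) ?A)"
  proof (rule sum.mono_neutral_right)
    show "\<forall>M\<in>mparts n - {replicate_mset n 1}. c M * coeff_sf (pm M) ?A = 0"
    proof
      fix M assume M: "M \<in> mparts n - {replicate_mset n 1}"
      then have "size M < n" using mparts_le [of M n] by auto
      then have "coeff_sf (pm M) ?A = 0"
        using coeff_pm_nonzero [of M ?A] M by (auto simp: mparts_def)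
      then show "c M * coeff_sf (pm M) ?A = 0" by simp
    qed
  qed (use ones finite_mparts in auto)
  also have "\<dots> = c (replicate_mset n 1) * fact n"
    using coeff_pm_ones [of "{1..n}" n] by simp
  finally show ?thesis using c by auto
qed

text \<open>Homogeneity gives an expansion into Schur functions of size \<open>N\<close> and
  independence makes it unique, so the description in \<open>plethysm_coeff\<close> denotes it; phi
  then adds up the coefficients. Most of the work is the translation between lists and functions by
  \<open>part_of\<close>.\<close>

lemma plethysm_coeff_sum:
  assumes G: "homog N (plethysm (schur la) (schur [m]))" and N: "N = sum_list la * m"
  shows "(\<Sum>\<nu>\<in>partitions N. plethysm_coeff la m \<nu>) = phi (plethysm (schur la) (schur [m]))"
proof -
  let ?G = "plethysm (schur la) (schur [m])"
  let ?Q = "{\<nu>. is_part \<nu> \<and> psize \<nu> = N}"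
  have Q: "part_of ` partitions N = ?Q" by (rule part_of_surj)
  have finQ: "finite ?Q" unfolding Q [symmetric] using finite_partitions by simp
  have "\<exists>b. ?G = (\<Sum>\<nu> | \<nu> \<in> Collect is_part \<and> psize \<nu> = N. scale_sf (b \<nu>) (sch \<nu>))"
    by (rule homog_expand [OF sch_span]) (use homog_sch G finQ in auto)
  then obtain b where b: "?G = (\<Sum>\<nu>\<in>?Q. scale_sf (b \<nu>) (sch \<nu>))" by auto
  have schur: "schur \<nu> = sch (part_of \<nu>)" if "\<nu> \<in> partitions N" for \<nu>
    using that is_part_part_of schur_eq_sch by blast
  have expand: "(\<Sum>\<nu>\<in>partitions N. scale_sf (a \<nu>) (schur \<nu>)) =
      (\<Sum>\<nu>\<in>?Q. scale_sf (a (inv_into (partitions N) part_of \<nu>)) (sch \<nu>))" for a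
    unfolding Q [symmetric] using schur
    by (subst sum.reindex [OF part_of_inj]) (auto simp: inv_into_f_f [OF part_of_inj] intro!: sum.cong)
  define a where "a \<nu> = (if \<nu> \<in> partitions N then b (part_of \<nu>) else 0)" for \<nu>
  have a: "(\<forall>\<nu>. \<nu> \<notin> partitions N \<longrightarrow> a \<nu> = 0) \<and> ?G = (\<Sum>\<nu>\<in>partitions N. scale_sf (a \<nu>) (schur \<nu>))"
  proof -
    have s: "(\<Sum>\<nu>\<in>?Q. scale_sf (a (inv_into (partitions N) part_of \<nu>)) (sch \<nu>)) = (\<Sum>\<nu>\<in>?Q. scale_sf (b \<nu>) (sch \<nu>))"
    proof (rule sum.cong [OF refl])
      fix \<nu> assume "\<nu> \<in> ?Q"
      then have "\<nu> \<in> part_of ` partitions N" unfolding Q .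
      then show "scale_sf (a (inv_into (partitions N) part_of \<nu>)) (sch \<nu>) = scale_sf (b \<nu>) (sch \<nu>)"
        by (simp add: a_def inv_into_into f_inv_into_f)
    qed
    have "?G = (\<Sum>\<nu>\<in>partitions N. scale_sf (a \<nu>) (schur \<nu>))"
      unfolding expand s by (rule b)
    then show ?thesis by (simp add: a_def)
  qed
  have uniq: "a' = a" if a': "(\<forall>\<nu>. \<nu> \<notin> partitions N \<longrightarrow> a' \<nu> = 0) \<and> ?G = (\<Sum>\<nu>\<in>partitions N. scale_sf (a' \<nu>) (schur \<nu>))" for a'
  proof
    fix \<mu>
    show "a' \<mu> = a \<mu>"
    proof (cases "\<mu> \<in> partitions N")
      case True
      let ?d = "\<lambda>\<nu>. a' (inv_into (partitions N) part_of \<nu>) - a (inv_into (partitions N) part_of \<nu>)"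
      have "(\<Sum>\<nu>\<in>?Q. scale_sf (?d \<nu>) (sch \<nu>)) = 0"
        using conjunct2 [OF a] conjunct2 [OF a'] unfolding expand
        by (simp add: sf.scale_left_diff_distrib sum_subtractf)
      moreover have "part_of \<mu> \<in> ?Q" using True Q by blast
      ultimately have "?d (part_of \<mu>) = 0" using sch_zero_sum [of ?Q ?d "part_of \<mu>"] finQ by auto
      then show ?thesis using True by (simp add: inv_into_f_f [OF part_of_inj])
    qed (use a a' in auto)
  qed
  have "plethysm_coeff la m = a"
    unfolding plethysm_coeff_def N [symmetric] using a uniq by (rule the_equality)
  moreover have "phi ?G = (\<Sum>\<nu>\<in>partitions N. a \<nu>)"
  proof -
    have "phi ?G = (\<Sum>\<nu>\<in>partitions N. phi (scale_sf (a \<nu>) (schur \<nu>)))" using a by simp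
    also have "\<dots> = (\<Sum>\<nu>\<in>partitions N. a \<nu>)"
      using schur is_part_part_of by (intro sum.cong refl) (simp add: phi_sch)
    finally show ?thesis .
  qed
  ultimately show ?thesis by simp
qed

text \<open>
  The coefficient of \<open>p\<^sub>1\<^sup>n\<close> in \<open>s\<^sub>\<lambda>\<close> is the number of standard tableaux divided by \<open>n!\<close>; all the other
  terms contribute a lower order of growth.
\<close>

lemma plethysm_coeff_sum_expansion:
  assumes la: "la \<in> partitions n"
  shows "\<exists>c. c (replicate_mset n 1) = of_nat (kostka (part_of la) (mset_set {1..n})) / fact n \<and>
    (\<forall>m. (\<Sum>\<nu>\<in>partitions (n * m). plethysm_coeff la m \<nu>) = (\<Sum>M\<in>mparts n. c M * phi (\<Prod>k\<in>#M. psi k (hh m))))"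
proof -
  have part: "is_part (part_of la)" using la by (rule is_part_part_of)
  have n: "sum_list la = n" using la by (simp add: partitions_def)
  have s: "schur la = sch (part_of la)" using part by (rule schur_eq_sch)
  have "homog n (schur la)" using homog_sch [OF part] s psize_part_of [of la] n by simp
  then obtain c where c: "schur la = (\<Sum>M\<in>mparts n. scale_sf (c M) (pm M))"
    and c1: "c (replicate_mset n 1) = coeff_sf (schur la) (mset_set {1..n}) / fact n"
    using power_sum_expansion by blast
  have "(\<Sum>\<nu>\<in>partitions (n * m). plethysm_coeff la m \<nu>) = (\<Sum>M\<in>mparts n. c M * phi (\<Prod>k\<in>#M. psi k (hh m)))" for m
  proof -
    have hom: "rat_alg_hom (\<lambda>f. plethysm f (hh m))" by (rule rat_alg_hom_plethysm)
    have sum: "plethysm (sum f S) (hh m) = (\<Sum>i\<in>S. plethysm (f i) (hh m))" for f :: "nat multiset \<Rightarrow> symfun" and S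
      using hom by (induction S rule: infinite_finite_induct) (auto simp: rat_alg_hom_def sf2.linear_0 [OF rat_alg_hom_linear [OF hom]])
    have G: "plethysm (schur la) (schur [m]) = (\<Sum>M\<in>mparts n. scale_sf (c M) (\<Prod>k\<in>#M. psi k (hh m)))"
      unfolding c schur_row sum
    proof (rule sum.cong [OF refl])
      fix M assume "M \<in> mparts n"
      then show "plethysm (scale_sf (c M) (pm M)) (hh m) = scale_sf (c M) (\<Prod>k\<in>#M. psi k (hh m))"
        using hom by (simp add: rat_alg_hom_def plethysm_pm mparts_def)
    qed
    have "homog (n * m) (plethysm (schur la) (schur [m]))"
      unfolding G by (intro homog_sum homog_scale) (use homog_prod_psi in \<open>auto simp: mparts_def\<close>)
    then have "(\<Sum>\<nu>\<in>partitions (n * m). plethysm_coeff la m \<nu>) = phi (plethysm (schur la) (schur [m]))"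
      by (rule plethysm_coeff_sum) (simp only: n)
    also have "\<dots> = (\<Sum>M\<in>mparts n. c M * phi (\<Prod>k\<in>#M. psi k (hh m)))"
      unfolding G phi_sum phi_scale ..
    finally show ?thesis .
  qed
  moreover have "coeff_sf (schur la) (mset_set {1..n}) = of_nat (kostka (part_of la) (mset_set {1..n}))"
    by (simp add: s coeff_sch part)
  ultimately show ?thesis using c1 by auto
qed


section \<open>Standard polytabloids are independent\<close>

section \<open>The dimension of the Specht module\<close>

lemma fun_sum_apply: "(sum f S) x = (\<Sum>i\<in>S. f i x)"
  for f :: "'i \<Rightarrow> 'x \<Rightarrow> 'a::comm_monoid_add"
  by (induction S rule: infinite_finite_induct) auto

lemma strict_mono_image_unique:
  fixes f g :: "nat \<Rightarrow> nat"
  assumes f: "\<And>i. Suc i < h \<Longrightarrow> f i < f (Suc i)" and g: "\<And>i. Suc i < h \<Longrightarrow> g i < g (Suc i)"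
    and e: "f ` {..<h} = g ` {..<h}" and i: "i < h"
  shows "f i = g i"
proof -
  have "sorted_wrt (<) (map f [0..<h])" "sorted_wrt (<) (map g [0..<h])"
    using f g by (simp_all add: sorted_wrt_iff_nth_Suc_transp)
  then have "sorted (map f [0..<h])" "distinct (map f [0..<h])" "sorted (map g [0..<h])" "distinct (map g [0..<h])"
    unfolding strict_sorted_iff by blast+
  moreover have "set (map f [0..<h]) = set (map g [0..<h])"
    using e by (simp add: atLeast0LessThan)
  ultimately have "map f [0..<h] = map g [0..<h]"
    by (intro sorted_distinct_set_unique)
  then have "\<forall>j\<in>{0..<h}. f j = g j" by simp
  then show ?thesis using i by simp
qed

text \<open>Equally many elements are exchanged, and each one that enters exceeds \<open>s\<close>
  while each one that leaves does not.\<close>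

lemma sum_set_less:
  fixes R R' :: "nat set"
  assumes fin: "finite R" "finite R'" and c: "card R = card R'" and ne: "R \<noteq> R'"
    and hi: "\<And>x. x \<in> R' - R \<Longrightarrow> s < x" and lo: "\<And>x. x \<in> R - R' \<Longrightarrow> x \<le> s"
  shows "\<Sum>R < \<Sum>R'"
proof -
  have c': "card (R - R') = card (R' - R)"
    using fin c by (simp add: card_Diff_subset_Int Int_commute)
  have "R' - R \<noteq> {}"
  proof
    assume "R' - R = {}"
    then have "R' \<subseteq> R" by blast
    then show False using card_subset_eq [OF fin(1), of R'] c ne by simp
  qed
  then have pos: "card (R' - R) > 0" using fin by (simp add: card_gt_0_iff)
  have "\<Sum>(R - R') \<le> card (R - R') * s" using lo sum_bounded_above [of "R - R'" id s] by simp
  also have "\<dots> < card (R' - R) * Suc s" using c' pos by simp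
  also have "\<dots> \<le> \<Sum>(R' - R)" using hi sum_bounded_below [of "R' - R" "Suc s" id] by (simp add: Suc_le_eq)
  finally have "\<Sum>(R - R') < \<Sum>(R' - R)" .
  moreover have "\<Sum>R = \<Sum>(R \<inter> R') + \<Sum>(R - R')" "\<Sum>R' = \<Sum>(R \<inter> R') + \<Sum>(R' - R)"
    using fin sum.Int_Diff [of R id R'] sum.Int_Diff [of R' id R] by (simp_all add: Int_commute)
  ultimately show ?thesis by simp
qed

context
  fixes la :: "nat list" and n :: nat
  assumes la: "la \<in> partitions n"
begin

definition tabloids :: "nat set list set" where
  "tabloids = tabloid la ` tableaux la"

text \<open>A numerical substitute for the dominance order on tabloids: it grows as large entries
  move to rows of higher index.\<close>

definition row_weight :: "nat set list \<Rightarrow> nat" where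
  "row_weight t = (\<Sum>k<length la. k * \<Sum>(t ! k))"

definition std :: "(nat \<times> nat \<Rightarrow> nat) set" where
  "std = tab (part_of la) (mset_set {1..n})"

lemma sum_list_la: "sum_list la = n"
  using la by (simp add: partitions_def)

lemma mem_cells: "(i, j) \<in> cells la \<longleftrightarrow> i < length la \<and> j < la ! i"
  by (simp add: cells_def)

lemma finite_cells: "finite (cells la)"
  unfolding cells_part_of using la is_part_part_of by simp

lemma la_antimono: "Suc i < length la \<Longrightarrow> la ! Suc i \<le> la ! i"
  using la by (auto simp: partitions_def sorted_wrt_iff_nth_less)

lemma cell_above: "(Suc i, j) \<in> cells la \<Longrightarrow> (i, j) \<in> cells la"
  using la_antimono [of i] by (auto simp: mem_cells)

lemma tableauD:
  assumes "T \<in> tableaux la"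
  shows "inj_on T (cells la)" "T ` cells la = {1..n}"
  using assms sum_list_la by (auto simp: tableaux_def bij_betw_def)

lemma length_tabloid [simp]: "length (tabloid la T) = length la"
  by (simp add: tabloid_def)

lemma tabloid_nth: "k < length la \<Longrightarrow> tabloid la T ! k = (\<lambda>j. T (k, j)) ` {..<la ! k}"
  by (auto simp: tabloid_def mem_cells)

lemma tabloid_cong: "(\<And>c. c \<in> cells la \<Longrightarrow> T c = T' c) \<Longrightarrow> tabloid la T = tabloid la T'"
  by (rule nth_equalityI) (auto simp: tabloid_nth mem_cells intro!: image_cong)

lemma inj_row: "T \<in> tableaux la \<Longrightarrow> k < length la \<Longrightarrow> inj_on (\<lambda>j. T (k, j)) {..<la ! k}"
proof (rule inj_onI)
  fix x y assume T: "T \<in> tableaux la" and k: "k < length la"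
    and xy: "x \<in> {..<la ! k}" "y \<in> {..<la ! k}" "T (k, x) = T (k, y)"
  have "(k, x) = (k, y)"
    using inj_onD [OF tableauD(1) [OF T] xy(3)] xy k by (simp add: mem_cells)
  then show "x = y" by simp
qed

lemma row_weight_tabloid:
  assumes T: "T \<in> tableaux la"
  shows "row_weight (tabloid la T) = (\<Sum>c\<in>cells la. fst c * T c)"
proof -
  have "row_weight (tabloid la T) = (\<Sum>k<length la. \<Sum>j<la ! k. k * T (k, j))"
    unfolding row_weight_def using inj_row [OF T]
    by (intro sum.cong refl) (simp add: tabloid_nth sum.reindex sum_distrib_left)
  also have "\<dots> = (\<Sum>c\<in>(SIGMA k:{..<length la}. {..<la ! k}). fst c * T c)"
    by (simp add: sum.Sigma case_prod_unfold)
  also have "(SIGMA k:{..<length la}. {..<la ! k}) = cells la" by (auto simp: cells_def)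
  finally show ?thesis .
qed

lemma tabloidsD:
  assumes "t \<in> tabloids" "k < length la"
  shows "finite (t ! k)" "card (t ! k) = la ! k"
    and "k' < length la \<Longrightarrow> k' \<noteq> k \<Longrightarrow> t ! k \<inter> t ! k' = {}"
    and "length t = length la"
proof -
  obtain T where T: "T \<in> tableaux la" "t = tabloid la T" using assms by (auto simp: tabloids_def)
  show "finite (t ! k)" "length t = length la" using assms T by (auto simp: tabloid_nth)
  show "card (t ! k) = la ! k" using assms T inj_row by (simp add: tabloid_nth card_image)
  show "t ! k \<inter> t ! k' = {}" if k': "k' < length la" "k' \<noteq> k"
  proof -
    have "T (k, j) \<noteq> T (k', j')" if j: "j < la ! k" "j' < la ! k'" for j j'
      using inj_onD [OF tableauD(1) [OF T(1)], of "(k, j)" "(k', j')"] j k' assms(2) by (auto simp: mem_cells)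
    then show ?thesis using assms(2) k' T by (auto simp: tabloid_nth)
  qed
qed

lemma finite_tabloids: "finite tabloids"
proof (rule finite_subset)
  show "tabloids \<subseteq> {t. set t \<subseteq> Pow {1..n} \<and> length t = length la}"
    unfolding tabloids_def tabloid_def using tableauD(2) by fastforce
qed (simp add: finite_lists_length_eq)

lemma finite_column_stabilizer: "finite (column_stabilizer la T)"
  by (rule finite_subset [OF _ finite_permutations [of "{1..n}"]])
     (auto simp: column_stabilizer_def sum_list_la)

lemma id_column_stabilizer: "id \<in> column_stabilizer la T"
  by (simp add: column_stabilizer_def permutes_id)

lemma column_stabilizer_tableau:
  assumes "T \<in> tableaux la" "\<sigma> \<in> column_stabilizer la T"
  shows "\<sigma> \<circ> T \<in> tableaux la"
  using assms permutes_imp_bij unfolding tableaux_def column_stabilizer_def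
  by (auto intro: bij_betw_trans)

text \<open>Exchanging two entries of a column.\<close>

lemma column_swap:
  assumes T: "T \<in> tableaux la" and \<sigma>: "\<sigma> \<in> column_stabilizer la T"
    and c: "(i, j) \<in> cells la" "(i', j) \<in> cells la" "i \<noteq> i'"
  defines "S \<equiv> \<sigma> \<circ> T"
  defines "\<sigma>' \<equiv> Transposition.transpose (S (i, j)) (S (i', j)) \<circ> \<sigma>"
  shows "\<sigma>' \<in> column_stabilizer la T" "sign \<sigma>' = - sign \<sigma>"
    and "(\<sigma>' \<circ> T) (i, j) = S (i', j)" "(\<sigma>' \<circ> T) (i', j) = S (i, j)"
    and "\<And>c. c \<in> cells la \<Longrightarrow> c \<noteq> (i, j) \<Longrightarrow> c \<noteq> (i', j) \<Longrightarrow> (\<sigma>' \<circ> T) c = S c"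
proof -
  let ?a = "S (i, j)" and ?b = "S (i', j)"
  have S: "S \<in> tableaux la" unfolding S_def by (rule column_stabilizer_tableau [OF T \<sigma>])
  have \<sigma>p: "\<sigma> permutes {1..n}" using \<sigma> by (simp add: column_stabilizer_def sum_list_la)
  have ab: "?a \<in> {1..n}" "?b \<in> {1..n}" using tableauD(2) [OF S] c by blast+
  have ne: "?a \<noteq> ?b" using tableauD(1) [OF S] c by (auto simp: inj_on_def)
  have "\<sigma>' ` {T (i, l) |i. (i, l) \<in> cells la} = {T (i, l) |i. (i, l) \<in> cells la}" for l
  proof -
    let ?C = "{T (i, l) |i. (i, l) \<in> cells la}"
    have C: "\<sigma> ` ?C = ?C" using \<sigma> by (simp add: column_stabilizer_def)
    have mem: "S (k, j) \<in> ?C \<longleftrightarrow> l = j" if "(k, j) \<in> cells la" for k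
    proof
      assume "S (k, j) \<in> ?C"
      then have "S (k, j) \<in> \<sigma> ` ?C" using C by simp
      then obtain k' where "(k', l) \<in> cells la" "S (k, j) = S (k', l)" by (auto simp: S_def)
      then show "l = j" using tableauD(1) [OF S] that by (auto simp: inj_on_def)
    next
      assume "l = j"
      then have "S (k, j) \<in> \<sigma> ` ?C" using that by (auto simp: S_def)
      then show "S (k, j) \<in> ?C" using C by simp
    qed
    have "\<sigma>' ` ?C = Transposition.transpose ?a ?b ` ?C"
      unfolding \<sigma>'_def image_comp [symmetric] C ..
    also have "\<dots> = ?C" using mem [OF c(1)] mem [OF c(2)] by (intro transpose_image_eq) simp
    finally show ?thesis .
  qed
  moreover have "\<sigma>' permutes {1..n}"
    unfolding \<sigma>'_def using \<sigma>p ab by (intro permutes_compose permutes_swap_id)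
  ultimately show "\<sigma>' \<in> column_stabilizer la T" by (simp add: column_stabilizer_def sum_list_la)
  show "sign \<sigma>' = - sign \<sigma>"
    unfolding \<sigma>'_def using \<sigma>p ne
    by (simp add: sign_compose permutation_swap_id permutes_imp_permutation [of "{1..n}"] sign_swap_id)
  show "(\<sigma>' \<circ> T) (i, j) = ?b" "(\<sigma>' \<circ> T) (i', j) = ?a" by (simp_all add: \<sigma>'_def S_def)
  show "(\<sigma>' \<circ> T) c = S c" if "c \<in> cells la" "c \<noteq> (i, j)" "c \<noteq> (i', j)" for c
  proof -
    have "S c \<noteq> ?a" "S c \<noteq> ?b" using tableauD(1) [OF S] that c by (auto simp: inj_on_def)
    then show ?thesis by (simp add: \<sigma>'_def S_def transpose_apply_other)
  qed
qed

definition col_incr :: "(nat \<times> nat \<Rightarrow> nat) \<Rightarrow> bool" where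
  "col_incr S \<longleftrightarrow> (\<forall>i j. (Suc i, j) \<in> cells la \<longrightarrow> S (i, j) < S (Suc i, j))"

text \<open>The column stabilizer preserves the set of entries of each column, and a finite set has
  only one increasing enumeration.\<close>

lemma col_incr_unique:
  assumes T: "col_incr T" and \<sigma>: "\<sigma> \<in> column_stabilizer la T" and S: "col_incr (\<sigma> \<circ> T)"
    and c: "c \<in> cells la"
  shows "(\<sigma> \<circ> T) c = T c"
proof -
  obtain i j where ij: "c = (i, j)" by (cases c)
  define h where "h = card {i. (i, j) \<in> cells la}"
  have "{i. (i, j) \<in> cells la} = {..<h}"
    unfolding h_def
  proof (rule downset_nat)
    show "finite {i. (i, j) \<in> cells la}" by (rule finite_subset [of _ "{..<length la}"]) (auto simp: mem_cells)
    show "k' \<in> {i. (i, j) \<in> cells la}" if "k \<in> {i. (i, j) \<in> cells la}" "k' < k" for k k'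
      using la that by (auto simp: mem_cells partitions_def sorted_wrt_iff_nth_less intro: less_le_trans)
  qed
  then have h: "(k, j) \<in> cells la \<longleftrightarrow> k < h" for k by blast
  have "\<sigma> ` {T (i, j) |i. (i, j) \<in> cells la} = {T (i, j) |i. (i, j) \<in> cells la}"
    using \<sigma> by (simp add: column_stabilizer_def)
  moreover have "{T (i, j) |i. (i, j) \<in> cells la} = (\<lambda>i. T (i, j)) ` {..<h}" using h by auto
  ultimately have "(\<lambda>i. (\<sigma> \<circ> T) (i, j)) ` {..<h} = (\<lambda>i. T (i, j)) ` {..<h}"
    by (simp add: image_image)
  moreover have "(\<sigma> \<circ> T) (k, j) < (\<sigma> \<circ> T) (Suc k, j)" if "Suc k < h" for k
    using S h [of "Suc k"] that unfolding col_incr_def by blast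
  moreover have "T (k, j) < T (Suc k, j)" if "Suc k < h" for k
    using T h [of "Suc k"] that unfolding col_incr_def by blast
  ultimately have "(\<sigma> \<circ> T) (i, j) = T (i, j)"
    using strict_mono_image_unique [where f = "\<lambda>i. (\<sigma> \<circ> T) (i, j)" and g = "\<lambda>i. T (i, j)" and h = h and i = i]
      c ij h [of i] by blast
  then show ?thesis using ij by simp
qed

text \<open>Exchanging a descent in adjacent rows of a column moves the larger entry one row
  down.\<close>

lemma swap_increases_weight:
  assumes T: "T \<in> tableaux la" and \<sigma>: "\<sigma> \<in> column_stabilizer la T" and nc: "\<not> col_incr (\<sigma> \<circ> T)"
  shows "\<exists>\<sigma>'\<in>column_stabilizer la T. row_weight (tabloid la (\<sigma> \<circ> T)) < row_weight (tabloid la (\<sigma>' \<circ> T))"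
proof -
  let ?S = "\<sigma> \<circ> T"
  have S: "?S \<in> tableaux la" by (rule column_stabilizer_tableau [OF T \<sigma>])
  obtain i j where ij: "(Suc i, j) \<in> cells la" "\<not> ?S (i, j) < ?S (Suc i, j)"
    using nc by (auto simp: col_incr_def)
  have ij': "(i, j) \<in> cells la" using ij(1) by (rule cell_above)
  have "?S (i, j) \<noteq> ?S (Suc i, j)" using inj_onD [OF tableauD(1) [OF S] _ ij' ij(1)] by auto
  then have lt: "?S (Suc i, j) < ?S (i, j)" using ij by simp
  define \<sigma>' where "\<sigma>' = Transposition.transpose (?S (i, j)) (?S (Suc i, j)) \<circ> \<sigma>"
  note sw = column_swap [OF T \<sigma> ij' ij(1), folded \<sigma>'_def, OF n_not_Suc_n]
  have S': "\<sigma>' \<circ> T \<in> tableaux la" by (rule column_stabilizer_tableau [OF T sw(1)])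
  define D where "D = cells la - {(i, j), (Suc i, j)}"
  have cells: "cells la = insert (i, j) (insert (Suc i, j) D)" "(i, j) \<notin> D" "(Suc i, j) \<notin> D" "finite D"
    using ij ij' finite_cells by (auto simp: D_def)
  have "(\<Sum>c\<in>D. fst c * (\<sigma>' \<circ> T) c) = (\<Sum>c\<in>D. fst c * ?S c)"
    using sw(5) by (intro sum.cong) (auto simp: D_def)
  then have "row_weight (tabloid la (\<sigma>' \<circ> T)) + (i * ?S (i, j) + Suc i * ?S (Suc i, j)) =
      row_weight (tabloid la ?S) + (i * ?S (Suc i, j) + Suc i * ?S (i, j))"
    unfolding row_weight_tabloid [OF S] row_weight_tabloid [OF S'] cells(1)
    using cells sw(3,4) by simp
  then have "row_weight (tabloid la ?S) < row_weight (tabloid la (\<sigma>' \<circ> T))" using lt by simp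
  with sw(1) show ?thesis by blast
qed

text \<open>As in bubble sort, an arrangement that is not column-increasing can be swapped to one of
  larger weight, and by \<open>col_incr_unique\<close> this can only end at \<open>T\<close>. The
  induction runs over the distance to the maximal weight \<open>B\<close>.\<close>

lemma row_weight_max:
  assumes T: "T \<in> tableaux la" "col_incr T" and \<sigma>: "\<sigma> \<in> column_stabilizer la T"
  shows "(\<forall>c\<in>cells la. (\<sigma> \<circ> T) c = T c) \<or>
    row_weight (tabloid la (\<sigma> \<circ> T)) < row_weight (tabloid la T)"
proof -
  define w where "w \<sigma> = row_weight (tabloid la (\<sigma> \<circ> T))" for \<sigma>
  define B where "B = Max (w ` column_stabilizer la T)"
  have B: "w \<sigma> \<le> B" if "\<sigma> \<in> column_stabilizer la T" for \<sigma>
    unfolding B_def using that finite_column_stabilizer by auto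
  have "(\<forall>c\<in>cells la. (\<sigma> \<circ> T) c = T c) \<or> w \<sigma> < row_weight (tabloid la T)"
    using \<sigma>
  proof (induction "B - w \<sigma>" arbitrary: \<sigma> rule: less_induct)
    case less
    show ?case
    proof (cases "col_incr (\<sigma> \<circ> T)")
      case True
      then show ?thesis using col_incr_unique [OF T(2) less.prems] by blast
    next
      case False
      then obtain \<sigma>' where s: "\<sigma>' \<in> column_stabilizer la T" "w \<sigma> < w \<sigma>'"
        using swap_increases_weight [OF T(1) less.prems] unfolding w_def by blast
      have "B - w \<sigma>' < B - w \<sigma>" using s B [OF s(1)] by simp
      from less.hyps [OF this s(1)] show ?thesis
      proof
        assume "\<forall>c\<in>cells la. (\<sigma>' \<circ> T) c = T c"
        then have "tabloid la (\<sigma>' \<circ> T) = tabloid la T" by (intro tabloid_cong) blast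
        then show ?thesis using s(2) by (simp add: w_def)
      qed (use s in simp)
    qed
  qed
  then show ?thesis by (simp add: w_def)
qed

lemma stdD:
  assumes T: "T \<in> std"
  shows "T \<in> tableaux la" "col_incr T" "\<And>i j. (i, Suc j) \<in> cells la \<Longrightarrow> T (i, j) < T (i, Suc j)"
    and "T \<in> extensional (cells la)"
proof -
  have D: "T \<in> cells la \<rightarrow>\<^sub>E UNIV" "\<And>i j. (i, Suc j) \<in> cells la \<Longrightarrow> T (i, j) \<le> T (i, Suc j)"
      "\<And>i j. (Suc i, j) \<in> cells la \<Longrightarrow> T (i, j) < T (Suc i, j)"
      "image_mset T (mset_set (cells la)) = mset_set {1..n}"
    using T unfolding std_def tab_def cells_part_of by (auto simp: diagram_def)
  note e = D(4)
  have im: "T ` cells la = {1..n}"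
    using arg_cong [OF e, of set_mset] finite_cells by simp
  moreover have "card (cells la) = n"
    using arg_cong [OF e, of size] by simp
  ultimately have inj: "inj_on T (cells la)" using finite_cells by (intro eq_card_imp_inj_on) auto
  then show "T \<in> tableaux la" using im by (simp add: tableaux_def bij_betw_def sum_list_la)
  show "col_incr T" "T \<in> extensional (cells la)"
    using D(1,3) by (auto simp: col_incr_def PiE_def)
  show "T (i, j) < T (i, Suc j)" if c: "(i, Suc j) \<in> cells la" for i j
  proof -
    have "T (i, j) \<le> T (i, Suc j)" using D(2) [OF c] .
    moreover have "(i, j) \<in> cells la" using c by (simp add: mem_cells)
    then have "T (i, j) \<noteq> T (i, Suc j)" using inj_onD [OF inj _ _ c, of "(i, j)"] by auto
    ultimately show ?thesis by simp
  qed
qed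

lemma finite_std: "finite std"
  unfolding std_def using la is_part_part_of by simp

lemma std_tabloid_inj:
  assumes T: "T \<in> std" and T': "T' \<in> std" and e: "tabloid la T = tabloid la T'"
  shows "T = T'"
proof (rule extensionalityI [OF stdD(4) [OF T] stdD(4) [OF T']])
  fix c assume c: "c \<in> cells la"
  obtain i j where ij: "c = (i, j)" by (cases c)
  have i: "i < length la" "j < la ! i" using c ij by (auto simp: mem_cells)
  have im: "(\<lambda>j. T (i, j)) ` {..<la ! i} = (\<lambda>j. T' (i, j)) ` {..<la ! i}"
    using e tabloid_nth [OF i(1), of T] tabloid_nth [OF i(1), of T'] by simp
  have "T (i, j) < T (i, Suc j)" "T' (i, j) < T' (i, Suc j)" if "Suc j < la ! i" for j
    using stdD(3) [OF T, of i j] stdD(3) [OF T', of i j] i that by (simp_all add: mem_cells)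
  then have "T (i, j) = T' (i, j)"
    using strict_mono_image_unique [where f = "\<lambda>j. T (i, j)" and g = "\<lambda>j. T' (i, j)" and h = "la ! i" and i = j]
      im i(2) by blast
  then show "T c = T' c" using ij by simp
qed

lemma polytabloid_nonzero:
  assumes "polytabloid la T t \<noteq> 0"
  shows "\<exists>\<sigma>\<in>column_stabilizer la T. tabloid la (\<sigma> \<circ> T) = t"
proof (rule ccontr)
  assume "\<not> ?thesis"
  then have "polytabloid la T t = 0" unfolding polytabloid_def by (intro sum.neutral) auto
  with assms show False by simp
qed

text \<open>A permutation that preserves the tabloid preserves its weight, so by
  \<open>row_weight_max\<close> it fixes all entries; only the identity contributes.\<close>

lemma polytabloid_diag:
  assumes T: "T \<in> tableaux la" "col_incr T"
  shows "polytabloid la T (tabloid la T) = 1"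
proof -
  have "polytabloid la T (tabloid la T) =
      (\<Sum>\<sigma>\<in>{id}. of_int (sign \<sigma>) * of_bool (tabloid la (\<sigma> \<circ> T) = tabloid la T))"
    unfolding polytabloid_def
  proof (rule sum.mono_neutral_right [OF finite_column_stabilizer])
    show "\<forall>\<sigma>\<in>column_stabilizer la T - {id}.
        of_int (sign \<sigma>) * of_bool (tabloid la (\<sigma> \<circ> T) = tabloid la T) = (0 :: complex)"
    proof
      fix \<sigma> assume s: "\<sigma> \<in> column_stabilizer la T - {id}"
      have "tabloid la (\<sigma> \<circ> T) \<noteq> tabloid la T"
      proof
        assume e: "tabloid la (\<sigma> \<circ> T) = tabloid la T"
        then have fixed: "\<forall>c\<in>cells la. \<sigma> (T c) = T c"
          using row_weight_max [OF T, of \<sigma>] s by auto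
        have "\<sigma> x = x" for x
        proof (cases "x \<in> {1..n}")
          case True
          then obtain c where "c \<in> cells la" "x = T c" using tableauD(2) [OF T(1)] by blast
          then show ?thesis using fixed by simp
        next
          case False
          then show ?thesis using s by (auto simp: column_stabilizer_def sum_list_la permutes_def)
        qed
        then have "\<sigma> = id" by auto
        with s show False by simp
      qed
      then show "of_int (sign \<sigma>) * of_bool (tabloid la (\<sigma> \<circ> T) = tabloid la T) = (0 :: complex)" by simp
    qed
  qed (use id_column_stabilizer in auto)
  then show ?thesis by simp
qed

lemma polytabloid_triangular:
  assumes T: "T \<in> std" and T': "T' \<in> std" and nz: "polytabloid la T (tabloid la T') \<noteq> 0"
  shows "T = T' \<or> row_weight (tabloid la T') < row_weight (tabloid la T)"
proof -
  obtain \<sigma> where s: "\<sigma> \<in> column_stabilizer la T" "tabloid la (\<sigma> \<circ> T) = tabloid la T'"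
    using polytabloid_nonzero [OF nz] by blast
  from row_weight_max [OF stdD(1,2) [OF T] s(1)] show ?thesis
  proof
    assume "\<forall>c\<in>cells la. (\<sigma> \<circ> T) c = T c"
    then have "tabloid la (\<sigma> \<circ> T) = tabloid la T" by (intro tabloid_cong) blast
    then have "tabloid la T = tabloid la T'" using s(2) by (rule trans [OF sym])
    then show ?thesis using std_tabloid_inj [OF T T'] by blast
  qed (use s in simp)
qed

text \<open>Triangularity with the standard tabloids as evaluation points and the negated row weight
  as weight.\<close>

lemma polytabloid_independent:
  "inj_on (polytabloid la) std" "cfun_independent (polytabloid la ` std)"
proof -
  show inj: "inj_on (polytabloid la) std"
  proof (rule inj_onI)
    fix T T' assume T: "T \<in> std" "T' \<in> std" "polytabloid la T = polytabloid la T'"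
    have nz: "polytabloid la T (tabloid la T') \<noteq> 0" "polytabloid la T' (tabloid la T) \<noteq> 0"
      using polytabloid_diag [OF stdD(1,2) [OF T(2)]] polytabloid_diag [OF stdD(1,2) [OF T(1)]] unfolding T(3) by simp_all
    from polytabloid_triangular [OF T(1,2) nz(1)] polytabloid_triangular [OF T(2,1) nz(2)]
    show "T = T'" by auto
  qed
  show "cfun_independent (polytabloid la ` std)"
    unfolding cfun_independent_def cfun.independent_explicit_finite_subsets
  proof (intro allI impI ballI)
    fix S :: "(nat set list \<Rightarrow> complex) set" and u v
    assume S: "S \<subseteq> polytabloid la ` std" "finite S" "(\<Sum>v\<in>S. (\<lambda>x. u v * v x)) = 0" "v \<in> S"
    then obtain R where R: "R \<subseteq> std" "finite R" "S = polytabloid la ` R" by (meson finite_subset_image)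
    then have injR: "inj_on (polytabloid la) R" using inj inj_on_subset by blast
    obtain T where T: "T \<in> R" "v = polytabloid la T" using S(4) R(3) by blast
    have "u (polytabloid la T) = 0"
    proof (rule triangular_zero [where S = R and e = "polytabloid la" and ev = "tabloid la"
          and wt = "\<lambda>T. - int (row_weight (tabloid la T))" and a = "\<lambda>T. u (polytabloid la T)"])
      show "(\<Sum>T\<in>R. u (polytabloid la T) * polytabloid la T x) = 0" for x
        using fun_cong [OF S(3), of x] injR by (simp add: fun_sum_apply R(3) sum.reindex)
      show "polytabloid la T (tabloid la T) \<noteq> 0" if "T \<in> R" for T
        using polytabloid_diag [OF stdD(1,2)] that R by force
      show "T' = T \<or> - int (row_weight (tabloid la T')) < - int (row_weight (tabloid la T))"
        if "T \<in> R" "T' \<in> R" "polytabloid la T' (tabloid la T) \<noteq> 0" for T T'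
        using polytabloid_triangular [of T' T] that R by auto
    qed (use R T in auto)
    then show "u v = 0" by (simp add: T)
  qed
qed

section \<open>Garnir-type relations and the dimension of the Specht module\<close>

text \<open>
  The transpose of the Garnir relations: they hold for the values of any element of the Specht
  module, and show by induction that it is determined by its values on standard tabloids.
\<close>

definition redistr :: "nat \<Rightarrow> nat set list \<Rightarrow> nat set \<Rightarrow> nat set \<Rightarrow> nat set list set" where
  "redistr i t Y Z = {t' \<in> tabloids. (\<forall>k<length la. k \<noteq> i \<and> k \<noteq> Suc i \<longrightarrow> t' ! k = t ! k) \<and>
     t' ! i \<union> t' ! Suc i = t ! i \<union> t ! Suc i \<and> Y \<subseteq> t' ! Suc i \<and> Z \<subseteq> t' ! i}"

text \<open>A sign-reversing involution. There are \<open>la ! Suc i\<close> columns that meet both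
  rows, more than there are elements of \<open>Y\<close> and \<open>Z\<close>, so some column has
  both of its entries in these rows outside \<open>Y\<close> and \<open>Z\<close>. Swapping them in
  the first such column keeps \<open>Y\<close> and \<open>Z\<close> in place.\<close>

lemma polytabloid_redistr:
  assumes T: "T \<in> tableaux la" and i: "Suc i < length la" and fin: "finite Y" "finite Z"
    and small: "card Y + card Z < la ! Suc i"
  shows "(\<Sum>t'\<in>redistr i t Y Z. polytabloid la T t') = 0"
proof -
  let ?C = "column_stabilizer la T" and ?Q = "redistr i t Y Z"
  define G where "G = {\<sigma> \<in> ?C. tabloid la (\<sigma> \<circ> T) \<in> ?Q}"
  define P where "P \<sigma> j \<longleftrightarrow> j < la ! Suc i \<and> \<sigma> (T (i, j)) \<notin> Y \<union> Z \<and> \<sigma> (T (Suc i, j)) \<notin> Y \<union> Z" for \<sigma> :: "nat \<Rightarrow> nat" and j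
  define j0 where "j0 \<sigma> = (LEAST j. P \<sigma> j)" for \<sigma>
  define f where "f \<sigma> = Transposition.transpose (\<sigma> (T (i, j0 \<sigma>))) (\<sigma> (T (Suc i, j0 \<sigma>))) \<circ> \<sigma>" for \<sigma>
  have cell: "(i, j) \<in> cells la" "(Suc i, j) \<in> cells la" if "j < la ! Suc i" for j
    using that i cell_above by (auto simp: mem_cells)
  have finQ: "finite ?Q" using finite_tabloids by (auto simp: redistr_def intro: finite_subset)
  have ex: "P \<sigma> (j0 \<sigma>)" if \<sigma>: "\<sigma> \<in> ?C" for \<sigma>
  proof -
    have inj: "inj_on (\<sigma> \<circ> T) (cells la)" using column_stabilizer_tableau [OF T \<sigma>] tableauD by blast
    have "\<exists>j. P \<sigma> j"
    proof (rule ccontr)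
      assume no: "\<nexists>j. P \<sigma> j"
      \<comment> \<open>If there were no such column, choosing from each one an entry in
        \<open>Y\<close> or \<open>Z\<close> would inject the columns into the union.\<close>
      define g where "g j = (if \<sigma> (T (i, j)) \<in> Y \<union> Z then \<sigma> (T (i, j)) else \<sigma> (T (Suc i, j)))" for j
      have "inj_on g {..<la ! Suc i}"
      proof (rule inj_onI)
        fix a b assume ab: "a \<in> {..<la ! Suc i}" "b \<in> {..<la ! Suc i}" "g a = g b"
        have "\<exists>k l. (\<sigma> \<circ> T) (k, a) = (\<sigma> \<circ> T) (l, b) \<and> (k, a) \<in> cells la \<and> (l, b) \<in> cells la"
          using ab cell by (auto simp: g_def split: if_splits)
        then obtain k l where "(\<sigma> \<circ> T) (k, a) = (\<sigma> \<circ> T) (l, b)" "(k, a) \<in> cells la" "(l, b) \<in> cells la" by blast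
        then have "(k, a) = (l, b)" by (rule inj_onD [OF inj])
        then show "a = b" by simp
      qed
      moreover have "g ` {..<la ! Suc i} \<subseteq> Y \<union> Z" using no by (auto simp: g_def P_def)
      ultimately have "la ! Suc i \<le> card (Y \<union> Z)" using fin by (intro card_inj_on_le [of g "{..<la ! Suc i}" "Y \<union> Z", simplified]) simp_all
      then show False using small card_Un_le [of Y Z] by simp
    qed
    then show ?thesis unfolding j0_def by (rule LeastI_ex)
  qed
  have f: "f \<sigma> \<in> G" "sign (f \<sigma>) = - sign \<sigma>" "f (f \<sigma>) = \<sigma>" if \<sigma>G: "\<sigma> \<in> G" for \<sigma>
  proof -
    have \<sigma>: "\<sigma> \<in> ?C" and Q: "tabloid la (\<sigma> \<circ> T) \<in> ?Q" using \<sigma>G by (auto simp: G_def)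
    let ?j = "j0 \<sigma>" and ?S = "\<sigma> \<circ> T"
    have P: "P \<sigma> ?j" by (rule ex [OF \<sigma>])
    then have j: "?j < la ! Suc i" by (simp add: P_def)
    have f_alt: "f \<sigma> = Transposition.transpose (?S (i, ?j)) (?S (Suc i, ?j)) \<circ> \<sigma>" by (simp add: f_def)
    note sw = column_swap [OF T \<sigma> cell [OF j] n_not_Suc_n, folded f_alt]
    have S': "f \<sigma> \<circ> T \<in> tableaux la" by (rule column_stabilizer_tableau [OF T sw(1)])
    have other: "(f \<sigma> \<circ> T) (k, l) = ?S (k, l)" if "(k, l) \<in> cells la" "k \<noteq> i \<and> k \<noteq> Suc i \<or> l \<noteq> ?j" for k l
      using that by (intro sw(5)) auto
    show "sign (f \<sigma>) = - sign \<sigma>" by (rule sw(2))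
    have "P (f \<sigma>) l = P \<sigma> l" for l
    proof (cases "l = ?j")
      case True
      then show ?thesis using sw(3,4) by (auto simp: P_def)
    next
      case False
      then show ?thesis using other [of i l] other [of "Suc i" l] cell [of l] by (auto simp: P_def)
    qed
    then have "j0 (f \<sigma>) = ?j" by (simp add: j0_def)
    then have "f (f \<sigma>) = Transposition.transpose (?S (Suc i, ?j)) (?S (i, ?j)) \<circ> (f \<sigma>)"
      using sw(3,4) by (simp add: f_def [of "f \<sigma>"])
    also have "\<dots> = \<sigma>" unfolding f_alt by (subst transpose_commute) (simp add: fun_eq_iff)
    finally show "f (f \<sigma>) = \<sigma>" .
    let ?t = "tabloid la ?S" and ?t' = "tabloid la (f \<sigma> \<circ> T)"
    have i': "i < length la" using i by simp
    have le: "la ! Suc i \<le> la ! i" by (rule la_antimono [OF i])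
    have rows: "?t' ! k = ?t ! k" if "k < length la" "k \<noteq> i \<and> k \<noteq> Suc i" for k
      unfolding tabloid_nth [OF that(1)] using that other by (intro image_cong refl) (auto simp: mem_cells)
    have un: "?t' ! i \<union> ?t' ! Suc i = ?t ! i \<union> ?t ! Suc i"
    proof -
      have a: "(f \<sigma> \<circ> T) (i, l) \<in> ?t ! i \<union> ?t ! Suc i" if "l < la ! i" for l
        using that sw(3) j other [of i l] i i'
        by (cases "l = ?j") (auto simp: tabloid_nth mem_cells simp del: o_apply)
      have b: "(f \<sigma> \<circ> T) (Suc i, l) \<in> ?t ! i \<union> ?t ! Suc i" if "l < la ! Suc i" for l
        using that sw(4) j le other [of "Suc i" l] i i'
        by (cases "l = ?j") (auto simp: tabloid_nth mem_cells simp del: o_apply)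
      have c: "?S (i, l) \<in> ?t' ! i \<union> ?t' ! Suc i" if "l < la ! i" for l
        using that sw(4) [symmetric] j other [of i l, symmetric] i i'
        by (cases "l = ?j") (auto simp: tabloid_nth mem_cells simp del: o_apply)
      have d: "?S (Suc i, l) \<in> ?t' ! i \<union> ?t' ! Suc i" if "l < la ! Suc i" for l
        using that sw(3) [symmetric] j le other [of "Suc i" l, symmetric] i i'
        by (cases "l = ?j") (auto simp: tabloid_nth mem_cells simp del: o_apply)
      show ?thesis
      proof (intro subset_antisym Un_least)
        show "?t' ! i \<subseteq> ?t ! i \<union> ?t ! Suc i" unfolding tabloid_nth [OF i', of "f \<sigma> \<circ> T"] using a by blast
        show "?t' ! Suc i \<subseteq> ?t ! i \<union> ?t ! Suc i" unfolding tabloid_nth [OF i, of "f \<sigma> \<circ> T"] using b by blast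
        show "?t ! i \<subseteq> ?t' ! i \<union> ?t' ! Suc i" unfolding tabloid_nth [OF i', of ?S] using c by blast
        show "?t ! Suc i \<subseteq> ?t' ! i \<union> ?t' ! Suc i" unfolding tabloid_nth [OF i, of ?S] using d by blast
      qed
    qed
    have Y: "Y \<subseteq> ?t' ! Suc i"
    proof
      fix y assume y: "y \<in> Y"
      then have "y \<in> ?t ! Suc i" using Q by (auto simp: redistr_def)
      then obtain l where l: "y = ?S (Suc i, l)" "l < la ! Suc i" unfolding tabloid_nth [OF i] by blast
      moreover have "l \<noteq> ?j" using P y l by (auto simp: P_def)
      ultimately have "y = (f \<sigma> \<circ> T) (Suc i, l)" using other [of "Suc i" l] cell [of l] by simp
      then show "y \<in> ?t' ! Suc i" unfolding tabloid_nth [OF i] using l by blast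
    qed
    have Z: "Z \<subseteq> ?t' ! i"
    proof
      fix z assume z: "z \<in> Z"
      then have "z \<in> ?t ! i" using Q by (auto simp: redistr_def)
      then obtain l where l: "z = ?S (i, l)" "l < la ! i" unfolding tabloid_nth [OF i'] by blast
      moreover have "l \<noteq> ?j" using P z l by (auto simp: P_def)
      ultimately have "z = (f \<sigma> \<circ> T) (i, l)" using other [of i l] i' by (simp add: mem_cells)
      then show "z \<in> ?t' ! i" unfolding tabloid_nth [OF i'] using l by blast
    qed
    have "?t' \<in> ?Q" using Q rows un Y Z S' unfolding redistr_def tabloids_def by auto
    then show "f \<sigma> \<in> G" using sw(1) by (simp add: G_def)
  qed
  have "(\<Sum>t'\<in>?Q. polytabloid la T t') =
      (\<Sum>\<sigma>\<in>?C. \<Sum>t'\<in>?Q. of_int (sign \<sigma>) * of_bool (tabloid la (\<sigma> \<circ> T) = t'))"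
    unfolding polytabloid_def by (rule sum.swap)
  also have "\<dots> = (\<Sum>\<sigma>\<in>?C. if tabloid la (\<sigma> \<circ> T) \<in> ?Q then of_int (sign \<sigma>) else 0)"
  proof (rule sum.cong [OF refl])
    fix \<sigma>
    have "(\<Sum>t'\<in>?Q. of_int (sign \<sigma>) * of_bool (tabloid la (\<sigma> \<circ> T) = t')) =
        (\<Sum>t'\<in>?Q. if t' = tabloid la (\<sigma> \<circ> T) then of_int (sign \<sigma>) else (0 :: complex))"
      by (intro sum.cong) auto
    then show "(\<Sum>t'\<in>?Q. of_int (sign \<sigma>) * of_bool (tabloid la (\<sigma> \<circ> T) = t')) =
        (if tabloid la (\<sigma> \<circ> T) \<in> ?Q then of_int (sign \<sigma>) else (0 :: complex))"
      using finQ by simp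
  qed
  also have "\<dots> = (\<Sum>\<sigma>\<in>G. of_int (sign \<sigma>))"
    unfolding G_def using finite_column_stabilizer by (simp add: sum.inter_filter)
  finally have s: "(\<Sum>t'\<in>?Q. polytabloid la T t') = (\<Sum>\<sigma>\<in>G. of_int (sign \<sigma>))" .
  have "(\<Sum>\<sigma>\<in>G. of_int (sign \<sigma>)) = (\<Sum>\<sigma>\<in>G. - of_int (sign \<sigma>) :: complex)"
    by (rule sum.reindex_bij_witness [where i = f and j = f]) (simp_all add: f)
  then have "(\<Sum>\<sigma>\<in>G. of_int (sign \<sigma>)) = (0 :: complex)" by (simp add: sum_negf)
  with s show ?thesis by simp
qed

lemma specht_support: "v \<in> specht la \<Longrightarrow> t \<notin> tabloids \<Longrightarrow> v t = 0"
  unfolding specht_def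
proof (induction rule: cfun.span_induct_alt)
  case (step c x y)
  then obtain T where T: "T \<in> tableaux la" "x = polytabloid la T" by blast
  have "x t = 0"
  proof (rule ccontr)
    assume "x t \<noteq> 0"
    then obtain \<sigma> where "\<sigma> \<in> column_stabilizer la T" "tabloid la (\<sigma> \<circ> T) = t"
      using polytabloid_nonzero T(2) by blast
    then show False using step.prems column_stabilizer_tableau [OF T(1)] by (auto simp: tabloids_def)
  qed
  then show ?case using step by simp
qed simp

lemma specht_redistr:
  assumes "Suc i < length la" "finite Y" "finite Z" "card Y + card Z < la ! Suc i"
  shows "v \<in> specht la \<Longrightarrow> (\<Sum>t'\<in>redistr i t Y Z. v t') = 0"
  unfolding specht_def
proof (induction rule: cfun.span_induct_alt)
  case (step c x y)
  then obtain T where "T \<in> tableaux la" "x = polytabloid la T" by blast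
  then have "(\<Sum>t'\<in>redistr i t Y Z. x t') = 0" using polytabloid_redistr assms by simp
  then show ?case using step by (simp add: sum.distrib sum_distrib_left [symmetric])
qed simp

text \<open>Only entries outside \<open>Y\<close> and \<open>Z\<close> change rows: those entering
  row \<open>Suc i\<close> exceed \<open>s\<close>, those leaving it do not. As the joint total of
  the two rows is fixed, the weight grows with the sum of row \<open>Suc i\<close>.\<close>

lemma row_weight_redistr:
  assumes t: "t \<in> tabloids" and i: "Suc i < length la" and t': "t' \<in> redistr i t Y Z" "t' \<noteq> t"
    and hi: "\<And>x. x \<in> t ! i - Z \<Longrightarrow> s < x" and lo: "\<And>x. x \<in> t ! Suc i - Y \<Longrightarrow> x \<le> s"
  shows "row_weight t < row_weight t'"
proof -
  have t'T: "t' \<in> tabloids" and rows: "\<And>k. k < length la \<Longrightarrow> k \<noteq> i \<and> k \<noteq> Suc i \<Longrightarrow> t' ! k = t ! k"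
    and un: "t' ! i \<union> t' ! Suc i = t ! i \<union> t ! Suc i" and YZ: "Y \<subseteq> t' ! Suc i" "Z \<subseteq> t' ! i"
    using t' by (auto simp: redistr_def)
  have i': "i < length la" using i by simp
  note d = tabloidsD [OF t i] tabloidsD [OF t i'] and d' = tabloidsD [OF t'T i] tabloidsD [OF t'T i']
  have disj: "t ! Suc i \<inter> t ! i = {}" "t' ! Suc i \<inter> t' ! i = {}"
    using d(3) [OF i'] d'(3) [OF i'] by auto
  have ne: "t ! Suc i \<noteq> t' ! Suc i"
  proof
    assume e: "t ! Suc i = t' ! Suc i"
    then have "t ! i = t' ! i" using un disj by blast
    then have "t' ! k = t ! k" if "k < length la" for k
      using rows [OF that] e by (cases "k = i"; cases "k = Suc i") auto
    then have "t' = t" using d(4) d'(4) by (intro nth_equalityI) auto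
    with t'(2) show False by simp
  qed
  have less: "\<Sum>(t ! Suc i) < \<Sum>(t' ! Suc i)"
  proof (rule sum_set_less [where s = s])
    show "s < x" if "x \<in> t' ! Suc i - t ! Suc i" for x
      using that un disj YZ by (intro hi) blast
    show "x \<le> s" if "x \<in> t ! Suc i - t' ! Suc i" for x
      using that YZ by (intro lo) blast
  qed (use d d' ne in auto)
  have tot: "\<Sum>(t ! i) + \<Sum>(t ! Suc i) = \<Sum>(t' ! i) + \<Sum>(t' ! Suc i)"
  proof -
    have "\<Sum>(t ! i) + \<Sum>(t ! Suc i) = \<Sum>(t ! i \<union> t ! Suc i)"
      using d disj by (subst sum.union_disjoint) auto
    also have "\<dots> = \<Sum>(t' ! i) + \<Sum>(t' ! Suc i)"
      unfolding un [symmetric] using d' disj by (subst sum.union_disjoint) auto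
    finally show ?thesis .
  qed
  define K where "K = {..<length la} - {i, Suc i}"
  have K: "{..<length la} = insert i (insert (Suc i) K)" "i \<notin> K" "Suc i \<notin> K" "finite K"
    using i by (auto simp: K_def)
  have "(\<Sum>k\<in>K. k * \<Sum>(t' ! k)) = (\<Sum>k\<in>K. k * \<Sum>(t ! k))"
    using rows by (intro sum.cong) (auto simp: K_def)
  then have w: "row_weight t' + (i * \<Sum>(t ! i) + Suc i * \<Sum>(t ! Suc i)) =
      row_weight t + (i * \<Sum>(t' ! i) + Suc i * \<Sum>(t' ! Suc i))"
    unfolding row_weight_def K(1) using K by simp
  have "i * \<Sum>(t ! i) + Suc i * \<Sum>(t ! Suc i) = i * (\<Sum>(t ! i) + \<Sum>(t ! Suc i)) + \<Sum>(t ! Suc i)"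
    by (simp add: algebra_simps)
  also have "\<dots> < i * (\<Sum>(t' ! i) + \<Sum>(t' ! Suc i)) + \<Sum>(t' ! Suc i)" using less tot by simp
  also have "\<dots> = i * \<Sum>(t' ! i) + Suc i * \<Sum>(t' ! Suc i)" by (simp add: algebra_simps)
  finally show ?thesis using w by linarith
qed

lemma row_sorted_tableau:
  assumes t: "t \<in> tabloids"
  shows "\<exists>S\<in>tableaux la. tabloid la S = t \<and> (\<forall>i j. (i, Suc j) \<in> cells la \<longrightarrow> S (i, j) < S (i, Suc j))"
proof -
  define S where "S c = sorted_list_of_set (t ! fst c) ! snd c" for c
  have len: "length (sorted_list_of_set (t ! k)) = la ! k" if "k < length la" for k
    using tabloidsD(2) [OF t that] by simp
  have set: "set (sorted_list_of_set (t ! k)) = t ! k" if "k < length la" for k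
    by (rule set_sorted_list_of_set [OF tabloidsD(1) [OF t that]])
  have img: "(\<lambda>j. S (k, j)) ` {..<la ! k} = t ! k" if k: "k < length la" for k
  proof -
    have "t ! k = (!) (sorted_list_of_set (t ! k)) ` {..<length (sorted_list_of_set (t ! k))}"
      using set [OF k] by (auto simp: set_conv_nth)
    then show ?thesis unfolding len [OF k] by (simp add: S_def)
  qed
  have incr: "S (i, j) < S (i, Suc j)" if "(i, Suc j) \<in> cells la" for i j
    using strict_sorted_list_of_set [of "t ! i"] that len [of i]
    by (auto simp: S_def mem_cells sorted_wrt_iff_nth_less)
  obtain T where T: "T \<in> tableaux la" "t = tabloid la T" using t by (auto simp: tabloids_def)
  have un: "\<Union>((\<lambda>k. R (k :: nat)) ` {..<length la}) = f ` cells la"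
    if "\<And>k. k < length la \<Longrightarrow> R k = (\<lambda>j. f (k, j)) ` {..<la ! k}" for R :: "nat \<Rightarrow> nat set" and f
    using that by (force simp: cells_def)
  have "S ` cells la = \<Union>((\<lambda>k. t ! k) ` {..<length la})" by (rule un [symmetric]) (simp add: img)
  also have "\<dots> = T ` cells la" by (rule un) (simp add: T tabloid_nth)
  also have "\<dots> = {1..n}" by (rule tableauD [OF T(1)])
  finally have im: "S ` cells la = {1..n}" .
  have "card (cells la) = n" using tableauD [OF T(1)] card_image [of T "cells la"] by simp
  then have "inj_on S (cells la)" using im finite_cells by (intro eq_card_imp_inj_on) auto
  then have "S \<in> tableaux la" using im by (simp add: tableaux_def bij_betw_def sum_list_la)
  moreover have "tabloid la S = t"
    using tabloidsD(4) [OF t] by (intro nth_equalityI) (auto simp: tabloid_nth img T)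
  ultimately show ?thesis using incr by blast
qed

text \<open>Induction from large row weight to small. If the row-sorted filling \<open>S\<close> of
  \<open>t\<close> is not standard, it has a descent in a column between rows \<open>i\<close> and
  \<open>Suc i\<close>, and freezing suitable entries yields a relation in which all tabloids other
  than \<open>t\<close> have larger weight; their values are 0 by induction, hence so is that of
  \<open>t\<close>.\<close>

lemma specht_determined:
  assumes v: "v \<in> specht la" and std: "\<And>T. T \<in> std \<Longrightarrow> v (tabloid la T) = 0"
  shows "v = (\<lambda>_. 0)"
proof -
  define B where "B = Max (row_weight ` tabloids)"
  have B: "row_weight t \<le> B" if "t \<in> tabloids" for t
    unfolding B_def using that finite_tabloids by auto
  have "v t = 0" if "t \<in> tabloids" for t
    using that
  proof (induction "B - row_weight t" arbitrary: t rule: less_induct)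
    case less
    note t = less.prems
    obtain S where S: "S \<in> tableaux la" "tabloid la S = t"
      and incr: "\<And>i j. (i, Suc j) \<in> cells la \<Longrightarrow> S (i, j) < S (i, Suc j)"
      using row_sorted_tableau [OF t] by blast
    have mono: "S (i, j) < S (i, j')" if "j < j'" "j' < la ! i" "i < length la" for i j j'
      using that
    proof (induction j')
      case (Suc j')
      then have "S (i, j') < S (i, Suc j')" by (intro incr) (simp add: mem_cells)
      then show ?case using Suc by (cases "j = j'") auto
    qed simp
    show ?case
    proof (cases "col_incr S")
      case True
      let ?T = "restrict S (cells la)"
      have "image_mset ?T (mset_set (cells la)) = image_mset S (mset_set (cells la))"
        using finite_cells by (intro image_mset_cong) simp
      also have "\<dots> = mset_set {1..n}"
        using tableauD [OF S(1)] by (simp add: image_mset_mset_set)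
      finally have "?T \<in> std"
        using True incr cell_above unfolding std_def tab_def col_incr_def cells_part_of [symmetric]
        by (auto simp: mem_cells intro: less_imp_le)
      moreover have "tabloid la ?T = t" unfolding S(2) [symmetric] by (rule tabloid_cong) simp
      ultimately show ?thesis using std by blast
    next
      case False
      then obtain i j where ij: "(Suc i, j) \<in> cells la" "\<not> S (i, j) < S (Suc i, j)"
        by (auto simp: col_incr_def)
      have i: "Suc i < length la" "i < length la" and j: "j < la ! Suc i" "j < la ! i"
        using ij cell_above [OF ij(1)] by (auto simp: mem_cells)
      have "S (i, j) \<noteq> S (Suc i, j)"
        using inj_onD [OF tableauD(1) [OF S(1)] _ cell_above [OF ij(1)] ij(1)] by auto
      then have gt: "S (Suc i, j) < S (i, j)" using ij by simp
      \<comment> \<open>Frozen are the entries to the right of the descent in row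
        \<open>Suc i\<close> and to its left in row \<open>i\<close>, one fewer than the length of
        row \<open>Suc i\<close>. Since rows increase, the free entries of row \<open>i\<close> all
        exceed \<open>S (Suc i, j)\<close>, and those of row \<open>Suc i\<close> do not.\<close>
      define Y Z where "Y = (\<lambda>l. S (Suc i, l)) ` {j<..<la ! Suc i}" and "Z = (\<lambda>l. S (i, l)) ` {..<j}"
      have "card Y \<le> la ! Suc i - Suc j" "card Z \<le> j"
        unfolding Y_def Z_def using card_image_le [of "{j<..<la ! Suc i}"] card_image_le [of "{..<j}"] by auto
      then have small: "card Y + card Z < la ! Suc i" using j by linarith
      have rows: "t ! i = (\<lambda>l. S (i, l)) ` {..<la ! i}" "t ! Suc i = (\<lambda>l. S (Suc i, l)) ` {..<la ! Suc i}"
        unfolding S(2) [symmetric] using i by (simp_all add: tabloid_nth)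
      have hi: "S (Suc i, j) < x" if x: "x \<in> t ! i - Z" for x
      proof -
        obtain l where l: "x = S (i, l)" "l < la ! i" "\<not> l < j" using x unfolding rows Z_def by blast
        then have "S (i, j) \<le> x" using mono [of j l i] i by (cases "l = j") auto
        with gt show ?thesis by simp
      qed
      have lo: "x \<le> S (Suc i, j)" if x: "x \<in> t ! Suc i - Y" for x
      proof -
        obtain l where l: "x = S (Suc i, l)" "l < la ! Suc i" using x unfolding rows by blast
        moreover have "\<not> j < l" using x l by (auto simp: Y_def)
        ultimately show ?thesis using mono [of l j "Suc i"] i j by (cases "l = j") simp_all
      qed
      have tQ: "t \<in> redistr i t Y Z"
        using t rows j by (auto simp: redistr_def Y_def Z_def)
      have finQ: "finite (redistr i t Y Z)" using finite_tabloids by (auto simp: redistr_def intro: finite_subset)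
      have zero: "v t' = 0" if t': "t' \<in> redistr i t Y Z - {t}" for t'
      proof (rule less.hyps)
        show T': "t' \<in> tabloids" using t' by (simp add: redistr_def)
        have "row_weight t < row_weight t'"
          using t' by (intro row_weight_redistr [OF t i(1) _ _ hi lo]) auto
        then show "B - row_weight t' < B - row_weight t" using B [OF T'] by simp
      qed
      have "0 = (\<Sum>t'\<in>redistr i t Y Z. v t')"
        using specht_redistr [OF i(1) _ _ small v] by (simp add: Y_def Z_def)
      also have "\<dots> = v t + (\<Sum>t'\<in>redistr i t Y Z - {t}. v t')" using finQ tQ by (rule sum.remove)
      also have "\<dots> = v t" using zero by simp
      finally show ?thesis by simp
    qed
  qed
  then show ?thesis using specht_support [OF v] by blast
qed

text \<open>Restriction to the standard tabloids is injective by \<open>specht_determined\<close>,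
  which bounds the dimension above; the independent standard polytabloids bound it below. Every
  basis is covered because \<open>trace_on\<close> uses an arbitrary one.\<close>

lemma specht_basis_card:
  assumes ind: "cfun_independent B" and span: "cfun_span B = specht la"
  shows "finite B \<and> card B = card std"
proof -
  interpret cc: vector_space_pair "\<lambda>(c::complex) (f :: nat set list \<Rightarrow> complex) x. c * f x"
    "\<lambda>(c::complex) (f :: nat set list \<Rightarrow> complex) x. c * f x"
    by unfold_locales
  define TS where "TS = tabloid la ` std"
  define \<rho> where "\<rho> v = (\<lambda>t. if t \<in> TS then v t else 0)" for v :: "nat set list \<Rightarrow> complex"
  define \<delta> where "\<delta> s = (\<lambda>t. if t = s then 1 else 0 :: complex)" for s :: "nat set list"
  have fin: "finite TS" using finite_std by (simp add: TS_def)
  have lin: "Vector_Spaces.linear (\<lambda>(c::complex) (f :: nat set list \<Rightarrow> complex) x. c * f x)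
      (\<lambda>(c::complex) (f :: nat set list \<Rightarrow> complex) x. c * f x) \<rho>"
    unfolding Vector_Spaces.linear_iff using cfun.vector_space_axioms by (auto simp: \<rho>_def fun_eq_iff)
  have inj: "inj_on \<rho> (cfun_span B)"
  proof (rule inj_onI)
    fix v w assume vw: "v \<in> cfun_span B" "w \<in> cfun_span B" "\<rho> v = \<rho> w"
    have "v - w \<in> specht la" using vw span cfun.span_diff [of v B w] by simp
    moreover have "(v - w) (tabloid la T) = 0" if "T \<in> std" for T
      using fun_cong [OF vw(3), of "tabloid la T"] that by (simp add: \<rho>_def TS_def)
    ultimately have "v - w = (\<lambda>_. 0)" by (rule specht_determined)
    then show "v = w" by (simp add: fun_eq_iff)
  qed
  have "\<not> cfun.dependent (\<rho> ` B)"
    using cc.linear_independent_injective_image [OF lin, of B] ind inj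
    unfolding cfun_independent_def cfun_span_def by blast
  moreover have "\<rho> ` B \<subseteq> cfun_span (\<delta> ` TS)"
  proof
    fix w assume "w \<in> \<rho> ` B"
    then obtain v where v: "w = \<rho> v" by blast
    have w: "w = (\<Sum>s\<in>TS. (\<lambda>x. v s * \<delta> s x))"
    proof
      fix t
      have "(\<Sum>s\<in>TS. v s * \<delta> s t) = (\<Sum>s\<in>TS. if s = t then v t else 0)"
        by (intro sum.cong) (auto simp: \<delta>_def)
      then show "w t = (\<Sum>s\<in>TS. (\<lambda>x. v s * \<delta> s x)) t" using fin by (simp add: v \<rho>_def fun_sum_apply)
    qed
    show "w \<in> cfun_span (\<delta> ` TS)"
      unfolding w by (intro cfun.span_sum cfun.span_scale cfun.span_base imageI)
  qed
  ultimately have "finite (\<rho> ` B) \<and> card (\<rho> ` B) \<le> card (\<delta> ` TS)"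
    using fin by (intro cfun.independent_span_bound) auto
  moreover have injB: "inj_on \<rho> B" using inj cfun.span_superset inj_on_subset by blast
  moreover have "card (\<delta> ` TS) \<le> card std"
    unfolding TS_def image_image by (rule card_image_le [OF finite_std])
  ultimately have 1: "finite B" "card B \<le> card std"
    by (auto simp: card_image finite_image_iff)
  have "polytabloid la ` std \<subseteq> cfun_span B"
    unfolding span specht_def using stdD(1) by (auto intro!: cfun.span_base)
  then have "card (polytabloid la ` std) \<le> card B"
    using cfun.independent_span_bound [OF 1(1)] polytabloid_independent(2)
    unfolding cfun_independent_def by blast
  then show ?thesis using 1 polytabloid_independent(1) by (simp add: card_image)
qed

lemma irr_char_id: "irr_char la id = of_nat (kostka (part_of la) (mset_set {1..n}))"
proof -
  have "\<exists>B. cfun_independent B \<and> cfun_span B = specht la"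
  proof -
    obtain B where "B \<subseteq> specht la" "\<not> cfun.dependent B" "specht la \<subseteq> cfun_span B"
      using cfun.maximal_independent_subset by blast
    moreover have "cfun_span B \<subseteq> specht la"
      using \<open>B \<subseteq> specht la\<close> unfolding specht_def by (intro cfun.span_minimal cfun.subspace_span)
    ultimately show ?thesis unfolding cfun_independent_def by blast
  qed
  then have B: "cfun_independent (SOME B. cfun_independent B \<and> cfun_span B = specht la) \<and>
      cfun_span (SOME B. cfun_independent B \<and> cfun_span B = specht la) = specht la"
    by (rule someI_ex)
  define B where "B = (SOME B. cfun_independent B \<and> cfun_span B = specht la)"
  have B': "cfun_independent B" "cfun_span B = specht la" using B unfolding B_def by auto
  have "irr_char la id = (\<Sum>b\<in>B. cfun_representation B (perm_act id b) b)"
    by (simp add: irr_char_def trace_on_def B_def Let_def)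
  also have "\<dots> = (\<Sum>b\<in>B. 1)"
  proof (rule sum.cong [OF refl])
    fix b assume b: "b \<in> B"
    have "perm_act id b = b" by (simp add: perm_act_def inv_id)
    moreover have "cfun_representation B b b = 1"
      unfolding cfun_representation_def using cfun.representation_basis [of B b] B'(1) b
      unfolding cfun_independent_def cfun_representation_def by simp
    ultimately show "cfun_representation B (perm_act id b) b = 1" by simp
  qed
  also have "\<dots> = of_nat (card std)" using specht_basis_card [OF B'] by simp
  finally show ?thesis by (simp add: std_def kostka_def)
qed

text \<open>A tableau of maximal row weight is column-increasing, so its polytabloid has a
  coefficient 1; but without standard tableaux \<open>specht_determined\<close> would make every
  element of the Specht module vanish.\<close>

lemma std_nonempty: "std \<noteq> {}"
proof
  assume e: "std = {}"
  have "card (cells la) = n"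
    unfolding cells_part_of using psize_part_of [of la] sum_list_la by (simp add: psize_def)
  then have "\<exists>T. bij_betw T (cells la) {1..n}"
    by (intro finite_same_card_bij finite_cells) simp_all
  then obtain T0 where "bij_betw T0 (cells la) {1..n}" by (elim exE)
  then have T0: "T0 \<in> tableaux la" by (simp add: tableaux_def sum_list_la)
  define w where "w T = row_weight (tabloid la T)" for T
  have "w ` tableaux la = row_weight ` tabloids" by (simp add: w_def tabloids_def image_image)
  then have fin: "finite (w ` tableaux la)" using finite_tabloids by simp
  then have "Max (w ` tableaux la) \<in> w ` tableaux la"
    using T0 by (intro Max_in [OF fin]) blast
  then obtain T where T: "T \<in> tableaux la" "w T = Max (w ` tableaux la)" by (elim imageE) simp
  have max: "w T' \<le> w T" if "T' \<in> tableaux la" for T'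
    unfolding T(2) using that by (intro Max_ge [OF fin] imageI)
  have "col_incr T"
  proof (rule ccontr)
    assume "\<not> col_incr T"
    then obtain \<sigma> where "\<sigma> \<in> column_stabilizer la T" "w T < w (\<sigma> \<circ> T)"
      using swap_increases_weight [OF T(1) id_column_stabilizer] unfolding w_def by auto
    then show False using max [OF column_stabilizer_tableau [OF T(1), of \<sigma>]] by (simp add: leD)
  qed
  then have "polytabloid la T (tabloid la T) = 1" by (rule polytabloid_diag [OF T(1)])
  moreover have "polytabloid la T = (\<lambda>_. 0)"
  proof (rule specht_determined)
    show "polytabloid la T \<in> specht la" unfolding specht_def using T(1) by (intro cfun.span_base) simp
  qed (simp add: e)
  ultimately show False by simp
qed

lemma kostka_std_pos: "kostka (part_of la) (mset_set {1..n}) > 0"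
  using std_nonempty finite_std by (simp add: kostka_def std_def card_gt_0_iff)

end


section \<open>Volume of a bounded polyhedron as a limit of grid point counts\<close>

section \<open>Counting lattice points and relative volume\<close>

text \<open>Fubini in the coordinate \<open>k\<close>: for fixed other coordinates the equation has
  at most one solution.\<close>

lemma AE_not_hyperplane:
  fixes \<alpha> :: "nat \<Rightarrow> real"
  assumes k: "k < d" "\<alpha> k \<noteq> 0"
  shows "AE t in (\<Pi>\<^sub>M i\<in>{..<d}. lborel). c + (\<Sum>i<d. t i * \<alpha> i) \<noteq> 0"
proof -
  interpret product_sigma_finite "\<lambda>_ :: nat. lborel :: real measure" by standard
  let ?M = "\<Pi>\<^sub>M i\<in>{..<d}. lborel :: real measure"
  define I where "I = {..<d} - {k}"
  have I: "{..<d} = insert k I" "k \<notin> I" "finite I" using k by (auto simp: I_def)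
  define H where "H = {t \<in> space ?M. c + (\<Sum>i<d. t i * \<alpha> i) = 0}"
  have "(\<lambda>t. c + (\<Sum>i<d. t i * \<alpha> i)) \<in> borel_measurable ?M"
    by measurable
  then have H: "H \<in> sets ?M" unfolding H_def by measurable
  have "emeasure ?M H = (\<integral>\<^sup>+ t. indicator H t \<partial>?M)" using H by simp
  also have "\<dots> = (\<integral>\<^sup>+ x. (\<integral>\<^sup>+ y. indicator H (x(k := y)) \<partial>lborel) \<partial>(\<Pi>\<^sub>M i\<in>I. lborel :: real measure))"
    unfolding I(1) using H I by (intro product_nn_integral_insert) (auto simp: I(1))
  also have "\<dots> = (\<integral>\<^sup>+ x. 0 \<partial>(\<Pi>\<^sub>M i\<in>I. lborel :: real measure))"
  proof (intro nn_integral_cong)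
    fix x :: "nat \<Rightarrow> real"
    define y0 where "y0 = - (c + (\<Sum>i\<in>I. x i * \<alpha> i)) / \<alpha> k"
    have "y = y0" if "x(k := y) \<in> H" for y
    proof -
      have "c + (\<Sum>i<d. (x(k := y)) i * \<alpha> i) = 0" using that unfolding H_def by (elim CollectE conjE)
      also have "(\<Sum>i<d. (x(k := y)) i * \<alpha> i) = y * \<alpha> k + (\<Sum>i\<in>I. (x(k := y)) i * \<alpha> i)"
        unfolding I(1) using I by simp
      also have "(\<Sum>i\<in>I. (x(k := y)) i * \<alpha> i) = (\<Sum>i\<in>I. x i * \<alpha> i)"
        using I by (intro sum.cong) auto
      finally show ?thesis using k by (simp add: y0_def field_simps)
    qed
    then have "(\<integral>\<^sup>+ y. indicator H (x(k := y)) \<partial>lborel) \<le> (\<integral>\<^sup>+ y. indicator {y0} y \<partial>lborel)"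
      by (intro nn_integral_mono) (auto simp: indicator_def)
    also have "\<dots> = 0" by simp
    finally show "(\<integral>\<^sup>+ y. indicator H (x(k := y)) \<partial>lborel) = 0" by simp
  qed
  finally have "H \<in> null_sets ?M" using H by (simp add: null_sets_def)
  then show ?thesis by (rule AE_I' ) (auto simp: H_def)
qed

lemma cube_measure:
  assumes "l \<le> u"
  shows "(\<Pi>\<^sub>E i\<in>{..<d}. {l..u :: real}) \<in> fmeasurable (\<Pi>\<^sub>M i\<in>{..<d}. lborel)"
    and "measure (\<Pi>\<^sub>M i\<in>{..<d}. lborel) (\<Pi>\<^sub>E i\<in>{..<d}. {l..u :: real}) = (u - l) ^ d"
proof -
  interpret finite_product_sigma_finite "\<lambda>_ :: nat. lborel :: real measure" "{..<d}"
    by standard simp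
  have e: "emeasure (\<Pi>\<^sub>M i\<in>{..<d}. lborel) (\<Pi>\<^sub>E i\<in>{..<d}. {l..u :: real}) = ennreal ((u - l) ^ d)"
    using assms by (subst measure_times) (auto simp: ennreal_power)
  then show "(\<Pi>\<^sub>E i\<in>{..<d}. {l..u :: real}) \<in> fmeasurable (\<Pi>\<^sub>M i\<in>{..<d}. lborel)"
    by (intro fmeasurableI sets_PiM_I_finite) auto
  show "measure (\<Pi>\<^sub>M i\<in>{..<d}. lborel) (\<Pi>\<^sub>E i\<in>{..<d}. {l..u :: real}) = (u - l) ^ d"
    using assms by (simp add: measure_def e)
qed

lemma fmeasurable_polyhedron:
  fixes a :: "'q \<Rightarrow> nat \<Rightarrow> real" and c :: "'q \<Rightarrow> real"
  assumes Q: "finite Q"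
    and K: "K = {t \<in> {..<d} \<rightarrow>\<^sub>E UNIV. \<forall>q\<in>Q. 0 \<le> c q + (\<Sum>i<d. t i * a q i)}"
    and B: "\<And>t i. t \<in> K \<Longrightarrow> i < d \<Longrightarrow> \<bar>t i\<bar> \<le> B"
  shows "K \<in> fmeasurable (\<Pi>\<^sub>M i\<in>{..<d}. lborel)"
proof (rule fmeasurableI2)
  let ?M = "\<Pi>\<^sub>M i\<in>{..<d}. lborel :: real measure"
  show "(\<Pi>\<^sub>E i\<in>{..<d}. {-\<bar>B\<bar>..\<bar>B\<bar>}) \<in> fmeasurable ?M" by (intro cube_measure) simp
  have "(\<lambda>t. c q + (\<Sum>i<d. t i * a q i)) \<in> borel_measurable ?M" for q by measurable
  then have "{t \<in> space ?M. \<forall>q\<in>Q. 0 \<le> c q + (\<Sum>i<d. t i * a q i)} \<in> sets ?M"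
    using Q by (intro sets.sets_Collect_finite_All borel_measurable_le) auto
  then show "K \<in> sets ?M" by (simp add: K space_PiM)
  show "K \<subseteq> (\<Pi>\<^sub>E i\<in>{..<d}. {-\<bar>B\<bar>..\<bar>B\<bar>})"
  proof
    fix t assume t: "t \<in> K"
    have "t i \<in> {-\<bar>B\<bar>..\<bar>B\<bar>}" if "i < d" for i using B [OF t that] by auto
    then show "t \<in> (\<Pi>\<^sub>E i\<in>{..<d}. {-\<bar>B\<bar>..\<bar>B\<bar>})" using t by (simp add: K PiE_iff)
  qed
qed

text \<open>The shifted grid of mesh 1/m cuts space into half-open cells of volume 1/m^d, so the
  scaled count is the integral of the indicator \<open>f m\<close> of the cells whose corner lies in
  \<open>K\<close>. It converges to the indicator of \<open>K\<close> off the bounding hyperplanes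
  and is dominated by that of a cube. The shift \<open>s m\<close> allows grids that do not contain
  the origin of the chart.\<close>

lemma lattice_count_limit:
  fixes a :: "'q \<Rightarrow> nat \<Rightarrow> real" and c :: "'q \<Rightarrow> real" and s :: "nat \<Rightarrow> nat \<Rightarrow> real"
  assumes Q: "finite Q"
    and K: "K = {t \<in> {..<d} \<rightarrow>\<^sub>E UNIV. \<forall>q\<in>Q. 0 \<le> c q + (\<Sum>i<d. t i * a q i)}"
    and B: "\<And>t i. t \<in> K \<Longrightarrow> i < d \<Longrightarrow> \<bar>t i\<bar> \<le> B"
  shows "(\<lambda>m. real (card {z \<in> {..<d} \<rightarrow>\<^sub>E (UNIV :: int set).
      (\<lambda>i\<in>{..<d}. (of_int (z i) + s m i) / real m) \<in> K}) / real m ^ d)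
    \<longlonglongrightarrow> measure (\<Pi>\<^sub>M i\<in>{..<d}. lborel) K"
proof -
  interpret finite_product_sigma_finite "\<lambda>_ :: nat. lborel :: real measure" "{..<d}"
    by standard simp
  let ?M = "\<Pi>\<^sub>M i\<in>{..<d}. lborel :: real measure"
  define F where "F q t = c q + (\<Sum>i<d. t i * a q i)" for q t
  have spM: "space ?M = {..<d} \<rightarrow>\<^sub>E UNIV" by (simp add: space_PiM)
  have F: "F q \<in> borel_measurable ?M" for q unfolding F_def by measurable
  have K': "t \<in> K \<longleftrightarrow> t \<in> space ?M \<and> (\<forall>q\<in>Q. 0 \<le> F q t)" for t by (auto simp: K F_def spM)
  have Km: "K \<in> sets ?M" 
    by (rule fmeasurableD, rule fmeasurable_polyhedron [where B = B, OF Q K]) (rule B)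
  define zt where "zt m t = (\<lambda>i\<in>{..<d}. \<lfloor>real m * t i - s m i\<rfloor>)" for m and t :: "nat \<Rightarrow> real"
  define pt where "pt m z = (\<lambda>i\<in>{..<d}. (of_int (z i) + s m i) / real m)" for m and z :: "nat \<Rightarrow> int"
  define L where "L m = {z \<in> {..<d} \<rightarrow>\<^sub>E (UNIV :: int set). pt m z \<in> K}" for m
  define C where "C m z = (\<Pi>\<^sub>E i\<in>{..<d}. {(of_int (z i) + s m i) / real m ..< (of_int (z i) + s m i + 1) / real m})"
    for m and z :: "nat \<Rightarrow> int"
  define f where "f m t = (\<Sum>z\<in>L m. indicator (C m z) t :: real)" for m t
  \<comment> \<open>The cube is enlarged by 1 because a point is within distance 1/m of the corner
    of its cell in every coordinate.\<close>
  define w where "w = (indicator (\<Pi>\<^sub>E i\<in>{..<d}. {-(B+1)..B+1}) :: (nat \<Rightarrow> real) \<Rightarrow> real)"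
  \<comment> \<open>This and what follows is stated for \<open>Suc m\<close> to avoid division by 0;
    \<open>LIMSEQ_imp_Suc\<close> returns to \<open>m\<close> at the end.\<close>
  have finL: "finite (L (Suc m))" for m
  proof -
    define b where "b i = \<lceil>real (Suc m) * \<bar>B\<bar> + \<bar>s (Suc m) i\<bar>\<rceil>" for i
    have "L (Suc m) \<subseteq> (\<Pi>\<^sub>E i\<in>{..<d}. {- b i..b i})"
    proof
      fix z assume z: "z \<in> L (Suc m)"
      have "z i \<in> {- b i..b i}" if i: "i < d" for i
      proof -
        have "\<bar>(of_int (z i) + s (Suc m) i) / real (Suc m)\<bar> \<le> \<bar>B\<bar>"
          using B [of "pt (Suc m) z" i] z i by (simp add: L_def pt_def)
        then have "\<bar>of_int (z i) + s (Suc m) i\<bar> \<le> real (Suc m) * \<bar>B\<bar>"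
          by (simp add: abs_divide divide_le_eq mult.commute)
        then have "\<bar>of_int (z i) :: real\<bar> \<le> real (Suc m) * \<bar>B\<bar> + \<bar>s (Suc m) i\<bar>" by linarith
        then have "of_int \<bar>z i\<bar> \<le> (of_int (b i) :: real)"
          unfolding b_def of_int_abs by (rule order.trans [OF _ le_of_int_ceiling])
        then have "\<bar>z i\<bar> \<le> b i" by (simp only: of_int_le_iff)
        then show ?thesis by auto
      qed
      then show "z \<in> (\<Pi>\<^sub>E i\<in>{..<d}. {- b i..b i})" using z by (auto simp: L_def PiE_iff)
    qed
    then show ?thesis by (rule finite_subset) (simp add: finite_PiE)
  qed
  have Cm: "C m z \<in> sets ?M" for m z unfolding C_def by (intro sets_PiM_I_finite) auto
  have Cmeas: "emeasure ?M (C (Suc m) z) = ennreal (1 / real (Suc m) ^ d)" for m z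
  proof -
    have "emeasure ?M (C (Suc m) z) = (\<Prod>i<d. ennreal (1 / real (Suc m)))"
      unfolding C_def by (subst measure_times) (auto simp: divide_right_mono simp flip: diff_divide_distrib)
    also have "\<dots> = ennreal (1 / real (Suc m) ^ d)" by (simp add: ennreal_power power_one_over)
    finally show ?thesis .
  qed
  have C_iff: "t \<in> C (Suc m) z \<longleftrightarrow> zt (Suc m) t = z"
    if "t \<in> space ?M" "z \<in> {..<d} \<rightarrow>\<^sub>E UNIV" for m z t
  proof -
    have "t \<in> C (Suc m) z \<longleftrightarrow> (\<forall>i<d. \<lfloor>real (Suc m) * t i - s (Suc m) i\<rfloor> = z i)"
      using that(1) unfolding C_def spM PiE_iff
      by (auto simp: floor_eq_iff divide_le_eq less_divide_eq algebra_simps simp del: of_nat_Suc)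
    also have "\<dots> \<longleftrightarrow> zt (Suc m) t = z"
    proof
      assume "\<forall>i<d. \<lfloor>real (Suc m) * t i - s (Suc m) i\<rfloor> = z i"
      then show "zt (Suc m) t = z"
        using that(2) by (intro PiE_ext [of _ "{..<d}" "\<lambda>_. UNIV"]) (auto simp: zt_def)
    qed (auto simp: zt_def)
    finally show ?thesis .
  qed
  have f_eq: "f (Suc m) t = indicator K (pt (Suc m) (zt (Suc m) t))" if "t \<in> space ?M" for m t
  proof -
    have "f (Suc m) t = (\<Sum>z\<in>L (Suc m). if zt (Suc m) t = z then 1 else 0)"
      unfolding f_def by (intro sum.cong refl) (auto simp: C_iff [OF that] L_def indicator_def)
    also have "\<dots> = indicator K (pt (Suc m) (zt (Suc m) t))"
      using finL [of m] by (auto simp: L_def indicator_def zt_def)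
    finally show ?thesis .
  qed
  have near: "\<bar>pt (Suc m) (zt (Suc m) t) i - t i\<bar> \<le> inverse (real (Suc m))" if "i < d" for m t i
  proof -
    let ?x = "real (Suc m) * t i - s (Suc m) i"
    have "pt (Suc m) (zt (Suc m) t) i - t i = (of_int \<lfloor>?x\<rfloor> - ?x) / real (Suc m)"
      using that by (simp add: pt_def zt_def field_simps del: of_nat_Suc)
    moreover have "\<bar>of_int \<lfloor>?x\<rfloor> - ?x\<bar> \<le> 1" by linarith
    ultimately show ?thesis by (simp add: abs_divide divide_le_eq inverse_eq_divide divide_right_mono del: of_nat_Suc)
  qed
  have "(\<lambda>m. integral\<^sup>L ?M (f (Suc m))) \<longlonglongrightarrow> integral\<^sup>L ?M (indicator K)"
  proof (rule integral_dominated_convergence)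
    show "(indicator K :: _ \<Rightarrow> real) \<in> borel_measurable ?M" using Km by simp
    show "f (Suc m) \<in> borel_measurable ?M" for m
      unfolding f_def by (intro borel_measurable_sum borel_measurable_indicator Cm)
    have "emeasure ?M (\<Pi>\<^sub>E i\<in>{..<d}. {-(B+1)..B+1}) < \<infinity>"
      by (subst measure_times) (auto simp: ennreal_power power_less_top_ennreal emeasure_lborel_Icc_eq)
    then show "integrable ?M w"
      unfolding w_def by (intro integrable_real_indicator sets_PiM_I_finite) auto
    show "AE t in ?M. norm (f (Suc m) t) \<le> w t" for m
    proof (rule AE_I2)
      fix t assume t: "t \<in> space ?M"
      have "w t = 1" if "pt (Suc m) (zt (Suc m) t) \<in> K"
      proof -
        have "t i \<in> {-(B+1)..B+1}" if i: "i < d" for i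
        proof -
          have "inverse (real (Suc m)) \<le> 1" by (simp add: inverse_le_1_iff)
          then show ?thesis using near [OF i, of m t] B [OF \<open>pt (Suc m) (zt (Suc m) t) \<in> K\<close> i]
            unfolding atLeastAtMost_iff by linarith
        qed
        then show ?thesis using t by (auto simp: w_def spM PiE_iff)
      qed
      then show "norm (f (Suc m) t) \<le> w t" unfolding f_eq [OF t]
        by (auto simp: indicator_def w_def)
    qed
    \<comment> \<open>A constraint with zero normal is constant in \<open>t\<close> and holds at the
      corner exactly if it holds at \<open>t\<close>; only the other hyperplanes have to be
      avoided.\<close>
    have nzAE: "AE t in ?M. \<forall>q\<in>{q \<in> Q. \<exists>k<d. a q k \<noteq> 0}. F q t \<noteq> 0"
    proof (subst AE_finite_all)
      show "\<forall>q\<in>{q \<in> Q. \<exists>k<d. a q k \<noteq> 0}. AE t in ?M. F q t \<noteq> 0"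
        unfolding F_def using AE_not_hyperplane by blast
    qed (use Q in simp)
    have lim: "(\<lambda>m. f (Suc m) t) \<longlonglongrightarrow> indicator K t"
      if t: "t \<in> space ?M" and nz: "\<forall>q\<in>{q \<in> Q. \<exists>k<d. a q k \<noteq> 0}. F q t \<noteq> 0" for t
    proof -
      let ?p = "\<lambda>m. pt (Suc m) (zt (Suc m) t)"
      have p: "(\<lambda>m. ?p m i) \<longlonglongrightarrow> t i" if "i < d" for i
      proof (rule LIM_zero_cancel, rule Lim_null_comparison [OF _ LIMSEQ_inverse_real_of_nat])
        show "\<forall>\<^sub>F m in sequentially. norm (?p m i - t i) \<le> inverse (real (Suc m))"
          using near [OF that] by simp
      qed
      have Fp: "(\<lambda>m. F q (?p m)) \<longlonglongrightarrow> F q t" for q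
        unfolding F_def by (intro tendsto_intros p) simp
      have "\<forall>\<^sub>F m in sequentially. (0 \<le> F q (?p m)) = (0 \<le> F q t)" if q: "q \<in> Q" for q
      proof (cases "\<exists>k<d. a q k \<noteq> 0")
        case False
        then show ?thesis by (simp add: F_def)
      next
        case True
        then have "F q t \<noteq> 0" using nz q by blast
        then consider "F q t > 0" | "F q t < 0" by linarith
        then show ?thesis
        proof cases
          case 1
          then show ?thesis using order_tendstoD(1) [OF Fp 1] by (auto elim!: eventually_mono)
        next
          case 2
          then show ?thesis using order_tendstoD(2) [OF Fp 2] by (auto elim!: eventually_mono)
        qed
      qed
      then have "\<forall>\<^sub>F m in sequentially. \<forall>q\<in>Q. (0 \<le> F q (?p m)) = (0 \<le> F q t)"
        using Q by (simp add: eventually_ball_finite)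
      then have "\<forall>\<^sub>F m in sequentially. f (Suc m) t = indicator K t"
      proof (rule eventually_mono)
        fix m assume e: "\<forall>q\<in>Q. (0 \<le> F q (?p m)) = (0 \<le> F q t)"
        have "?p m \<in> space ?M" by (auto simp: spM pt_def)
        then have "?p m \<in> K \<longleftrightarrow> t \<in> K" using e t by (simp add: K')
        then show "f (Suc m) t = indicator K t" unfolding f_eq [OF t] by (simp add: indicator_def)
      qed
      then show ?thesis by (rule tendsto_eventually)
    qed
    show "AE t in ?M. (\<lambda>m. f (Suc m) t) \<longlonglongrightarrow> indicator K t"
      using nzAE by (rule AE_mp) (rule AE_I2, use lim in blast)
  qed
  moreover have "integral\<^sup>L ?M (f (Suc m)) = real (card (L (Suc m))) / real (Suc m) ^ d" for m
  proof -
    have "integral\<^sup>L ?M (f (Suc m)) = (\<Sum>z\<in>L (Suc m). integral\<^sup>L ?M (indicator (C (Suc m) z)))"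
      unfolding f_def
      by (intro Bochner_Integration.integral_sum integrable_real_indicator Cm) (simp add: Cmeas)
    also have "\<dots> = (\<Sum>z\<in>L (Suc m). 1 / real (Suc m) ^ d)"
      using Cm by (intro sum.cong refl) (simp add: measure_def Cmeas del: of_nat_Suc)
    finally show ?thesis by simp
  qed
  moreover have "integral\<^sup>L ?M (indicator K) = measure ?M K" using Km by simp
  ultimately have "(\<lambda>m. real (card (L (Suc m))) / real (Suc m) ^ d) \<longlonglongrightarrow> measure ?M K" by simp
  then have "(\<lambda>m. real (card (L m)) / real m ^ d) \<longlonglongrightarrow> measure ?M K" by (rule LIMSEQ_imp_Suc)
  then show ?thesis by (simp add: L_def pt_def)
qed


section \<open>Relative volume is independent of the chart\<close>

lemma direction_nonempty_add:
  assumes "p \<in> affine hull P" "v \<in> direction P"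
  shows "p + v \<in> affine hull P"
proof -
  obtain x y where "x \<in> affine hull P" "y \<in> affine hull P" "v = x - y"
    using assms(2) by (auto simp: direction_def)
  then have "p + 1 *\<^sub>R (x - y) \<in> affine hull P"
    using assms(1) by (intro mem_affine_3_minus) auto
  then show ?thesis using \<open>v = x - y\<close> by simp
qed

lemma lattice_basis_coordinates:
  assumes b: "is_lattice_basis d b V"
  shows "\<exists>g :: nat \<Rightarrow> 'a::euclidean_space \<Rightarrow> real. \<forall>k<d. linear (g k) \<and> (\<forall>l<d. g k (b l) = (if k = l then 1 else 0))"
proof -
  have "\<exists>g. linear g \<and> (\<forall>x\<in>b ` {..<d}. g x = (if x = b k then 1 else 0 :: real))" for k
    using b by (intro linear_independent_extend) (simp add: is_lattice_basis_def)
  then obtain g :: "nat \<Rightarrow> 'a \<Rightarrow> real" where g: "\<And>k. linear (g k)" "\<And>k x. x \<in> b ` {..<d} \<Longrightarrow> g k x = (if x = b k then 1 else 0 :: real)"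
    by metis
  have "g k (b l) = (if k = l then 1 else 0)" if "k < d" "l < d" for k l
  proof -
    have "b l = b k \<longleftrightarrow> k = l"
      using inj_on_eq_iff [of b "{..<d}" l k] b that unfolding is_lattice_basis_def by auto
    then show ?thesis using g(2) [of "b l" k] that by simp
  qed
  then show ?thesis using g(1) by blast
qed

text \<open>The sequence on the left does not mention the chart \<open>p\<close>, \<open>b\<close>,
  while its limit is the measure in that chart; this is what makes the measure independent of the
  chart. For positivity, a point where all inequalities are strict is the centre of a cube inside
  the polytope.\<close>

lemma rel_volume_chart:
  fixes P :: "'a::euclidean_space set" and h :: "'q \<Rightarrow> 'a \<Rightarrow> real"
  assumes P: "P = {x \<in> affine hull P. \<forall>q\<in>Q. 0 \<le> h q x}" and bP: "bounded P"
    and Q: "finite Q" and h: "\<forall>q\<in>Q. linear (h q)"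
    and p0: "p0 \<in> P" and p: "p \<in> affine hull P" and b: "is_lattice_basis d b (direction P)"
  shows "(\<lambda>m. real (card {v \<in> integer_points \<inter> direction P. p0 + (1 / real m) *\<^sub>R v \<in> P}) / real m ^ d)
    \<longlonglongrightarrow> measure (\<Pi>\<^sub>M i\<in>{..<d}. lborel)
        {t \<in> {..<d} \<rightarrow>\<^sub>E UNIV. p + (\<Sum>i<d. t i *\<^sub>R b i) \<in> P}"
    (is ?limit)
    and "\<forall>q\<in>Q. 0 < h q p \<Longrightarrow>
      0 < measure (\<Pi>\<^sub>M i\<in>{..<d}. lborel) {t \<in> {..<d} \<rightarrow>\<^sub>E UNIV. p + (\<Sum>i<d. t i *\<^sub>R b i) \<in> P}"
proof -
  let ?K = "{t \<in> {..<d} \<rightarrow>\<^sub>E UNIV. p + (\<Sum>i<d. t i *\<^sub>R b i) \<in> P}"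
  obtain g :: "nat \<Rightarrow> 'a \<Rightarrow> real" where g: "\<And>k. k < d \<Longrightarrow> linear (g k)"
      "\<And>k l. k < d \<Longrightarrow> l < d \<Longrightarrow> g k (b l) = (if k = l then 1 else 0 :: real)"
    using lattice_basis_coordinates [OF b] by blast
  have g_sum: "g k (\<Sum>i<d. t i *\<^sub>R b i) = t k" if k: "k < d" for k t
  proof -
    have "g k (\<Sum>i<d. t i *\<^sub>R b i) = (\<Sum>i<d. t i * g k (b i))"
      using g(1) [OF k] by (simp add: linear_sum linear_scale)
    also have "\<dots> = (\<Sum>i<d. if i = k then t i else 0)" using g(2) k by (intro sum.cong) auto
    finally show ?thesis using k by simp
  qed
  have span: "span (b ` {..<d}) = direction P" and inj: "inj_on b {..<d}"
    and lat: "integer_points \<inter> direction P = {(\<Sum>i<d. of_int (c i) *\<^sub>R b i) | c :: nat \<Rightarrow> int. True}"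
    using b by (auto simp: is_lattice_basis_def)
  have dir: "(\<Sum>i<d. t i *\<^sub>R b i) \<in> direction P" for t
    unfolding span [symmetric] by (intro span_sum span_scale span_base) auto
  have mem_P: "p + (\<Sum>i<d. t i *\<^sub>R b i) \<in> P \<longleftrightarrow> (\<forall>q\<in>Q. 0 \<le> h q p + (\<Sum>i<d. t i * h q (b i)))" for t
  proof -
    have "h q (p + (\<Sum>i<d. t i *\<^sub>R b i)) = h q p + (\<Sum>i<d. t i * h q (b i))" if "q \<in> Q" for q
      using bspec [OF h that] by (simp add: linear_add linear_sum linear_scale)
    then show ?thesis using direction_nonempty_add [OF p dir [of t]] by (subst P) auto
  qed
  have K: "?K = {t \<in> {..<d} \<rightarrow>\<^sub>E UNIV. \<forall>q\<in>Q. 0 \<le> h q p + (\<Sum>i<d. t i * h q (b i))}"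
    by (simp only: mem_P)
  have "\<exists>B. \<forall>t\<in>?K. \<forall>i<d. \<bar>t i\<bar> \<le> B"
  proof -
    obtain R where R: "\<And>x. x \<in> P \<Longrightarrow> norm x \<le> R" using bP by (auto simp: bounded_iff)
    have "\<exists>C. \<forall>x. \<bar>g k x\<bar> \<le> C * norm x" if "k < d" for k
      using linear_bounded [OF g(1) [OF that]] by auto
    then obtain C where C: "\<And>k x. k < d \<Longrightarrow> \<bar>g k x\<bar> \<le> C k * norm x" by metis
    have "\<bar>t i\<bar> \<le> (\<Sum>k<d. \<bar>C k\<bar> * (R + norm p))" if t: "t \<in> ?K" and i: "i < d" for t i
    proof -
      let ?v = "\<Sum>j<d. t j *\<^sub>R b j"
      have "norm ?v \<le> norm (p + ?v) + norm p" using norm_triangle_ineq4 [of "p + ?v" p] by simp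
      also have "\<dots> \<le> R + norm p" using R t by simp
      finally have v: "norm ?v \<le> R + norm p" .
      then have R0: "0 \<le> R + norm p" by (rule order_trans [OF norm_ge_zero])
      have "\<bar>t i\<bar> \<le> C i * norm ?v" using C [OF i, of ?v] g_sum [OF i] by simp
      also have "\<dots> \<le> \<bar>C i\<bar> * (R + norm p)" using v by (intro mult_mono) auto
      also have "\<dots> \<le> (\<Sum>k<d. \<bar>C k\<bar> * (R + norm p))"
        using i R0 by (intro member_le_sum) auto
      finally show ?thesis .
    qed
    then show ?thesis by (intro exI ballI allI impI)
  qed
  then obtain B where B: "\<forall>t\<in>?K. \<forall>i<d. \<bar>t i\<bar> \<le> B" by (elim exE)
  show "0 < measure (\<Pi>\<^sub>M i\<in>{..<d}. lborel) ?K" if pos: "\<forall>q\<in>Q. 0 < h q p"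
  proof -
    define \<sigma> where "\<sigma> q = (\<Sum>i<d. \<bar>h q (b i)\<bar>)" for q
    \<comment> \<open>A move of at most \<open>\<epsilon>\<close> in every coordinate changes
      \<open>h q\<close> by at most \<open>\<epsilon> * \<sigma> q\<close>, which must not exceed
      \<open>h q p\<close>; the summand 1 keeps the denominator positive.\<close>
    define \<epsilon> where "\<epsilon> = Min (insert 1 ((\<lambda>q. h q p / (1 + \<sigma> q)) ` Q))"
    have \<sigma>: "\<sigma> q \<ge> 0" for q unfolding \<sigma>_def by (intro sum_nonneg) simp
    have \<epsilon>: "\<epsilon> > 0" unfolding \<epsilon>_def using Q pos \<sigma> by (simp add: divide_pos_pos add_pos_nonneg)
    have "(\<Pi>\<^sub>E i\<in>{..<d}. {-\<epsilon>..\<epsilon>}) \<subseteq> ?K"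
    proof
      fix t assume t: "t \<in> (\<Pi>\<^sub>E i\<in>{..<d}. {-\<epsilon>..\<epsilon>})"
      have "0 \<le> h q p + (\<Sum>i<d. t i * h q (b i))" if q: "q \<in> Q" for q
      proof -
        have "\<epsilon> \<le> h q p / (1 + \<sigma> q)" unfolding \<epsilon>_def using Q q by (intro Min_le) auto
        then have "\<epsilon> * (1 + \<sigma> q) \<le> h q p" using \<sigma> [of q] by (simp add: pos_le_divide_eq add_pos_nonneg)
        then have "\<epsilon> * \<sigma> q \<le> h q p" using \<epsilon> by (simp add: algebra_simps)
        moreover have "\<bar>\<Sum>i<d. t i * h q (b i)\<bar> \<le> (\<Sum>i<d. \<epsilon> * \<bar>h q (b i)\<bar>)"
        proof (rule order_trans [OF sum_abs], rule sum_mono)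
          fix i assume "i \<in> {..<d}"
          then have "t i \<in> {-\<epsilon>..\<epsilon>}" using t by (auto simp: PiE_iff)
          then have "\<bar>t i\<bar> \<le> \<epsilon>" by (simp add: abs_le_iff)
          then show "\<bar>t i * h q (b i)\<bar> \<le> \<epsilon> * \<bar>h q (b i)\<bar>" by (simp add: abs_mult mult_right_mono)
        qed
        ultimately show ?thesis by (simp add: \<sigma>_def sum_distrib_left)
      qed
      then show "t \<in> ?K" unfolding K using t by (simp add: PiE_iff)
    qed
    moreover have "(\<Pi>\<^sub>E i\<in>{..<d}. {-\<epsilon>..\<epsilon>}) \<in> sets (\<Pi>\<^sub>M i\<in>{..<d}. lborel)"
      by (rule fmeasurableD, rule cube_measure) (use \<epsilon> in simp)
    moreover have "?K \<in> fmeasurable (\<Pi>\<^sub>M i\<in>{..<d}. lborel)"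
      using B by (intro fmeasurable_polyhedron [where B = B, OF Q K]) blast
    ultimately have "measure (\<Pi>\<^sub>M i\<in>{..<d}. lborel) (\<Pi>\<^sub>E i\<in>{..<d}. {-\<epsilon>..\<epsilon>}) \<le> measure (\<Pi>\<^sub>M i\<in>{..<d}. lborel) ?K"
      by (rule measure_mono_fmeasurable)
    moreover have "measure (\<Pi>\<^sub>M i\<in>{..<d}. lborel) (\<Pi>\<^sub>E i\<in>{..<d}. {-\<epsilon>..\<epsilon>}) = (2 * \<epsilon>) ^ d"
      using \<epsilon> by (subst cube_measure) auto
    moreover have "(2 * \<epsilon>) ^ d > 0" using \<epsilon> by simp
    ultimately show ?thesis by linarith
  qed
  have "p0 \<in> affine hull P" using p0 by (rule hull_inc)
  then have "p0 - p \<in> span (b ` {..<d})" unfolding span using p by (auto simp: direction_def)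
  then obtain u where "p0 - p = (\<Sum>x\<in>b ` {..<d}. u x *\<^sub>R x)" by (auto simp: span_finite)
  then have u: "p0 = p + (\<Sum>i<d. u (b i) *\<^sub>R b i)" using inj by (simp add: sum.reindex algebra_simps)
  \<comment> \<open>The coordinates of \<open>p0\<close> relative to \<open>p\<close>, scaled by
    \<open>m\<close>: the shift of the grid.\<close>
  define s where "s m i = real m * u (b i)" for m i
  define L where "L m = {z \<in> {..<d} \<rightarrow>\<^sub>E (UNIV :: int set).
      (\<lambda>i\<in>{..<d}. (of_int (z i) + s m i) / real m) \<in> ?K}" for m
  define f where "f z = (\<Sum>i<d. of_int (z i) *\<^sub>R b i)" for z :: "nat \<Rightarrow> int"
  have "bij_betw f (L m) {v \<in> integer_points \<inter> direction P. p0 + (1 / real m) *\<^sub>R v \<in> P}" if m: "m > 0" for m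
  proof -
    have key: "(\<lambda>i\<in>{..<d}. (of_int (z i) + s m i) / real m) \<in> ?K \<longleftrightarrow> p0 + (1 / real m) *\<^sub>R f z \<in> P" for z
    proof -
      have "p + (\<Sum>i<d. (\<lambda>i\<in>{..<d}. (of_int (z i) + s m i) / real m) i *\<^sub>R b i) =
          p + (\<Sum>i<d. u (b i) *\<^sub>R b i + (1 / real m) *\<^sub>R (of_int (z i) *\<^sub>R b i))"
        using m by (intro arg_cong [where f = "(+) p"] sum.cong)
          (auto simp: s_def add_divide_distrib scaleR_add_left add.commute)
      also have "\<dots> = p0 + (1 / real m) *\<^sub>R f z"
        unfolding u f_def by (simp add: sum.distrib scaleR_sum_right add.assoc)
      finally show ?thesis by simp
    qed
    have "inj_on f (L m)"
    proof (rule inj_onI)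
      fix x y assume xy: "x \<in> L m" "y \<in> L m" "f x = f y"
      have "x k = y k" if "k < d" for k
      proof -
        have "real_of_int (x k) = real_of_int (y k)"
          using g_sum [OF that, of "\<lambda>i. of_int (x i)"] g_sum [OF that, of "\<lambda>i. of_int (y i)"] xy(3)
          unfolding f_def by simp
        then show ?thesis by simp
      qed
      then show "x = y" using xy(1,2) unfolding L_def by (intro PiE_ext [of x "{..<d}" "\<lambda>_. UNIV" y]) auto
    qed
    moreover have "f ` L m = {v \<in> integer_points \<inter> direction P. p0 + (1 / real m) *\<^sub>R v \<in> P}"
    proof (intro equalityI subsetI)
      fix v assume "v \<in> f ` L m"
      then show "v \<in> {v \<in> integer_points \<inter> direction P. p0 + (1 / real m) *\<^sub>R v \<in> P}"
        using key unfolding lat L_def f_def by blast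
    next
      fix v assume v: "v \<in> {v \<in> integer_points \<inter> direction P. p0 + (1 / real m) *\<^sub>R v \<in> P}"
      then obtain z where z: "v = f z" unfolding lat f_def by blast
      define z' where "z' = restrict z {..<d}"
      have "v = f z'" unfolding z f_def by (intro sum.cong) (auto simp: z'_def)
      moreover from this have "z' \<in> L m" using v key [of z'] unfolding L_def by (simp add: z'_def)
      ultimately show "v \<in> f ` L m" by blast
    qed
    ultimately show ?thesis by (simp add: bij_betw_def)
  qed
  then have card: "card {v \<in> integer_points \<inter> direction P. p0 + (1 / real m) *\<^sub>R v \<in> P} = card (L m)" if "m > 0" for m
    using bij_betw_same_card [symmetric] that by blast
  have "(\<lambda>m. real (card (L m)) / real m ^ d) \<longlonglongrightarrow> measure (\<Pi>\<^sub>M i\<in>{..<d}. lborel) ?K"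
    unfolding L_def using B by (intro lattice_count_limit [OF Q K]) blast
  then show ?limit
  proof (rule Lim_transform_eventually)
    show "\<forall>\<^sub>F m in sequentially. real (card (L m)) / real m ^ d =
        real (card {v \<in> integer_points \<inter> direction P. p0 + (1 / real m) *\<^sub>R v \<in> P}) / real m ^ d"
      using eventually_gt_at_top [of 0] by (rule eventually_mono) (simp only: card)
  qed
qed

text \<open>All charts have the same dimension \<open>d\<close>, and their measures are limits of
  one and the same sequence. So the description in \<open>rel_volume\<close> has a unique solution,
  namely this limit.\<close>

lemma rel_volume_limit:
  fixes P :: "'a::euclidean_space set" and h :: "'q \<Rightarrow> 'a \<Rightarrow> real"
  assumes P: "P = {x \<in> affine hull P. \<forall>q\<in>Q. 0 \<le> h q x}" and bP: "bounded P"
    and Q: "finite Q" and h: "\<forall>q\<in>Q. linear (h q)"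
    and p0: "p0 \<in> P" and b: "is_lattice_basis d b (direction P)"
  shows "(\<lambda>m. real (card {v \<in> integer_points \<inter> direction P. p0 + (1 / real m) *\<^sub>R v \<in> P}) / real m ^ d)
    \<longlonglongrightarrow> rel_volume P"
    (is "?N \<longlonglongrightarrow> _")
    and "p \<in> affine hull P \<Longrightarrow> \<forall>q\<in>Q. 0 < h q p \<Longrightarrow> 0 < rel_volume P"
proof -
  let ?m = "\<lambda>p d b. measure (\<Pi>\<^sub>M i\<in>{..<d}. lborel)
      {t \<in> {..<d} \<rightarrow>\<^sub>E UNIV. p + (\<Sum>i<d. t i *\<^sub>R b i) \<in> P}"
  note chart = rel_volume_chart(1) [OF P bP Q h p0]
  have p0': "p0 \<in> affine hull P" using p0 by (rule hull_inc)
  have dim: "d' = dim (direction P)" if "is_lattice_basis d' b' (direction P)" for d' and b' :: "nat \<Rightarrow> 'a"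
  proof -
    have "dim (direction P) = card (b' ` {..<d'})"
      using that unfolding is_lattice_basis_def by (metis dim_span dim_eq_card_independent)
    then show ?thesis using that by (simp add: is_lattice_basis_def card_image)
  qed
  have eq: "rel_volume P = ?m p0 d b" if p0': "p0 \<in> affine hull P" for p0
    unfolding rel_volume_def
  proof (rule the_equality)
    show "\<exists>p d' b'. p \<in> affine hull P \<and> is_lattice_basis d' b' (direction P) \<and> ?m p0 d b = ?m p d' b'"
      using p0' b by (intro exI [of _ p0] exI [of _ d] exI [of _ b] conjI refl)
    fix v assume "\<exists>p d' b'. p \<in> affine hull P \<and> is_lattice_basis d' b' (direction P) \<and> v = ?m p d' b'"
    then obtain p d' b' where v: "p \<in> affine hull P" "is_lattice_basis d' b' (direction P)" "v = ?m p d' b'"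
      by (elim exE conjE)
    have "d' = d" using dim [OF b] dim [OF v(2)] by simp
    have "?N \<longlonglongrightarrow> v" unfolding v(3) using chart [OF v(1,2)] by (simp only: \<open>d' = d\<close>)
    then show "v = ?m p0 d b" using chart [OF p0' b] by (rule LIMSEQ_unique)
  qed
  show "?N \<longlonglongrightarrow> rel_volume P" unfolding eq [OF p0'] by (rule chart [OF p0' b])
  show "0 < rel_volume P" if "p \<in> affine hull P" "\<forall>q\<in>Q. 0 < h q p"
    unfolding eq [OF that(1)] by (rule rel_volume_chart(2) [OF P bP Q h p0 that(1) b that(2)])
qed


text \<open>Dual coordinates that are integral on integer points ensure that integer combinations of
  the basis reach every lattice point.\<close>

lemma is_lattice_basisI:
  assumes V: "subspace V" and b: "\<And>k. k < d \<Longrightarrow> b k \<in> V \<inter> integer_points"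
    and g: "\<And>k l. k < d \<Longrightarrow> l < d \<Longrightarrow> g k (b l) = (if k = l then 1 else 0 :: real)"
    and lin: "\<And>k. k < d \<Longrightarrow> linear (g k)"
    and exp: "\<And>v. v \<in> V \<Longrightarrow> v = (\<Sum>k<d. g k v *\<^sub>R b k)"
    and int: "\<And>k v. k < d \<Longrightarrow> v \<in> integer_points \<Longrightarrow> g k v \<in> \<int>"
  shows "is_lattice_basis d b V"
  unfolding is_lattice_basis_def
proof (intro conjI)
  show inj: "inj_on b {..<d}"
  proof (rule inj_onI)
    fix k l assume kl: "k \<in> {..<d}" "l \<in> {..<d}" "b k = b l"
    then have "g k (b k) = g k (b l)" by simp
    then show "k = l" using g [of k k] g [of k l] kl(1,2) by (auto split: if_splits)
  qed
  have g_sum: "g k (\<Sum>i<d. t i *\<^sub>R b i) = t k" if k: "k < d" for k t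
  proof -
    have "g k (\<Sum>i<d. t i *\<^sub>R b i) = (\<Sum>i<d. t i * g k (b i))"
      using lin [OF k] by (simp add: linear_sum linear_scale)
    also have "\<dots> = (\<Sum>i<d. if i = k then t i else 0)" using g k by (intro sum.cong) auto
    finally show ?thesis using k by simp
  qed
  show "independent (b ` {..<d})"
  proof (rule independent_if_scalars_zero)
    fix f x assume s: "(\<Sum>x\<in>b ` {..<d}. f x *\<^sub>R x) = 0" and x: "x \<in> b ` {..<d}"
    obtain k where k: "k < d" "x = b k" using x by blast
    have "(\<Sum>i<d. f (b i) *\<^sub>R b i) = 0" using s inj by (simp add: sum.reindex)
    then show "f x = 0" using g_sum [OF k(1), of "\<lambda>i. f (b i)"] linear_0 [OF lin [OF k(1)]] k(2) by simp
  qed simp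
  show "span (b ` {..<d}) = V"
  proof
    show "span (b ` {..<d}) \<subseteq> V" using b by (intro span_minimal V) auto
    show "V \<subseteq> span (b ` {..<d})"
    proof
      fix v assume "v \<in> V"
      then have v: "v = (\<Sum>k<d. g k v *\<^sub>R b k)" by (rule exp)
      have "(\<Sum>k<d. g k v *\<^sub>R b k) \<in> span (b ` {..<d})"
        by (intro span_sum span_scale span_base) simp
      then show "v \<in> span (b ` {..<d})" by (subst v)
    qed
  qed
  show "integer_points \<inter> V = {\<Sum>i<d. of_int (c i) *\<^sub>R b i |c :: nat \<Rightarrow> int. True}"
  proof (intro equalityI subsetI)
    fix v assume v: "v \<in> integer_points \<inter> V"
    define c where "c i = \<lfloor>g i v\<rfloor>" for i
    have "of_int (c i) = g i v" if "i < d" for i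
      using int [OF that, of v] v by (simp add: c_def)
    then have "(\<Sum>i<d. of_int (c i) *\<^sub>R b i) = (\<Sum>i<d. g i v *\<^sub>R b i)" by simp
    also have "\<dots> = v" using exp v by (auto simp flip: exp)
    finally show "v \<in> {\<Sum>i<d. of_int (c i) *\<^sub>R b i |c :: nat \<Rightarrow> int. True}" by (intro CollectI exI [of _ c]) simp
  next
    fix v assume "v \<in> {\<Sum>i<d. of_int (c i) *\<^sub>R b i |c :: nat \<Rightarrow> int. True}"
    then obtain c :: "nat \<Rightarrow> int" where v: "v = (\<Sum>i<d. of_int (c i) *\<^sub>R b i)" by blast
    have "v \<in> V" unfolding v using b by (intro subspace_sum [OF V] subspace_scale [OF V]) auto
    moreover have "v \<bullet> e \<in> \<int>" if e: "e \<in> Basis" for e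
      unfolding v inner_sum_left inner_scaleR_left
    proof (intro Ints_sum Ints_mult Ints_of_int)
      show "b i \<bullet> e \<in> \<int>" if "i \<in> {..<d}" for i
        using b [of i] e that by (simp add: integer_points_def)
    qed
    ultimately show "v \<in> integer_points \<inter> V" by (simp add: integer_points_def)
  qed
qed

section \<open>Lattice, affine hull and volume of the polytope of symmetric stochastic
  matrices\<close>

section \<open>Symmetric stochastic matrices\<close>

definition zero_sum_matrices :: "(real ^ 'n ^ 'n) set" where
  "zero_sum_matrices = {A. transpose A = A \<and> (\<forall>i. (\<Sum>j\<in>UNIV. A $ i $ j) = 0)}"

lemma transpose_eq_iff: "transpose A = A \<longleftrightarrow> (\<forall>i j. A $ i $ j = A $ j $ i)"
  by (auto simp: transpose_def vec_eq_iff)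

lemma integer_points_matrix: "A \<in> integer_points \<longleftrightarrow> (\<forall>i j. A $ i $ j \<in> \<int>)"
  for A :: "real ^ 'n ^ 'm"
  unfolding integer_points_def Basis_vec_def by (auto simp: inner_axis)

definition uniform_matrix :: "real ^ 'n ^ 'n" where
  "uniform_matrix = (\<chi> i j. 1 / real CARD('n))"

lemma uniform_matrix_stochastic: "uniform_matrix \<in> sym_stochastic"
  by (simp add: uniform_matrix_def sym_stochastic_def transpose_eq_iff)

text \<open>The uniform matrix J has positive entries, so J + eps (A - J) stays non-negative for
  small eps, and A lies on the line through J and this stochastic matrix.\<close>

lemma affine_hull_stochastic:
  "affine hull sym_stochastic = {A :: real ^ 'n ^ 'n. transpose A = A \<and> (\<forall>i. (\<Sum>j\<in>UNIV. A $ i $ j) = 1)}"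
    (is "_ = ?A")
proof
  have "affine ?A"
    unfolding affine_def
    by (auto simp: transpose_eq_iff sum.distrib simp flip: sum_distrib_left)
  then show "affine hull sym_stochastic \<subseteq> ?A"
    by (intro hull_minimal) (auto simp: sym_stochastic_def)
  show "?A \<subseteq> affine hull sym_stochastic"
  proof
    fix A assume A: "A \<in> ?A"
    define J where "J = (uniform_matrix :: real ^ 'n ^ 'n)"
    define \<epsilon> where "\<epsilon> = 1 / (1 + real CARD('n) * norm (A - J))"
    have \<epsilon>: "\<epsilon> > 0" unfolding \<epsilon>_def by (simp add: add_pos_nonneg)
    have J: "J \<in> sym_stochastic" unfolding J_def by (rule uniform_matrix_stochastic)
    have "0 \<le> (J + \<epsilon> *\<^sub>R (A - J)) $ i $ j" for i j
    proof -
      have "\<bar>(A - J) $ i $ j\<bar> \<le> norm (A - J)"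
        using component_le_norm_cart [of "(A - J) $ i" j] Finite_Cartesian_Product.norm_nth_le [of "A - J" i]
        by linarith
      then have "\<epsilon> * \<bar>(A - J) $ i $ j\<bar> \<le> \<epsilon> * norm (A - J)" using \<epsilon> by (intro mult_left_mono) auto
      also have "\<dots> \<le> 1 / real CARD('n)"
        unfolding \<epsilon>_def by (simp add: field_simps add_pos_nonneg)
      finally have "\<bar>\<epsilon> * (A - J) $ i $ j\<bar> \<le> 1 / real CARD('n)" using \<epsilon> by (simp add: abs_mult)
      then have "0 \<le> 1 / real CARD('n) + \<epsilon> * (A - J) $ i $ j" by linarith
      then show ?thesis by (simp add: J_def uniform_matrix_def)
    qed
    then have J\<epsilon>: "J + \<epsilon> *\<^sub>R (A - J) \<in> sym_stochastic"
      using A J by (auto simp: sym_stochastic_def transpose_eq_iff sum.distrib sum_subtractf simp flip: sum_distrib_left)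
    have "J + (1 / \<epsilon>) *\<^sub>R ((J + \<epsilon> *\<^sub>R (A - J)) - J) \<in> affine hull sym_stochastic"
      by (rule mem_affine_3_minus [OF affine_affine_hull hull_inc [OF J] hull_inc [OF J\<epsilon>] hull_inc [OF J]])
    then show "A \<in> affine hull sym_stochastic" using \<epsilon> by simp
  qed
qed

lemma direction_stochastic: "direction sym_stochastic = (zero_sum_matrices :: (real ^ 'n ^ 'n) set)"
proof
  show "direction sym_stochastic \<subseteq> (zero_sum_matrices :: (real ^ 'n ^ 'n) set)"
    unfolding direction_def affine_hull_stochastic
    by (auto simp: zero_sum_matrices_def transpose_eq_iff sum_subtractf)
  show "zero_sum_matrices \<subseteq> (direction sym_stochastic :: (real ^ 'n ^ 'n) set)"
  proof
    fix A :: "real ^ 'n ^ 'n" assume A: "A \<in> zero_sum_matrices"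
    have J: "uniform_matrix \<in> affine hull (sym_stochastic :: (real ^ 'n ^ 'n) set)"
      by (rule hull_inc, rule uniform_matrix_stochastic)
    then have "uniform_matrix + A \<in> affine hull sym_stochastic"
      using A unfolding affine_hull_stochastic
      by (simp add: zero_sum_matrices_def transpose_eq_iff sum.distrib)
    moreover have "A = (uniform_matrix + A) - uniform_matrix" by simp
    ultimately show "A \<in> direction sym_stochastic" unfolding direction_def using J by blast
  qed
qed

lemma bounded_stochastic: "bounded (sym_stochastic :: (real ^ 'n ^ 'n) set)"
proof (rule boundedI)
  fix A :: "real ^ 'n ^ 'n" assume A: "A \<in> sym_stochastic"
  have "norm A \<le> (\<Sum>i\<in>UNIV. norm (A $ i))" 
    unfolding norm_vec_def by (intro L2_set_le_sum) simp
  also have "\<dots> \<le> (\<Sum>i\<in>(UNIV :: 'n set). 1)"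
  proof (rule sum_mono)
    fix i
    have "norm (A $ i) \<le> (\<Sum>j\<in>UNIV. \<bar>A $ i $ j\<bar>)" by (rule norm_le_l1_cart)
    also have "\<dots> = 1" using A by (simp add: sym_stochastic_def)
    finally show "norm (A $ i) \<le> 1" .
  qed
  finally show "norm A \<le> real CARD('n)" by simp
qed


text \<open>In matrix units, E_ij + E_ji - E_ii - E_jj: for distinct indices the symmetric zero-sum
  matrix with a single pair of off-diagonal entries 1.\<close>

definition swap_matrix :: "'n \<Rightarrow> 'n \<Rightarrow> real ^ 'n ^ 'n" where
  "swap_matrix i j = (\<chi> p q. (if p = i \<and> q = j then 1 else 0) + (if p = j \<and> q = i then 1 else 0)
     - (if p = i \<and> q = i then 1 else 0) - (if p = j \<and> q = j then 1 else 0))"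

lemma swap_matrix_nth: "swap_matrix i j $ p $ q = (if p = i \<and> q = j then 1 else 0) + (if p = j \<and> q = i then 1 else 0)
     - (if p = i \<and> q = i then 1 else 0) - (if p = j \<and> q = j then 1 else 0)"
  by (simp add: swap_matrix_def)

lemma swap_matrix_zero_sum:
  assumes "i \<noteq> j"
  shows "swap_matrix i j \<in> (zero_sum_matrices :: (real ^ 'n ^ 'n) set)"
proof -
  have "(\<Sum>q\<in>UNIV. swap_matrix i j $ p $ q) = 0" for p :: 'n
    using assms by (cases "p = i"; cases "p = j")
      (simp_all add: swap_matrix_nth sum_subtractf sum.distrib)
  moreover have "swap_matrix i j $ p $ q = swap_matrix i j $ q $ p" for p q :: 'n
    by (simp add: swap_matrix_nth conj_commute)
  ultimately show ?thesis by (simp add: zero_sum_matrices_def transpose_eq_iff)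
qed

text \<open>The entries on one side of the diagonal are free; symmetry gives the other side and the
  vanishing row sums give the diagonal. The injection \<open>r\<close> supplies a linear order on
  the index type.\<close>

lemma zero_sum_expansion:
  fixes A :: "real ^ 'n ^ 'n" and r :: "'n \<Rightarrow> nat"
  assumes r: "inj r" and A: "A \<in> zero_sum_matrices"
  shows "A = (\<Sum>(i, j)\<in>{(i, j). r i < r j}. A $ i $ j *\<^sub>R swap_matrix i j)"
proof -
  have sym: "A $ i $ j = A $ j $ i" and zero: "(\<Sum>j\<in>UNIV. A $ i $ j) = 0" for i j
    using A by (auto simp: zero_sum_matrices_def transpose_eq_iff)
  have r_iff: "r i = r j \<longleftrightarrow> i = j" for i j using r by (auto simp: inj_def)
  let ?B = "\<Sum>(i, j)\<in>{(i, j). r i < r j}. A $ i $ j *\<^sub>R swap_matrix i j"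
  have entry: "?B $ p $ q = (\<Sum>i\<in>UNIV. \<Sum>j\<in>UNIV. if r i < r j then A $ i $ j * swap_matrix i j $ p $ q else 0)" for p q
  proof -
    have E: "{x. r (fst x) < r (snd x)} = {x \<in> UNIV \<times> UNIV. r (fst x) < r (snd x)}" by auto
    have "?B $ p $ q = (\<Sum>x\<in>{x \<in> UNIV \<times> UNIV. r (fst x) < r (snd x)}.
        A $ fst x $ snd x * swap_matrix (fst x) (snd x) $ p $ q)"
      unfolding sum_component case_prod_unfold E by (simp only: vector_scaleR_component real_scaleR_def)
    also have "\<dots> = (\<Sum>x\<in>UNIV \<times> UNIV. if r (fst x) < r (snd x) then A $ fst x $ snd x * swap_matrix (fst x) (snd x) $ p $ q else 0)"
      by (rule sum.inter_filter) simp
    also have "\<dots> = (\<Sum>i\<in>UNIV. \<Sum>j\<in>UNIV. if r i < r j then A $ i $ j * swap_matrix i j $ p $ q else 0)"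
      unfolding sum.cartesian_product case_prod_unfold ..
    finally show ?thesis .
  qed
  have off: "?B $ p $ q = A $ p $ q" if pq: "r p < r q" for p q
  proof -
    have "(if r i < r j then A $ i $ j * swap_matrix i j $ p $ q else 0) =
        (if i = p then if j = q then A $ p $ q else 0 else 0)" for i j
    proof (cases "i = p \<and> j = q")
      case True
      moreover have "p \<noteq> q" using pq by auto
      ultimately show ?thesis using pq by (simp add: swap_matrix_nth)
    next
      case False
      have "p \<noteq> q" using pq by auto
      then have n: "\<not> (p = i \<and> q = j)" "\<not> (p = i \<and> q = i)" "\<not> (p = j \<and> q = j)" using False by blast+
      have "swap_matrix i j $ p $ q = 0" if "r i < r j"
      proof -
        have "\<not> (p = j \<and> q = i)" using pq that by (metis less_asym)
        with n show ?thesis unfolding swap_matrix_nth by (simp only: if_False)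
      qed
      then show ?thesis using False by (cases "r i < r j"; cases "i = p"; cases "j = q") simp_all
    qed
    then have "?B $ p $ q = (\<Sum>i\<in>UNIV. \<Sum>j\<in>UNIV. if i = p then if j = q then A $ p $ q else 0 else 0)"
      by (simp only: entry)
    also have "\<dots> = (\<Sum>i\<in>UNIV. if i = p then A $ p $ q else 0)"
      by (rule sum.cong) simp_all
    finally show ?thesis by simp
  qed
  have sym': "?B $ p $ q = ?B $ q $ p" for p q
  proof -
    have "swap_matrix i j $ p $ q = swap_matrix i j $ q $ p" for i j :: 'n
      by (simp add: swap_matrix_nth conj_commute)
    then show ?thesis by (simp only: entry)
  qed
  have diag: "?B $ p $ p = A $ p $ p" for p
  proof -
    define R where "R j = (if r p < r j then - A $ p $ j else 0)" for j
    define R' where "R' i = (if r i < r p then - A $ p $ i else 0)" for i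
    have "(if r i < r j then A $ i $ j * swap_matrix i j $ p $ p else 0) =
        (if i = p then R j else 0) + (if j = p then R' i else 0)" for i j
    proof (cases "r i < r j")
      case True
      then have "i \<noteq> j" by auto
      then show ?thesis using True sym [of i j]
        by (cases "i = p"; cases "j = p") (simp_all add: swap_matrix_nth R_def R'_def)
    qed (auto simp: R_def R'_def)
    then have "?B $ p $ p = (\<Sum>i\<in>UNIV. \<Sum>j\<in>UNIV. (if i = p then R j else 0) + (if j = p then R' i else 0))"
      by (simp only: entry)
    also have "\<dots> = (\<Sum>j\<in>UNIV. \<Sum>i\<in>UNIV. if i = p then R j else 0) + (\<Sum>i\<in>UNIV. \<Sum>j\<in>UNIV. if j = p then R' i else 0)"
      unfolding sum.distrib by (subst sum.swap) (rule refl)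
    also have "\<dots> = (\<Sum>j\<in>UNIV. R j + R' j)" by (simp add: sum.distrib)
    also have "\<dots> = (\<Sum>j\<in>UNIV. (if j = p then A $ p $ p else 0) - A $ p $ j)"
    proof (rule sum.cong [OF refl])
      fix j
      consider "r p < r j" | "r j < r p" | "j = p" using r_iff [of j p] by linarith
      then show "R j + R' j = (if j = p then A $ p $ p else 0) - A $ p $ j"
        by cases (auto simp: R_def R'_def)
    qed
    also have "\<dots> = A $ p $ p" using zero [of p] by (simp add: sum_subtractf)
    finally show ?thesis .
  qed
  have AB: "A $ p $ q = ?B $ p $ q" for p q
  proof -
    consider "r p < r q" | "r q < r p" | "p = q" using r_iff [of p q] by linarith
    then show ?thesis
      using off [of p q] off [of q p] sym [of p q] sym' [of p q] diag [of p] by cases simp_all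
  qed
  show ?thesis by (intro iffD2 [OF vec_eq_iff] allI AB)
qed

lemma card_ordered_pairs:
  fixes r :: "'n::finite \<Rightarrow> nat"
  assumes r: "inj r"
  shows "card {(i, j). r i < r j} = CARD('n) * (CARD('n) - 1) div 2"
proof -
  let ?E = "{(i, j). r i < r j}"
  have r_iff: "r i = r j \<longleftrightarrow> i = j" for i j using r by (auto simp: inj_def)
  have swap: "card (prod.swap ` ?E) = card ?E" by (intro card_image) simp
  have "(UNIV :: ('n \<times> 'n) set) = ?E \<union> (prod.swap ` ?E \<union> range (\<lambda>i. (i, i)))"
    using r_iff by (auto simp: image_iff)
  then have "CARD('n \<times> 'n) = card (?E \<union> (prod.swap ` ?E \<union> range (\<lambda>i. (i, i))))" by simp
  also have "\<dots> = card ?E + (card (prod.swap ` ?E) + card (range (\<lambda>i :: 'n. (i, i))))"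
    by (subst card_Un_disjoint; (subst card_Un_disjoint)?) auto
  also have "card (range (\<lambda>i :: 'n. (i, i))) = CARD('n)" by (intro card_image) (simp add: inj_on_def)
  finally have "CARD('n) * CARD('n) = 2 * card ?E + CARD('n)" by (simp add: swap)
  then have "CARD('n) * (CARD('n) - 1) = 2 * card ?E" by (simp add: algebra_simps)
  then show ?thesis by simp
qed

text \<open>The coordinates with respect to the swap matrices are matrix entries, hence integral on
  integer matrices.\<close>

lemma stochastic_lattice_basis:
  "\<exists>b. is_lattice_basis (CARD('n) * (CARD('n) - 1) div 2) b (zero_sum_matrices :: (real ^ 'n ^ 'n) set)"
proof -
  obtain r :: "'n \<Rightarrow> nat" where r: "inj r"
    using finite_imp_inj_to_nat_seg [of "UNIV :: 'n set"] by auto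
  let ?E = "{(i, j). r i < r j}"
  define d where "d = CARD('n) * (CARD('n) - 1) div 2"
  have "card ?E = d" unfolding d_def by (rule card_ordered_pairs [OF r])
  moreover obtain f where "bij_betw f {0..<card ?E} ?E"
    using ex_bij_betw_nat_finite [of ?E] finite by blast
  ultimately have f: "bij_betw f {..<d} ?E" by (simp add: atLeast0LessThan)
  define i where "i k = fst (f k)" for k
  define j where "j k = snd (f k)" for k
  have ij: "r (i k) < r (j k)" if "k < d" for k
    using bij_betwE [OF f] that by (force simp: i_def j_def)
  have eq: "k = l" if "k < d" "l < d" "i k = i l" "j k = j l" for k l
    using f that unfolding bij_betw_def by (auto simp: i_def j_def inj_on_def prod_eq_iff)
  have ne: "i k \<noteq> j k" if "k < d" for k using ij [OF that] by auto
  have "is_lattice_basis d (\<lambda>k. swap_matrix (i k) (j k)) (zero_sum_matrices :: (real ^ 'n ^ 'n) set)"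
  proof (rule is_lattice_basisI [where g = "\<lambda>k A. A $ i k $ j k"])
    show "subspace (zero_sum_matrices :: (real ^ 'n ^ 'n) set)"
      by (auto simp: subspace_def zero_sum_matrices_def transpose_eq_iff sum.distrib simp flip: sum_distrib_left)
    show "swap_matrix (i k) (j k) \<in> zero_sum_matrices \<inter> integer_points" if "k < d" for k
      using swap_matrix_zero_sum [OF ne [OF that]] by (simp add: integer_points_matrix swap_matrix_nth)
    show "swap_matrix (i l) (j l) $ i k $ j k = (if k = l then 1 else 0)" if "k < d" "l < d" for k l
    proof (cases "k = l")
      case True
      then show ?thesis using ne [OF that(1)] by (simp add: swap_matrix_nth)
    next
      case False
      then have "\<not> (i k = i l \<and> j k = j l)" using eq [OF that] by blast
      moreover have "\<not> (i k = j l \<and> j k = i l)" using ij [OF that(1)] ij [OF that(2)] by (metis less_asym)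
      moreover have "\<not> (i k = i l \<and> j k = i l)" "\<not> (i k = j l \<and> j k = j l)" using ne [OF that(1)] by metis+
      ultimately show ?thesis unfolding swap_matrix_nth using False by (simp only: if_False)
    qed
    show "linear (\<lambda>A :: real ^ 'n ^ 'n. A $ i k $ j k)" for k by (rule linearI) simp_all
    show "A = (\<Sum>k<d. A $ i k $ j k *\<^sub>R swap_matrix (i k) (j k))" if "A \<in> zero_sum_matrices" for A
    proof -
      have "A = (\<Sum>x\<in>?E. A $ fst x $ snd x *\<^sub>R swap_matrix (fst x) (snd x))"
        using zero_sum_expansion [OF r that] by (simp add: case_prod_unfold)
      also have "\<dots> = (\<Sum>k<d. A $ i k $ j k *\<^sub>R swap_matrix (i k) (j k))"
        using sum.reindex_bij_betw [OF f, of "\<lambda>x. A $ fst x $ snd x *\<^sub>R swap_matrix (fst x) (snd x)"]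
        by (simp add: i_def j_def)
      finally show ?thesis .
    qed
    show "A $ i k $ j k \<in> \<int>" if "A \<in> integer_points" for k and A :: "real ^ 'n ^ 'n"
      using that by (simp add: integer_points_matrix)
  qed
  then show ?thesis unfolding d_def by blast
qed

definition sym_nat_matrices :: "nat \<Rightarrow> ('n \<Rightarrow> 'n \<Rightarrow> nat) set" where
  "sym_nat_matrices m = {X. (\<forall>i j. X i j = X j i) \<and> (\<forall>i. (\<Sum>j\<in>UNIV. X i j) = m)}"

text \<open>The identity matrix is an integral point, so scaling by \<open>m\<close> sends the
  counted points to integral points of the m-th dilate; in coordinates, a matrix \<open>X\<close>
  corresponds to the difference of \<open>X\<close> and \<open>m\<close> times the identity.\<close>

lemma card_sym_nat_matrices:
  assumes m: "m > 0"
  shows "card {v \<in> integer_points \<inter> zero_sum_matrices. mat 1 + (1 / real m) *\<^sub>R v \<in> (sym_stochastic :: (real ^ 'n ^ 'n) set)} =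
    card (sym_nat_matrices m :: ('n \<Rightarrow> 'n \<Rightarrow> nat) set)"
    (is "card ?V = card ?X")
proof -
  define f where "f X = (\<chi> i j. real (X i j) - (if i = j then real m else 0))" for X :: "'n \<Rightarrow> 'n \<Rightarrow> nat"
  define g where "g v i j = nat \<lfloor>v $ i $ j + (if i = j then real m else 0)\<rfloor>" for v :: "real ^ 'n ^ 'n" and i j
  have "bij_betw f ?X ?V"
  proof (rule bij_betw_byWitness [where f' = g])
    show "\<forall>X\<in>?X. g (f X) = X" by (auto simp: f_def g_def fun_eq_iff)
    have nat: "real (g v i j) = v $ i $ j + (if i = j then real m else 0)" if v: "v \<in> ?V" for v i j
    proof -
      define w where "w = v $ i $ j + (if i = j then real m else 0)"
      have "v $ i $ j \<in> \<int>" using v by (simp add: integer_points_matrix)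
      then have w: "of_int \<lfloor>w\<rfloor> = w" unfolding w_def by (intro of_int_floor) simp
      have "0 \<le> (mat 1 + (1 / real m) *\<^sub>R v) $ i $ j" using v by (auto simp: sym_stochastic_def)
      then have "0 \<le> w"
        using m by (cases "i = j") (simp_all add: w_def mat_def field_simps)
      then have "real (nat \<lfloor>w\<rfloor>) = of_int \<lfloor>w\<rfloor>" by simp
      then show ?thesis unfolding g_def w_def [symmetric] using w by simp
    qed
    show "\<forall>v\<in>?V. f (g v) = v" by (auto simp: f_def vec_eq_iff nat)
    show "f ` ?X \<subseteq> ?V"
    proof (intro image_subsetI)
      fix X :: "'n \<Rightarrow> 'n \<Rightarrow> nat" assume X: "X \<in> ?X"
      have Xm: "(\<Sum>j\<in>UNIV. X i j) = m" for i using X unfolding sym_nat_matrices_def by blast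
      have sum: "(\<Sum>j\<in>UNIV. f X $ i $ j) = 0" for i
      proof -
        have "(\<Sum>j\<in>UNIV. f X $ i $ j) = real (\<Sum>j\<in>UNIV. X i j) - real m"
          by (simp add: f_def sum_subtractf)
        then show ?thesis unfolding Xm by simp
      qed
      have sym: "f X $ i $ j = f X $ j $ i" for i j using X by (auto simp: f_def sym_nat_matrices_def)
      have eq: "mat 1 + (1 / real m) *\<^sub>R f X = (\<chi> i j. real (X i j) / real m)"
        using m by (auto simp: vec_eq_iff f_def mat_def field_simps)
      have "(\<Sum>j\<in>UNIV. real (X i j) / real m) = 1" for i
      proof -
        have "(\<Sum>j\<in>UNIV. real (X i j) / real m) = real (\<Sum>j\<in>UNIV. X i j) / real m"
          by (simp add: sum_divide_distrib)
        then show ?thesis unfolding Xm using m by simp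
      qed
      then have "mat 1 + (1 / real m) *\<^sub>R f X \<in> sym_stochastic"
        unfolding eq using X by (auto simp: sym_stochastic_def transpose_eq_iff sym_nat_matrices_def)
      moreover have "f X \<in> zero_sum_matrices" unfolding zero_sum_matrices_def transpose_eq_iff using sum sym by blast
      moreover have "f X \<in> integer_points" by (simp add: integer_points_matrix f_def)
      ultimately show "f X \<in> ?V" by blast
    qed
    show "g ` ?V \<subseteq> ?X"
    proof (intro image_subsetI)
      fix v assume v: "v \<in> ?V"
      then have z: "v \<in> zero_sum_matrices" by blast
      have "g v i j = g v j i" for i j
        using z by (auto simp: g_def zero_sum_matrices_def transpose_eq_iff)
      moreover have "(\<Sum>j\<in>UNIV. g v i j) = m" for i
      proof -
        have "real (\<Sum>j\<in>UNIV. g v i j) = (\<Sum>j\<in>UNIV. v $ i $ j) + real m"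
          by (simp only: of_nat_sum nat [OF v] sum.distrib) simp
        also have "\<dots> = real m" using z by (simp add: zero_sum_matrices_def)
        finally show ?thesis by (simp only: of_nat_eq_iff)
      qed
      ultimately show "g v \<in> ?X" by (simp add: sym_nat_matrices_def)
    qed
  qed
  then show ?thesis by (rule bij_betw_same_card [symmetric])
qed

text \<open>The identity matrix is the base point of the count, and the uniform matrix, all of whose
  entries are positive, is the interior point that makes the volume positive.\<close>

lemma stochastic_volume:
  defines "d \<equiv> CARD('n) * (CARD('n) - 1) div 2"
  shows "(\<lambda>m. real (card (sym_nat_matrices m :: ('n \<Rightarrow> 'n \<Rightarrow> nat) set)) / real m ^ d)
      \<longlonglongrightarrow> rel_volume (sym_stochastic :: (real ^ 'n ^ 'n) set)"
    and "0 < rel_volume (sym_stochastic :: (real ^ 'n ^ 'n) set)"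
proof -
  let ?P = "sym_stochastic :: (real ^ 'n ^ 'n) set"
  let ?h = "\<lambda>(i, j) A :: real ^ 'n ^ 'n. A $ i $ j"
  have P: "?P = {A \<in> affine hull ?P. \<forall>q\<in>UNIV. 0 \<le> ?h q A}"
    unfolding affine_hull_stochastic by (auto simp: sym_stochastic_def)
  have h: "\<forall>q\<in>UNIV. linear (?h q)" by (auto intro!: linearI)
  have id: "mat 1 \<in> ?P" by (auto simp: sym_stochastic_def transpose_eq_iff mat_def)
  obtain b where b: "is_lattice_basis d b (direction ?P)"
    using stochastic_lattice_basis unfolding direction_stochastic d_def by blast
  note lim = rel_volume_limit [OF P bounded_stochastic finite h id b]
  have "(\<lambda>m. real (card {v \<in> integer_points \<inter> direction ?P. mat 1 + (1 / real m) *\<^sub>R v \<in> ?P}) / real m ^ d)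
      \<longlonglongrightarrow> rel_volume ?P"
    by (rule lim(1))
  then show "(\<lambda>m. real (card (sym_nat_matrices m :: ('n \<Rightarrow> 'n \<Rightarrow> nat) set)) / real m ^ d) \<longlonglongrightarrow> rel_volume ?P"
  proof (rule Lim_transform_eventually)
    show "\<forall>\<^sub>F m in sequentially.
        real (card {v \<in> integer_points \<inter> direction ?P. mat 1 + (1 / real m) *\<^sub>R v \<in> ?P}) / real m ^ d =
        real (card (sym_nat_matrices m :: ('n \<Rightarrow> 'n \<Rightarrow> nat) set)) / real m ^ d"
      using eventually_gt_at_top [of "0 :: nat"]
      by (rule eventually_mono) (simp only: direction_stochastic card_sym_nat_matrices)
  qed
  have "uniform_matrix \<in> affine hull ?P" by (rule hull_inc, rule uniform_matrix_stochastic)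
  then show "0 < rel_volume ?P" by (rule lim(2)) (auto simp: uniform_matrix_def)
qed


section \<open>Leading term, error bound and conclusion\<close>

section \<open>Asymptotics\<close>

text \<open>If all \<open>k i\<close> are 1, there is one variable for each pair
  \<open>a <= b\<close>, with weight 1 in the rows \<open>a\<close> and \<open>b\<close>; row
  \<open>i\<close> thus meets the variable of the pair of \<open>i\<close> and \<open>j\<close> once
  for each \<open>j\<close>.\<close>

lemma row_sum_ones:
  assumes i: "i < n"
  shows "(\<Sum>v\<in>vars n (\<lambda>_. 1). wgt (\<lambda>_. 1) v i * x v) = (\<Sum>j<n. x (min i j, max i j, 0))"
proof -
  let ?V = "vars n (\<lambda>_. 1)" and ?w = "\<lambda>v. wgt (\<lambda>_. 1) v i"
  define t where "t j = (min i j, max i j, 0 :: nat)" for j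
  have inj: "inj_on t {..<n}" by (auto simp: t_def inj_on_def min_def max_def split: if_splits)
  have sub: "t ` {..<n} \<subseteq> ?V" using i by (auto simp: t_def vars_def mult_var_def min_def max_def)
  have zero: "?w v * x v = 0" if v: "v \<in> ?V - t ` {..<n}" for v
  proof -
    obtain a b g where abg: "v = (a, b, g)" by (cases v)
    have ab: "a < n" "b < n" "a \<le> b" "g = 0"
      using v abg by (auto simp: vars_def mult_var_def split: if_splits)
    have "v \<noteq> t a" "v \<noteq> t b" using v ab by blast+
    then have "i \<noteq> a" "i \<noteq> b" using ab by (auto simp: abg t_def)
    then show ?thesis by (simp add: abg wgt_def)
  qed
  have "(\<Sum>v\<in>?V. ?w v * x v) = (\<Sum>v\<in>t ` {..<n}. ?w v * x v)"
    using zero by (intro sum.mono_neutral_right [OF finite_vars sub]) blast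
  also have "\<dots> = (\<Sum>j<n. ?w (t j) * x (t j))" by (simp add: sum.reindex [OF inj])
  also have "\<dots> = (\<Sum>j<n. x (min i j, max i j, 0))"
    by (intro sum.cong refl) (auto simp: t_def wgt_def min_def max_def)
  finally show ?thesis .
qed

text \<open>The variable of the pair \<open>a <= b\<close> is the common entry at
  \<open>(a, b)\<close> and \<open>(b, a)\<close> of a symmetric matrix, with indices enumerated by
  \<open>r\<close>.\<close>

lemma csol_ones:
  "csol CARD('n) (\<lambda>_. 1) (\<lambda>_. int m) = of_nat (card (sym_nat_matrices m :: ('n::finite \<Rightarrow> 'n \<Rightarrow> nat) set))"
proof -
  let ?n = "CARD('n)"
  let ?V = "vars ?n (\<lambda>_. 1)"
  let ?S = "sols ?V (wgt (\<lambda>_. 1)) ?n (\<lambda>_. int m)"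
  obtain r :: "'n \<Rightarrow> nat" where r: "bij_betw r UNIV {..<?n}"
    using finite_same_card_bij [of "UNIV :: 'n set" "{..<?n}"] by auto
  define e where "e = inv_into UNIV r"
  have er: "e (r p) = p" for p using r by (simp add: e_def bij_betw_def)
  have re: "r (e i) = i" if "i < ?n" for i
    using r that unfolding e_def bij_betw_def by (metis f_inv_into_f lessThan_iff)
  have rn: "r p < ?n" for p using bij_betwE [OF r] by auto
  have V: "(a, b, g) \<in> ?V \<longleftrightarrow> a < ?n \<and> b < ?n \<and> a \<le> b \<and> g = 0" for a b g
    by (auto simp: vars_def mult_var_def split: if_splits)
  define f where "f x p q = x (min (r p) (r q), max (r p) (r q), 0 :: nat)" for x :: "nat \<times> nat \<times> nat \<Rightarrow> nat" and p q
  define h where "h X = (\<lambda>v\<in>?V. X (e (fst v)) (e (fst (snd v))) :: nat)" for X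
  have row: "(\<Sum>q\<in>UNIV. f x p q) = (\<Sum>v\<in>?V. wgt (\<lambda>_. 1) v (r p) * x v)" for x p
    unfolding row_sum_ones [OF rn] f_def
    using sum.reindex_bij_betw [OF r, of "\<lambda>j. x (min (r p) j, max (r p) j, 0)"] by simp
  have fh: "f (h X) p q = X p q" if X: "X \<in> sym_nat_matrices m" for X p q
  proof -
    have "(min (r p) (r q), max (r p) (r q), 0) \<in> ?V" using rn [of p] rn [of q] unfolding V by (simp add: min_def max_def)
    then have "f (h X) p q = X (e (min (r p) (r q))) (e (max (r p) (r q)))"
      unfolding f_def h_def by (simp only: restrict_apply' fst_conv snd_conv)
    also have "\<dots> = X p q"
      using X by (cases "r p \<le> r q") (auto simp: min_def max_def er sym_nat_matrices_def)
    finally show ?thesis .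
  qed
  have "bij_betw f ?S (sym_nat_matrices m)"
  proof (rule bij_betw_byWitness [where f' = h])
    show "\<forall>x\<in>?S. h (f x) = x"
    proof
      fix x assume x: "x \<in> ?S"
      show "h (f x) = x"
      proof
        fix v :: "nat \<times> nat \<times> nat"
        obtain a b g where abg: "v = (a, b, g)" by (cases v)
        show "h (f x) v = x v"
        proof (cases "v \<in> ?V")
          case True
          then have "(a, b, g) \<in> ?V" by (simp only: abg)
          then have ab: "a < ?n" "b < ?n" "a \<le> b" "g = 0" using V by blast+
          have "h (f x) v = f x (e a) (e b)"
            using True unfolding h_def by (simp only: restrict_apply' abg fst_conv snd_conv)
          also have "\<dots> = x v" using ab by (simp add: f_def re abg)
          finally show ?thesis .
        next
          case False
          have "x \<in> extensional ?V" using x unfolding sols_def PiE_def by blast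
          then have "x v = undefined" using False by (rule extensional_arb)
          with False show ?thesis unfolding h_def by (simp only: restrict_apply if_False)
        qed
      qed
    qed
    show "\<forall>X\<in>sym_nat_matrices m. f (h X) = X" using fh by blast
    show "f ` ?S \<subseteq> sym_nat_matrices m"
    proof (intro image_subsetI)
      fix x assume x: "x \<in> ?S"
      have "(\<Sum>q\<in>UNIV. f x p q) = m" for p
        unfolding row using solsD [OF x rn [of p]] by (simp only: of_nat_eq_iff)
      moreover have "f x p q = f x q p" for p q by (simp add: f_def min.commute max.commute)
      ultimately show "f x \<in> sym_nat_matrices m" unfolding sym_nat_matrices_def by blast
    qed
    show "h ` sym_nat_matrices m \<subseteq> ?S"
    proof (intro image_subsetI)
      fix X :: "'n \<Rightarrow> 'n \<Rightarrow> nat" assume X: "X \<in> sym_nat_matrices m"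
      have "int (\<Sum>v\<in>?V. wgt (\<lambda>_. 1) v i * h X v) = int m" if i: "i < ?n" for i
      proof -
        have "(\<Sum>v\<in>?V. wgt (\<lambda>_. 1) v i * h X v) = (\<Sum>q\<in>UNIV. f (h X) (e i) q)"
          using row [of "h X" "e i"] by (simp only: re [OF i])
        also have "\<dots> = (\<Sum>q\<in>UNIV. X (e i) q)" by (simp only: fh [OF X])
        also have "\<dots> = m" using X unfolding sym_nat_matrices_def by blast
        finally show ?thesis by (simp only:)
      qed
      moreover have "h X \<in> ?V \<rightarrow>\<^sub>E UNIV" by (simp add: h_def)
      ultimately show "h X \<in> ?S" unfolding sols_def by blast
    qed
  qed
  then show ?thesis unfolding csol_def by (simp add: bij_betw_same_card)
qed

lemma phi_ones:
  "phi (\<Prod>k\<in>#replicate_mset n 1. psi k (hh m)) = csol n (\<lambda>_. 1) (\<lambda>_. int m)"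
proof -
  let ?ks = "replicate n 1 :: nat list"
  have "phi (\<Prod>k\<in>#mset (?ks). psi k (hh m)) =
      csol (length (?ks)) (\<lambda>i. ?ks ! i) (\<lambda>_. int m)"
    by (rule phi_prod_psi) simp
  moreover have "csol n (\<lambda>i. ?ks ! i) (\<lambda>_. int m) = csol n (\<lambda>_. 1) (\<lambda>_. int m)"
  proof -
    have 1: "mult_var (\<lambda>i. ?ks ! i) i j = mult_var (\<lambda>_. 1) i j" if "i < n" "j < n" for i j
      using that by (simp add: mult_var_def)
    have V: "vars n (\<lambda>i. ?ks ! i) = vars n (\<lambda>_. 1)"
      unfolding vars_def using 1 by (intro Sigma_cong refl arg_cong [where f = lessThan]) simp
    have W: "wgt (\<lambda>i. ?ks ! i) v i = wgt (\<lambda>_. 1) v i" if "v \<in> vars n (\<lambda>_. 1)" for v i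
      using that by (auto simp: vars_def wgt_def split: if_splits)
    have "sols (vars n (\<lambda>_. 1)) (wgt (\<lambda>i. ?ks ! i)) n (\<lambda>_. int m) =
        sols (vars n (\<lambda>_. 1)) (wgt (\<lambda>_. 1)) n (\<lambda>_. int m)"
      unfolding sols_def using W by (simp cong: sum.cong)
    then show ?thesis unfolding csol_def V by simp
  qed
  ultimately show ?thesis by simp
qed

text \<open>A partition of \<open>n\<close> other than the one into ones has a part of size at least
  2, as \<open>card_vars_bound\<close> requires.\<close>

lemma phi_not_ones_bound:
  assumes M: "M \<in> mparts n" "M \<noteq> replicate_mset n 1"
  shows "\<bar>phi (\<Prod>k\<in>#M. psi k (hh m))\<bar> \<le> of_nat ((m + 1) ^ ((n - 1) * (n - 2) div 2))"
proof -
  obtain ks where ks: "mset ks = M" using ex_mset by blast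
  have k0: "0 \<notin> set ks" and sum: "sum_list ks = n"
    using M(1) ks by (auto simp: mparts_def sum_mset_sum_list)
  have k1: "ks ! i \<ge> 1" if "i < length ks" for i
    using k0 that by (metis nth_mem less_one not_less)
  have "\<exists>i<length ks. ks ! i \<ge> 2"
  proof (rule ccontr)
    assume no: "\<not> ?thesis"
    have "ks ! i = 1" if "i < length ks" for i
    proof -
      have "\<not> ks ! i \<ge> 2" using no that by blast
      then show ?thesis using k1 [OF that] by linarith
    qed
    then have r: "ks = replicate (length ks) 1" by (intro nth_equalityI) auto
    have "sum_list ks = length ks" by (subst r) (simp add: sum_list_replicate)
    then have "ks = replicate n 1" using r sum by simp
    then have "M = replicate_mset n 1" unfolding ks [symmetric] by (simp only: mset_replicate)
    with M(2) show False by simp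
  qed
  then obtain i0 where i0: "i0 < length ks" "ks ! i0 \<ge> 2" by blast
  have n: "(\<Sum>i<length ks. ks ! i) = n" using sum by (simp add: sum_list_sum_nth atLeast0LessThan)
  let ?e = "card (vars (length ks) (\<lambda>i. ks ! i)) - length ks"
  have e: "?e \<le> (n - 1) * (n - 2) div 2"
    using card_vars_bound [of "length ks" "\<lambda>i. ks ! i" i0] k1 i0 unfolding n by blast
  have "\<bar>phi (\<Prod>k\<in>#M. psi k (hh m))\<bar> = csol (length ks) (\<lambda>i. ks ! i) (\<lambda>_. int m)"
    using phi_prod_psi [OF k0, of m] unfolding ks by (simp add: csol_def)
  also have "\<dots> \<le> of_nat ((m + 1) ^ ?e)" using k1 by (rule csol_bound)
  also have "\<dots> \<le> of_nat ((m + 1) ^ ((n - 1) * (n - 2) div 2))"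
    using e by (intro of_nat_mono power_increasing) auto
  finally show ?thesis .
qed

lemma mparts_1: "mparts 1 - {replicate_mset 1 1} = {}"
proof -
  have "M = replicate_mset 1 1" if M: "M \<in> mparts 1" for M
  proof -
    have "M \<noteq> {#}" using M by (auto simp: mparts_def)
    then have "size M \<noteq> 0" by simp
    then show ?thesis using mparts_le [OF M] by linarith
  qed
  then show ?thesis by blast
qed

text \<open>The error collects all power sum products other than p_1^n. The clause for
  \<open>n = 1\<close> records that there are none: both exponents of m are 0 in that case, so a
  mere bound would not give the asymptotic formula.\<close>

lemma plethysm_coeff_sum_remainder:
  assumes la: "la \<in> partitions n"
  shows "\<exists>C\<ge>0. (n = 1 \<longrightarrow> C = 0) \<and> (\<forall>m. \<bar>(\<Sum>\<nu>\<in>partitions (n * m). plethysm_coeff la m \<nu>) -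
      of_nat (kostka (part_of la) (mset_set {1..n})) / fact n * csol n (\<lambda>_. 1) (\<lambda>_. int m)\<bar>
      \<le> C * of_nat ((m + 1) ^ ((n - 1) * (n - 2) div 2)))"
proof -
  let ?o = "replicate_mset n 1" and ?N = "\<lambda>m. csol n (\<lambda>_. 1) (\<lambda>_. int m)"
  let ?k = "of_nat (kostka (part_of la) (mset_set {1..n})) / fact n :: rat"
  let ?B = "\<lambda>m. of_nat ((m + 1) ^ ((n - 1) * (n - 2) div 2)) :: rat"
  obtain c where c: "c ?o = ?k" "\<And>m. (\<Sum>\<nu>\<in>partitions (n * m). plethysm_coeff la m \<nu>) =
      (\<Sum>M\<in>mparts n. c M * phi (\<Prod>k\<in>#M. psi k (hh m)))"
    using plethysm_coeff_sum_expansion [OF la] by blast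
  define C where "C = (\<Sum>M\<in>mparts n - {?o}. \<bar>c M\<bar>)"
  have o: "?o \<in> mparts n" by (simp add: mparts_def)
  have bound: "\<bar>(\<Sum>\<nu>\<in>partitions (n * m). plethysm_coeff la m \<nu>) - ?k * ?N m\<bar> \<le> C * ?B m" for m
  proof -
    have "(\<Sum>\<nu>\<in>partitions (n * m). plethysm_coeff la m \<nu>) =
        (\<Sum>M\<in>mparts n. c M * phi (\<Prod>k\<in>#M. psi k (hh m)))" by (rule c(2))
    also have "\<dots> = c ?o * phi (\<Prod>k\<in>#?o. psi k (hh m)) +
        (\<Sum>M\<in>mparts n - {?o}. c M * phi (\<Prod>k\<in>#M. psi k (hh m)))"
      by (rule sum.remove [OF finite_mparts o])
    also have "c ?o * phi (\<Prod>k\<in>#?o. psi k (hh m)) = ?k * ?N m" by (simp only: c(1) phi_ones)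
    finally have "\<bar>(\<Sum>\<nu>\<in>partitions (n * m). plethysm_coeff la m \<nu>) - ?k * ?N m\<bar> =
        \<bar>\<Sum>M\<in>mparts n - {?o}. c M * phi (\<Prod>k\<in>#M. psi k (hh m))\<bar>" by simp
    also have "\<dots> \<le> (\<Sum>M\<in>mparts n - {?o}. \<bar>c M\<bar> * ?B m)"
    proof (rule order_trans [OF sum_abs], rule sum_mono)
      fix M assume M: "M \<in> mparts n - {?o}"
      have "\<bar>phi (\<Prod>k\<in>#M. psi k (hh m))\<bar> \<le> ?B m" using M by (intro phi_not_ones_bound) auto
      then show "\<bar>c M * phi (\<Prod>k\<in>#M. psi k (hh m))\<bar> \<le> \<bar>c M\<bar> * ?B m"
        unfolding abs_mult by (rule mult_left_mono) simp
    qed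
    finally show ?thesis unfolding C_def sum_distrib_right .
  qed
  have nonneg: "C \<ge> 0" unfolding C_def by (intro sum_nonneg) simp
  have zero: "C = 0" if "n = 1" unfolding C_def that mparts_1 by (rule sum.empty)
  show ?thesis by (intro exI [of _ C] conjI allI impI bound nonneg zero)
qed

lemma power_Suc_le_double:
  assumes "m \<ge> 1"
  shows "real ((m + 1) ^ e) \<le> 2 ^ e * real m ^ e"
proof -
  have "real (m + 1) ^ e \<le> (2 * real m) ^ e" using assms by (intro power_mono) auto
  then show ?thesis by (simp add: power_mult_distrib)
qed

lemma of_real_of_rat: "complex_of_real (of_rat q) = of_rat q"
  by (cases q) (simp add: of_rat_rat)

lemma real_of_rat_fact: "real_of_rat (fact k) = fact k"
proof -
  have "real_of_rat (of_nat (fact k)) = of_nat (fact k)" by (rule of_rat_of_nat_eq)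
  then show ?thesis by (simp only: of_nat_fact)
qed

theorem theorem4p4:
  fixes n :: nat and la :: "nat list"
  assumes "n = CARD('n::finite)" and "la \<in> partitions n"
  shows
    "(\<lambda>m. (\<Sum>\<nu>\<in>partitions (n * m). of_rat (plethysm_coeff la m \<nu>)) /
           (irr_char la id / fact n *
            complex_of_real (rel_volume (sym_stochastic :: (real ^ 'n ^ 'n) set)) *
            of_nat m ^ (n * (n - 1) div 2)))
       \<longlonglongrightarrow> 1
     \<and>
     (\<lambda>m. (\<Sum>\<nu>\<in>partitions (n * m). of_rat (plethysm_coeff la m \<nu>)) -
           irr_char la id *
             (\<Sum>\<nu>\<in>partitions (n * m). of_rat (plethysm_coeff [n] m \<nu>)))
       \<in> O(\<lambda>m. complex_of_real (real m ^ ((n - 1) * (n - 2) div 2)))"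
proof -
  let ?V = "rel_volume (sym_stochastic :: (real ^ 'n ^ 'n) set)"
  define d where "d = n * (n - 1) div 2"
  define e where "e = (n - 1) * (n - 2) div 2"
  define D where "D = kostka (part_of la) (mset_set {1..n})"
  define N where "N m = real (card (sym_nat_matrices m :: ('n \<Rightarrow> 'n \<Rightarrow> nat) set))" for m
  define S where "S la m = (\<Sum>\<nu>\<in>partitions (n * m). real_of_rat (plethysm_coeff la m \<nu>))" for la m
  have n: "n \<ge> 1" using assms(1) by (simp add: Suc_le_eq)
  have Sc: "(\<Sum>\<nu>\<in>partitions (n * m). of_rat (plethysm_coeff la m \<nu>)) = complex_of_real (S la m)" for la m
    unfolding S_def of_real_sum of_real_of_rat ..
  have ic: "irr_char la id = complex_of_real (real D)" using irr_char_id [OF assms(2)] by (simp add: D_def)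
  have D: "real D > 0" using kostka_std_pos [OF assms(2)] by (simp add: D_def)
  \<comment> \<open>Stated for any partition of \<open>n\<close>, as it is applied to both
    \<open>la\<close> and \<open>[n]\<close>. The factor \<open>2 ^ e\<close> in the constant pays
    for replacing \<open>m + 1\<close> by \<open>m\<close>.\<close>
  have rem: "\<exists>C\<ge>0. (n = 1 \<longrightarrow> C = 0) \<and> (\<forall>m\<ge>1. \<bar>S la m - real (kostka (part_of la) (mset_set {1..n})) / fact n * N m\<bar> \<le> C * real m ^ e)"
    if la: "la \<in> partitions n" for la
  proof -
    obtain C where "C \<ge> 0 \<and> (n = 1 \<longrightarrow> C = 0) \<and> (\<forall>m. \<bar>(\<Sum>\<nu>\<in>partitions (n * m). plethysm_coeff la m \<nu>) -
          of_nat (kostka (part_of la) (mset_set {1..n})) / fact n * csol n (\<lambda>_. 1) (\<lambda>_. int m)\<bar>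
        \<le> C * of_nat ((m + 1) ^ e))"
      using plethysm_coeff_sum_remainder [OF la, folded e_def] by (elim exE)
    note C = this [THEN conjunct1] this [THEN conjunct2, THEN conjunct1]
      this [THEN conjunct2, THEN conjunct2, THEN spec]
    have bound: "\<bar>S la m - real (kostka (part_of la) (mset_set {1..n})) / fact n * N m\<bar> \<le> (of_rat C * 2 ^ e) * real m ^ e"
      if m: "m \<ge> 1" for m
    proof -
      have "real_of_rat \<bar>(\<Sum>\<nu>\<in>partitions (n * m). plethysm_coeff la m \<nu>) -
          of_nat (kostka (part_of la) (mset_set {1..n})) / fact n * csol n (\<lambda>_. 1) (\<lambda>_. int m)\<bar>
        \<le> real_of_rat (C * of_nat ((m + 1) ^ e))"
        unfolding of_rat_less_eq by (rule C(3))
      also have "real_of_rat \<bar>(\<Sum>\<nu>\<in>partitions (n * m). plethysm_coeff la m \<nu>) -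
          of_nat (kostka (part_of la) (mset_set {1..n})) / fact n * csol n (\<lambda>_. 1) (\<lambda>_. int m)\<bar> =
          \<bar>S la m - real (kostka (part_of la) (mset_set {1..n})) / fact n * N m\<bar>"
        unfolding S_def N_def assms(1) csol_ones abs_of_rat [symmetric] of_rat_diff of_rat_mult of_rat_divide
          of_rat_sum of_rat_of_nat_eq real_of_rat_fact ..
      also have "real_of_rat (C * of_nat ((m + 1) ^ e)) = of_rat C * real ((m + 1) ^ e)"
        by (simp only: of_rat_mult of_rat_of_nat_eq)
      also have "\<dots> \<le> of_rat C * (2 ^ e * real m ^ e)"
        using C(1) by (intro mult_left_mono power_Suc_le_double m) simp
      finally show ?thesis by (simp only: mult.assoc)
    qed
    have nonneg: "of_rat C * 2 ^ e \<ge> (0 :: real)" using C(1) by simp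
    have zero: "of_rat C * 2 ^ e = (0 :: real)" if "n = 1" using C(2) that by simp
    show ?thesis by (intro exI [of _ "of_rat C * 2 ^ e"] conjI allI impI bound nonneg zero)
  qed
  obtain C where "C \<ge> 0 \<and> (n = 1 \<longrightarrow> C = 0) \<and> (\<forall>m\<ge>1. \<bar>S la m - real D / fact n * N m\<bar> \<le> C * real m ^ e)"
    using rem [OF assms(2), folded D_def] by (elim exE)
  then have C: "C \<ge> 0" "n = 1 \<Longrightarrow> C = 0" "\<And>m. m \<ge> 1 \<Longrightarrow> \<bar>S la m - real D / fact n * N m\<bar> \<le> C * real m ^ e"
    by simp_all
  have pn: "[n] \<in> partitions n" using n by (simp add: partitions_def)
  \<comment> \<open>A single row has exactly one standard tableau, so \<open>[n]\<close> has leading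
    coefficient 1/n!.\<close>
  have "kostka (part_of [n]) (mset_set {1..n}) = 1"
  proof -
    have "part_of [n] = one_row n" by (auto simp: part_of_def one_row_def fun_eq_iff)
    then show ?thesis by (simp add: kostka_one_row)
  qed
  then have one: "real (kostka (part_of [n]) (mset_set {1..n})) = 1" by (simp only: of_nat_1)
  obtain C' where "C' \<ge> 0 \<and> (n = 1 \<longrightarrow> C' = 0) \<and> (\<forall>m\<ge>1. \<bar>S [n] m - 1 / fact n * N m\<bar> \<le> C' * real m ^ e)"
    using rem [OF pn, unfolded one] by (elim exE)
  then have C': "\<And>m. m \<ge> 1 \<Longrightarrow> \<bar>S [n] m - 1 / fact n * N m\<bar> \<le> C' * real m ^ e"
    by simp
  define q where "q = real D / fact n * ?V"
  have V: "?V > 0" "(\<lambda>m. N m / real m ^ d) \<longlonglongrightarrow> ?V"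
    unfolding N_def d_def assms(1) by (rule stochastic_volume)+
  have q: "q > 0" unfolding q_def using D V(1) by simp
  \<comment> \<open>For \<open>n = 1\<close> the error is exactly 0; otherwise \<open>d\<close>
    exceeds \<open>e\<close> by \<open>n - 1 >= 1\<close>, and the quotient is at most a constant
    times 1/m.\<close>
  have lim0: "(\<lambda>m. (S la m - real D / fact n * N m) / real m ^ d) \<longlonglongrightarrow> 0"
  proof (cases "n = 1")
    case True
    have "\<forall>\<^sub>F m in sequentially. (S la m - real D / fact n * N m) / real m ^ d = 0"
      using eventually_ge_at_top [of "1 :: nat"]
    proof (rule eventually_mono)
      fix m :: nat assume "1 \<le> m"
      then show "(S la m - real D / fact n * N m) / real m ^ d = 0"
        using C(3) [of m] unfolding C(2) [OF True] by simp
    qed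
    then show ?thesis by (rule tendsto_eventually)
  next
    case False
    have de: "d = e + (n - 1)"
    proof -
      have "even ((n - 1) * (n - 2))" "even (n * (n - 1))" using n by (cases n; cases "n - 1"; simp)+
      moreover have "n * (n - 1) = (n - 1) * (n - 2) + 2 * (n - 1)"
        using False n by (cases n; cases "n - 1") (auto simp: algebra_simps)
      ultimately show ?thesis unfolding d_def e_def by simp
    qed
    show ?thesis
    proof (rule Lim_null_comparison)
      show "\<forall>\<^sub>F m in sequentially. norm ((S la m - real D / fact n * N m) / real m ^ d) \<le> C * inverse (real m)"
        using eventually_ge_at_top [of "1 :: nat"]
      proof (rule eventually_mono)
        fix m :: nat assume m: "1 \<le> m"
        have "real m ^ e * real m ^ 1 \<le> real m ^ e * real m ^ (n - 1)"
          using m False n by (intro mult_left_mono power_increasing) auto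
        then have md: "real m ^ e * real m \<le> real m ^ d" unfolding de power_add by simp
        have "norm ((S la m - real D / fact n * N m) / real m ^ d) \<le> C * real m ^ e / real m ^ d"
          using C(3) [OF m] by (simp add: abs_divide divide_right_mono)
        also have "\<dots> \<le> C * real m ^ e / (real m ^ e * real m)"
          using m md C(1) by (intro divide_left_mono mult_nonneg_nonneg mult_pos_pos) auto
        also have "\<dots> = C * inverse (real m)" using m by (simp add: field_simps)
        finally show "norm ((S la m - real D / fact n * N m) / real m ^ d) \<le> C * inverse (real m)" .
      qed
      show "(\<lambda>m. C * inverse (real m)) \<longlonglongrightarrow> 0"
        using tendsto_mult [OF tendsto_const lim_inverse_n, of C] by simp
    qed
  qed
  have "(\<lambda>m. (real D / fact n * (N m / real m ^ d) + (S la m - real D / fact n * N m) / real m ^ d) / q)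
      \<longlonglongrightarrow> (real D / fact n * ?V + 0) / q"
    using q by (intro tendsto_intros V(2) lim0) auto
  also have "(real D / fact n * ?V + 0) / q = 1" unfolding q_def [symmetric] using q by simp
  also have "(\<lambda>m. (real D / fact n * (N m / real m ^ d) + (S la m - real D / fact n * N m) / real m ^ d) / q) =
      (\<lambda>m. S la m / (q * real m ^ d))"
    by (simp add: fun_eq_iff diff_divide_distrib)
  finally have "(\<lambda>m. complex_of_real (S la m / (q * real m ^ d))) \<longlonglongrightarrow> complex_of_real 1"
    by (rule tendsto_of_real)
  then have 1: "(\<lambda>m. complex_of_real (S la m) / (complex_of_real (real D) / fact n * complex_of_real ?V * of_nat m ^ d)) \<longlonglongrightarrow> 1"
    by (simp add: q_def)
  have 2: "(\<lambda>m. complex_of_real (S la m) - complex_of_real (real D) * complex_of_real (S [n] m))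
      \<in> O(\<lambda>m. complex_of_real (real m ^ e))"
  proof (rule bigoI)
    show "\<forall>\<^sub>F m in sequentially. norm (complex_of_real (S la m) - complex_of_real (real D) * complex_of_real (S [n] m))
        \<le> (C + real D * C') * norm (complex_of_real (real m ^ e))"
      using eventually_ge_at_top [of "1 :: nat"]
    proof (rule eventually_mono)
      fix m :: nat assume m: "1 \<le> m"
      have "norm (complex_of_real (S la m) - complex_of_real (real D) * complex_of_real (S [n] m)) =
          \<bar>S la m - real D * S [n] m\<bar>"
        by (simp only: norm_of_real flip: of_real_mult of_real_diff)
      \<comment> \<open>The multiples of \<open>N m\<close> cancel, which leaves only the two
        remainders.\<close>
      also have "\<dots> = \<bar>(S la m - real D / fact n * N m) - real D * (S [n] m - 1 / fact n * N m)\<bar>"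
        by (simp add: algebra_simps)
      also have "\<dots> \<le> \<bar>S la m - real D / fact n * N m\<bar> + real D * \<bar>S [n] m - 1 / fact n * N m\<bar>"
        by (rule order_trans [OF abs_triangle_ineq4]) (simp add: abs_mult)
      also have "\<dots> \<le> C * real m ^ e + real D * (C' * real m ^ e)"
        using C(3) [OF m] C' [OF m] by (intro add_mono mult_left_mono) auto
      also have "\<dots> = (C + real D * C') * norm (complex_of_real (real m ^ e))"
        by (simp add: algebra_simps norm_power)
      finally show "norm (complex_of_real (S la m) - complex_of_real (real D) * complex_of_real (S [n] m))
        \<le> (C + real D * C') * norm (complex_of_real (real m ^ e))" .
    qed
  qed
  show ?thesis unfolding Sc ic d_def [symmetric] e_def [symmetric] using 1 2 by blast
qed

end
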